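(* Let $\alpha\in(0,2)$, $a,b\in(0,\infty]$, $X_{12}\in\mathcal S_\alpha(a)$ complex-valued and $X_{11}\in\mathcal S_\alpha(b)$ real-valued, and let $\Phi:\mathcal P(\mathbb R)\to[0,\infty]$ be the associated function defined in the context. For $\nu\in\mathcal P(\mathbb R)$ put $m_\alpha(\nu)=\int|x|^\alpha\,d\nu(x)\in[0,\infty]$. When $b<\infty$, let $\vartheta_b$ be the probability measure on $\{-1,1\}$ associated to $X_{11}\in\mathcal S_\alpha(b)$. Then: (a) For any $\nu\in\mathcal P(\mathbb R)$, $\Phi(\nu)\ge\left(\frac a2\wedge b\right)m_\alpha(\nu)$. (b) If $b<\infty$ and $\operatorname{supp}(\vartheta_b)=\{-1,1\}$, then for any $\nu\in\mathcal P(\mathbb R)$, $\Phi(\nu)\le b\,m_\alpha(\nu)$. (c) If $b<\infty$ and $\operatorname{supp}(\vartheta_b)=\{-1,1\}$, and $\nu\in\mathcal P(\mathbb R)$ is symmetric, then $\Phi(\nu)=\left(\frac a2\wedge b\right)m_\alpha(\nu)$.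
   Context: Class $\mathcal S_\alpha(a)$: for $0<a<\infty$, a complex random variable $Y$ belongs to $\mathcal S_\alpha(a)$ if $\lim_{t\to\infty}-t^{-\alpha}\log\mathbb P(|Y|\ge t)=a$ and there exist $t_0>0$ and a probability measure $\vartheta$ on the unit circle $\mathbb S^1$ such that for all $t\ge t_0$ and all measurable $U\subset\mathbb S^1$, $\mathbb P(Y/|Y|\in U,\ |Y|\ge t)=\vartheta(U)\,\mathbb P(|Y|\ge t)$; $\vartheta$ is called the measure associated to $Y$. For $a=\infty$, $Y\in\mathcal S_\alpha(\infty)$ means only that $\lim_{t\to\infty}-t^{-\alpha}\log\mathbb P(|Y|\ge t)=\infty$. Let $\vartheta_a$ (if $a<\infty$) and $\vartheta_b$ (if $b<\infty$) be the measures associated to $X_{12}$ and $X_{11}$, with supports $S_a\subset\mathbb S^1$, $S_b\subset\{-1,1\}$; if $a=\infty$ put $S_a=\mathbb S^1$, and if $b=\infty$ put $S_b=\{-1,1\}$. Convention throughout: $\infty\times0=0$. Networks. A network $G=(V_G,\omega_G)$ is a countable set $V_G$ with a map $\omega_G:V_G^2\to\mathbb C$ that is Hermitian, $\omega_G(u,v)=\overline{\omega_G(v,u)}$, and locally finite, $\deg_G(v):=\sum_{u}|\omega_G(v,u)|^2<\infty$ for all $v$. Write $\omega_G(v)=\omega_G(v,v)$. A path from $u$ to $v$ is a sequence $u=u_0,\dots,u_k=v$ with $\omega_G(u_{i-1},u_i)\ne0$; its length is $(\sum_{i=1}^k|\omega_G(u_{i-1},u_i)|^{-2})^{1/2}$;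 $D(u,v)$ is the infimum of lengths of paths from $u$ to $v$ ($\infty$ if there is none; $D(u,u)=0$). $G$ is connected if $D<\infty$ everywhere; $G(v)$ is the connected component of $v$. A rooted network $(G,o)$ is a connected network with a distinguished vertex $o$; $(G,o)_t$ is the rooted network induced on $\{u:D(o,u)\le t\}$. Rooted isomorphisms are weight-preserving bijections of vertex sets preserving roots; $\mathcal G_*$ is the set of isomorphism classes. On $\mathcal G_*$, $d_{\mathrm{loc}}((G_1,o_1),(G_2,o_2))=\frac1{1+T}$, where $T$ is the supremum of $t>0$ such that there is a bijection $\sigma:V_{(G_1,o_1)_t}\to V_{(G_2,o_2)_t}$ with $\sigma(o_1)=o_2$ and $|\omega_{G_2}\circ\sigma-\omega_{G_1}|\le1/t$ on $V_{(G_1,o_1)_t}^2$. Local weak convergence in $\mathcal P(\mathcal G_* )$ is weak convergence of probability measures on $(\mathcal G_*,d_{\mathrm{loc}})$. For a finite network $G$, $U(G)\in\mathcal P(\mathcal G_* )$ is the law of the class of $(G(o),o)$ with $o$ uniform in $V_G$. A Hermitian $n\times n$ matrix $H$ is viewed as the network on $\{1,\dots,n\}$ with $\omega(i,j)=H_{ij}$. Admissible sofic measures. $\mathcal A_n$ is the set of $n\times n$ Hermitian matrices $H$ with $H_{ij}=0$ or $H_{ij}/|H_{ij}|\in S_a$ for all $i<j$, and $H_{ii}=0$ or $H_{ii}/|H_{ii}|\in S_b$ for all $i$. $\mathcal P_s(\mathcal G_* )$ is the set of $\rho\in\mathcal P(\mathcal G_* )$ that are local weak limits of $U(H_n)$ for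 some sequence $H_n\in\mathcal A_n$. Truncation. For $0<\theta<1$ let $\chi_\theta(x)=0$ on $[0,\theta)$, $(x-\theta)/\theta$ on $[\theta,2\theta)$, $1$ on $[2\theta,\infty)$; $\tilde\chi_\theta(x)=1$ on $[0,\theta^{-2}-1)$, $\theta^{-2}-x$ on $[\theta^{-2}-1,\theta^{-2})$, $0$ on $[\theta^{-2},\infty)$. For a network $G=(V,\omega)$ put $\tilde\omega_\theta(u,v)=\omega(u,v)\tilde\chi_\theta(\deg_G(u)\vee\deg_G(v))$, $\omega_\theta(u,v)=\tilde\omega_\theta(u,v)\chi_\theta(|\tilde\omega_\theta(u,v)|)$, $G_\theta=(V,\omega_\theta)$. For $\rho\in\mathcal P(\mathcal G_* )$, $\rho_\theta$ is the law of the class of $(G_\theta(o),o)$ when $(G,o)$ has law $\rho$. Spectral measure. If $G=(V,\omega)$ has $\deg_G\le\theta^{-2}$ and all nonzero weights of modulus $\ge\theta$, the operator $Te_v=\sum_u\omega(u,v)e_u$ on $\ell^2(V)$ is bounded self-adjoint; $\mu_T^v$ is its spectral measure at $e_v$: $\int x^k\,d\mu_T^v=\langle e_v,T^ke_v\rangle$, $k\ge1$. Put $\mu_{\rho_\theta}=\mathbb E_{\rho_\theta}\mu_T^o$. For $\beta>0$ let $\xi_\beta(G,o)=\sum_{v\in V_G}|\omega_G(o,v)|^\beta$. For $\rho\in\mathcal P_s(\mathcal G_* )$ with $\mathbb E_\rho\xi_\beta<\infty$ for some $\beta\in(0,2)$, $\mu_\rho:=\lim_{\theta\to0}\mu_{\rho_\theta}$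 (weak limit, which exists in $\mathcal P(\mathbb R)$); for all other $\rho\in\mathcal P_s(\mathcal G_* )$, $\mu_\rho:=\delta_0$. Rate function. For $\rho\in\mathcal P_s(\mathcal G_* )$, $I(\rho)=b\,\mathbb E_\rho|\omega_G(o)|^\alpha+\frac a2\,\mathbb E_\rho\sum_{v\in V_G\setminus\{o\}}|\omega_G(o,v)|^\alpha$. For $\nu\in\mathcal P(\mathbb R)$, $$\Phi(\nu)=\inf\{I(\rho):\rho\in\mathcal P_s(\mathcal G_* ),\ \mu_\rho=\nu\}\qquad(\inf\emptyset=+\infty).$$ ($\Phi$ is the function such that $J(\mu_{\mathrm{sc}}\boxplus\nu)=\Phi(\nu)$ for the rate function $J$, at speed $n^{1+\alpha/2}$, of the empirical spectral measures of $X/\sqrt n$, $X$ the Wigner matrix with off-diagonal entries distributed as $X_{12}$, of variance $1$, and diagonal entries distributed as $X_{11}$; $\mu_{\mathrm{sc}}$ is the semicircle law.) *)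

theory Defs
  imports "HOL-Probability.Probability"
begin

section \<open>The class \<open>S\<^sub>\<alpha>(a)\<close>\<close>

text \<open>\<open>- log p\<close> for a probability \<open>p\<close>, as an extended nonnegative number. The case \<open>p = 0\<close> is
  separate because \<open>ln 0 = 0\<close> in HOL.\<close>

definition neg_log :: "real \<Rightarrow> ennreal" where
  "neg_log p = (if p = 0 then \<top> else ennreal (- ln p))"

definition tail_exponent :: "'w measure \<Rightarrow> real \<Rightarrow> ennreal \<Rightarrow> ('w \<Rightarrow> complex) \<Rightarrow> bool" where
  "tail_exponent M \<alpha> a Y \<longleftrightarrow>
     ((\<lambda>t::real. ennreal (t powr (- \<alpha>)) * neg_log (measure M {w \<in> space M. t \<le> cmod (Y w)}))
        \<longlongrightarrow> a) at_top"

definition unit_circle :: "complex set" where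
  "unit_circle = sphere 0 1"

definition angular_measure :: "'w measure \<Rightarrow> ('w \<Rightarrow> complex) \<Rightarrow> complex measure \<Rightarrow> bool" where
  "angular_measure M Y \<theta> \<longleftrightarrow>
     prob_space \<theta> \<and> sets \<theta> = sets (restrict_space borel unit_circle) \<and>
     (\<exists>t0>0. \<forall>t\<ge>t0. \<forall>U \<in> sets \<theta>.
        measure M {w \<in> space M. Y w / complex_of_real (cmod (Y w)) \<in> U \<and> t \<le> cmod (Y w)}
          = measure \<theta> U * measure M {w \<in> space M. t \<le> cmod (Y w)})"

definition class_S :: "'w measure \<Rightarrow> real \<Rightarrow> ennreal \<Rightarrow> ('w \<Rightarrow> complex) \<Rightarrow> bool" where
  "class_S M \<alpha> a Y \<longleftrightarrow>
     Y \<in> borel_measurable M \<and> tail_exponent M \<alpha> a Y \<and>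
     (a < \<top> \<longrightarrow> (\<exists>\<theta>. angular_measure M Y \<theta>))"

text \<open>For \<open>a < \<infinity>\<close> the tail probabilities are eventually positive, hence there is exactly one
  angular measure.\<close>

definition associated_measure :: "'w measure \<Rightarrow> ('w \<Rightarrow> complex) \<Rightarrow> complex measure" where
  "associated_measure M Y = (THE \<theta>. angular_measure M Y \<theta>)"

definition msupport :: "'a::topological_space measure \<Rightarrow> 'a set" where
  "msupport \<mu> = {x \<in> space \<mu>. \<forall>U. open U \<and> x \<in> U \<longrightarrow> 0 < emeasure \<mu> (U \<inter> space \<mu>)}"

definition support_a :: "'w measure \<Rightarrow> ennreal \<Rightarrow> ('w \<Rightarrow> complex) \<Rightarrow> complex set" where
  "support_a M a Y = (if a = \<top> then unit_circle else msupport (associated_measure M Y))"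

definition support_b :: "'w measure \<Rightarrow> ennreal \<Rightarrow> ('w \<Rightarrow> complex) \<Rightarrow> complex set" where
  "support_b M b Y = (if b = \<top> then {- 1, 1} else msupport (associated_measure M Y))"


section \<open>Networks\<close>

text \<open>A countable vertex set is, up to isomorphism, a set of natural numbers. Only the values of
  the weight function on the vertex set are meaningful.\<close>

datatype network = Network (verts: "nat set") (wgt: "nat \<Rightarrow> nat \<Rightarrow> complex")

definition deg :: "network \<Rightarrow> nat \<Rightarrow> real" where
  "deg G v = (\<Sum>\<^sub>\<infinity>u\<in>verts G. (cmod (wgt G v u))\<^sup>2)"

definition is_network :: "network \<Rightarrow> bool" where
  "is_network G \<longleftrightarrow>
     (\<forall>u\<in>verts G. \<forall>v\<in>verts G. wgt G u v = cnj (wgt G v u)) \<and>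
     (\<forall>v\<in>verts G. (\<lambda>u. (cmod (wgt G v u))\<^sup>2) summable_on verts G)"

definition is_path :: "network \<Rightarrow> nat \<Rightarrow> nat \<Rightarrow> nat list \<Rightarrow> bool" where
  "is_path G u v p \<longleftrightarrow>
     p \<noteq> [] \<and> hd p = u \<and> last p = v \<and> set p \<subseteq> verts G \<and>
     (\<forall>i. Suc i < length p \<longrightarrow> wgt G (p ! i) (p ! Suc i) \<noteq> 0)"

definition path_length :: "network \<Rightarrow> nat list \<Rightarrow> real" where
  "path_length G p = sqrt (\<Sum>i<length p - 1. 1 / (cmod (wgt G (p ! i) (p ! Suc i)))\<^sup>2)"

text \<open>\<open>net_dist G u v\<close> is \<open>D(u,v)\<close>; the infimum of the empty set in \<^typ>\<open>ennreal\<close> is \<open>\<top>\<close>, and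
  the path \<open>[u]\<close> has length 0.\<close>

definition net_dist :: "network \<Rightarrow> nat \<Rightarrow> nat \<Rightarrow> ennreal" where
  "net_dist G u v = (INF p\<in>{p. is_path G u v p}. ennreal (path_length G p))"

definition net_connected :: "network \<Rightarrow> bool" where
  "net_connected G \<longleftrightarrow> (\<forall>u\<in>verts G. \<forall>v\<in>verts G. net_dist G u v < \<top>)"

definition induced :: "network \<Rightarrow> nat set \<Rightarrow> network" where
  "induced G W = Network (verts G \<inter> W) (wgt G)"

definition component :: "network \<Rightarrow> nat \<Rightarrow> network" where
  "component G v = induced G {u. net_dist G v u < \<top>}"


section \<open>Rooted networks and local weak convergence\<close>

datatype rooted = Rooted (net: network) (base: nat)

definition is_rooted :: "rooted \<Rightarrow> bool" where
  "is_rooted R \<longleftrightarrow> is_network (net R) \<and> net_connected (net R) \<and> base R \<in> verts (net R)"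

definition rooted_iso :: "rooted \<Rightarrow> rooted \<Rightarrow> bool" where
  "rooted_iso R1 R2 \<longleftrightarrow> is_rooted R1 \<and> is_rooted R2 \<and>
     (\<exists>\<sigma>. bij_betw \<sigma> (verts (net R1)) (verts (net R2)) \<and> \<sigma> (base R1) = base R2 \<and>
        (\<forall>u\<in>verts (net R1). \<forall>v\<in>verts (net R1). wgt (net R2) (\<sigma> u) (\<sigma> v) = wgt (net R1) u v))"

lemma is_rooted_trivial: "is_rooted (Rooted (Network {0} (\<lambda>_ _. 0)) 0)"
proof -
  have "net_dist (Network {0} (\<lambda>_ _. 0)) 0 0 \<le> ennreal (path_length (Network {0} (\<lambda>_ _. 0)) [0])"
    unfolding net_dist_def by (rule INF_lower) (simp add: is_path_def)
  then have "net_dist (Network {0} (\<lambda>_ _. 0)) 0 0 < \<top>"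
    by (simp add: path_length_def)
  then show ?thesis
    by (simp add: is_rooted_def is_network_def net_connected_def)
qed

lemma rooted_iso_refl: "is_rooted R \<Longrightarrow> rooted_iso R R"
  unfolding rooted_iso_def by (auto intro!: exI[of _ id])

lemma rooted_iso_sym:
  assumes "rooted_iso R1 R2"
  shows "rooted_iso R2 R1"
proof -
  obtain \<sigma> where r: "is_rooted R1" "is_rooted R2"
    and bij: "bij_betw \<sigma> (verts (net R1)) (verts (net R2))" and base: "\<sigma> (base R1) = base R2"
    and w: "\<And>u v. u \<in> verts (net R1) \<Longrightarrow> v \<in> verts (net R1) \<Longrightarrow>
              wgt (net R2) (\<sigma> u) (\<sigma> v) = wgt (net R1) u v"
    using assms unfolding rooted_iso_def by blast
  define \<tau> where "\<tau> = inv_into (verts (net R1)) \<sigma>"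
  have bij': "bij_betw \<tau> (verts (net R2)) (verts (net R1))"
    unfolding \<tau>_def by (rule bij_betw_inv_into[OF bij])
  have st: "\<sigma> (\<tau> u) = u" if "u \<in> verts (net R2)" for u
    unfolding \<tau>_def using that bij by (simp add: bij_betw_inv_into_right)
  have t: "\<tau> u \<in> verts (net R1)" if "u \<in> verts (net R2)" for u
    using that bij' by (meson bij_betwE)
  have "base R1 \<in> verts (net R1)" using r by (simp add: is_rooted_def)
  then have "\<tau> (base R2) = base R1"
    unfolding \<tau>_def base[symmetric] using bij by (simp add: bij_betw_inv_into_left)
  moreover have "wgt (net R1) (\<tau> u) (\<tau> v) = wgt (net R2) u v"
    if "u \<in> verts (net R2)" "v \<in> verts (net R2)" for u v
    using w[OF t t, of u v] st that by simp
  ultimately show ?thesis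
    unfolding rooted_iso_def using r bij' by blast
qed

lemma rooted_iso_trans:
  assumes "rooted_iso R1 R2" "rooted_iso R2 R3"
  shows "rooted_iso R1 R3"
proof -
  obtain \<sigma> where s: "is_rooted R1" "bij_betw \<sigma> (verts (net R1)) (verts (net R2))"
      "\<sigma> (base R1) = base R2"
      "\<And>u v. u \<in> verts (net R1) \<Longrightarrow> v \<in> verts (net R1) \<Longrightarrow>
         wgt (net R2) (\<sigma> u) (\<sigma> v) = wgt (net R1) u v"
    using assms(1) unfolding rooted_iso_def by blast
  obtain \<tau> where t: "is_rooted R3" "bij_betw \<tau> (verts (net R2)) (verts (net R3))"
      "\<tau> (base R2) = base R3"
      "\<And>u v. u \<in> verts (net R2) \<Longrightarrow> v \<in> verts (net R2) \<Longrightarrow>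
         wgt (net R3) (\<tau> u) (\<tau> v) = wgt (net R2) u v"
    using assms(2) unfolding rooted_iso_def by blast
  have "\<sigma> u \<in> verts (net R2)" if "u \<in> verts (net R1)" for u
    using that s(2) by (meson bij_betwE)
  then show ?thesis
    unfolding rooted_iso_def using s t bij_betw_trans[OF s(2) t(2)]
    by (auto intro!: exI[of _ "\<tau> \<circ> \<sigma>"])
qed

text \<open>The type of isomorphism classes of rooted networks. The functions on it below are
  evaluated at a representative; all of them are invariant under rooted isomorphism.\<close>

quotient_type gstar = rooted / partial: rooted_iso
proof (rule part_equivpI)
  show "\<exists>R. rooted_iso R R" using rooted_iso_refl[OF is_rooted_trivial] by blast
  show "symp rooted_iso" by (rule sympI) (rule rooted_iso_sym)
  show "transp rooted_iso" by (rule transpI) (rule rooted_iso_trans)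
qed

definition rooted_ball :: "rooted \<Rightarrow> real \<Rightarrow> rooted" where
  "rooted_ball R t =
     Rooted (induced (net R) {u. net_dist (net R) (base R) u \<le> ennreal t}) (base R)"

definition close_at :: "rooted \<Rightarrow> rooted \<Rightarrow> real \<Rightarrow> bool" where
  "close_at R1 R2 t \<longleftrightarrow>
     (\<exists>\<sigma>. bij_betw \<sigma> (verts (net (rooted_ball R1 t))) (verts (net (rooted_ball R2 t))) \<and>
        \<sigma> (base R1) = base R2 \<and>
        (\<forall>u\<in>verts (net (rooted_ball R1 t)). \<forall>v\<in>verts (net (rooted_ball R1 t)).
           cmod (wgt (net R2) (\<sigma> u) (\<sigma> v) - wgt (net R1) u v) \<le> 1 / t))"

definition d_loc :: "gstar \<Rightarrow> gstar \<Rightarrow> real" where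
  "d_loc g h = enn2real (1 / (1 + (SUP t\<in>{t. 0 < t \<and> close_at (rep_gstar g) (rep_gstar h) t}. ennreal t)))"

text \<open>The topology, hence the Borel sigma-algebra, of \<open>d_loc\<close>.\<close>

instantiation gstar :: topological_space
begin

definition open_gstar :: "gstar set \<Rightarrow> bool" where
  "open_gstar U \<longleftrightarrow> (\<forall>g\<in>U. \<exists>r>0. \<forall>h. d_loc g h < r \<longrightarrow> h \<in> U)"

instance
proof
  show "open (UNIV :: gstar set)"
    unfolding open_gstar_def by (auto intro: exI[of _ 1])
next
  fix S T :: "gstar set"
  assume S: "open S" and T: "open T"
  show "open (S \<inter> T)"
    unfolding open_gstar_def
  proof
    fix g assume "g \<in> S \<inter> T"
    then obtain r s where "r > 0" "\<And>h. d_loc g h < r \<Longrightarrow> h \<in> S" "s > 0" "\<And>h. d_loc g h < s \<Longrightarrow> h \<in> T"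
      using S T unfolding open_gstar_def by blast
    then show "\<exists>r>0. \<forall>h. d_loc g h < r \<longrightarrow> h \<in> S \<inter> T"
      by (intro exI[of _ "min r s"]) auto
  qed
next
  fix K :: "gstar set set"
  assume "\<forall>S\<in>K. open S"
  then show "open (\<Union>K)"
    unfolding open_gstar_def by (meson Union_iff)
qed

end

definition prob_on :: "'a::topological_space measure \<Rightarrow> bool" where
  "prob_on \<mu> \<longleftrightarrow> prob_space \<mu> \<and> sets \<mu> = sets borel"

definition weakly_converges ::
  "('i \<Rightarrow> 'a::topological_space measure) \<Rightarrow> 'a measure \<Rightarrow> 'i filter \<Rightarrow> bool" where
  "weakly_converges \<mu> \<mu>' F \<longleftrightarrow>
     (\<forall>f :: 'a \<Rightarrow> real. continuous_on UNIV f \<and> bounded (range f) \<longrightarrow>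
        ((\<lambda>i. \<integral>x. f x \<partial>\<mu> i) \<longlongrightarrow> (\<integral>x. f x \<partial>\<mu>')) F)"

definition rooted_component :: "network \<Rightarrow> nat \<Rightarrow> gstar" where
  "rooted_component G v = abs_gstar (Rooted (component G v) v)"

definition U_law :: "network \<Rightarrow> gstar measure" where
  "U_law G = distr (uniform_count_measure (verts G)) borel (rooted_component G)"


section \<open>Admissible sofic measures\<close>

text \<open>An \<open>n \<times> n\<close> matrix is a function restricted to indices in \<open>{1..n}\<close>.\<close>

definition admissible :: "complex set \<Rightarrow> complex set \<Rightarrow> nat \<Rightarrow> (nat \<Rightarrow> nat \<Rightarrow> complex) \<Rightarrow> bool" where
  "admissible Sa Sb n H \<longleftrightarrow>
     (\<forall>i\<in>{1..n}. \<forall>j\<in>{1..n}. H i j = cnj (H j i)) \<and>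
     (\<forall>i\<in>{1..n}. \<forall>j\<in>{1..n}. i < j \<longrightarrow>
        H i j = 0 \<or> H i j / complex_of_real (cmod (H i j)) \<in> Sa) \<and>
     (\<forall>i\<in>{1..n}. H i i = 0 \<or> H i i / complex_of_real (cmod (H i i)) \<in> Sb)"

definition sofic :: "complex set \<Rightarrow> complex set \<Rightarrow> gstar measure set" where
  "sofic Sa Sb = {\<rho>. prob_on \<rho> \<and>
     (\<exists>H. (\<forall>n\<ge>1. admissible Sa Sb n (H n)) \<and>
          weakly_converges (\<lambda>n. U_law (Network {1..n} (H n))) \<rho> sequentially)}"


section \<open>Truncation\<close>

definition chi :: "real \<Rightarrow> real \<Rightarrow> real" where
  "chi \<theta> x = (if x < \<theta> then 0 else if x < 2 * \<theta> then (x - \<theta>) / \<theta> else 1)"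

definition chi_tilde :: "real \<Rightarrow> real \<Rightarrow> real" where
  "chi_tilde \<theta> x =
     (if x < 1 / \<theta>\<^sup>2 - 1 then 1 else if x < 1 / \<theta>\<^sup>2 then 1 / \<theta>\<^sup>2 - x else 0)"

definition wgt_tilde :: "real \<Rightarrow> network \<Rightarrow> nat \<Rightarrow> nat \<Rightarrow> complex" where
  "wgt_tilde \<theta> G u v = wgt G u v * complex_of_real (chi_tilde \<theta> (max (deg G u) (deg G v)))"

definition truncate :: "real \<Rightarrow> network \<Rightarrow> network" where
  "truncate \<theta> G = Network (verts G)
     (\<lambda>u v. wgt_tilde \<theta> G u v * complex_of_real (chi \<theta> (cmod (wgt_tilde \<theta> G u v))))"

definition truncate_class :: "real \<Rightarrow> gstar \<Rightarrow> gstar" where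
  "truncate_class \<theta> g =
     rooted_component (truncate \<theta> (net (rep_gstar g))) (base (rep_gstar g))"

definition truncate_law :: "real \<Rightarrow> gstar measure \<Rightarrow> gstar measure" where
  "truncate_law \<theta> \<rho> = distr \<rho> borel (truncate_class \<theta>)"


section \<open>Spectral measures\<close>

text \<open>Vectors of \<open>\<ell>\<^sup>2(V)\<close> are functions on the vertex set. \<open>net_op G\<close> is the operator
  \<open>T e\<^sub>v = \<Sum>\<^sub>u \<omega>(u,v) e\<^sub>u\<close>; it is applied only to iterates of the \<open>e\<^sub>v\<close>, which have finite
  support when every vertex has finitely many neighbours (as in a truncated network).\<close>

definition net_op :: "network \<Rightarrow> (nat \<Rightarrow> complex) \<Rightarrow> (nat \<Rightarrow> complex)" where
  "net_op G f = (\<lambda>u. \<Sum>\<^sub>\<infinity>v\<in>verts G. wgt G u v * f v)"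

definition basis_vec :: "nat \<Rightarrow> nat \<Rightarrow> complex" where
  "basis_vec v = (\<lambda>u. if u = v then 1 else 0)"

definition l2_inner :: "network \<Rightarrow> (nat \<Rightarrow> complex) \<Rightarrow> (nat \<Rightarrow> complex) \<Rightarrow> complex" where
  "l2_inner G f g = (\<Sum>\<^sub>\<infinity>u\<in>verts G. cnj (f u) * g u)"

text \<open>The moment equations determine the measure when \<open>T\<close> is bounded, the only case used: the
  truncated networks have degrees at most \<open>1/\<theta>\<^sup>2\<close> and at most \<open>1/\<theta>\<^sup>4\<close> neighbours per vertex.\<close>

definition spectral_measure :: "network \<Rightarrow> nat \<Rightarrow> real measure" where
  "spectral_measure G v = (THE \<mu>. real_distribution \<mu> \<and>
     (\<forall>k\<ge>1. integrable \<mu> (\<lambda>x. x ^ k) \<and>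
        complex_of_real (\<integral>x. x ^ k \<partial>\<mu>)
          = l2_inner G (basis_vec v) ((net_op G ^^ k) (basis_vec v))))"

definition root_spectral_measure :: "gstar \<Rightarrow> real measure" where
  "root_spectral_measure g = spectral_measure (net (rep_gstar g)) (base (rep_gstar g))"

text \<open>The mixture is written out rather than obtained from \<^const>\<open>bind\<close>, which would require
  \<^const>\<open>root_spectral_measure\<close> to be well behaved also on classes of networks with unbounded
  operator, outside the support of the truncated law.\<close>

definition mean_spectral_measure :: "gstar measure \<Rightarrow> real measure" where
  "mean_spectral_measure \<rho> =
     measure_of UNIV (sets borel) (\<lambda>A. \<integral>\<^sup>+ g. emeasure (root_spectral_measure g) A \<partial>\<rho>)"

definition xi :: "real \<Rightarrow> gstar \<Rightarrow> ennreal" where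
  "xi \<beta> g = (\<Sum>\<^sub>\<infinity>v\<in>verts (net (rep_gstar g)).
     ennreal (cmod (wgt (net (rep_gstar g)) (base (rep_gstar g)) v) powr \<beta>))"

text \<open>\<open>mu \<rho>\<close> is \<open>\<mu>\<^sub>\<rho>\<close> for sofic \<open>\<rho>\<close>.\<close>

definition mu :: "gstar measure \<Rightarrow> real measure" where
  "mu \<rho> =
     (if \<exists>\<beta>. 0 < \<beta> \<and> \<beta> < 2 \<and> (\<integral>\<^sup>+ g. xi \<beta> g \<partial>\<rho>) < \<top>
      then (THE \<mu>. real_distribution \<mu> \<and>
              weakly_converges (\<lambda>\<theta>. mean_spectral_measure (truncate_law \<theta> \<rho>)) \<mu> (at_right 0))
      else return borel 0)"


section \<open>The rate function\<close>

text \<open>In \<^typ>\<open>ennreal\<close>, \<open>\<infinity> * 0 = 0\<close>.\<close>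

definition rate_I :: "real \<Rightarrow> ennreal \<Rightarrow> ennreal \<Rightarrow> gstar measure \<Rightarrow> ennreal" where
  "rate_I \<alpha> a b \<rho> =
     b * (\<integral>\<^sup>+ g. ennreal (cmod (wgt (net (rep_gstar g)) (base (rep_gstar g)) (base (rep_gstar g)))
                        powr \<alpha>) \<partial>\<rho>)
     + a / 2 * (\<integral>\<^sup>+ g. (\<Sum>\<^sub>\<infinity>v\<in>verts (net (rep_gstar g)) - {base (rep_gstar g)}.
                        ennreal (cmod (wgt (net (rep_gstar g)) (base (rep_gstar g)) v) powr \<alpha>)) \<partial>\<rho>)"

definition Phi ::
  "'w measure \<Rightarrow> ('w \<Rightarrow> complex) \<Rightarrow> ('w \<Rightarrow> complex) \<Rightarrow> real \<Rightarrow> ennreal \<Rightarrow> ennreal \<Rightarrow>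
   real measure \<Rightarrow> ennreal" where
  "Phi M X12 X11 \<alpha> a b \<nu> =
     (INF \<rho>\<in>{\<rho> \<in> sofic (support_a M a X12) (support_b M b X11). mu \<rho> = \<nu>}. rate_I \<alpha> a b \<rho>)"

definition abs_moment :: "real \<Rightarrow> real measure \<Rightarrow> ennreal" where
  "abs_moment \<alpha> \<nu> = (\<integral>\<^sup>+ x. ennreal (\<bar>x\<bar> powr \<alpha>) \<partial>\<nu>)"

definition symmetric_law :: "real measure \<Rightarrow> bool" where
  "symmetric_law \<nu> \<longleftrightarrow> distr \<nu> borel uminus = \<nu>"

end

theory Submission
 imports Defs
begin

text \<open>Lower bound. For \<open>\<alpha> < 2\<close>, Jensen's inequality and the subadditivity of \<open>t \<mapsto> t\<close> to the power
 \<open>\<alpha>/2\<close> bound the \<open>\<alpha>\<close>-th absolute moment of a spectral measure at the root, whose second moment is at most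
 the degree, by \<open>\<xi>\<^sub>\<alpha>\<close>; and \<open>min (a/2) b \<cdot> E \<xi>\<^sub>\<alpha> \<le> I(\<rho>)\<close>. The bound passes to \<open>\<mu>\<^sub>\<rho>\<close> because moments are lower
 semicontinuous. The weak limit \<open>\<mu>\<^sub>\<rho>\<close> exists because the Stieltjes transforms at two truncation levels
 differ little: on a finite network the two operators agree, up to an operator that is small on every
 basis vector, off a few vertices of large degree, and this controls the normalized trace of the
 resolvents; the estimate passes to local limits.

 Upper bounds. The law of a vertex with a loop of weight \<open>x\<close>, \<open>x\<close> of law \<open>\<nu>\<close>, is sofic (diagonal matrices
 of quantiles of \<open>\<nu>\<close>) and costs \<open>b\<close> times the moment. An edge of weight \<open>\<bar>x\<bar> s\<close>, \<open>s\<close> in the support of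
 the measure associated to \<open>X\<^sub>1\<^sub>2\<close>, has spectral measure \<open>(\<delta>\<^sub>x + \<delta>\<^bsub>-x\<^esub>)/2\<close> at both ends; for symmetric \<open>\<nu>\<close> this averages to \<open>\<nu>\<close>
 and costs \<open>a/2\<close> times the moment.\<close>

section \<open>Probability measures on the line\<close>

text \<open>Truncation depends on degrees, and degrees are not continuous for \<open>d_loc\<close>:
  many weights may tend to 0 while the sum of their squares does not. Limits are therefore taken in
  two stages. With degrees that ignore weights below a cut-off d > 0 all statistics are bounded and
  continuous, so weak convergence applies; then d tends to 0 at fixed \<theta>, by dominated
  convergence. This closes because the error in comparing two levels can be bounded independently of
  d and of the lower level, by a quantity that vanishes with the upper level.

  \<open>mu\<close> also asks for measurability of the truncation map on isomorphism classes. It is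
  proved with a countable family of finite rational patterns of the truncated network, and it makes
  the spectral measure at the root a probability kernel, so that mean spectral measures are mixtures
  to which the rules of integration apply.

  Truncated operators are bounded, so their spectral measures are determined by moments, which are
  weighted counts of closed walks; existence, invariance and continuity are all obtained from these
  numbers.\<close>

lemma bounded_continuous_integrable:
 fixes f :: "real \<Rightarrow> 'b::{banach, second_countable_topology}"
 assumes "real_distribution \<mu>" "continuous_on UNIV f" "\<And>x. norm (f x) \<le> B"
 shows "integrable \<mu> f"
proof -
 interpret real_distribution \<mu> by fact
 have "f \<in> borel_measurable borel" using assms(2) by (rule borel_measurable_continuous_onI)
 then have "f \<in> borel_measurable \<mu>" by simp
 then show ?thesis by (rule integrable_const_bound[where B=B, rotated]) (use assms(3) in auto)
qed

lemma AE_bounded_continuous_integrable: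
 fixes f :: "real \<Rightarrow> 'b::{banach, second_countable_topology}"
 assumes "real_distribution \<mu>" "continuous_on UNIV f" "AE x in \<mu>. \<bar>x\<bar> \<le> M"
 shows "integrable \<mu> f"
proof -
 interpret real_distribution \<mu> by fact
 have "f \<in> borel_measurable borel" using assms(2) by (rule borel_measurable_continuous_onI)
 then have meas: "f \<in> borel_measurable \<mu>" by simp
 have "bounded (f ` {-M..M})" by (intro compact_imp_bounded compact_continuous_image continuous_on_subset[OF assms(2)]) auto
 then obtain B where B: "\<And>x. x \<in> {-M..M} \<Longrightarrow> norm (f x) \<le> B" unfolding bounded_iff by (meson imageI)
 have "AE x in \<mu>. norm (f x) \<le> B" using assms(3) by eventually_elim (rule B, auto)
 then show ?thesis using meas by (rule integrable_const_bound)
qed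

text \<open>Bounded continuous functions include \<open>cos (t * x)\<close> and
  \<open>sin (t * x)\<close>, so the characteristic functions agree and Levy's uniqueness theorem
  applies.\<close>

lemma real_distribution_eqI:
 assumes "real_distribution \<mu>" "real_distribution \<nu>"
  and eq: "\<And>f :: real \<Rightarrow> real. continuous_on UNIV f \<Longrightarrow> bounded (range f) \<Longrightarrow> (\<integral>x. f x \<partial>\<mu>) = (\<integral>x. f x \<partial>\<nu>)"
 shows "\<mu> = \<nu>"
proof (rule Levy_uniqueness[OF assms(1,2)])
 show "char \<mu> = char \<nu>"
 proof
  fix t :: real
  have b: "bounded (range (\<lambda>x::real. cos (t * x)))" "bounded (range (\<lambda>x::real. sin (t * x)))" by (auto intro!: boundedI[where B=1])
  have c: "continuous_on UNIV (\<lambda>x::real. cos (t * x))" "continuous_on UNIV (\<lambda>x::real. sin (t * x))" by (auto intro!: continuous_intros)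
  have i: "integrable \<rho> (\<lambda>x. iexp (t * x))" if "real_distribution \<rho>" for \<rho>
   by (rule bounded_continuous_integrable[OF that, where B=1]) (auto intro!: continuous_intros)
  have "Re (char \<rho> t) = (\<integral>x. cos (t * x) \<partial>\<rho>) \<and> Im (char \<rho> t) = (\<integral>x. sin (t * x) \<partial>\<rho>)"
   if "real_distribution \<rho>" for \<rho> unfolding char_def using i[OF that] by (simp flip: integral_Re integral_Im add: Re_exp Im_exp)
  then show "char \<mu> t = char \<nu> t" using assms(1,2) eq[OF c(1) b(1)] eq[OF c(2) b(2)] by (simp add: complex_eq_iff)
 qed
qed

lemma complex_polynomial_approx:
 fixes f :: "real \<Rightarrow> complex"
 assumes "continuous_on {-M..M} f" "0 < e"
 obtains a n where "\<And>x. x \<in> {-M..M} \<Longrightarrow> cmod (f x - (\<Sum>i\<le>n::nat. a i * of_real x ^ i)) < e"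
proof -
 have "compact {-M..M}" by simp
 obtain g where g: "real_polynomial_function g" "\<And>x. x \<in> {-M..M} \<Longrightarrow> \<bar>Re (f x) - g x\<bar> < e/2"
  by (rule Stone_Weierstrass_real_polynomial_function[of "{-M..M}" "\<lambda>x. Re (f x)" "e/2"])
   (use assms in \<open>auto intro: continuous_intros\<close>)
 obtain h where h: "real_polynomial_function h" "\<And>x. x \<in> {-M..M} \<Longrightarrow> \<bar>Im (f x) - h x\<bar> < e/2"
  by (rule Stone_Weierstrass_real_polynomial_function[of "{-M..M}" "\<lambda>x. Im (f x)" "e/2"])
   (use assms in \<open>auto intro: continuous_intros\<close>)
 obtain a n where an: "g = (\<lambda>x. \<Sum>i\<le>n::nat. a i * x^i)" using g(1) real_polynomial_function_iff_sum by metis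
 obtain b m where bm: "h = (\<lambda>x. \<Sum>i\<le>m::nat. b i * x^i)" using h(1) real_polynomial_function_iff_sum by metis
 \<comment> \<open>The two real polynomials may have different degrees; their coefficients are
   padded with 0 up to the larger one.\<close>
 define c where "c i = Complex (if i \<le> n then a i else 0) (if i \<le> m then b i else 0)" for i
 have pw: "(\<Sum>i\<le>max n m. c i * of_real x ^ i) = Complex (g x) (h x)" for x
 proof -
  have 1: "(\<Sum>i\<le>max n m. (if i \<le> n then a i else 0) * x ^ i) = g x" unfolding an by (rule sum.mono_neutral_cong_right) auto
  have 2: "(\<Sum>i\<le>max n m. (if i \<le> m then b i else 0) * x ^ i) = h x" unfolding bm by (rule sum.mono_neutral_cong_right) auto
  have "Re (\<Sum>i\<le>max n m. c i * of_real x ^ i) = g x" "Im (\<Sum>i\<le>max n m. c i * of_real x ^ i) = h x"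
   unfolding 1[symmetric] 2[symmetric] Re_sum Im_sum c_def of_real_power[symmetric] by (simp_all del: of_real_power)
  then show ?thesis by (simp add: complex_eq_iff)
 qed
 show thesis
 proof (rule that)
  fix x assume x: "x \<in> {-M..M}"
  have "cmod (f x - Complex (g x) (h x)) \<le> \<bar>Re (f x) - g x\<bar> + \<bar>Im (f x) - h x\<bar>" using cmod_le[of "f x - Complex (g x) (h x)"] by simp
  also have "\<dots> < e" using g(2)[OF x] h(2)[OF x] by simp
  finally show "cmod (f x - (\<Sum>i\<le>max n m. c i * of_real x ^ i)) < e" unfolding pw .
 qed
qed

text \<open>Convergence of moments is only assumed; the support bound is what makes it imply
 convergence of all integrals.\<close>

lemma tendsto_integral_of_moments:
 fixes f :: "real \<Rightarrow> complex" and \<mu> :: "'i \<Rightarrow> real measure"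
 assumes rd: "\<forall>\<^sub>F i in F. real_distribution (\<mu> i) \<and> (AE x in \<mu> i. \<bar>x\<bar> \<le> M)"
  and rd0: "real_distribution \<nu>" "AE x in \<nu>. \<bar>x\<bar> \<le> M"
  and mom: "\<And>k. ((\<lambda>i. \<integral>x. x ^ k \<partial>\<mu> i) \<longlongrightarrow> (\<integral>x. x ^ k \<partial>\<nu>)) F"
  and f: "continuous_on UNIV f"
 shows "((\<lambda>i. \<integral>x. f x \<partial>\<mu> i) \<longlongrightarrow> (\<integral>x. f x \<partial>\<nu>)) F"
proof (rule tendstoI)
 fix e :: real assume e: "e > 0"
 obtain a n where an: "\<And>x. x \<in> {-M..M} \<Longrightarrow> cmod (f x - (\<Sum>i\<le>n::nat. a i * of_real x ^ i)) < e/3"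
  by (rule complex_polynomial_approx[of M f "e/3"]) (use f e in \<open>auto intro: continuous_on_subset\<close>)
 define p where "p x = (\<Sum>i\<le>n. a i * of_real x ^ i)" for x :: real
 have pc: "continuous_on UNIV p" unfolding p_def by (auto intro!: continuous_intros)
 have pI: "(\<integral>x. p x \<partial>\<rho>) = (\<Sum>i\<le>n. a i * of_real (\<integral>x. x ^ i \<partial>\<rho>))"
  if "real_distribution \<rho>" "AE x in \<rho>. \<bar>x\<bar> \<le> M" for \<rho>
 proof -
  have "integrable \<rho> (\<lambda>x. a i * of_real x ^ i)" for i
   by (rule AE_bounded_continuous_integrable[OF that(1) _ that(2)]) (auto intro!: continuous_intros)
  moreover have "(\<integral>x. a i * of_real x ^ i \<partial>\<rho>) = a i * of_real (\<integral>x. x ^ i \<partial>\<rho>)" for i unfolding of_real_power[symmetric] by (simp del: of_real_power)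
  ultimately show ?thesis unfolding p_def by (subst Bochner_Integration.integral_sum) (simp_all only:)
 qed
 have close: "cmod ((\<integral>x. f x \<partial>\<rho>) - (\<integral>x. p x \<partial>\<rho>)) \<le> e/3"
  if "real_distribution \<rho>" "AE x in \<rho>. \<bar>x\<bar> \<le> M" for \<rho>
 proof -
  interpret real_distribution \<rho> by fact
  have "cmod ((\<integral>x. f x \<partial>\<rho>) - (\<integral>x. p x \<partial>\<rho>)) = cmod (\<integral>x. f x - p x \<partial>\<rho>)"
   using AE_bounded_continuous_integrable[OF that(1) f that(2)] AE_bounded_continuous_integrable[OF that(1) pc that(2)] by simp
  also have "\<dots> \<le> (\<integral>x. cmod (f x - p x) \<partial>\<rho>)" by (rule integral_norm_bound)
  also have "\<dots> \<le> e/3"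
  proof (rule integral_le_const)
   show "integrable \<rho> (\<lambda>x. cmod (f x - p x))" by (rule AE_bounded_continuous_integrable[OF that(1) _ that(2)]) (intro continuous_intros f pc)
   show "AE x in \<rho>. cmod (f x - p x) \<le> e/3" using that(2)
   proof eventually_elim
    case (elim x)
    then show ?case using an[of x] by (auto simp: p_def abs_le_iff)
   qed
  qed
  finally show ?thesis .
 qed
 have "((\<lambda>i. \<Sum>k\<le>n. a k * of_real (\<integral>x. x ^ k \<partial>\<mu> i)) \<longlongrightarrow> (\<Sum>k\<le>n. a k * of_real (\<integral>x. x ^ k \<partial>\<nu>))) F" by (intro tendsto_intros mom)
 then have "\<forall>\<^sub>F i in F. dist (\<Sum>k\<le>n. a k * of_real (\<integral>x. x ^ k \<partial>\<mu> i)) (\<Sum>k\<le>n. a k * of_real (\<integral>x. x ^ k \<partial>\<nu>)) < e/3" by (rule tendstoD) (use e in simp)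
 with rd show "\<forall>\<^sub>F i in F. dist (\<integral>x. f x \<partial>\<mu> i) (\<integral>x. f x \<partial>\<nu>) < e"
 proof eventually_elim
  case (elim i)
  have "dist (\<integral>x. p x \<partial>\<mu> i) (\<integral>x. p x \<partial>\<nu>) < e/3" using elim pI[OF rd0] pI[of "\<mu> i"] by simp
  moreover have "dist (\<integral>x. f x \<partial>\<mu> i) (\<integral>x. p x \<partial>\<mu> i) \<le> e/3" using close[of "\<mu> i"] elim by (simp add: dist_norm)
  moreover have "dist (\<integral>x. p x \<partial>\<nu>) (\<integral>x. f x \<partial>\<nu>) \<le> e/3" using close[OF rd0] by (simp add: dist_norm norm_minus_commute)
  ultimately show ?case using dist_triangle[of "\<integral>x. f x \<partial>\<mu> i" "\<integral>x. f x \<partial>\<nu>" "\<integral>x. p x \<partial>\<mu> i"]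
    dist_triangle[of "\<integral>x. p x \<partial>\<mu> i" "\<integral>x. f x \<partial>\<nu>" "\<integral>x. p x \<partial>\<nu>"] by linarith
 qed
qed

text \<open>Markov's inequality for the moment of order 2k bounds the mass of |x| >= M + e by
  \<open>(M / (M + e)) ^ (2 * k)\<close>, which tends to 0. The support of \<open>\<nu>\<close> is
  not known beforehand, because the description that defines \<open>spectral_measure\<close> ranges
  over all real distributions.\<close>

lemma AE_bounded_of_moments:
 assumes "real_distribution \<mu>" "AE x in \<mu>. \<bar>x\<bar> \<le> M" "real_distribution \<nu>" "0 \<le> M"
  and int: "\<And>k. integrable \<nu> (\<lambda>x. x ^ k)" and mom: "\<And>k. (\<integral>x. x ^ k \<partial>\<nu>) = (\<integral>x. x ^ k \<partial>\<mu>)"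
 shows "AE x in \<nu>. \<bar>x\<bar> \<le> M"
proof -
 interpret \<mu>: real_distribution \<mu> by fact
 interpret \<nu>: real_distribution \<nu> by fact
 have null: "measure \<nu> {x. M + e \<le> \<bar>x\<bar>} = 0" if "e > 0" for e :: real
 proof -
  have le: "measure \<nu> {x. M + e \<le> \<bar>x\<bar>} \<le> (M / (M + e)) ^ (2 * k)" for k
  proof -
   have "(M + e) ^ (2 * k) * measure \<nu> {x. M + e \<le> \<bar>x\<bar>} = (\<integral>x. (M + e) ^ (2 * k) * indicator {x. M + e \<le> \<bar>x\<bar>} x \<partial>\<nu>)" by simp
   also have "\<dots> \<le> (\<integral>x. x ^ (2 * k) \<partial>\<nu>)"
   proof (rule integral_mono)
    show "integrable \<nu> (\<lambda>x. (M + e) ^ (2 * k) * indicator {x. M + e \<le> \<bar>x\<bar>} x)"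
     by (intro integrable_mult_right integrable_real_indicator) (auto simp: \<nu>.emeasure_eq_measure)
    show "integrable \<nu> (\<lambda>x. x ^ (2 * k))" by (rule int)
    fix x :: real
    show "(M + e) ^ (2 * k) * indicator {x. M + e \<le> \<bar>x\<bar>} x \<le> x ^ (2 * k)"
    proof (cases "M + e \<le> \<bar>x\<bar>")
     case True
     then have "(M + e) ^ (2 * k) \<le> \<bar>x\<bar> ^ (2 * k)" by (rule power_mono) (use that assms(4) in simp)
     then show ?thesis using True by (simp add: power_even_abs)
    qed simp
   qed
   also have "\<dots> = (\<integral>x. x ^ (2 * k) \<partial>\<mu>)" by (rule mom)
   also have "\<dots> \<le> M ^ (2 * k)"
   proof (rule \<mu>.integral_le_const)
    show "integrable \<mu> (\<lambda>x. x ^ (2 * k))" by (rule AE_bounded_continuous_integrable[OF assms(1) _ assms(2)]) (intro continuous_intros)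
    show "AE x in \<mu>. x ^ (2 * k) \<le> M ^ (2 * k)" using assms(2)
    proof eventually_elim
     case (elim x)
     then have "\<bar>x\<bar> ^ (2 * k) \<le> M ^ (2 * k)" by (rule power_mono) simp
     then show ?case by (simp add: power_even_abs)
    qed
   qed
   finally show ?thesis using that assms(4) by (simp add: power_divide field_simps)
  qed
  have "(\<lambda>k. (M / (M + e)) ^ (2 * k)) \<longlonglongrightarrow> 0"
   unfolding power_mult by (rule LIMSEQ_realpow_zero) (use that assms(4) in \<open>auto simp: abs_square_less_1 simp del: power_divide\<close>)
  then have "measure \<nu> {x. M + e \<le> \<bar>x\<bar>} \<le> 0" by (rule Lim_bounded2) (use le in auto)
  then show ?thesis by (simp add: measure_le_0_iff)
 qed
 have "AE x in \<nu>. \<not> (M + 1 / Suc n \<le> \<bar>x\<bar>)" for n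
 proof (rule AE_I[where N="{x. M + 1 / Suc n \<le> \<bar>x\<bar>}"])
  show "emeasure \<nu> {x. M + 1 / Suc n \<le> \<bar>x\<bar>} = 0" using null[of "1 / Suc n"] by (simp add: \<nu>.emeasure_eq_measure)
 qed auto
 then have "AE x in \<nu>. \<forall>n. \<not> (M + 1 / Suc n \<le> \<bar>x\<bar>)" by (simp add: AE_all_countable)
 then show ?thesis
 proof eventually_elim
  case (elim x)
  show ?case
  proof (rule ccontr)
   assume "\<not> \<bar>x\<bar> \<le> M"
   then obtain n where "1 / Suc n < \<bar>x\<bar> - M" using nat_approx_posE[of "\<bar>x\<bar> - M"] by (metis diff_gt_0_iff_gt not_le)
   then show False using elim[rule_format, of n] by simp
  qed
 qed
qed

lemma real_distribution_eq_of_moments: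
 assumes "real_distribution \<mu>" "AE x in \<mu>. \<bar>x\<bar> \<le> M" "real_distribution \<nu>" "0 \<le> M"
  and int: "\<And>k. integrable \<nu> (\<lambda>x. x ^ k)" and mom: "\<And>k. (\<integral>x. x ^ k \<partial>\<nu>) = (\<integral>x. x ^ k \<partial>\<mu>)"
 shows "\<mu> = \<nu>"
proof (rule real_distribution_eqI[OF assms(1,3)])
 fix f :: "real \<Rightarrow> real" assume f: "continuous_on UNIV f"
 have "AE x in \<nu>. \<bar>x\<bar> \<le> M" by (rule AE_bounded_of_moments[OF assms])
 \<comment> \<open>A constant sequence: its moments are those of \<open>\<nu>\<close>, so the
   convergence lemma yields equality of the integrals.\<close>
 then have "((\<lambda>_::nat. \<integral>x. complex_of_real (f x) \<partial>\<mu>) \<longlongrightarrow> (\<integral>x. complex_of_real (f x) \<partial>\<nu>)) sequentially"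
  using assms f by (intro tendsto_integral_of_moments[where M=M]) (auto intro!: continuous_intros)
 then show "(\<integral>x. f x \<partial>\<mu>) = (\<integral>x. f x \<partial>\<nu>)" by (simp add: LIMSEQ_const_iff)
qed

lemma weakly_converges_unique:
 assumes "real_distribution \<mu>" "real_distribution \<nu>" "weakly_converges X \<mu> F" "weakly_converges X \<nu> F" "F \<noteq> bot"
 shows "\<mu> = \<nu>" by (rule real_distribution_eqI[OF assms(1,2)])
  (use assms(3-5) in \<open>auto simp: weakly_converges_def intro: tendsto_unique\<close>)

section \<open>The moment problem on a bounded interval, solved with Bernstein polynomials\<close>

lemma sum_binomial_choose:
 fixes a b :: "'a::comm_semiring_1"
 assumes "j \<le> n"
 shows "(\<Sum>k\<le>n. of_nat (n choose k) * of_nat (k choose j) * a ^ k * b ^ (n - k))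
      = of_nat (n choose j) * a ^ j * (a + b) ^ (n - j)"
proof -
 have "(\<Sum>k\<le>n. of_nat (n choose k) * of_nat (k choose j) * a ^ k * b ^ (n - k))
   = (\<Sum>k\<in>(+) j ` {..n-j}. of_nat (n choose k) * of_nat (k choose j) * a ^ k * b ^ (n - k))"
 proof (rule sum.mono_neutral_right)
  have "k \<in> (+) j ` {..n-j}" if "j \<le> k" "k \<le> n" for k by (rule image_eqI[of _ _ "k - j"]) (use that in auto)
  then show "\<forall>i\<in>{..n} - (+) j ` {..n - j}. of_nat (n choose i) * of_nat (i choose j) * a ^ i * b ^ (n - i) = 0"
   by (metis Diff_iff atMost_iff binomial_eq_0 mult_zero_left mult_zero_right not_le of_nat_0)
 qed (use assms in auto)
 also have "\<dots> = (\<Sum>i\<le>n-j. of_nat (n choose (j+i)) * of_nat ((j+i) choose j) * a ^ (j+i) * b ^ (n - (j+i)))" by (subst sum.reindex) auto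
 \<comment> \<open>Choosing k of n and then j of those k is choosing j of n and then k - j of the
   rest; what remains is the binomial theorem. With \<open>a + b = 1\<close> this evaluates the j-th
   binomial moment of the Bernstein weights exactly.\<close>
 also have "\<dots> = (\<Sum>i\<le>n-j. of_nat (n choose j) * a ^ j * (of_nat ((n-j) choose i) * a ^ i * b ^ (n - j - i)))"
 proof (rule sum.cong)
  fix i assume "i \<in> {..n-j}"
  then have "(n choose (j+i)) * ((j+i) choose j) = (n choose j) * ((n-j) choose i)" using choose_mult[of j "j+i" n] assms by simp
  then have "(of_nat (n choose (j+i)) * of_nat ((j+i) choose j) :: 'a) = of_nat (n choose j) * of_nat ((n-j) choose i)" by (metis of_nat_mult)
  then show "of_nat (n choose (j+i)) * of_nat ((j+i) choose j) * a ^ (j+i) * b ^ (n - (j+i))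
   = of_nat (n choose j) * a ^ j * (of_nat ((n-j) choose i) * a ^ i * b ^ (n - j - i))" by (simp add: power_add mult.assoc mult.left_commute)
 qed simp
 also have "\<dots> = of_nat (n choose j) * a ^ j * (a + b) ^ (n - j)" by (simp add: sum_distrib_left binomial_ring)
 finally show ?thesis .
qed

text \<open>The quotient is the product over i < j of (k - i)/(n - i), and each factor is within
  j/(n - j) of k/n. As n grows, binomial moments divided by \<open>n choose j\<close> thus become
  power moments of the points k/n.\<close>

lemma choose_ratio_approx:
 assumes "2 * j < n" "k \<le> n"
 shows "\<bar>real (k choose j) / real (n choose j) - (real k / real n) ^ j\<bar> \<le> real j * real j / (real n - real j)"
proof -
 have ratio: "real (k choose j) / real (n choose j) = (\<Prod>i<j. (real k - real i) / (real n - real i))"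
  by (simp add: binomial_gbinomial gbinomial_prod_rev prod_dividef atLeast0LessThan)
 have "\<bar>(\<Prod>i<j. (real k - real i) / (real n - real i)) - (\<Prod>i<j. real k / real n)\<bar>
   \<le> (\<Sum>i<j. \<bar>(real k - real i) / (real n - real i) - real k / real n\<bar>)"
  using norm_prod_diff[of "{..<j}" "\<lambda>i. (real k - real i) / (real n - real i)" "\<lambda>i. real k / real n"] assms by (auto simp: abs_le_iff divide_simps)
 also have "\<dots> \<le> (\<Sum>i<j. real j / (real n - real j))"
 proof (rule sum_mono)
  fix i assume i: "i \<in> {..<j}"
  have "(real k - real i) / (real n - real i) - real k / real n = - (real i * (1 - real k / real n) / (real n - real i))"
   using assms i by (auto simp: field_simps)
  then have "\<bar>(real k - real i) / (real n - real i) - real k / real n\<bar> = real i * (1 - real k / real n) / (real n - real i)"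
   using assms i by (auto simp: abs_mult divide_simps)
  also have "\<dots> \<le> real j / (real n - real j)"
  proof (rule frac_le)
   have "real i * (1 - real k / real n) \<le> real i * 1" by (rule mult_left_mono) auto
   then show "real i * (1 - real k / real n) \<le> real j" using i by auto
  qed (use assms i in auto)
  finally show "\<bar>(real k - real i) / (real n - real i) - real k / real n\<bar> \<le> real j / (real n - real j)" .
 qed
 finally show ?thesis unfolding ratio by (simp add: power_divide)
qed

text \<open>The Hausdorff moment problem. The approximating measures put the (nonnegative) values of the
 functional on the Bernstein polynomials at the points \<open>k/n\<close>; their \<open>j\<close>-th binomial moments are
 those of the functional exactly, hence so are the power moments of a limit point.\<close>

lemma moment_problem_unit_interval:
 fixes L :: "real poly \<Rightarrow> real"
 assumes add: "\<And>p q. L (p + q) = L p + L q" and smult: "\<And>c p. L (smult c p) = c * L p" and one: "L 1 = 1"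
  and sq: "\<And>p. 0 \<le> L (p * p)" and sq0: "\<And>p. 0 \<le> L ([:0,1:] * (p * p))" and sq1: "\<And>p. 0 \<le> L ([:1,-1:] * (p * p))"
 shows "\<exists>\<mu>. real_distribution \<mu> \<and> (AE x in \<mu>. x \<in> {0..1}) \<and> (\<forall>p. (\<integral>x. poly p x \<partial>\<mu>) = L p)"
proof -
 let ?X = "[:0,1:] :: real poly" and ?Y = "[:1,-1:] :: real poly"
 have L0: "L 0 = 0" using smult[of 0 0] by simp
 have Lsum: "L (\<Sum>i\<in>A. f i) = (\<Sum>i\<in>A. L (f i))" for A :: "nat set" and f by (induction A rule: infinite_finite_induct) (auto simp: L0 add)
 have XY: "?X + ?Y = 1" by (simp add: one_pCons)
 have pos: "0 \<le> L (?X ^ k * ?Y ^ m)" for k m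
 proof -
  have e: "even k \<Longrightarrow> \<exists>q. p ^ k = q * q" for p :: "real poly" and k by (metis evenE mult_2 power_add)
  have o: "odd k \<Longrightarrow> \<exists>q. p ^ k = p * (q * q)" for p :: "real poly" and k using e[of "k-1" p] by (cases k) auto
  consider "even k" "even m" | "odd k" "even m" | "even k" "odd m" | "odd k" "odd m" by blast
  then show ?thesis
  proof cases
   case 1 then obtain p q where "?X ^ k = p * p" "?Y ^ m = q * q" using e by metis
   then show ?thesis using sq[of "p * q"] by (simp only: mult_ac)
  next
   case 2 then obtain p q where "?X ^ k = ?X * (p * p)" "?Y ^ m = q * q" using e o by metis
   then show ?thesis using sq0[of "p * q"] by (simp only: mult_ac)
  next
   case 3 then obtain p q where "?X ^ k = p * p" "?Y ^ m = ?Y * (q * q)" using e o by metis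
   then show ?thesis using sq1[of "p * q"] by (simp only: mult_ac)
  next
   \<comment> \<open>X Y times a square is covered by neither \<open>sq0\<close> nor
     \<open>sq1\<close>; multiplying by X + Y = 1 splits it into Y times the square of X p q plus X
     times the square of Y p q.\<close>
   case 4 then obtain p q where pq: "?X ^ k = ?X * (p * p)" "?Y ^ m = ?Y * (q * q)" using o by metis
   have "?X ^ k * ?Y ^ m = (?X + ?Y) * (?X ^ k * ?Y ^ m)" unfolding XY by simp
   also have "\<dots> = ?Y * ((?X * (p * q)) * (?X * (p * q))) + ?X * ((?Y * (p * q)) * (?Y * (p * q)))" unfolding pq by (simp only: ring_distribs mult_ac)
   finally show ?thesis using sq1[of "?X * (p * q)"] sq0[of "?Y * (p * q)"] by (simp only: add)
  qed
 qed
 define w where "w n k = L (of_nat (n choose k) * ?X ^ k * ?Y ^ (n - k))" for n k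
 have of_nat_smult: "of_nat c * p = Polynomial.smult (real c) p" for c and p :: "real poly" by (simp add: of_nat_poly)
 have w_nonneg: "0 \<le> w n k" for n k unfolding w_def mult.assoc by (subst of_nat_smult, subst smult) (simp add: pos)
 have w_choose: "(\<Sum>k\<le>n. w n k * real (k choose j)) = real (n choose j) * L (?X ^ j)" if "j \<le> n" for n j
 proof -
  have "(\<Sum>k\<le>n. w n k * real (k choose j)) = (\<Sum>k\<le>n. L (of_nat (n choose k) * of_nat (k choose j) * ?X ^ k * ?Y ^ (n - k)))"
   unfolding w_def by (intro sum.cong) (simp_all add: mult.assoc of_nat_smult smult)
  also have "\<dots> = L (of_nat (n choose j) * ?X ^ j * (?X + ?Y) ^ (n - j))" by (simp only: sum_binomial_choose[OF that] flip: Lsum)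
  finally show ?thesis unfolding XY by (simp add: of_nat_smult smult)
 qed
 have w_sum: "(\<Sum>k\<le>n. w n k) = 1" for n using w_choose[of 0 n] one by simp
 define \<mu> where "\<mu> n = distr (point_measure {..n} (\<lambda>k. ennreal (w n k))) borel (\<lambda>k. real k / real n)" for n
 have int\<mu>: "(\<integral>x. f x \<partial>\<mu> n) = (\<Sum>k\<le>n. w n k * f (real k / real n))" if "f \<in> borel_measurable borel" for f :: "real \<Rightarrow> real" and n
  unfolding \<mu>_def using that w_nonneg
  by (subst integral_distr) (auto simp: lebesgue_integral_point_measure_finite space_point_measure sets_point_measure measurable_def)
 have rd: "real_distribution (\<mu> n)" for n
 proof -
  have "prob_space (point_measure {..n} (\<lambda>k. ennreal (w n k)))"
   by (rule prob_spaceI) (simp add: space_point_measure emeasure_point_measure_finite w_nonneg w_sum sum_ennreal)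
  then have "prob_space (\<mu> n)" unfolding \<mu>_def
   by (rule prob_space.prob_space_distr) (auto simp: sets_point_measure measurable_def space_point_measure)
  then show ?thesis unfolding real_distribution_def real_distribution_axioms_def by (simp add: \<mu>_def)
 qed
 have "tight \<mu>" unfolding tight_def
 proof (intro conjI allI impI rd)
  fix e :: real assume e: "e > 0"
  \<comment> \<open>Tightness is stated with half-open intervals; starting at -1 keeps the atom at 0
    inside.\<close>
  have "measure (\<mu> n) {-1<..1} = 1" for n
  proof -
   interpret real_distribution "\<mu> n" by (rule rd)
   have "measure (\<mu> n) {-1<..1} = (\<integral>x. indicator {-1<..1} x \<partial>\<mu> n)" by simp
   also have "\<dots> = (\<Sum>k\<le>n. w n k * indicator {-1<..1} (real k / real n))" by (rule int\<mu>) simp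
   also have "\<dots> = (\<Sum>k\<le>n. w n k)"
   proof (rule sum.cong)
    fix k assume "k \<in> {..n}"
    then have "real k / real n \<le> 1" by (cases "n = 0") auto
    moreover have "- 1 < real k / real n" by (rule less_le_trans[of _ 0]) auto
    ultimately show "w n k * indicator {-1<..1} (real k / real n) = w n k" by simp
   qed simp
   finally show ?thesis by (simp add: w_sum)
  qed
  then show "\<exists>a b. a < b \<and> (\<forall>n. 1 - e < measure (\<mu> n) {a<..b})" using e by (intro exI[of _ "-1"] exI[of _ 1]) auto
 qed
 from tight_imp_convergent_subsubsequence[OF this strict_mono_id] obtain r \<nu>
  where r: "strict_mono (r :: nat \<Rightarrow> nat)" and \<nu>: "real_distribution \<nu>" and wc: "weak_conv_m (\<mu> \<circ> r) \<nu>" by auto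
 interpret \<nu>: real_distribution \<nu> by fact
 have conv: "(\<lambda>n. \<integral>x. f x \<partial>\<mu> (r n)) \<longlonglongrightarrow> (\<integral>x. f x \<partial>\<nu>)" if "continuous_on UNIV f" "\<And>x. \<bar>f x\<bar> \<le> B" for f :: "real \<Rightarrow> real" and B
  using weak_conv_imp_integral_bdd_continuous_conv[of "\<mu> \<circ> r" \<nu> f B] rd \<nu> wc that by (auto simp: continuous_on_eq_continuous_at)
 \<comment> \<open>Weak convergence tests only bounded continuous functions. Composing with
   \<open>clip\<close> bounds the powers on the whole line and changes nothing at the points
   k/n.\<close>
 define clip where "clip x = min 1 (max 0 x)" for x :: real
 have clip: "continuous_on UNIV clip" "\<And>x. 0 \<le> clip x" "\<And>x. clip x \<le> 1" "\<And>x. x \<in> {0..1} \<Longrightarrow> clip x = x"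
  unfolding clip_def by (auto intro!: continuous_intros)
 have unit: "real k / real n \<in> {0..1}" if "k \<le> n" for k n using that by (cases "n = 0") auto
 have supp: "AE x in \<nu>. x \<in> {0..1}"
 proof -
  \<comment> \<open>A capped distance to [0,1]: its integral vanishes for every approximating
    measure, hence in the limit, so the limit lives on [0,1].\<close>
  define h where "h x = min 1 \<bar>x - clip x\<bar>" for x
  have hc: "continuous_on UNIV h" unfolding h_def by (intro continuous_intros clip)
  have hb: "\<bar>h x\<bar> \<le> 1" for x unfolding h_def by simp
  have "(\<integral>x. h x \<partial>\<mu> n) = 0" for n by (subst int\<mu>) (auto intro!: borel_measurable_continuous_onI hc sum.neutral simp: h_def clip(4)[OF unit])
  then have "(\<integral>x. h x \<partial>\<nu>) = 0" using conv[OF hc hb] by (simp add: LIMSEQ_const_iff)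
  then have "AE x in \<nu>. h x = 0" using bounded_continuous_integrable[OF \<nu> hc, of 1] hb by (subst (asm) integral_nonneg_eq_0_iff_AE) (auto simp: h_def)
  then show ?thesis by eventually_elim (auto simp: h_def clip_def min_def max_def split: if_splits)
 qed
 have mom: "(\<integral>x. x ^ j \<partial>\<nu>) = L (?X ^ j)" for j
 proof -
  define f where "f x = clip x ^ j" for x
  have fc: "continuous_on UNIV f" unfolding f_def by (intro continuous_intros clip)
  have fb: "\<bar>f x\<bar> \<le> 1" for x unfolding f_def using clip(2,3) by (simp add: power_le_one)
  have est: "\<bar>(\<integral>x. f x \<partial>\<mu> n) - L (?X ^ j)\<bar> \<le> real j * real j / (real n - real j)" if n: "2 * j < n" for n
  proof -
   have "(\<integral>x. f x \<partial>\<mu> n) = (\<Sum>k\<le>n. w n k * (real k / real n) ^ j)"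
    by (subst int\<mu>) (auto intro!: borel_measurable_continuous_onI fc sum.cong simp: f_def clip(4)[OF unit])
   moreover have "L (?X ^ j) = (\<Sum>k\<le>n. w n k * (real (k choose j) / real (n choose j)))"
    using w_choose[of j n] n by (simp add: sum_divide_distrib[symmetric] field_simps)
   ultimately have "\<bar>(\<integral>x. f x \<partial>\<mu> n) - L (?X ^ j)\<bar> = \<bar>\<Sum>k\<le>n. w n k * ((real k / real n) ^ j - real (k choose j) / real (n choose j))\<bar>"
    by (simp add: sum_subtractf right_diff_distrib)
   also have "\<dots> \<le> (\<Sum>k\<le>n. w n k * (real j * real j / (real n - real j)))" using w_nonneg choose_ratio_approx[OF n]
    by (intro sum_abs[THEN order_trans] sum_mono) (auto simp: abs_mult abs_minus_commute simp del: times_divide_eq_right intro!: mult_left_mono)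
   also have "\<dots> = real j * real j / (real n - real j)" by (simp only: w_sum mult_1 flip: sum_distrib_right)
   finally show ?thesis .
  qed
  have "(\<lambda>n. (\<integral>x. f x \<partial>\<mu> n) - L (?X ^ j)) \<longlonglongrightarrow> 0"
  proof (rule Lim_null_comparison)
   show "\<forall>\<^sub>F n in sequentially. norm ((\<integral>x. f x \<partial>\<mu> n) - L (?X ^ j)) \<le> real j * real j / (real n - real j)"
    using eventually_gt_at_top[of "2 * j"] by eventually_elim (use est in auto)
   show "(\<lambda>n. real j * real j / (real n - real j)) \<longlonglongrightarrow> 0" by (rule real_tendsto_divide_at_top[OF tendsto_const])
     (use filterlim_tendsto_add_at_top[OF tendsto_const filterlim_real_sequentially, of "- real j"] in simp)
  qed
  then have "(\<lambda>n. \<integral>x. f x \<partial>\<mu> n) \<longlonglongrightarrow> L (?X ^ j)" by (simp add: LIM_zero_iff)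
  then have "(\<lambda>n. \<integral>x. f x \<partial>\<mu> (r n)) \<longlonglongrightarrow> L (?X ^ j)" using LIMSEQ_subseq_LIMSEQ[OF _ r] by (auto simp: o_def)
  then have "(\<integral>x. f x \<partial>\<nu>) = L (?X ^ j)" using conv[OF fc fb] LIMSEQ_unique by blast
  moreover have "(\<integral>x. f x \<partial>\<nu>) = (\<integral>x. x ^ j \<partial>\<nu>)"
  proof (rule integral_cong_AE)
   show "f \<in> borel_measurable \<nu>" using borel_measurable_continuous_onI[OF fc] by simp
   show "AE x in \<nu>. f x = x ^ j" using supp by eventually_elim (simp add: f_def clip(4))
  qed simp
  ultimately show ?thesis by simp
 qed
 have supp': "AE x in \<nu>. \<bar>x\<bar> \<le> 1" using supp by eventually_elim auto
 have "(\<integral>x. poly p x \<partial>\<nu>) = L p" for p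
 proof -
  have "(\<integral>x. poly p x \<partial>\<nu>) = (\<integral>x. (\<Sum>i\<le>degree p. coeff p i * x ^ i) \<partial>\<nu>)" by (simp add: poly_altdef)
  also have "\<dots> = (\<Sum>i\<le>degree p. coeff p i * (\<integral>x. x ^ i \<partial>\<nu>))" by (subst Bochner_Integration.integral_sum)
    (auto intro!: AE_bounded_continuous_integrable[OF \<nu> _ supp'] continuous_intros integrable_mult_right)
  also have "\<dots> = L (\<Sum>i\<le>degree p. Polynomial.smult (coeff p i) (?X ^ i))" by (simp add: mom Lsum smult)
  also have "(\<Sum>i\<le>degree p. Polynomial.smult (coeff p i) (?X ^ i)) = p" by (simp add: smult_monom poly_as_sum_of_monoms flip: monom_altdef)
  finally show ?thesis .
 qed
 then show ?thesis using \<nu> supp by blast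
qed

text \<open>The substitution \<open>s\<close>, which maps [-M, M] onto [0,1], turns X and 1 - X into
  multiples of M + X and M - X; by \<open>bd\<close> both are nonnegative against squares. The
  measure found on [0,1] is carried back by the inverse map \<open>t\<close>.\<close>

lemma moment_problem_symmetric_interval:
 fixes L :: "real poly \<Rightarrow> real"
 assumes add: "\<And>p q. L (p + q) = L p + L q" and smult: "\<And>c p. L (smult c p) = c * L p" and one: "L 1 = 1"
  and sq: "\<And>p. 0 \<le> L (p * p)" and bd: "\<And>p. \<bar>L ([:0,1:] * (p * p))\<bar> \<le> M * L (p * p)" and M: "0 < M"
 shows "\<exists>\<mu>. real_distribution \<mu> \<and> (AE x in \<mu>. \<bar>x\<bar> \<le> M) \<and> (\<forall>p. (\<integral>x. poly p x \<partial>\<mu>) = L p)"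
proof -
 define s where "s = [:1/2, 1/(2*M):]"
 define \<Lambda> where "\<Lambda> q = L (q \<circ>\<^sub>p s)" for q
 have pos: "0 \<le> L ([:M, 1:] * (p * p))" "0 \<le> L ([:M, -1:] * (p * p))" for p
 proof -
  have 1: "[:M, 1:] * (p * p) = Polynomial.smult M (p * p) + [:0,1:] * (p * p)"
   "[:M, -1:] * (p * p) = Polynomial.smult M (p * p) + Polynomial.smult (-1) ([:0,1:] * (p * p))" by (simp_all add: mult_pCons_left)
  show "0 \<le> L ([:M, 1:] * (p * p))" "0 \<le> L ([:M, -1:] * (p * p))" using bd[of p] unfolding 1 add smult by linarith+
 qed
 have s1: "[:0,1:] \<circ>\<^sub>p s = Polynomial.smult (1/(2*M)) [:M, 1:]" "[:1,-1:] \<circ>\<^sub>p s = Polynomial.smult (1/(2*M)) [:M, -1:]"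
  using M by (simp_all add: s_def pcompose_pCons field_simps)
 have nn: "0 \<le> \<Lambda> ([:0,1:] * (p * p))" "0 \<le> \<Lambda> ([:1,-1:] * (p * p))" for p
 proof -
  have "\<Lambda> ([:0,1:] * (p * p)) = 1/(2*M) * L ([:M, 1:] * ((p \<circ>\<^sub>p s) * (p \<circ>\<^sub>p s)))"
   "\<Lambda> ([:1,-1:] * (p * p)) = 1/(2*M) * L ([:M, -1:] * ((p \<circ>\<^sub>p s) * (p \<circ>\<^sub>p s)))" unfolding \<Lambda>_def pcompose_mult s1 mult_smult_left smult by auto
  then show "0 \<le> \<Lambda> ([:0,1:] * (p * p))" "0 \<le> \<Lambda> ([:1,-1:] * (p * p))" using pos[of "p \<circ>\<^sub>p s"] M by (simp_all del: mult_pCons_left)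
 qed
 have "\<exists>\<mu>. real_distribution \<mu> \<and> (AE x in \<mu>. x \<in> {0..1}) \<and> (\<forall>p. (\<integral>x. poly p x \<partial>\<mu>) = \<Lambda> p)"
 proof (rule moment_problem_unit_interval)
  show "\<Lambda> 1 = 1" unfolding \<Lambda>_def by (simp add: one pcompose_1)
 qed (use nn in \<open>auto simp: \<Lambda>_def pcompose_add pcompose_smult pcompose_mult add smult sq\<close>)
 then obtain \<mu> where \<mu>: "real_distribution \<mu>" "AE x in \<mu>. x \<in> {0..1}" "\<And>p. (\<integral>x. poly p x \<partial>\<mu>) = \<Lambda> p" by blast
 interpret real_distribution \<mu> by fact
 define t where "t x = M * (2 * x - 1)" for x
 define \<nu> where "\<nu> = distr \<mu> borel t"
 have tm: "t \<in> borel_measurable borel" unfolding t_def by simp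
 then have tm': "t \<in> borel_measurable \<mu>" by simp
 have "real_distribution \<nu>" unfolding \<nu>_def real_distribution_def real_distribution_axioms_def using tm' by (simp add: prob_space_distr)
 moreover have "AE x in \<nu>. \<bar>x\<bar> \<le> M" unfolding \<nu>_def
 proof (subst AE_distr_iff[OF tm'])
  show "AE x in \<mu>. \<bar>t x\<bar> \<le> M" using \<mu>(2)
  proof eventually_elim
   case (elim x)
   then have "\<bar>2 * x - 1\<bar> \<le> 1" by auto
   then show ?case using M by (simp add: t_def abs_mult mult_left_le)
  qed
 qed simp
 moreover have "(\<integral>x. poly p x \<partial>\<nu>) = L p" for p
 proof -
  have "(\<integral>x. poly p x \<partial>\<nu>) = (\<integral>x. poly (p \<circ>\<^sub>p [:-M, 2*M:]) x \<partial>\<mu>)"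
   unfolding \<nu>_def by (subst integral_distr[OF tm']) (auto simp: poly_pcompose t_def right_diff_distrib mult.assoc mult.left_commute intro!: borel_measurable_continuous_onI continuous_intros Bochner_Integration.integral_cong arg_cong[where f="poly p"])
  also have "\<dots> = L (p \<circ>\<^sub>p [:-M, 2*M:] \<circ>\<^sub>p s)" by (simp add: \<mu>(3) \<Lambda>_def)
  also have "p \<circ>\<^sub>p [:-M, 2*M:] \<circ>\<^sub>p s = p \<circ>\<^sub>p ([:-M, 2*M:] \<circ>\<^sub>p s)" by (rule pcompose_assoc[symmetric])
  also have "[:-M, 2*M:] \<circ>\<^sub>p s = [:0, 1:]" using M by (simp add: s_def pcompose_pCons)
  finally show ?thesis by simp
 qed
 ultimately show ?thesis by blast
qed

section \<open>Stieltjes transforms: uniqueness and weak limits\<close>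

lemma norm_resolvent_le:
 assumes "0 < Im z"
 shows "cmod (1 / (complex_of_real x - z)) \<le> 1 / Im z"
proof -
 have "Im z \<le> cmod (complex_of_real x - z)" using abs_Im_le_cmod[of "complex_of_real x - z"] by simp
 then show ?thesis using assms by (simp add: norm_divide frac_le)
qed

lemma continuous_resolvent:
 assumes "0 < Im z"
 shows "continuous_on UNIV (\<lambda>x. 1 / (complex_of_real x - z))" using assms by (auto intro!: continuous_intros)

lemma integrable_resolvent:
 assumes "0 < Im z" "real_distribution \<mu>"
 shows "integrable \<mu> (\<lambda>x. 1 / (complex_of_real x - z))"
 by (rule bounded_continuous_integrable[OF assms(2) continuous_resolvent norm_resolvent_le]) (use assms in auto)

abbreviation stieltjes :: "real measure \<Rightarrow> complex \<Rightarrow> complex" where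
 "stieltjes \<mu> z \<equiv> (\<integral>x. 1 / (complex_of_real x - z) \<partial>\<mu>)"

text \<open>\<open>Im (1/(x - z))\<close> is, up to the factor \<open>\<pi>\<close>, a Cauchy density: equality of the Stieltjes
 transforms gives equality of the convolutions with all Cauchy laws.\<close>

lemma real_distribution_eq_of_stieltjes:
 assumes \<mu>: "real_distribution \<mu>" and \<nu>: "real_distribution \<nu>"
  and eq: "\<And>z. 0 < Im z \<Longrightarrow> (stieltjes \<mu> z) = stieltjes \<nu> z"
 shows "\<mu> = \<nu>"
proof -
 have k_int: "integrable lborel (\<lambda>y::real. inverse (1 + y\<^sup>2))" using integrable_inverse_1_plus_square by (simp add: set_integrable_def)
 define K where "K = (\<integral>y. inverse (1 + (y::real)\<^sup>2) \<partial>lborel)"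
 have K: "K = pi" unfolding K_def using LBINT_inverse_1_plus_square by (simp add: interval_lebesgue_integral_def set_lebesgue_integral_def)
 have main: "(\<integral>x. f x \<partial>\<mu>) = (\<integral>x. f x \<partial>\<nu>)"
  if f: "continuous_on UNIV f" and f0: "\<And>x. 0 \<le> f x" and fB: "\<And>x. f x \<le> B" for f :: "real \<Rightarrow> real" and B
 proof -
  have [measurable]: "f \<in> borel_measurable borel" by (rule borel_measurable_continuous_onI[OF f])
  have B0: "0 \<le> B" using f0[of 0] fB[of 0] by simp
  \<comment> \<open>The convolution of \<open>f\<close> with the Cauchy law of scale e, up to the
    factor 1/pi; as e tends to 0 it tends to \<open>f x * K\<close>.\<close>
  define h where "h e x = (\<integral>y. f (x + e * y) * inverse (1 + y\<^sup>2) \<partial>lborel)" for e x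
  have int: "integrable lborel (\<lambda>y. f (x + e * y) * inverse (1 + y\<^sup>2))" for e x
  proof (rule Bochner_Integration.integrable_bound[where f="\<lambda>y. B * inverse (1 + y\<^sup>2)"])
   show "integrable lborel (\<lambda>y. B * inverse (1 + y\<^sup>2))" using k_int by simp
   show "AE y in lborel. norm (f (x + e * y) * inverse (1 + y\<^sup>2)) \<le> norm (B * inverse (1 + y\<^sup>2))"
    using f0 fB B0 by (auto simp: abs_mult intro!: AE_I2 mult_right_mono)
  qed measurable
  have h0: "0 \<le> h e x" for e x unfolding h_def using f0 by (intro Bochner_Integration.integral_nonneg) auto
  have hB: "h e x \<le> B * K" for e x
  proof -
   have "h e x \<le> (\<integral>y. B * inverse (1 + y\<^sup>2) \<partial>lborel)" unfolding h_def using fB k_int by (intro integral_mono int) (auto intro!: mult_right_mono)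
   then show ?thesis by (simp add: K_def)
  qed
  have [measurable]: "h e \<in> borel_measurable borel" for e unfolding h_def by measurable
  have hint: "integrable \<rho> (h e)" if "real_distribution \<rho>" for \<rho> e
  proof -
   interpret real_distribution \<rho> by fact
   show ?thesis by (rule integrable_const_bound[where B="B * K"]) (use h0 hB in auto)
  qed
  have lim: "(\<lambda>n. \<integral>x. h (1 / Suc n) x \<partial>\<rho>) \<longlonglongrightarrow> (\<integral>x. f x * K \<partial>\<rho>)" if "real_distribution \<rho>" for \<rho>
  proof (rule integral_dominated_convergence[where w="\<lambda>_. B * K"])
   interpret real_distribution \<rho> by fact
   show "(\<lambda>x. f x * K) \<in> borel_measurable \<rho>" by simp
   show "h (1 / Suc n) \<in> borel_measurable \<rho>" for n by simp
   show "integrable \<rho> (\<lambda>_. B * K)" by simp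
   show "AE x in \<rho>. norm (h (1 / Suc n) x) \<le> B * K" for n using h0 hB by simp
   show "AE x in \<rho>. (\<lambda>n. h (1 / Suc n) x) \<longlonglongrightarrow> f x * K"
   proof (rule AE_I2)
    fix x
    have "(\<lambda>n. h (1 / Suc n) x) \<longlonglongrightarrow> (\<integral>y. f x * inverse (1 + y\<^sup>2) \<partial>lborel)" unfolding h_def
    proof (rule integral_dominated_convergence[where w="\<lambda>y. B * inverse (1 + y\<^sup>2)"])
     show "integrable lborel (\<lambda>y. B * inverse (1 + y\<^sup>2))" using k_int by simp
     show "AE y in lborel. norm (f (x + 1 / real (Suc n) * y) * inverse (1 + y\<^sup>2)) \<le> B * inverse (1 + y\<^sup>2)" for n
      using f0 fB by (auto simp: abs_mult intro!: AE_I2 mult_right_mono)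
     show "AE y in lborel. (\<lambda>n. f (x + 1 / real (Suc n) * y) * inverse (1 + y\<^sup>2)) \<longlonglongrightarrow> f x * inverse (1 + y\<^sup>2)"
     proof (rule AE_I2)
      fix y :: real
      have "(\<lambda>n. 1 / real (Suc n)) \<longlonglongrightarrow> 0" by (rule LIMSEQ_Suc[OF lim_1_over_n])
      then have "(\<lambda>n. x + 1 / real (Suc n) * y) \<longlonglongrightarrow> x + 0 * y" by (intro tendsto_intros)
      then have "(\<lambda>n. f (x + 1 / real (Suc n) * y)) \<longlonglongrightarrow> f x" using continuous_on_tendsto_compose[OF f] by simp
      then show "(\<lambda>n. f (x + 1 / real (Suc n) * y) * inverse (1 + y\<^sup>2)) \<longlonglongrightarrow> f x * inverse (1 + y\<^sup>2)" by (intro tendsto_intros)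
     qed
    qed measurable
    then show "(\<lambda>n. h (1 / Suc n) x) \<longlonglongrightarrow> f x * K" by (simp add: K_def)
   qed
  qed
  \<comment> \<open>The substitution t = x + e y and Tonelli's theorem express the smoothed integral
    through the values of the Stieltjes transform on the line Im z = e.\<close>
  have smooth: "ennreal (\<integral>x. h e x \<partial>\<rho>) = (\<integral>\<^sup>+ t. ennreal (f t * Im (\<integral>x. 1 / (complex_of_real x - Complex t e) \<partial>\<rho>)) \<partial>lborel)"
   if "real_distribution \<rho>" "e > 0" for \<rho> e
  proof -
   interpret real_distribution \<rho> by fact
   interpret pair_sigma_finite lborel \<rho> ..
   have inner: "ennreal (h e x) = (\<integral>\<^sup>+ t. ennreal (f t * (e / ((x - t)\<^sup>2 + e\<^sup>2))) \<partial>lborel)" for x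
   proof -
    have "(\<integral>\<^sup>+ t. ennreal (f t * (e / ((x - t)\<^sup>2 + e\<^sup>2))) \<partial>lborel)
     = ennreal \<bar>e\<bar> * (\<integral>\<^sup>+ y. ennreal (f (x + e * y) * (e / ((x - (x + e * y))\<^sup>2 + e\<^sup>2))) \<partial>lborel)"
     by (rule nn_integral_real_affine) (use \<open>e > 0\<close> in auto)
    also have "\<dots> = (\<integral>\<^sup>+ y. ennreal \<bar>e\<bar> * ennreal (f (x + e * y) * (e / ((x - (x + e * y))\<^sup>2 + e\<^sup>2))) \<partial>lborel)"
     by (rule nn_integral_cmult[symmetric]) measurable
    also have "\<dots> = (\<integral>\<^sup>+ y. ennreal (f (x + e * y) * inverse (1 + y\<^sup>2)) \<partial>lborel)"
    proof (rule nn_integral_cong)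
     fix y :: real
     have pos: "1 + y\<^sup>2 > 0" by (simp add: add_pos_nonneg)
     have "e * (f (x + e * y) * (e / ((x - (x + e * y))\<^sup>2 + e\<^sup>2))) = f (x + e * y) * inverse (1 + y\<^sup>2)"
     proof -
      have "(x - (x + e * y))\<^sup>2 + e\<^sup>2 = e\<^sup>2 * (1 + y\<^sup>2)" by (simp add: power_mult_distrib distrib_left)
      then show ?thesis using \<open>e > 0\<close> pos by (simp add: divide_simps power2_eq_square)
     qed
     then show "ennreal \<bar>e\<bar> * ennreal (f (x + e * y) * (e / ((x - (x + e * y))\<^sup>2 + e\<^sup>2))) = ennreal (f (x + e * y) * inverse (1 + y\<^sup>2))"
      using \<open>e > 0\<close> by (simp flip: ennreal_mult')
    qed
    also have "\<dots> = ennreal (h e x)" unfolding h_def using f0 by (intro nn_integral_eq_integral int AE_I2) auto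
    finally show ?thesis by simp
   qed
   have "ennreal (\<integral>x. h e x \<partial>\<rho>) = (\<integral>\<^sup>+ x. ennreal (h e x) \<partial>\<rho>)" using hint[OF that(1)] h0 by (intro nn_integral_eq_integral[symmetric]) auto
   also have "\<dots> = (\<integral>\<^sup>+ x. \<integral>\<^sup>+ t. ennreal (f t * (e / ((x - t)\<^sup>2 + e\<^sup>2))) \<partial>lborel \<partial>\<rho>)" by (simp only: inner)
   also have "\<dots> = (\<integral>\<^sup>+ t. \<integral>\<^sup>+ x. ennreal (f t * (e / ((x - t)\<^sup>2 + e\<^sup>2))) \<partial>\<rho> \<partial>lborel)" by (rule Fubini') measurable
   also have "\<dots> = (\<integral>\<^sup>+ t. ennreal (f t * Im (\<integral>x. 1 / (complex_of_real x - Complex t e) \<partial>\<rho>)) \<partial>lborel)"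
   proof (rule nn_integral_cong)
    fix t
    have Im: "Im (1 / (complex_of_real x - Complex t e)) = e / ((x - t)\<^sup>2 + e\<^sup>2)" for x by (simp add: Im_divide)
    have ir: "integrable \<rho> (\<lambda>x. 1 / (complex_of_real x - Complex t e))" by (rule integrable_resolvent) (use that in auto)
    have "integrable \<rho> (\<lambda>x. f t * (e / ((x - t)\<^sup>2 + e\<^sup>2)))" using integrable_Im[OF ir] unfolding Im by (rule integrable_mult_right)
    then have "(\<integral>\<^sup>+ x. ennreal (f t * (e / ((x - t)\<^sup>2 + e\<^sup>2))) \<partial>\<rho>) = ennreal (\<integral>x. f t * (e / ((x - t)\<^sup>2 + e\<^sup>2)) \<partial>\<rho>)"
     using f0 \<open>e > 0\<close> by (intro nn_integral_eq_integral) auto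
    also have "(\<integral>x. f t * (e / ((x - t)\<^sup>2 + e\<^sup>2)) \<partial>\<rho>) = f t * Im (\<integral>x. 1 / (complex_of_real x - Complex t e) \<partial>\<rho>)"
     using integral_Im[OF ir] unfolding Im by (subst integral_mult_right_zero) simp
    finally show "(\<integral>\<^sup>+ x. ennreal (f t * (e / ((x - t)\<^sup>2 + e\<^sup>2))) \<partial>\<rho>) = ennreal (f t * Im (\<integral>x. 1 / (complex_of_real x - Complex t e) \<partial>\<rho>))" .
   qed
   finally show ?thesis .
  qed
  have "(\<integral>x. h (1 / Suc n) x \<partial>\<mu>) = (\<integral>x. h (1 / Suc n) x \<partial>\<nu>)" for n
  proof -
   have "ennreal (\<integral>x. h (1 / Suc n) x \<partial>\<mu>) = ennreal (\<integral>x. h (1 / Suc n) x \<partial>\<nu>)"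
    using smooth[OF \<mu>, of "1 / Suc n"] smooth[OF \<nu>, of "1 / Suc n"] eq[of "Complex t (1 / Suc n)" for t] by simp
   then show ?thesis using h0 by (simp add: Bochner_Integration.integral_nonneg)
  qed
  then have "(\<lambda>n. \<integral>x. h (1 / Suc n) x \<partial>\<mu>) \<longlonglongrightarrow> (\<integral>x. f x * K \<partial>\<nu>)" using lim[OF \<nu>] by simp
  then have "(\<integral>x. f x * K \<partial>\<mu>) = (\<integral>x. f x * K \<partial>\<nu>)" by (rule LIMSEQ_unique[OF lim[OF \<mu>]])
  then show ?thesis by (simp add: K)
 qed
 show ?thesis
 proof (rule real_distribution_eqI[OF \<mu> \<nu>])
  fix f :: "real \<Rightarrow> real" assume f: "continuous_on UNIV f" "bounded (range f)"
  then obtain B where B: "\<And>x. \<bar>f x\<bar> \<le> B" unfolding bounded_iff by auto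
  have i: "integrable \<rho> f" if "real_distribution \<rho>" for \<rho> by (rule bounded_continuous_integrable[OF that f(1)]) (use B in auto)
  \<comment> \<open>\<open>main\<close> wants a nonnegative function; adding the bound B adds the
    same constant on both sides, because the total masses are 1.\<close>
  have "(\<integral>x. f x + B \<partial>\<mu>) = (\<integral>x. f x + B \<partial>\<nu>)"
  proof (rule main[of _ "2 * B"])
   show "0 \<le> f x + B" "f x + B \<le> 2 * B" for x using B[of x] by linarith+
  qed (use f(1) in \<open>intro continuous_intros\<close>)
  moreover have "(\<integral>x. f x + B \<partial>\<rho>) = (\<integral>x. f x \<partial>\<rho>) + B" if "real_distribution \<rho>" for \<rho>
  proof -
   interpret real_distribution \<rho> by fact
   have "prob UNIV = 1" using prob_space by simp
   then show ?thesis using i[OF that] by simp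
  qed
  ultimately show "(\<integral>x. f x \<partial>\<mu>) = (\<integral>x. f x \<partial>\<nu>)" using \<mu> \<nu> by simp
 qed
qed

lemma tight_of_abs_moment:
 assumes rd: "\<And>n. real_distribution (\<mu> n)" and bd: "\<And>n. abs_moment \<alpha> (\<mu> n) \<le> ennreal C" and "0 < \<alpha>"
 shows "tight \<mu>" unfolding tight_def
proof (intro conjI allI impI rd)
 fix e :: real assume e: "e > 0"
 \<comment> \<open>With this b, Markov's inequality leaves outside the interval a mass of at most
   \<open>\<bar>C\<bar> / (\<bar>C\<bar> + 1) * e\<close>, which is strictly below e even for C =
   0.\<close>
 define b where "b = ((\<bar>C\<bar> + 1) / e) powr (1 / \<alpha>)"
 have b0: "b > 0" using e by (simp add: b_def add_nonneg_pos)
 have ba: "b powr \<alpha> = (\<bar>C\<bar> + 1) / e" using \<open>0 < \<alpha>\<close> e by (simp add: b_def powr_powr)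
 have "1 - e < measure (\<mu> n) {-b<..b}" for n
 proof -
  interpret real_distribution "\<mu> n" by (rule rd)
  have "ennreal (b powr \<alpha>) * emeasure (\<mu> n) (- {-b<..b}) = (\<integral>\<^sup>+ x. ennreal (b powr \<alpha>) * indicator (- {-b<..b}) x \<partial>\<mu> n)"
   by (subst nn_integral_cmult_indicator) auto
  also have "\<dots> \<le> abs_moment \<alpha> (\<mu> n)" unfolding abs_moment_def
  proof (rule nn_integral_mono)
   fix x show "ennreal (b powr \<alpha>) * indicator (- {-b<..b}) x \<le> ennreal (\<bar>x\<bar> powr \<alpha>)"
   proof (cases "x \<in> {-b<..b}")
    case False
    then have "b \<le> \<bar>x\<bar>" by auto
    then show ?thesis using False b0 \<open>0 < \<alpha>\<close> by (simp add: powr_mono2 ennreal_leI)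
   qed simp
  qed
  also have "\<dots> \<le> ennreal C" by (rule bd)
  finally have "ennreal (b powr \<alpha> * measure (\<mu> n) (- {-b<..b})) \<le> ennreal \<bar>C\<bar>"
   unfolding emeasure_eq_measure by (auto simp: ennreal_mult' intro: order_trans ennreal_leI)
  then have "(\<bar>C\<bar> + 1) / e * measure (\<mu> n) (- {-b<..b}) \<le> \<bar>C\<bar>" unfolding ba by (subst (asm) ennreal_le_iff) auto
  then have "(\<bar>C\<bar> + 1) * measure (\<mu> n) (- {-b<..b}) \<le> \<bar>C\<bar> * e" using e by (simp add: field_simps)
  also have "\<dots> < (\<bar>C\<bar> + 1) * e" using e by simp
  finally have "measure (\<mu> n) (- {-b<..b}) < e" by (simp add: mult_less_cancel_left)
  moreover have "measure (\<mu> n) (- {-b<..b}) = 1 - measure (\<mu> n) {-b<..b}" using prob_compl[of "{-b<..b}"] by (simp add: Compl_eq_Diff_UNIV)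
  ultimately show ?thesis by simp
 qed
 then show "\<exists>a b. a < b \<and> (\<forall>n. 1 - e < measure (\<mu> n) {a<..b})" using b0 by (intro exI[of _ "-b"] exI[of _ b]) auto
qed

text \<open>The moment bound makes every sequence tight, and every subsequential limit has the
  Stieltjes transform l, so all of them are the same measure. The limit at 0 from the right is
  tested along sequences in (0,1), where the hypotheses hold.\<close>

lemma weak_limit_of_stieltjes:
 fixes \<mu> :: "real \<Rightarrow> real measure"
 assumes rd: "\<And>\<theta>. 0 < \<theta> \<Longrightarrow> \<theta> < 1 \<Longrightarrow> real_distribution (\<mu> \<theta>)"
  and bd: "\<And>\<theta>. 0 < \<theta> \<Longrightarrow> \<theta> < 1 \<Longrightarrow> abs_moment \<alpha> (\<mu> \<theta>) \<le> ennreal C" and "0 < \<alpha>"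
  and st: "\<And>z. 0 < Im z \<Longrightarrow> \<exists>l. ((\<lambda>\<theta>. \<integral>x. 1 / (complex_of_real x - z) \<partial>\<mu> \<theta>) \<longlongrightarrow> l) (at_right 0)"
 shows "\<exists>\<nu>. real_distribution \<nu> \<and> weakly_converges \<mu> \<nu> (at_right 0)"
proof -
 obtain l where l: "\<And>z. 0 < Im z \<Longrightarrow> ((\<lambda>\<theta>. \<integral>x. 1 / (complex_of_real x - z) \<partial>\<mu> \<theta>) \<longlongrightarrow> l z) (at_right 0)" using st by metis
 have tight: "tight (\<lambda>n. \<mu> (S n))" if "\<And>n. 0 < S n" "\<And>n. S n < 1" for S :: "nat \<Rightarrow> real"
  by (rule tight_of_abs_moment[OF _ _ \<open>0 < \<alpha>\<close>, of _ C]) (use rd bd that in auto)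
 have st_lim: "stieltjes \<nu> z = l z"
  if S: "\<And>n. 0 < S n" "\<And>n. S n < 1" "S \<longlonglongrightarrow> 0" and "weak_conv_m (\<lambda>n. \<mu> (S n)) \<nu>" "real_distribution \<nu>" "0 < Im z"
  for S :: "nat \<Rightarrow> real" and \<nu> z
 proof (rule LIMSEQ_unique)
  show "(\<lambda>n. \<integral>x. 1 / (complex_of_real x - z) \<partial>\<mu> (S n)) \<longlonglongrightarrow> (stieltjes \<nu> z)"
   by (rule weak_conv_imp_integral_bdd_continuous_conv[OF _ _ _ _ norm_resolvent_le])
    (use rd S that continuous_resolvent[of z] in \<open>auto simp: continuous_on_eq_continuous_at\<close>)
  have "filterlim S (at_right 0) sequentially" unfolding filterlim_at using S(1,3) by (auto intro!: always_eventually less_imp_neq[THEN not_sym])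
  then show "(\<lambda>n. \<integral>x. 1 / (complex_of_real x - z) \<partial>\<mu> (S n)) \<longlonglongrightarrow> l z" by (rule filterlim_compose[OF l[OF \<open>0 < Im z\<close>]])
 qed
 define S0 where "S0 n = 1 / (2 + real n)" for n :: nat
 have S0: "0 < S0 n" "S0 n < 1" "S0 \<longlonglongrightarrow> 0" for n
  unfolding S0_def by (auto intro!: real_tendsto_divide_at_top[OF tendsto_const] filterlim_tendsto_add_at_top[OF tendsto_const] filterlim_real_sequentially)
 obtain r \<nu> where r: "strict_mono (r :: nat \<Rightarrow> nat)" and \<nu>: "real_distribution \<nu>" and wc: "weak_conv_m (\<lambda>n. \<mu> (S0 (r n))) \<nu>"
  using tight_imp_convergent_subsubsequence[OF tight, where s=id, of S0] S0(1,2) by (auto simp: o_def strict_mono_def)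
 have l\<nu>: "stieltjes \<nu> z = l z" if "0 < Im z" for z
  by (rule st_lim[OF _ _ _ wc \<nu> that]) (use S0 LIMSEQ_subseq_LIMSEQ[OF S0(3) r] in \<open>auto simp: o_def\<close>)
 have wcS: "weak_conv_m (\<lambda>n. \<mu> (S n)) \<nu>" if S: "\<And>n. 0 < S n" "\<And>n. S n < 1" "S \<longlonglongrightarrow> 0" for S :: "nat \<Rightarrow> real"
 proof (rule tight_subseq_weak_converge[OF _ \<nu> tight[OF S(1,2)]])
  fix s \<nu>' assume s: "strict_mono (s :: nat \<Rightarrow> nat)" "real_distribution \<nu>'" "weak_conv_m ((\<lambda>n. \<mu> (S n)) \<circ> s) \<nu>'"
  have "\<nu>' = \<nu>"
  proof (rule real_distribution_eq_of_stieltjes[OF s(2) \<nu>])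
   fix z :: complex assume "0 < Im z"
   then show "stieltjes \<nu>' z = stieltjes \<nu> z" using l\<nu> st_lim[of "S \<circ> s" \<nu>' z] s S LIMSEQ_subseq_LIMSEQ[OF S(3) s(1)] by (simp add: o_def)
  qed
  then show "weak_conv_m ((\<lambda>n. \<mu> (S n)) \<circ> s) \<nu>" using s by simp
 qed (use rd S in auto)
 have "weakly_converges \<mu> \<nu> (at_right 0)" unfolding weakly_converges_def
 proof (intro allI impI, elim conjE)
  fix f :: "real \<Rightarrow> real" assume f: "continuous_on UNIV f" "bounded (range f)"
  then obtain B where B: "\<And>x. \<bar>f x\<bar> \<le> B" unfolding bounded_iff by auto
  show "((\<lambda>\<theta>. \<integral>x. f x \<partial>\<mu> \<theta>) \<longlongrightarrow> (\<integral>x. f x \<partial>\<nu>)) (at_right 0)"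
  proof (rule tendsto_at_right_sequentially[of 0 1])
   fix S :: "nat \<Rightarrow> real" assume S: "\<And>n. 0 < S n" "\<And>n. S n < 1" "S \<longlonglongrightarrow> 0"
   show "(\<lambda>n. \<integral>x. f x \<partial>\<mu> (S n)) \<longlonglongrightarrow> (\<integral>x. f x \<partial>\<nu>)" by (rule weak_conv_imp_integral_bdd_continuous_conv[OF _ \<nu> wcS[OF S], of _ B])
     (use rd S f B in \<open>auto simp: continuous_on_eq_continuous_at\<close>)
  qed simp
 qed
 then show ?thesis using \<nu> by blast
qed

section \<open>Resolvents of Hermitian matrices\<close>

definition hermitian_on :: "'a set \<Rightarrow> ('a \<Rightarrow> 'a \<Rightarrow> complex) \<Rightarrow> bool" where
 "hermitian_on V A \<longleftrightarrow> (\<forall>u\<in>V. \<forall>v\<in>V. A u v = cnj (A v u))"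

text \<open>A right inverse of A - z on V; for Hermitian A it is also a left inverse
  (\<open>left_inverse\<close>). Matrices are functions whose values off V are ignored.\<close>

definition resolvent :: "'a set \<Rightarrow> ('a \<Rightarrow> 'a \<Rightarrow> complex) \<Rightarrow> complex \<Rightarrow> ('a \<Rightarrow> 'a \<Rightarrow> complex) \<Rightarrow> bool" where
 "resolvent V A z R \<longleftrightarrow>
   (\<forall>u\<in>V. \<forall>v\<in>V. (\<Sum>w\<in>V. A u w * R w v) - z * R u v = (if u = v then 1 else 0))"

lemma cmod_sum_mult_le:
 "cmod (\<Sum>v\<in>V. x v * y v) \<le> L2_set (\<lambda>v. cmod (x v)) V * L2_set (\<lambda>v. cmod (y v)) V"
proof -
 have "cmod (\<Sum>v\<in>V. x v * y v) \<le> (\<Sum>v\<in>V. cmod (x v * y v))" by (rule norm_sum)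
 also have "\<dots> \<le> L2_set (\<lambda>v. cmod (x v)) V * L2_set (\<lambda>v. cmod (y v)) V"
  using L2_set_mult_ineq[of "\<lambda>v. cmod (x v)" "\<lambda>v. cmod (y v)" V] by (simp add: norm_mult)
 finally show ?thesis .
qed

lemma L2_set_cmod_add:
 "L2_set (\<lambda>v. cmod (x v + y v)) V \<le> L2_set (\<lambda>v. cmod (x v)) V + L2_set (\<lambda>v. cmod (y v)) V"
proof -
 have "L2_set (\<lambda>v. cmod (x v + y v)) V \<le> L2_set (\<lambda>v. cmod (x v) + cmod (y v)) V" by (intro L2_set_mono norm_triangle_ineq norm_ge_zero)
 also have "\<dots> \<le> L2_set (\<lambda>v. cmod (x v)) V + L2_set (\<lambda>v. cmod (y v)) V" by (rule L2_set_triangle_ineq)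
 finally show ?thesis .
qed

text \<open>The imaginary part of \<open>\<langle>y, (A - z) y\<rangle>\<close> is \<open>- Im z \<cdot> \<parallel>y\<parallel>\<^sup>2\<close>.\<close>

lemma hermitian_shift_bound:
 assumes fin: "finite V" and A: "hermitian_on V A" and z: "0 < Im z"
  and eq: "\<And>u. u \<in> V \<Longrightarrow> (\<Sum>w\<in>V. A u w * y w) - z * y u = x u"
 shows "L2_set (\<lambda>v. cmod (y v)) V \<le> L2_set (\<lambda>v. cmod (x v)) V / Im z"
proof -
 let ?y = "L2_set (\<lambda>v. cmod (y v)) V" and ?x = "L2_set (\<lambda>v. cmod (x v)) V"
 define q where "q = (\<Sum>u\<in>V. \<Sum>w\<in>V. cnj (y u) * A u w * y w)"
 have cA: "cnj (A u w) = A w u" if "u \<in> V" "w \<in> V" for u w using A that unfolding hermitian_on_def by (metis complex_cnj_cnj)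
 have "cnj q = (\<Sum>u\<in>V. \<Sum>w\<in>V. y u * cnj (A u w) * cnj (y w))" by (simp add: q_def)
 also have "\<dots> = (\<Sum>u\<in>V. \<Sum>w\<in>V. cnj (y w) * A w u * y u)" by (intro sum.cong) (simp_all add: cA)
 also have "\<dots> = q" unfolding q_def by (rule sum.swap)
 finally have Imq: "Im q = 0" by (metis Reals_cnj_iff complex_is_Real_iff)
 have "(\<Sum>u\<in>V. cnj (y u) * x u) = (\<Sum>u\<in>V. cnj (y u) * ((\<Sum>w\<in>V. A u w * y w) - z * y u))" by (intro sum.cong) (simp_all add: eq)
 also have "\<dots> = q - z * (\<Sum>u\<in>V. cnj (y u) * y u)" by (simp add: q_def right_diff_distrib sum_subtractf sum_distrib_left mult.assoc mult.left_commute)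
 also have "(\<Sum>u\<in>V. cnj (y u) * y u) = of_real (?y\<^sup>2)" by (simp add: L2_set_def sum_nonneg complex_norm_square mult.commute del: of_real_power)
 finally have e: "(\<Sum>u\<in>V. cnj (y u) * x u) = q - z * of_real (?y\<^sup>2)" .
 have "Im z * ?y\<^sup>2 = \<bar>Im (q - z * of_real (?y\<^sup>2))\<bar>" using Imq z by simp
 also have "\<dots> \<le> cmod (\<Sum>u\<in>V. cnj (y u) * x u)" unfolding e by (rule abs_Im_le_cmod)
 also have "\<dots> \<le> ?y * ?x" using cmod_sum_mult_le[of "\<lambda>u. cnj (y u)" x V] by simp
 finally have "Im z * ?y * ?y \<le> ?x * ?y" by (simp add: power2_eq_square mult_ac)
 moreover have "0 \<le> ?y" "0 \<le> ?x" by auto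
 ultimately have "Im z * ?y \<le> ?x" by (cases "?y = 0") auto
 then show ?thesis using z by (simp add: field_simps)
qed

text \<open>Induction over the vertices by Schur complements. With \<open>c\<close> solving the
  smaller system for minus the column of i, the vector \<open>e\<close> that is 1 at i and
  \<open>c\<close> elsewhere is sent to s times the unit vector at i; a solution on V is then
  corrected by a multiple of \<open>e\<close>.\<close>

lemma hermitian_shift_surj:
 assumes "finite V" "hermitian_on V A" "0 < Im z"
 shows "\<exists>y. \<forall>u\<in>V. (\<Sum>w\<in>V. A u w * y w) - z * y u = b u" using assms
proof (induction V arbitrary: b rule: finite_induct)
 case (insert i V)
 have A: "hermitian_on V A" using insert.prems unfolding hermitian_on_def by blast
 obtain c where c: "\<And>u. u \<in> V \<Longrightarrow> (\<Sum>w\<in>V. A u w * c w) - z * c u = - A u i" using insert.IH[OF A insert.prems(2), of "\<lambda>u. - A u i"] by blast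
 obtain x where x: "\<And>u. u \<in> V \<Longrightarrow> (\<Sum>w\<in>V. A u w * x w) - z * x u = b u" using insert.IH[OF A insert.prems(2), of b] by blast
 have ext: "(\<Sum>w\<in>insert i V. A u w * (if w = i then s else f w)) = A u i * s + (\<Sum>w\<in>V. A u w * f w)" for u s f
  using insert.hyps by (simp add: sum.insert) (intro sum.cong, auto)
 define s where "s = A i i + (\<Sum>w\<in>V. A i w * c w) - z"
 define e where "e w = (if w = i then 1 else c w)" for w
 have e: "(\<Sum>w\<in>insert i V. A u w * e w) - z * e u = (if u = i then s else 0)" if "u \<in> insert i V" for u
  using that c[of u] insert.hyps unfolding e_def ext by (auto simp: s_def diff_eq_eq)
 \<comment> \<open>If s were 0, A - z would send \<open>e\<close> to 0, and
   \<open>hermitian_shift_bound\<close> would give \<open>e = 0\<close>, although its entry at i is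
   1.\<close>
 have "s \<noteq> 0"
 proof
  assume "s = 0"
  then have "L2_set (\<lambda>v. cmod (e v)) (insert i V) \<le> L2_set (\<lambda>v. cmod 0) (insert i V) / Im z"
   by (intro hermitian_shift_bound[OF _ insert.prems]) (use insert.hyps e in auto)
  then have "L2_set (\<lambda>v. cmod (e v)) (insert i V) \<le> 0" by (simp add: L2_set_constant)
  moreover have "cmod (e i) \<le> L2_set (\<lambda>v. cmod (e v)) (insert i V)" by (rule member_le_L2_set) (use insert.hyps in auto)
  ultimately have "cmod (e i) \<le> 0" by linarith
  then show False by (simp add: e_def)
 qed
 define t where "t = (b i - (\<Sum>w\<in>V. A i w * x w)) / s"
 define y where "y w = (if w = i then 0 else x w) + t * e w" for w
 have "(\<Sum>w\<in>insert i V. A u w * y w) - z * y u = b u" if u: "u \<in> insert i V" for u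
 proof -
  have "(\<Sum>w\<in>insert i V. A u w * y w) - z * y u
   = ((\<Sum>w\<in>insert i V. A u w * (if w = i then 0 else x w)) - z * (if u = i then 0 else x u))
    + t * ((\<Sum>w\<in>insert i V. A u w * e w) - z * e u)"
   unfolding y_def by (simp only: distrib_left right_diff_distrib sum.distrib sum_distrib_left mult.left_commute) simp
  also have "\<dots> = b u" unfolding e[OF u] ext using u x[of u] insert.hyps \<open>s \<noteq> 0\<close> by (auto simp: t_def)
  finally show ?thesis .
 qed
 then show ?case by blast
qed simp

locale hermitian_resolvent =
 fixes V :: "'a set" and A :: "'a \<Rightarrow> 'a \<Rightarrow> complex" and z :: complex and R :: "'a \<Rightarrow> 'a \<Rightarrow> complex"
 assumes fin: "finite V" and herm: "hermitian_on V A" and Im_z: "0 < Im z" and res: "resolvent V A z R"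
begin

lemma right_inverse: "u \<in> V \<Longrightarrow> v \<in> V \<Longrightarrow> (\<Sum>w\<in>V. A u w * R w v) = (if u = v then 1 else 0) + z * R u v" using res by (simp add: resolvent_def diff_eq_eq)

lemma bound: "L2_set (\<lambda>u. cmod (\<Sum>v\<in>V. R u v * x v)) V \<le> L2_set (\<lambda>v. cmod (x v)) V / Im z"
proof (rule hermitian_shift_bound[OF fin herm Im_z])
 fix u assume u: "u \<in> V"
 have "(\<Sum>w\<in>V. A u w * (\<Sum>v\<in>V. R w v * x v)) = (\<Sum>v\<in>V. (\<Sum>w\<in>V. A u w * R w v) * x v)"
  unfolding sum_distrib_left sum_distrib_right by (subst sum.swap) (simp add: mult.assoc)
 also have "\<dots> = (\<Sum>v\<in>V. ((if u = v then 1 else 0) + z * R u v) * x v)" using u by (intro sum.cong) (simp_all add: right_inverse)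
 also have "\<dots> = (\<Sum>v\<in>V. (if u = v then x v else 0)) + z * (\<Sum>v\<in>V. R u v * x v)"
  by (simp add: distrib_right sum.distrib sum_distrib_left mult.assoc if_distrib[of "\<lambda>a. a * _"] cong: if_cong)
 also have "(\<Sum>v\<in>V. (if u = v then x v else 0)) = x u" using u fin by simp
 finally show "(\<Sum>w\<in>V. A u w * (\<Sum>v\<in>V. R w v * x v)) - z * (\<Sum>v\<in>V. R u v * x v) = x u" by simp
qed

lemma column_bound:
 assumes "v \<in> V"
 shows "L2_set (\<lambda>u. cmod (R u v)) V \<le> 1 / Im z"
proof -
 have "(\<Sum>w\<in>V. R u w * (if w = v then 1 else 0)) = R u v" for u using assms fin by (simp add: if_distrib[of "\<lambda>a. _ * a"] cong: if_cong)
 moreover have "L2_set (\<lambda>w. cmod (if w = v then 1 else 0)) V = 1"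
  using assms fin by (simp add: L2_set_def if_distrib[of cmod] if_distrib[of "\<lambda>x. x\<^sup>2"] cong: if_cong)
 ultimately show ?thesis using bound[of "\<lambda>w. if w = v then 1 else 0"] by simp
qed

lemma entry_bound:
 assumes "u \<in> V" "v \<in> V"
 shows "cmod (R u v) \<le> 1 / Im z" using column_bound[OF assms(2)] member_le_L2_set[OF fin assms(1), of "\<lambda>u. cmod (R u v)"] by linarith

text \<open>\<open>D\<close> is the column v of R A - z R - 1. It is mapped to 0 by A - z, because R
  is a right inverse, and so vanishes by \<open>hermitian_shift_bound\<close>.\<close>

lemma left_inverse:
 assumes "u \<in> V" "v \<in> V"
 shows "(\<Sum>w\<in>V. R u w * A w v) = (if u = v then 1 else 0) + z * R u v"
proof -
 define D where "D w = (\<Sum>t\<in>V. R w t * A t v) - z * R w v - (if w = v then 1 else 0)" for w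
 have "L2_set (\<lambda>w. cmod (D w)) V \<le> L2_set (\<lambda>w. cmod 0) V / Im z"
 proof (rule hermitian_shift_bound[OF fin herm Im_z])
  fix s assume s: "s \<in> V"
  have 1: "(\<Sum>w\<in>V. A s w * (\<Sum>t\<in>V. R w t * A t v)) = A s v + z * (\<Sum>t\<in>V. R s t * A t v)"
  proof -
   have "(\<Sum>w\<in>V. A s w * (\<Sum>t\<in>V. R w t * A t v)) = (\<Sum>t\<in>V. (\<Sum>w\<in>V. A s w * R w t) * A t v)"
    unfolding sum_distrib_left sum_distrib_right by (subst sum.swap) (simp add: mult.assoc)
   also have "\<dots> = (\<Sum>t\<in>V. ((if s = t then 1 else 0) + z * R s t) * A t v)" using s by (intro sum.cong) (simp_all add: right_inverse)
   also have "\<dots> = (\<Sum>t\<in>V. (if s = t then A t v else 0)) + z * (\<Sum>t\<in>V. R s t * A t v)"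
    by (simp add: distrib_right sum.distrib sum_distrib_left mult.assoc if_distrib[of "\<lambda>a. a * _"] cong: if_cong)
   finally show ?thesis using s fin by simp
  qed
  have 2: "(\<Sum>w\<in>V. A s w * (if w = v then 1 else 0)) = A s v" using assms fin by (simp add: if_distrib[of "\<lambda>a. _ * a"] cong: if_cong)
  have "(\<Sum>w\<in>V. A s w * D w) = (\<Sum>w\<in>V. A s w * (\<Sum>t\<in>V. R w t * A t v)) - z * (\<Sum>w\<in>V. A s w * R w v)
    - (\<Sum>w\<in>V. A s w * (if w = v then 1 else 0))"
   unfolding D_def by (simp only: right_diff_distrib sum_subtractf sum_distrib_left mult.left_commute[of _ z])
  also have "\<dots> = z * D s" unfolding 1 2 using s assms by (simp add: right_inverse D_def algebra_simps)
  finally show "(\<Sum>w\<in>V. A s w * D w) - z * D s = 0" by simp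
 qed
 then have "L2_set (\<lambda>w. cmod (D w)) V \<le> 0" by (simp add: L2_set_def)
 then have "cmod (D u) \<le> 0" using member_le_L2_set[OF fin assms(1), of "\<lambda>w. cmod (D w)"] by linarith
 then show ?thesis by (simp add: D_def algebra_simps)
qed

end

lemma resolvent_exists:
 assumes "finite V" "hermitian_on V A" "0 < Im z"
 shows "\<exists>R. hermitian_resolvent V A z R"
proof -
 have "\<exists>y. \<forall>u\<in>V. (\<Sum>w\<in>V. A u w * y w) - z * y u = (if u = v then 1 else 0)" for v by (rule hermitian_shift_surj[OF assms])
 then obtain Y where "\<And>v u. u \<in> V \<Longrightarrow> (\<Sum>w\<in>V. A u w * Y v w) - z * Y v u = (if u = v then 1 else 0)" by metis
 then have "resolvent V A z (\<lambda>u v. Y v u)" by (simp add: resolvent_def)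
 with assms show ?thesis by (auto simp: hermitian_resolvent_def)
qed

section \<open>Resolvent identities and trace estimates\<close>

lemma second_resolvent_identity:
 assumes "hermitian_resolvent V A z R" "hermitian_resolvent V B z S" "u \<in> V" "v \<in> V"
 shows "S u v - R u v = (\<Sum>a\<in>V. \<Sum>b\<in>V. R u a * (A a b - B a b) * S b v)"
proof -
 interpret R: hermitian_resolvent V A z R by fact
 interpret S: hermitian_resolvent V B z S by fact
 have "(\<Sum>a\<in>V. \<Sum>b\<in>V. R u a * (A a b - B a b) * S b v)
  = (\<Sum>b\<in>V. (\<Sum>a\<in>V. R u a * A a b) * S b v) - (\<Sum>a\<in>V. R u a * (\<Sum>b\<in>V. B a b * S b v))"
  unfolding sum_distrib_left sum_distrib_right right_diff_distrib left_diff_distrib sum_subtractf by (subst (2) sum.swap) (simp add: mult.assoc)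
 also have "(\<Sum>b\<in>V. (\<Sum>a\<in>V. R u a * A a b) * S b v) = (\<Sum>b\<in>V. (if u = b then S b v else 0) + z * R u b * S b v)"
  using assms(3) by (intro sum.cong) (simp_all add: R.left_inverse distrib_right)
 also have "(\<Sum>a\<in>V. R u a * (\<Sum>b\<in>V. B a b * S b v)) = (\<Sum>a\<in>V. (if a = v then R u a else 0) + z * R u a * S a v)"
  using assms(4) by (intro sum.cong) (simp_all add: S.right_inverse distrib_left)
 finally show ?thesis using assms(3,4) R.fin by (simp add: sum.distrib)
qed

text \<open>By cyclicity the trace of R (A - B) S is the sum over b of the entry (b, b) of S R (A -
  B). Each is at most the norm of the column b of A - B divided by (Im z)^2, so that column norms
  suffice where one would expect an operator norm.\<close>

lemma resolvent_trace_perturbation: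
 assumes "hermitian_resolvent V A z R" "hermitian_resolvent V B z S"
  and small: "\<And>v. v \<in> V \<Longrightarrow> L2_set (\<lambda>u. cmod (A u v - B u v)) V \<le> e"
 shows "cmod ((\<Sum>v\<in>V. S v v) - (\<Sum>v\<in>V. R v v)) \<le> real (card V) * e / (Im z)\<^sup>2"
proof -
 interpret R: hermitian_resolvent V A z R by fact
 interpret S: hermitian_resolvent V B z S by fact
 define K where "K a b = A a b - B a b" for a b
 define y where "y b u = (\<Sum>a\<in>V. R u a * K a b)" for b u
 have "(\<Sum>v\<in>V. S v v) - (\<Sum>v\<in>V. R v v) = (\<Sum>v\<in>V. S v v - R v v)" by (simp add: sum_subtractf)
 also have "\<dots> = (\<Sum>v\<in>V. \<Sum>a\<in>V. \<Sum>b\<in>V. R v a * K a b * S b v)" unfolding K_def by (intro sum.cong second_resolvent_identity[OF assms(1,2)]) auto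
 also have "\<dots> = (\<Sum>v\<in>V. \<Sum>b\<in>V. S b v * y b v)" by (rule sum.cong[OF refl], subst sum.swap) (simp add: y_def sum_distrib_left mult_ac)
 also have "\<dots> = (\<Sum>b\<in>V. \<Sum>v\<in>V. S b v * y b v)" by (rule sum.swap)
 finally have eq: "(\<Sum>v\<in>V. S v v) - (\<Sum>v\<in>V. R v v) = (\<Sum>b\<in>V. \<Sum>v\<in>V. S b v * y b v)" .
 have "cmod (\<Sum>v\<in>V. S b v * y b v) \<le> e / (Im z)\<^sup>2" if b: "b \<in> V" for b
 proof -
  have "cmod (\<Sum>v\<in>V. S b v * y b v) \<le> L2_set (\<lambda>u. cmod (\<Sum>v\<in>V. S u v * y b v)) V"
   using member_le_L2_set[OF R.fin b, of "\<lambda>u. cmod (\<Sum>v\<in>V. S u v * y b v)"] by simp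
  also have "\<dots> \<le> L2_set (\<lambda>v. cmod (y b v)) V / Im z" by (rule S.bound)
  also have "\<dots> \<le> (L2_set (\<lambda>a. cmod (K a b)) V / Im z) / Im z" unfolding y_def using R.Im_z by (intro divide_right_mono R.bound) simp
  also have "\<dots> \<le> (e / Im z) / Im z" using small[OF b] R.Im_z unfolding K_def by (intro divide_right_mono) auto
  finally show ?thesis by (simp add: power2_eq_square)
 qed
 then have "(\<Sum>b\<in>V. cmod (\<Sum>v\<in>V. S b v * y b v)) \<le> (\<Sum>b\<in>V. e / (Im z)\<^sup>2)" by (rule sum_mono)
 then have "cmod (\<Sum>b\<in>V. \<Sum>v\<in>V. S b v * y b v) \<le> (\<Sum>b\<in>V. e / (Im z)\<^sup>2)" by (rule order_trans[OF norm_sum])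
 then show ?thesis unfolding eq by simp
qed

text \<open>Removing one vertex changes the resolvent, on the other columns, by a matrix of rank one,
 whose trace is at most its norm.\<close>

lemma resolvent_trace_remove_one:
 assumes RA: "hermitian_resolvent V A z R" and SB: "hermitian_resolvent V B z S" and i: "i \<in> V"
  and B: "\<And>u v. u \<in> V \<Longrightarrow> v \<in> V \<Longrightarrow> B u v = (if u = i \<or> v = i then 0 else A u v)"
 shows "cmod ((\<Sum>v\<in>V. S v v) - (\<Sum>v\<in>V. R v v)) \<le> 4 / Im z"
proof -
 interpret R: hermitian_resolvent V A z R by fact
 interpret S: hermitian_resolvent V B z S by fact
 have z0: "z \<noteq> 0" using R.Im_z by auto
 \<comment> \<open>Row i of B vanishes, so (B - z) S = 1 decouples i from the other
   vertices.\<close>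
 have Si: "S i v = 0" if "v \<in> V" "v \<noteq> i" for v
 proof -
  have "(\<Sum>w\<in>V. B i w * S w v) = 0" by (rule sum.neutral) (use i B in auto)
  then show ?thesis using S.right_inverse[OF i that(1)] that(2) z0 by auto
 qed
 define x where "x v = (if v = i then 0 else (\<Sum>b\<in>V. A i b * S b v))" for v
 have key: "S u v - R u v = R u i * x v" if "u \<in> V" "v \<in> V" "v \<noteq> i" for u v
 proof -
  have "S u v - R u v = (\<Sum>a\<in>V. \<Sum>b\<in>V. R u a * (A a b - B a b) * S b v)" by (rule second_resolvent_identity[OF RA SB that(1,2)])
  also have "\<dots> = (\<Sum>a\<in>V. if a = i then (\<Sum>b\<in>V. R u i * A i b * S b v) else 0)"
  proof (intro sum.cong refl)
   fix a assume a: "a \<in> V"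
   show "(\<Sum>b\<in>V. R u a * (A a b - B a b) * S b v) = (if a = i then (\<Sum>b\<in>V. R u i * A i b * S b v) else 0)"
    using a i Si[OF that(2,3)] B by (auto intro!: sum.cong sum.neutral)
  qed
  also have "\<dots> = R u i * x v" using i R.fin that(3) by (simp add: x_def sum_distrib_left mult.assoc)
  finally show ?thesis .
 qed
 let ?r = "L2_set (\<lambda>u. cmod (R u i)) V" and ?x = "L2_set (\<lambda>v. cmod (x v)) V"
 \<comment> \<open>Off column i the matrix S - R has the rank-one form \<open>R u i * x v\<close>.
   Applied to \<open>cnj x\<close>, which is 0 at i, it gives a vector of norm
   \<open>?x\<^sup>2 * ?r\<close>, whereas each resolvent has norm at most 1 / Im z.\<close>
 have rx: "?r * ?x \<le> 2 / Im z"
 proof -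
  have sq: "(\<Sum>v\<in>V. x v * cnj (x v)) = of_real (?x\<^sup>2)" by (simp add: L2_set_def sum_nonneg complex_norm_square del: of_real_power)
  have "?x\<^sup>2 * ?r = L2_set (\<lambda>u. cmod (R u i * of_real (?x\<^sup>2))) V"
   unfolding norm_mult by (subst L2_set_left_distrib[symmetric]) (simp_all add: mult.commute norm_power)
  also have "\<dots> = L2_set (\<lambda>u. cmod ((\<Sum>v\<in>V. S u v * cnj (x v)) + - (\<Sum>v\<in>V. R u v * cnj (x v)))) V"
  proof (rule L2_set_cong)
   fix u assume u: "u \<in> V"
   have "R u i * of_real (?x\<^sup>2) = (\<Sum>v\<in>V. (R u i * x v) * cnj (x v))" unfolding sq[symmetric] by (simp add: sum_distrib_left mult.assoc)
   also have "\<dots> = (\<Sum>v\<in>V. (S u v - R u v) * cnj (x v))" by (intro sum.cong) (use key[OF u] in \<open>auto simp: x_def\<close>)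
   finally show "cmod (R u i * of_real (?x\<^sup>2)) = cmod ((\<Sum>v\<in>V. S u v * cnj (x v)) + - (\<Sum>v\<in>V. R u v * cnj (x v)))"
    by (simp add: left_diff_distrib sum_subtractf)
  qed simp
  also have "\<dots> \<le> L2_set (\<lambda>u. cmod (\<Sum>v\<in>V. S u v * cnj (x v))) V + L2_set (\<lambda>u. cmod (\<Sum>v\<in>V. R u v * cnj (x v))) V"
   using L2_set_cmod_add[of "\<lambda>u. \<Sum>v\<in>V. S u v * cnj (x v)" "\<lambda>u. - (\<Sum>v\<in>V. R u v * cnj (x v))" V] by simp
  also have "\<dots> \<le> ?x / Im z + ?x / Im z" using S.bound[of "\<lambda>v. cnj (x v)"] R.bound[of "\<lambda>v. cnj (x v)"] by simp
  finally have "(?r * ?x) * ?x \<le> (2 / Im z) * ?x" by (simp add: power2_eq_square mult_ac)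
  moreover have "0 \<le> ?x" by (rule L2_set_nonneg)
  ultimately show ?thesis using R.Im_z by (cases "?x = 0") (simp_all add: mult_le_cancel_right del: times_divide_eq_left)
 qed
 have "cmod ((\<Sum>v\<in>V. S v v) - (\<Sum>v\<in>V. R v v)) = cmod (\<Sum>v\<in>V. S v v - R v v)" by (simp add: sum_subtractf)
 also have "(\<Sum>v\<in>V. S v v - R v v) = (S i i - R i i) + (\<Sum>v\<in>V - {i}. S v v - R v v)" using i R.fin by (rule sum.remove[rotated])
 also have "(\<Sum>v\<in>V - {i}. S v v - R v v) = (\<Sum>v\<in>V. R v i * x v)" using i R.fin by (subst (2) sum.remove[of _ i]) (auto simp: key x_def intro!: sum.cong)
 also have "cmod ((S i i - R i i) + (\<Sum>v\<in>V. R v i * x v)) \<le> (cmod (S i i) + cmod (R i i)) + ?r * ?x" using cmod_sum_mult_le[of "\<lambda>v. R v i" x V]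
  by (intro order_trans[OF norm_triangle_ineq] add_mono norm_triangle_ineq4)
 \<comment> \<open>The column i is treated apart: its two diagonal entries give 2 / Im z, the
   rank-one part another 2 / Im z.\<close>
 also have "\<dots> \<le> (1 / Im z + 1 / Im z) + 2 / Im z" using S.entry_bound[OF i i] R.entry_bound[OF i i] rx by (intro add_mono)
 finally show ?thesis by simp
qed

text \<open>\<open>S\<close> is the set that is removed. Its vertices stay in V, isolated, so that
  all resolvents are indexed by the same set.\<close>

definition restrict_matrix :: "'a set \<Rightarrow> ('a \<Rightarrow> 'a \<Rightarrow> complex) \<Rightarrow> 'a \<Rightarrow> 'a \<Rightarrow> complex" where
 "restrict_matrix S A u v = (if u \<in> S \<or> v \<in> S then 0 else A u v)"

lemma hermitian_on_restrict_matrix: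
 assumes "hermitian_on V A"
 shows "hermitian_on V (restrict_matrix S A)" unfolding hermitian_on_def
proof (intro ballI)
 fix u v assume "u \<in> V" "v \<in> V"
 then have "A u v = cnj (A v u)" using assms unfolding hermitian_on_def by blast
 then show "restrict_matrix S A u v = cnj (restrict_matrix S A v u)" by (cases "u \<in> S \<or> v \<in> S") (auto simp: restrict_matrix_def)
qed

lemma resolvent_trace_remove:
 assumes "finite S" "S \<subseteq> V" "hermitian_resolvent V A z R" "hermitian_resolvent V (restrict_matrix S A) z T"
 shows "cmod ((\<Sum>v\<in>V. T v v) - (\<Sum>v\<in>V. R v v)) \<le> real (card S) * (4 / Im z)" using assms
proof (induction S arbitrary: T rule: finite_induct)
 case empty
 interpret R: hermitian_resolvent V A z R by fact
 have "(\<Sum>v\<in>V. T v v) - (\<Sum>v\<in>V. R v v) = (\<Sum>v\<in>V. T v v - R v v)" by (simp add: sum_subtractf)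
 also have "\<dots> = (\<Sum>v\<in>V. 0)" by (intro sum.cong refl, subst second_resolvent_identity[OF empty(2,3)]) (auto simp: restrict_matrix_def)
 finally show ?case by simp
next
 case (insert i S)
 interpret R: hermitian_resolvent V A z R by fact
 have "hermitian_on V (restrict_matrix S A)" by (rule hermitian_on_restrict_matrix[OF R.herm])
 then obtain Q where Q: "hermitian_resolvent V (restrict_matrix S A) z Q" using resolvent_exists R.fin R.Im_z by blast
 have "cmod ((\<Sum>v\<in>V. Q v v) - (\<Sum>v\<in>V. R v v)) \<le> real (card S) * (4 / Im z)" by (rule insert.IH) (use insert.prems Q in auto)
 moreover have "cmod ((\<Sum>v\<in>V. T v v) - (\<Sum>v\<in>V. Q v v)) \<le> 4 / Im z"
  by (rule resolvent_trace_remove_one[OF Q insert.prems(3), of i]) (use insert.prems(1) in \<open>auto simp: restrict_matrix_def\<close>)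
 moreover have "cmod ((\<Sum>v\<in>V. T v v) - (\<Sum>v\<in>V. R v v))
   \<le> cmod ((\<Sum>v\<in>V. T v v) - (\<Sum>v\<in>V. Q v v)) + cmod ((\<Sum>v\<in>V. Q v v) - (\<Sum>v\<in>V. R v v))"
  using norm_triangle_ineq[of "(\<Sum>v\<in>V. T v v) - (\<Sum>v\<in>V. Q v v)" "(\<Sum>v\<in>V. Q v v) - (\<Sum>v\<in>V. R v v)"] by simp
 ultimately have "cmod ((\<Sum>v\<in>V. T v v) - (\<Sum>v\<in>V. R v v)) \<le> (1 + real (card S)) * (4 / Im z)" unfolding distrib_right by linarith
 then show ?case using insert.hyps by simp
qed

text \<open>Removing the exceptional set E costs 4 / Im z per vertex for each of the two matrices;
  the remainders are compared column by column.\<close>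

lemma resolvent_trace_compare:
 assumes RA: "hermitian_resolvent V A z R" and SB: "hermitian_resolvent V B z S" and "E \<subseteq> V" "0 \<le> e"
  and small: "\<And>v. v \<in> V \<Longrightarrow> v \<notin> E \<Longrightarrow> L2_set (\<lambda>u. cmod (A u v - B u v)) (V - E) \<le> e"
 shows "cmod ((\<Sum>v\<in>V. S v v) - (\<Sum>v\<in>V. R v v)) \<le> real (card E) * (8 / Im z) + real (card V) * e / (Im z)\<^sup>2"
proof -
 interpret R: hermitian_resolvent V A z R by fact
 interpret S: hermitian_resolvent V B z S by fact
 have fE: "finite E" using \<open>E \<subseteq> V\<close> R.fin by (rule finite_subset)
 have "hermitian_on V (restrict_matrix E A)" "hermitian_on V (restrict_matrix E B)"
  by (rule hermitian_on_restrict_matrix[OF R.herm], rule hermitian_on_restrict_matrix[OF S.herm])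
 then obtain R' S' where R': "hermitian_resolvent V (restrict_matrix E A) z R'" and S': "hermitian_resolvent V (restrict_matrix E B) z S'"
  using resolvent_exists R.fin R.Im_z by metis
 have "cmod ((\<Sum>v\<in>V. S' v v) - (\<Sum>v\<in>V. R' v v)) \<le> real (card V) * e / (Im z)\<^sup>2"
 proof (rule resolvent_trace_perturbation[OF R' S'])
  fix v assume v: "v \<in> V"
  have "L2_set (\<lambda>u. cmod (restrict_matrix E A u v - restrict_matrix E B u v)) V
   = L2_set (\<lambda>u. cmod (restrict_matrix E A u v - restrict_matrix E B u v)) (V - E)"
   unfolding L2_set_def using R.fin by (intro arg_cong[where f=sqrt] sum.mono_neutral_right) (auto simp: restrict_matrix_def)
  also have "\<dots> \<le> e"
  proof (cases "v \<in> E")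
   case True then show ?thesis using \<open>0 \<le> e\<close> by (simp add: restrict_matrix_def L2_set_def)
  next
   case False
   then have "L2_set (\<lambda>u. cmod (restrict_matrix E A u v - restrict_matrix E B u v)) (V - E) = L2_set (\<lambda>u. cmod (A u v - B u v)) (V - E)"
    by (intro L2_set_cong) (auto simp: restrict_matrix_def)
   then show ?thesis using small[OF v False] by simp
  qed
  finally show "L2_set (\<lambda>u. cmod (restrict_matrix E A u v - restrict_matrix E B u v)) V \<le> e" .
 qed
 moreover have "cmod ((\<Sum>v\<in>V. R' v v) - (\<Sum>v\<in>V. R v v)) \<le> real (card E) * (4 / Im z)" by (rule resolvent_trace_remove[OF fE \<open>E \<subseteq> V\<close> RA R'])
 moreover have "cmod ((\<Sum>v\<in>V. S' v v) - (\<Sum>v\<in>V. S v v)) \<le> real (card E) * (4 / Im z)" by (rule resolvent_trace_remove[OF fE \<open>E \<subseteq> V\<close> SB S'])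
 moreover have "cmod (s - r) \<le> cmod (s' - r') + cmod (r' - r) + cmod (s' - s)" for s r s' r' :: complex
  using norm_triangle_ineq[of "(s' - r') + (r' - r)" "- (s' - s)"] norm_triangle_ineq[of "s' - r'" "r' - r"] by (simp add: norm_minus_commute)
 note this[of "\<Sum>v\<in>V. S v v" "\<Sum>v\<in>V. R v v" "\<Sum>v\<in>V. S' v v" "\<Sum>v\<in>V. R' v v"]
 moreover define t where "t = real (card E) * (4 / Im z)"
 moreover have c: "real (card E) * (8 / Im z) = t + t" by (simp add: t_def)
 ultimately show ?thesis unfolding c by linarith
qed

section \<open>Spectral measures of networks\<close>

definition nb :: "network \<Rightarrow> nat \<Rightarrow> nat set" where
 "nb G u = {v \<in> verts G. wgt G u v \<noteq> 0}"

text \<open>By the Schur test M bounds the norm of the operator. Finite neighbourhoods make the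
  entries of all its powers finite sums.\<close>

definition bounded_net :: "real \<Rightarrow> network \<Rightarrow> bool" where
 "bounded_net M G \<longleftrightarrow> hermitian_on (verts G) (wgt G) \<and>
   (\<forall>u\<in>verts G. finite (nb G u) \<and> (\<Sum>v\<in>nb G u. cmod (wgt G u v)) \<le> M)"

text \<open>The entry (u, v) of the k-th power of the operator: the total weight of the walks with k
  steps from u to v.\<close>

primrec walks :: "network \<Rightarrow> nat \<Rightarrow> nat \<Rightarrow> nat \<Rightarrow> complex" where
 "walks G 0 u v = (if u = v then 1 else 0)"
| "walks G (Suc k) u v = (\<Sum>w\<in>nb G u. wgt G u w * walks G k w v)"

lemma infsum_eq_sum_neutral:
 assumes "finite S" "S \<subseteq> A" "\<And>x. x \<in> A - S \<Longrightarrow> f x = 0"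
 shows "infsum f A = sum f S"
proof -
 have "infsum f A = infsum f S" by (rule infsum_cong_neutral) (use assms in auto)
 then show ?thesis using assms(1) by simp
qed

lemma walks_Suc_infsum:
 assumes "finite (nb G u)"
 shows "walks G (Suc k) u v = (\<Sum>\<^sub>\<infinity>w\<in>verts G. wgt G u w * walks G k w v)" unfolding walks.simps
 by (rule infsum_eq_sum_neutral[symmetric]) (use assms in \<open>auto simp: nb_def\<close>)

lemma net_op_power:
 assumes "\<And>u. u \<in> verts G \<Longrightarrow> finite (nb G u)" "u \<in> verts G"
 shows "(net_op G ^^ k) (basis_vec v) u = walks G k u v" using assms(2)
proof (induction k arbitrary: u)
 case (Suc k)
 have "(net_op G ^^ Suc k) (basis_vec v) u = (\<Sum>\<^sub>\<infinity>w\<in>verts G. wgt G u w * (net_op G ^^ k) (basis_vec v) w)" by (simp add: net_op_def)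
 also have "\<dots> = (\<Sum>\<^sub>\<infinity>w\<in>verts G. wgt G u w * walks G k w v)" by (intro infsum_cong) (simp add: Suc.IH)
 finally show ?case using walks_Suc_infsum[OF assms(1)[OF Suc.prems]] by metis
qed (simp add: basis_vec_def)

lemma l2_inner_basis_vec:
 assumes "v \<in> verts G"
 shows "l2_inner G (basis_vec v) f = f v"
proof -
 have "l2_inner G (basis_vec v) f = (\<Sum>u\<in>{v}. cnj (basis_vec v u) * f u)"
  unfolding l2_inner_def by (rule infsum_eq_sum_neutral) (use assms in \<open>auto simp: basis_vec_def\<close>)
 then show ?thesis by (simp add: basis_vec_def)
qed

lemma hermitian_onD: "hermitian_on V A \<Longrightarrow> u \<in> V \<Longrightarrow> v \<in> V \<Longrightarrow> cnj (A u v) = A v u" unfolding hermitian_on_def by (metis complex_cnj_cnj)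

lemma finite_walks_support:
 assumes "bounded_net M G" "v \<in> verts G"
 shows "finite {u \<in> verts G. walks G k u v \<noteq> 0}"
proof (induction k)
 case 0
 have "{u \<in> verts G. walks G 0 u v \<noteq> 0} \<subseteq> {v}" by auto
 then show ?case by (rule finite_subset) simp
next
 case (Suc k)
 \<comment> \<open>By symmetry a vertex with an edge into the support is a neighbour of the support,
   so each power adds only finitely many vertices.\<close>
 have "u \<in> (\<Union>w\<in>{w \<in> verts G. walks G k w v \<noteq> 0}. nb G w)" if u: "u \<in> verts G" "walks G (Suc k) u v \<noteq> 0" for u
 proof -
  obtain w where w: "w \<in> nb G u" "wgt G u w * walks G k w v \<noteq> 0" using u(2) unfolding walks.simps by (meson sum.neutral)
  then have "w \<in> verts G" by (simp add: nb_def)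
  then have "cnj (wgt G u w) = wgt G w u" using assms(1) u(1) by (auto simp: bounded_net_def intro: hermitian_onD)
  then have "u \<in> nb G w" using w u(1) unfolding nb_def by (metis (mono_tags, lifting) complex_cnj_zero_iff mem_Collect_eq mult_eq_0_iff)
  then show ?thesis using w \<open>w \<in> verts G\<close> by auto
 qed
 then have "{u \<in> verts G. walks G (Suc k) u v \<noteq> 0} \<subseteq> (\<Union>w\<in>{w \<in> verts G. walks G k w v \<noteq> 0}. nb G w)" by blast
 then show ?case by (rule finite_subset) (use Suc assms in \<open>auto simp: bounded_net_def\<close>)
qed

lemma sum_nb_eq:
 assumes "finite S" "S \<subseteq> verts G" "finite (nb G u)" "\<And>w. w \<in> verts G - S \<Longrightarrow> f w = 0"
 shows "(\<Sum>w\<in>nb G u. wgt G u w * f w) = (\<Sum>w\<in>S. wgt G u w * f w)"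
proof -
 have "(\<Sum>w\<in>nb G u. wgt G u w * f w) = (\<Sum>w\<in>nb G u \<union> S. wgt G u w * f w)" by (rule sum.mono_neutral_left) (use assms in \<open>auto simp: nb_def\<close>)
 also have "\<dots> = (\<Sum>w\<in>S. wgt G u w * f w)" by (rule sum.mono_neutral_right) (use assms in \<open>auto simp: nb_def\<close>)
 finally show ?thesis .
qed

text \<open>With p the polynomial of coefficients \<open>c\<close>, the two double sums are <p(T)
  e_v, p(T) e_v> and <p(T) e_v, T p(T) e_v>. The first is a squared norm, the second is bounded by
  the Schur test. The finite set \<open>S N\<close> carries all the vectors involved.\<close>

lemma spectral_moment_functional:
 assumes G: "bounded_net M G" and v: "v \<in> verts G"
 shows walks_real: "Im (walks G k v v) = 0"
  and walks_gram: "0 \<le> (\<Sum>i\<le>n. \<Sum>j\<le>n. c i * c j * Re (walks G (i + j) v v))"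
  and walks_gram_bound: "\<bar>\<Sum>i\<le>n. \<Sum>j\<le>n. c i * c j * Re (walks G (Suc (i + j)) v v)\<bar>
      \<le> M * (\<Sum>i\<le>n. \<Sum>j\<le>n. c i * c j * Re (walks G (i + j) v v))"
proof -
 have herm: "cnj (wgt G u w) = wgt G w u" if "u \<in> verts G" "w \<in> verts G" for u w using G that by (auto simp: bounded_net_def intro: hermitian_onD)
 have fin: "finite (nb G u)" if "u \<in> verts G" for u using G that by (auto simp: bounded_net_def)
 define S where "S N = insert v (\<Union>k\<in>{..N}. {u \<in> verts G. walks G k u v \<noteq> 0})" for N :: nat
 have S: "finite (S N)" "S N \<subseteq> verts G" "v \<in> S N" for N unfolding S_def using finite_walks_support[OF assms] v by auto
 have supp: "walks G k u v = 0" if "u \<in> verts G - S N" "k \<le> N" for u k N using that unfolding S_def by auto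
 have step: "walks G (Suc k) u v = (\<Sum>w\<in>S N. wgt G u w * walks G k w v)" if "u \<in> verts G" "k \<le> N" for u k N
  unfolding walks.simps by (rule sum_nb_eq[OF S(1,2) fin[OF that(1)]]) (use supp that in auto)
 \<comment> \<open>Moves the factors of T to the left side of the inner product one at a
   time.\<close>
 have prod: "walks G (i + j) v v = (\<Sum>u\<in>S N. cnj (walks G i u v) * walks G j u v)" if "i + j \<le> N" for i j N using that
 proof (induction i arbitrary: j)
  case 0
  have "(\<Sum>u\<in>S N. cnj (walks G 0 u v) * walks G j u v) = (\<Sum>u\<in>S N. if u = v then walks G j u v else 0)" by (rule sum.cong) auto
  then show ?case using S[of N] by simp
 next
  case (Suc i)
  have "(\<Sum>u\<in>S N. cnj (walks G (Suc i) u v) * walks G j u v)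
    = (\<Sum>u\<in>S N. \<Sum>w\<in>S N. cnj (walks G i w v) * (wgt G w u * walks G j u v))"
  proof (rule sum.cong[OF refl])
   fix u assume u: "u \<in> S N"
   then have uv: "u \<in> verts G" using S by auto
   have "cnj (walks G (Suc i) u v) = (\<Sum>w\<in>S N. cnj (wgt G u w * walks G i w v))"
    unfolding step[OF uv, of i N, OF Suc_leD[OF order_trans[OF le_add1 Suc.prems]]] by (rule cnj_sum)
   also have "\<dots> = (\<Sum>w\<in>S N. wgt G w u * cnj (walks G i w v))" by (rule sum.cong[OF refl]) (use herm uv S(2)[of N] in auto)
   finally show "cnj (walks G (Suc i) u v) * walks G j u v = (\<Sum>w\<in>S N. cnj (walks G i w v) * (wgt G w u * walks G j u v))"
    by (simp only: sum_distrib_left sum_distrib_right mult_ac)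
  qed
  also have "\<dots> = (\<Sum>w\<in>S N. \<Sum>u\<in>S N. cnj (walks G i w v) * (wgt G w u * walks G j u v))" by (rule sum.swap)
  also have "\<dots> = (\<Sum>w\<in>S N. cnj (walks G i w v) * walks G (Suc j) w v)"
  proof (rule sum.cong[OF refl])
   fix w assume "w \<in> S N"
   then have "w \<in> verts G" using S by auto
   then show "(\<Sum>u\<in>S N. cnj (walks G i w v) * (wgt G w u * walks G j u v)) = cnj (walks G i w v) * walks G (Suc j) w v"
    using step[of w j N] Suc.prems by (simp only: sum_distrib_left[symmetric])
  qed
  also have "\<dots> = walks G (i + Suc j) v v" using Suc.prems by (intro Suc.IH[symmetric]) simp
  finally show ?case by simp
 qed
 have "cnj (walks G k v v) = walks G k v v"
 proof -
  have "walks G k v v = (\<Sum>u\<in>S k. cnj (walks G 0 u v) * walks G k u v)" using prod[of 0 k k] by simp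
  moreover have "walks G k v v = (\<Sum>u\<in>S k. cnj (walks G k u v) * walks G 0 u v)" using prod[of k 0 k] by simp
  ultimately have "cnj (walks G k v v) = (\<Sum>u\<in>S k. cnj (cnj (walks G k u v) * walks G 0 u v))" by (metis cnj_sum)
  also have "\<dots> = (\<Sum>u\<in>S k. cnj (walks G 0 u v) * walks G k u v)" by (simp add: mult.commute)
  finally show ?thesis using prod[of 0 k k] by simp
 qed
 then show "Im (walks G k v v) = 0" by (simp add: complex_eq_iff)
 define N where "N = Suc (n + n)"
 define P where "P u = (\<Sum>i\<le>n. of_real (c i) * walks G i u v)" for u
 define Q where "Q u = (\<Sum>w\<in>S N. wgt G u w * P w)" for u
 have gram: "(\<Sum>i\<le>n. \<Sum>j\<le>n. c i * c j * Re (walks G (i + j) v v)) = (\<Sum>u\<in>S N. (cmod (P u))\<^sup>2)"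
 proof -
  have "of_real (\<Sum>u\<in>S N. (cmod (P u))\<^sup>2) = (\<Sum>u\<in>S N. cnj (P u) * P u)" by (simp add: complex_norm_square mult.commute del: of_real_power)
  also have "\<dots> = (\<Sum>u\<in>S N. \<Sum>i\<le>n. \<Sum>j\<le>n. of_real (c i * c j) * (cnj (walks G i u v) * walks G j u v))"
   unfolding P_def cnj_sum sum_product by (simp add: mult_ac)
  also have "\<dots> = (\<Sum>i\<le>n. \<Sum>j\<le>n. \<Sum>u\<in>S N. of_real (c i * c j) * (cnj (walks G i u v) * walks G j u v))"
   by (subst sum.swap, rule sum.cong[OF refl], rule sum.swap)
  also have "\<dots> = (\<Sum>i\<le>n. \<Sum>j\<le>n. of_real (c i * c j) * walks G (i + j) v v)"
  proof (intro sum.cong refl)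
   fix i j assume "i \<in> {..n}" "j \<in> {..n}"
   then have "i + j \<le> N" by (simp add: N_def)
   then show "(\<Sum>u\<in>S N. of_real (c i * c j) * (cnj (walks G i u v) * walks G j u v)) = of_real (c i * c j) * walks G (i + j) v v"
    by (simp only: prod sum_distrib_left)
  qed
  finally have "complex_of_real (\<Sum>u\<in>S N. (cmod (P u))\<^sup>2) = (\<Sum>i\<le>n. \<Sum>j\<le>n. of_real (c i * c j) * walks G (i + j) v v)" .
  then have "Re (complex_of_real (\<Sum>u\<in>S N. (cmod (P u))\<^sup>2)) = (\<Sum>i\<le>n. \<Sum>j\<le>n. c i * c j * Re (walks G (i + j) v v))" by (simp only: Re_sum) simp
  then show ?thesis by simp
 qed
 then show "0 \<le> (\<Sum>i\<le>n. \<Sum>j\<le>n. c i * c j * Re (walks G (i + j) v v))" by (simp add: sum_nonneg)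
 have Q: "Q u = (\<Sum>j\<le>n. of_real (c j) * walks G (Suc j) u v)" if "u \<in> S N" for u
 proof -
  have uv: "u \<in> verts G" using that S by auto
  have "Q u = (\<Sum>w\<in>S N. \<Sum>j\<le>n. of_real (c j) * (wgt G u w * walks G j w v))" unfolding Q_def P_def by (simp add: sum_distrib_left mult_ac)
  also have "\<dots> = (\<Sum>j\<le>n. \<Sum>w\<in>S N. of_real (c j) * (wgt G u w * walks G j w v))" by (rule sum.swap)
  also have "\<dots> = (\<Sum>j\<le>n. of_real (c j) * walks G (Suc j) u v)" by (intro sum.cong refl) (subst step[OF uv, of _ N], auto simp: N_def sum_distrib_left)
  finally show ?thesis .
 qed
 have shifted: "(\<Sum>i\<le>n. \<Sum>j\<le>n. c i * c j * Re (walks G (Suc (i + j)) v v)) = Re (\<Sum>u\<in>S N. cnj (P u) * Q u)"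
 proof -
  have "(\<Sum>u\<in>S N. cnj (P u) * Q u) = (\<Sum>u\<in>S N. \<Sum>i\<le>n. \<Sum>j\<le>n. of_real (c i * c j) * (cnj (walks G i u v) * walks G (Suc j) u v))"
  proof (rule sum.cong[OF refl])
   fix u assume u: "u \<in> S N"
   show "cnj (P u) * Q u = (\<Sum>i\<le>n. \<Sum>j\<le>n. of_real (c i * c j) * (cnj (walks G i u v) * walks G (Suc j) u v))"
    unfolding Q[OF u] P_def by (simp add: sum_product mult_ac del: walks.simps)
  qed
  also have "\<dots> = (\<Sum>i\<le>n. \<Sum>j\<le>n. \<Sum>u\<in>S N. of_real (c i * c j) * (cnj (walks G i u v) * walks G (Suc j) u v))"
   by (subst sum.swap, rule sum.cong[OF refl], rule sum.swap)
  also have "\<dots> = (\<Sum>i\<le>n. \<Sum>j\<le>n. of_real (c i * c j) * walks G (i + Suc j) v v)"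
  proof (intro sum.cong refl)
   fix i j assume "i \<in> {..n}" "j \<in> {..n}"
   then have "i + Suc j \<le> N" by (simp add: N_def)
   then show "(\<Sum>u\<in>S N. of_real (c i * c j) * (cnj (walks G i u v) * walks G (Suc j) u v)) = of_real (c i * c j) * walks G (i + Suc j) v v"
    by (simp only: prod sum_distrib_left)
  qed
  finally have "(\<Sum>u\<in>S N. cnj (P u) * Q u) = (\<Sum>i\<le>n. \<Sum>j\<le>n. of_real (c i * c j) * walks G (i + Suc j) v v)" .
  then show ?thesis by (simp only: Re_sum) (simp del: walks.simps)
 qed
 have M0: "(\<Sum>w\<in>S N. cmod (wgt G u w)) \<le> M" if "u \<in> S N" for u
 proof -
  have uv: "u \<in> verts G" using that S by auto
  have "(\<Sum>w\<in>S N. cmod (wgt G u w)) = (\<Sum>w\<in>S N \<inter> nb G u. cmod (wgt G u w))" by (rule sum.mono_neutral_right) (use S in \<open>auto simp: nb_def\<close>)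
  also have "\<dots> \<le> (\<Sum>w\<in>nb G u. cmod (wgt G u w))" by (rule sum_mono2) (use fin[OF uv] in auto)
  also have "\<dots> \<le> M" using G uv by (auto simp: bounded_net_def)
  finally show ?thesis .
 qed
 have "\<bar>Re (\<Sum>u\<in>S N. cnj (P u) * Q u)\<bar> \<le> cmod (\<Sum>u\<in>S N. cnj (P u) * Q u)" by (rule abs_Re_le_cmod)
 also have "\<dots> \<le> (\<Sum>u\<in>S N. \<Sum>w\<in>S N. cmod (P u) * (cmod (wgt G u w) * cmod (P w)))"
 proof (intro order_trans[OF norm_sum] sum_mono)
  fix u
  have "cmod (cnj (P u) * Q u) \<le> cmod (P u) * (\<Sum>w\<in>S N. cmod (wgt G u w * P w))"
   unfolding Q_def norm_mult complex_mod_cnj by (intro mult_left_mono order_trans[OF norm_sum] sum_mono) (auto simp: norm_mult)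
  then show "cmod (cnj (P u) * Q u) \<le> (\<Sum>w\<in>S N. cmod (P u) * (cmod (wgt G u w) * cmod (P w)))" by (simp add: sum_distrib_left norm_mult)
 qed
 \<comment> \<open>Schur test: the product of the two moduli is split by the arithmetic-geometric
   mean, and symmetry of the moduli turns both halves into row sums.\<close>
 also have "\<dots> \<le> (\<Sum>u\<in>S N. \<Sum>w\<in>S N. cmod (wgt G u w) * (cmod (P u))\<^sup>2 / 2 + cmod (wgt G u w) * (cmod (P w))\<^sup>2 / 2)"
 proof (intro sum_mono)
  fix u w
  have "cmod (P u) * cmod (P w) \<le> ((cmod (P u))\<^sup>2 + (cmod (P w))\<^sup>2) / 2" using sum_squares_bound[of "cmod (P u)" "cmod (P w)"] by simp
  then have "cmod (wgt G u w) * (cmod (P u) * cmod (P w)) \<le> cmod (wgt G u w) * (((cmod (P u))\<^sup>2 + (cmod (P w))\<^sup>2) / 2)" by (rule mult_left_mono) simp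
  then show "cmod (P u) * (cmod (wgt G u w) * cmod (P w)) \<le> cmod (wgt G u w) * (cmod (P u))\<^sup>2 / 2 + cmod (wgt G u w) * (cmod (P w))\<^sup>2 / 2"
   by (simp add: algebra_simps)
 qed
 also have "\<dots> = (\<Sum>u\<in>S N. \<Sum>w\<in>S N. cmod (wgt G u w) * (cmod (P u))\<^sup>2 / 2) + (\<Sum>u\<in>S N. \<Sum>w\<in>S N. cmod (wgt G u w) * (cmod (P w))\<^sup>2 / 2)"
  by (simp add: sum.distrib)
 also have "(\<Sum>u\<in>S N. \<Sum>w\<in>S N. cmod (wgt G u w) * (cmod (P w))\<^sup>2 / 2) = (\<Sum>u\<in>S N. \<Sum>w\<in>S N. cmod (wgt G u w) * (cmod (P u))\<^sup>2 / 2)"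
 proof (subst sum.swap, intro sum.cong refl)
  fix u w assume "u \<in> S N" "w \<in> S N"
  then have "cmod (wgt G w u) = cmod (wgt G u w)" using herm S(2)[of N] by (metis complex_mod_cnj subsetD)
  then show "cmod (wgt G w u) * (cmod (P u))\<^sup>2 / 2 = cmod (wgt G u w) * (cmod (P u))\<^sup>2 / 2" by simp
 qed
 also have "(\<Sum>u\<in>S N. \<Sum>w\<in>S N. cmod (wgt G u w) * (cmod (P u))\<^sup>2 / 2) + (\<Sum>u\<in>S N. \<Sum>w\<in>S N. cmod (wgt G u w) * (cmod (P u))\<^sup>2 / 2)
   = (\<Sum>u\<in>S N. (\<Sum>w\<in>S N. cmod (wgt G u w)) * (cmod (P u))\<^sup>2)" by (simp add: sum_distrib_right flip: sum.distrib)
 also have "\<dots> \<le> (\<Sum>u\<in>S N. M * (cmod (P u))\<^sup>2)" by (intro sum_mono mult_right_mono M0) auto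
 also have "\<dots> = M * (\<Sum>u\<in>S N. (cmod (P u))\<^sup>2)" by (simp add: sum_distrib_left)
 finally show "\<bar>\<Sum>i\<le>n. \<Sum>j\<le>n. c i * c j * Re (walks G (Suc (i + j)) v v)\<bar>
   \<le> M * (\<Sum>i\<le>n. \<Sum>j\<le>n. c i * c j * Re (walks G (i + j) v v))" unfolding gram shifted .
qed

text \<open>The functional \<open>L\<close> sends p to <e_v, p(T) e_v>; \<open>walks_gram\<close>
  and \<open>walks_gram_bound\<close> are exactly what the moment problem on [-M, M] asks for. This
  takes the place of the spectral theorem.\<close>

lemma moment_measure_exists:
 assumes G: "bounded_net M G" and v: "v \<in> verts G" and M: "0 < M"
 shows "\<exists>\<mu>. real_distribution \<mu> \<and> (AE x in \<mu>. \<bar>x\<bar> \<le> M) \<and> (\<forall>k. complex_of_real (\<integral>x. x ^ k \<partial>\<mu>) = walks G k v v)"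
proof -
 define m where "m k = Re (walks G k v v)" for k
 define L where "L p = (\<Sum>i\<le>degree p. coeff p i * m i)" for p :: "real poly"
 have L: "L p = (\<Sum>i\<le>n. coeff p i * m i)" if "degree p \<le> n" for p n
  unfolding L_def by (rule sum.mono_neutral_left) (use that in \<open>auto simp: coeff_eq_0\<close>)
 have add: "L (p + q) = L p + L q" for p q
 proof -
  define n where "n = max (degree p) (degree q)"
  have "degree (p + q) \<le> n" unfolding n_def by (rule degree_add_le_max)
  then show ?thesis using L[of "p + q" n] L[of p n] L[of q n] by (simp add: n_def distrib_right sum.distrib)
 qed
 have smult: "L (smult c p) = c * L p" for c p
  using L[of "smult c p" "degree p"] degree_smult_le[of c p] by (simp add: L_def sum_distrib_left mult.assoc)
 have sum: "L (\<Sum>i\<in>A. f i) = (\<Sum>i\<in>A. L (f i))" for A :: "nat set" and f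
 proof (induction A rule: infinite_finite_induct)
  case (insert x F)
  then show ?case by (simp add: add)
 qed (simp_all add: L_def)
 have mon: "L (monom c k) = c * m k" for c k using L[of "monom c k" k] by (simp add: degree_monom_le if_distrib[of "\<lambda>x. x * _"] cong: if_cong)
 have mult: "L (monom 1 d * (p * p)) = (\<Sum>i\<le>degree p. \<Sum>j\<le>degree p. coeff p i * coeff p j * m (d + (i + j)))" for p d
 proof -
  have "monom 1 d * (p * p) = monom 1 d * ((\<Sum>i\<le>degree p. monom (coeff p i) i) * (\<Sum>j\<le>degree p. monom (coeff p j) j))"
   by (simp add: poly_as_sum_of_monoms)
  also have "\<dots> = (\<Sum>i\<le>degree p. \<Sum>j\<le>degree p. monom (coeff p i * coeff p j) (d + (i + j)))"
   by (simp only: sum_product) (simp add: sum_distrib_left mult_monom)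
  finally show ?thesis by (simp only: sum mon)
 qed
 have "\<exists>\<mu>. real_distribution \<mu> \<and> (AE x in \<mu>. \<bar>x\<bar> \<le> M) \<and> (\<forall>p. (\<integral>x. poly p x \<partial>\<mu>) = L p)"
 proof (rule moment_problem_symmetric_interval[OF add smult])
  show "L 1 = 1" by (simp add: L_def m_def)
  fix p
  have X: "[:0, 1:] = monom (1::real) 1" by (simp add: monom_altdef)
  have pp: "L (p * p) = (\<Sum>i\<le>degree p. \<Sum>j\<le>degree p. coeff p i * coeff p j * m (i + j))" using mult[of 0 p] by simp
  show "0 \<le> L (p * p)" unfolding pp m_def by (rule walks_gram[OF G v])
  show "\<bar>L ([:0, 1:] * (p * p))\<bar> \<le> M * L (p * p)" unfolding X mult pp m_def using walks_gram_bound[OF G v, of "coeff p" "degree p"] by simp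
 qed (rule M)
 then obtain \<mu> where \<mu>: "real_distribution \<mu>" "AE x in \<mu>. \<bar>x\<bar> \<le> M" "\<And>p. (\<integral>x. poly p x \<partial>\<mu>) = L p" by blast
 have "(\<integral>x. x ^ k \<partial>\<mu>) = m k" for k using \<mu>(3)[of "monom 1 k"] by (simp add: poly_monom mon)
 then show ?thesis using \<mu>(1,2) walks_real[OF G v] by (auto simp: m_def complex_eq_iff)
qed

text \<open>One solution of the moment equations has bounded support, by
  \<open>moment_measure_exists\<close>, and then it is the only one. Hence exhibiting any
  \<open>\<nu>\<close> with the right moments computes the spectral measure.\<close>

lemma spectral_measure_unique:
 assumes G: "bounded_net M G" and v: "v \<in> verts G" and M: "0 < M"
  and \<nu>: "real_distribution \<nu>" "\<And>k. integrable \<nu> (\<lambda>x. x ^ k)" "\<And>k. complex_of_real (\<integral>x. x ^ k \<partial>\<nu>) = walks G k v v"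
 shows "spectral_measure G v = \<nu>"
proof -
 have inner: "l2_inner G (basis_vec v) ((net_op G ^^ k) (basis_vec v)) = walks G k v v" for k
  using G v by (simp add: l2_inner_basis_vec net_op_power bounded_net_def)
 obtain \<mu> where \<mu>: "real_distribution \<mu>" "AE x in \<mu>. \<bar>x\<bar> \<le> M" "\<And>k. complex_of_real (\<integral>x. x ^ k \<partial>\<mu>) = walks G k v v"
  using moment_measure_exists[OF G v M] by blast
 have uniq: "\<mu> = \<rho>" if "real_distribution \<rho>" "\<forall>k\<ge>1. integrable \<rho> (\<lambda>x. x ^ k) \<and> complex_of_real (\<integral>x. x ^ k \<partial>\<rho>) = walks G k v v" for \<rho>
 proof (rule real_distribution_eq_of_moments[OF \<mu>(1,2) that(1)])
  interpret \<rho>: real_distribution \<rho> by fact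
  interpret \<mu>: real_distribution \<mu> by fact
  fix k
  \<comment> \<open>The definition fixes the moments of order at least 1; the moment of order 0 is
    the total mass.\<close>
  have one: "\<rho>.prob UNIV = 1" "\<mu>.prob UNIV = 1" using \<rho>.prob_space \<mu>.prob_space by simp_all
  show "integrable \<rho> (\<lambda>x. x ^ k)" by (cases k) (use that(2) in auto)
  have "complex_of_real (\<integral>x. x ^ k \<partial>\<rho>) = complex_of_real (\<integral>x. x ^ k \<partial>\<mu>)" by (cases "k = 0") (use that(2)[rule_format, of k] \<mu>(3)[of k] one in auto)
  then show "(\<integral>x. x ^ k \<partial>\<rho>) = (\<integral>x. x ^ k \<partial>\<mu>)" by simp
 qed (use M in simp)
 have "\<mu> = \<nu>" using uniq[OF \<nu>(1)] \<nu> by blast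
 then show ?thesis unfolding spectral_measure_def inner using uniq \<nu> by (intro the_equality) auto
qed

lemma spectral_measure_props:
 assumes "bounded_net M G" "v \<in> verts G" "0 < M"
 shows "real_distribution (spectral_measure G v)" "AE x in spectral_measure G v. \<bar>x\<bar> \<le> M"
  "complex_of_real (\<integral>x. x ^ k \<partial>spectral_measure G v) = walks G k v v"
proof -
 obtain \<mu> where \<mu>: "real_distribution \<mu>" "AE x in \<mu>. \<bar>x\<bar> \<le> M" "\<And>k. complex_of_real (\<integral>x. x ^ k \<partial>\<mu>) = walks G k v v"
  using moment_measure_exists[OF assms] by blast
 have "spectral_measure G v = \<mu>" by (rule spectral_measure_unique[OF assms \<mu>(1) _ \<mu>(3)])
   (rule AE_bounded_continuous_integrable[OF \<mu>(1) _ \<mu>(2)], intro continuous_intros)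
 then show "real_distribution (spectral_measure G v)" "AE x in spectral_measure G v. \<bar>x\<bar> \<le> M"
  "complex_of_real (\<integral>x. x ^ k \<partial>spectral_measure G v) = walks G k v v" using \<mu> by auto
qed

section \<open>Truncation\<close>

text \<open>At d = 0 this is \<open>deg\<close>, because \<open>chi 0\<close> is 1 on nonnegative
  numbers; so \<open>tr 0\<close> is the truncation of the definitions. For d > 0 the sum over a
  network has finitely many nonzero terms.\<close>

definition degd :: "real \<Rightarrow> network \<Rightarrow> nat \<Rightarrow> real" where
 "degd d G v = (\<Sum>\<^sub>\<infinity>u\<in>verts G. (cmod (wgt G v u))\<^sup>2 * chi d (cmod (wgt G v u)))"

text \<open>The truncation of the definitions with degrees that count only the weights above \<open>d\<close>:
 for \<open>d > 0\<close> it is continuous under local convergence, which fails for \<open>d = 0\<close>.\<close>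

definition trw :: "real \<Rightarrow> real \<Rightarrow> network \<Rightarrow> nat \<Rightarrow> nat \<Rightarrow> complex" where
 "trw d \<theta> G u v = wgt G u v * complex_of_real (chi_tilde \<theta> (max (degd d G u) (degd d G v)))"

definition tr :: "real \<Rightarrow> real \<Rightarrow> network \<Rightarrow> network" where
 "tr d \<theta> G = Network (verts G) (\<lambda>u v. trw d \<theta> G u v * complex_of_real (chi \<theta> (cmod (trw d \<theta> G u v))))"

lemma verts_tr [simp]: "verts (tr d \<theta> G) = verts G" by (simp add: tr_def)

lemma chi_nonneg: "0 \<le> x \<Longrightarrow> 0 \<le> d \<Longrightarrow> 0 \<le> chi d x" by (auto simp: chi_def divide_simps)
lemma chi_le_1: "0 \<le> d \<Longrightarrow> chi d x \<le> 1" by (auto simp: chi_def divide_simps)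
lemma chi_eq_1: "0 \<le> d \<Longrightarrow> 2 * d \<le> x \<Longrightarrow> chi d x = 1" by (auto simp: chi_def)
lemma chi_eq_0: "x < d \<Longrightarrow> chi d x = 0" by (auto simp: chi_def)
lemma chi_0: "0 \<le> x \<Longrightarrow> chi 0 x = 1" by (auto simp: chi_def)
lemma chi_eq_clip: "0 < d \<Longrightarrow> chi d x = min 1 (max 0 ((x - d) / d))" by (auto simp: chi_def min_def max_def divide_simps)
lemma chi_antimono:
 assumes "0 < d" "d \<le> e" "0 \<le> x"
 shows "chi e x \<le> chi d x"
proof -
 have "(x - e) / e \<le> (x - d) / d" using assms by (simp add: diff_divide_distrib divide_left_mono)
 then show ?thesis using assms by (simp add: chi_eq_clip min_def max_def)
qed
lemma continuous_chi:
 assumes "0 < d"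
 shows "continuous_on UNIV (chi d)"
proof -
 have "chi d = (\<lambda>x. min 1 (max 0 ((x - d) / d)))" by (rule ext) (rule chi_eq_clip[OF assms])
 then show ?thesis using assms by (auto intro!: continuous_intros)
qed

lemma chi_tilde_eq_clip: "chi_tilde \<theta> x = min 1 (max 0 (1 / \<theta>\<^sup>2 - x))" by (auto simp: chi_tilde_def min_def max_def)
lemma continuous_chi_tilde: "continuous_on UNIV (chi_tilde \<theta>)" unfolding chi_tilde_eq_clip[abs_def] by (intro continuous_intros)
lemma chi_tilde_bounds: "0 \<le> chi_tilde \<theta> x" "chi_tilde \<theta> x \<le> 1" by (auto simp: chi_tilde_eq_clip)
lemma chi_tilde_nonzero: "chi_tilde \<theta> x \<noteq> 0 \<Longrightarrow> x < 1 / \<theta>\<^sup>2" by (auto simp: chi_tilde_def split: if_splits)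

lemma is_network_hermitian: "is_network G \<Longrightarrow> hermitian_on (verts G) (wgt G)" unfolding is_network_def hermitian_on_def by blast

lemma cmod_wgt_sym:
 assumes "is_network G" "u \<in> verts G" "v \<in> verts G"
 shows "cmod (wgt G u v) = cmod (wgt G v u)"
proof -
 have "wgt G u v = cnj (wgt G v u)" using assms unfolding is_network_def by blast
 then show ?thesis by simp
qed

lemma eventually_at_right_small: "0 < c \<Longrightarrow> \<forall>\<^sub>F d in at_right (0::real). 0 < d \<and> d < c" using eventually_at_right_real[of 0 c] by simp

lemma summable_degd:
 assumes "is_network G" "v \<in> verts G" "0 \<le> d"
 shows "(\<lambda>u. (cmod (wgt G v u))\<^sup>2 * chi d (cmod (wgt G v u))) summable_on verts G"
proof (rule summable_on_comparison_test)
 show "(\<lambda>u. (cmod (wgt G v u))\<^sup>2) summable_on verts G" using assms by (simp add: is_network_def)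
 fix u show "(cmod (wgt G v u))\<^sup>2 * chi d (cmod (wgt G v u)) \<le> (cmod (wgt G v u))\<^sup>2" using chi_le_1[OF assms(3)] by (simp add: mult_left_le)
 show "0 \<le> (cmod (wgt G v u))\<^sup>2 * chi d (cmod (wgt G v u))" using assms(3) by (simp add: chi_nonneg)
qed

lemma degd_0: "degd 0 G v = deg G v" unfolding degd_def deg_def by (simp add: chi_0)

lemma degd_nonneg: "0 \<le> d \<Longrightarrow> 0 \<le> degd d G v" unfolding degd_def by (intro infsum_nonneg mult_nonneg_nonneg chi_nonneg) auto

lemma degd_antimono:
 assumes "is_network G" "v \<in> verts G" "0 < d" "d \<le> e"
 shows "degd e G v \<le> degd d G v" unfolding degd_def by (intro infsum_mono summable_degd mult_left_mono chi_antimono assms) (use assms in auto)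

lemma degd_le_deg:
 assumes "is_network G" "v \<in> verts G" "0 \<le> d"
 shows "degd d G v \<le> deg G v" unfolding degd_0[symmetric] unfolding degd_def
 by (intro infsum_mono summable_degd mult_left_mono assms) (use chi_le_1[OF assms(3)] in \<open>auto simp: chi_0\<close>)

lemma truncate_eq_tr: "truncate \<theta> G = tr 0 \<theta> G" by (simp add: truncate_def tr_def trw_def wgt_tilde_def degd_0)

lemma finite_large_weights:
 assumes "is_network G" "v \<in> verts G" "0 < d"
 shows "finite {u \<in> verts G. d \<le> cmod (wgt G v u)}"
proof (rule ccontr)
 let ?S = "{u \<in> verts G. d \<le> cmod (wgt G v u)}"
 assume inf: "infinite ?S"
 have sm: "(\<lambda>u. (cmod (wgt G v u))\<^sup>2) summable_on verts G" using assms by (simp add: is_network_def)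
 obtain n :: nat where n: "deg G v / d\<^sup>2 < real n" using reals_Archimedean2 by blast
 obtain F where F: "F \<subseteq> ?S" "finite F" "card F = n" using infinite_arbitrarily_large[OF inf] by blast
 have "real n * d\<^sup>2 = (\<Sum>u\<in>F. d\<^sup>2)" using F by simp
 also have "\<dots> \<le> (\<Sum>u\<in>F. (cmod (wgt G v u))\<^sup>2)" using F assms(3) by (intro sum_mono power_mono) auto
 also have "\<dots> \<le> deg G v" unfolding deg_def by (rule finite_sum_le_infsum[OF sm]) (use F in auto)
 finally show False using n assms(3) by (simp add: field_simps)
qed

lemma trw_le: "cmod (trw d \<theta> G u v) \<le> cmod (wgt G u v)" unfolding trw_def norm_mult using chi_tilde_bounds[of \<theta>] by (simp add: mult_left_le)

lemma wgt_tr: "wgt (tr d \<theta> G) u v = trw d \<theta> G u v * complex_of_real (chi \<theta> (cmod (trw d \<theta> G u v)))" by (simp add: tr_def)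

lemma wgt_tr_le: "0 \<le> \<theta> \<Longrightarrow> cmod (wgt (tr d \<theta> G) u v) \<le> cmod (wgt G u v)" unfolding wgt_tr norm_mult by (rule order_trans[OF mult_left_le trw_le])
  (use chi_le_1[of \<theta> "cmod (trw d \<theta> G u v)"] chi_nonneg[of "cmod (trw d \<theta> G u v)" \<theta>] in auto)

lemma wgt_tr_nonzero:
 assumes "wgt (tr d \<theta> G) u v \<noteq> 0"
 shows "\<theta> \<le> cmod (wgt G u v)" "degd d G u < 1 / \<theta>\<^sup>2" "degd d G v < 1 / \<theta>\<^sup>2"
proof -
 have "chi \<theta> (cmod (trw d \<theta> G u v)) \<noteq> 0" "trw d \<theta> G u v \<noteq> 0" using assms by (auto simp: wgt_tr)
 then show "\<theta> \<le> cmod (wgt G u v)" using trw_le[of d \<theta> G u v] chi_eq_0[of "cmod (trw d \<theta> G u v)" \<theta>] by linarith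
 have "chi_tilde \<theta> (max (degd d G u) (degd d G v)) \<noteq> 0" using \<open>trw d \<theta> G u v \<noteq> 0\<close> by (auto simp: trw_def)
 from chi_tilde_nonzero[OF this] show "degd d G u < 1 / \<theta>\<^sup>2" "degd d G v < 1 / \<theta>\<^sup>2" by auto
qed

lemma wgt_tr_eq_0: "cmod (wgt G u v) < \<theta> \<Longrightarrow> wgt (tr d \<theta> G) u v = 0" using wgt_tr_nonzero(1)[of d \<theta> G u v] by linarith

lemma hermitian_tr:
 assumes "is_network G"
 shows "hermitian_on (verts G) (wgt (tr d \<theta> G))" unfolding hermitian_on_def
proof (intro ballI)
 fix u v assume "u \<in> verts G" "v \<in> verts G"
 then have "wgt G u v = cnj (wgt G v u)" using assms unfolding is_network_def by blast
 then have "trw d \<theta> G u v = cnj (trw d \<theta> G v u)" by (simp add: trw_def max.commute)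
 then show "wgt (tr d \<theta> G) u v = cnj (wgt (tr d \<theta> G) v u)" by (simp add: wgt_tr)
qed

text \<open>An edge that survives at level \<theta> has weight at least \<theta> >= 2d, so
  \<open>degd d\<close> counts it in full, and its ends have \<open>degd d\<close> below
  1/\<theta>^2. This leaves at most 1/\<theta>^4 neighbours, and |w| <= |w|^2/\<theta> bounds the
  row sum by 1/\<theta>^3, the radius of the intervals that carry the spectral measures.\<close>

lemma tr_bounds:
 assumes G: "is_network G" and u: "u \<in> verts G" and d: "0 \<le> d" "2 * d \<le> \<theta>" and \<theta>: "0 < \<theta>"
 shows finite_nb_tr: "finite (nb (tr d \<theta> G) u)"
  and card_nb_tr: "real (card (nb (tr d \<theta> G) u)) \<le> 1 / \<theta> ^ 4"
  and sum_nb_tr: "(\<Sum>v\<in>nb (tr d \<theta> G) u. cmod (wgt (tr d \<theta> G) u v)) \<le> 1 / \<theta> ^ 3"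
proof -
 let ?N = "nb (tr d \<theta> G) u"
 have N: "?N \<subseteq> {v \<in> verts G. \<theta> \<le> cmod (wgt G u v)}" using wgt_tr_nonzero(1) by (fastforce simp: nb_def)
 show fin: "finite ?N" by (rule finite_subset[OF N finite_large_weights[OF G u \<theta>]])
 have sq: "(\<Sum>v\<in>?N. (cmod (wgt G u v))\<^sup>2) \<le> 1 / \<theta>\<^sup>2"
 proof (cases "?N = {}")
  case False
  then obtain v where "v \<in> ?N" by blast
  then have lt: "degd d G u < 1 / \<theta>\<^sup>2" using wgt_tr_nonzero(2) by (auto simp: nb_def)
  have "(\<Sum>v\<in>?N. (cmod (wgt G u v))\<^sup>2) = (\<Sum>v\<in>?N. (cmod (wgt G u v))\<^sup>2 * chi d (cmod (wgt G u v)))" using N d by (intro sum.cong) (auto simp: chi_eq_1)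
  also have "\<dots> \<le> degd d G u" unfolding degd_def by (rule finite_sum_le_infsum[OF summable_degd[OF G u d(1)] fin]) (use N d in \<open>auto simp: chi_nonneg\<close>)
  finally show ?thesis using lt by simp
 qed simp
 have "real (card ?N) * \<theta>\<^sup>2 = (\<Sum>v\<in>?N. \<theta>\<^sup>2)" by simp
 also have "\<dots> \<le> (\<Sum>v\<in>?N. (cmod (wgt G u v))\<^sup>2)" using N \<theta> by (intro sum_mono power_mono) auto
 finally have "real (card ?N) * \<theta>\<^sup>2 \<le> 1 / \<theta>\<^sup>2" using sq by simp
 then show "real (card ?N) \<le> 1 / \<theta> ^ 4" using \<theta> by (simp add: field_simps power2_eq_square power4_eq_xxxx)
 have "(\<Sum>v\<in>?N. cmod (wgt (tr d \<theta> G) u v)) \<le> (\<Sum>v\<in>?N. (cmod (wgt G u v))\<^sup>2 / \<theta>)"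
 proof (rule sum_mono)
  fix v assume "v \<in> ?N"
  then have "\<theta> \<le> cmod (wgt G u v)" using N by auto
  then have "cmod (wgt G u v) * \<theta> \<le> cmod (wgt G u v) * cmod (wgt G u v)" by (rule mult_left_mono) simp
  then have "cmod (wgt G u v) \<le> (cmod (wgt G u v))\<^sup>2 / \<theta>" using \<theta> by (simp add: field_simps power2_eq_square)
  then show "cmod (wgt (tr d \<theta> G) u v) \<le> (cmod (wgt G u v))\<^sup>2 / \<theta>" using wgt_tr_le[of \<theta> d G u v] \<theta> by simp
 qed
 also have "\<dots> = (\<Sum>v\<in>?N. (cmod (wgt G u v))\<^sup>2) / \<theta>" by (simp add: sum_divide_distrib)
 also have "\<dots> \<le> (1 / \<theta>\<^sup>2) / \<theta>" using sq \<theta> by (intro divide_right_mono) auto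
 finally show "(\<Sum>v\<in>?N. cmod (wgt (tr d \<theta> G) u v)) \<le> 1 / \<theta> ^ 3" by (simp add: power3_eq_cube power2_eq_square)
qed

lemma bounded_net_tr:
 assumes "is_network G" "0 \<le> d" "2 * d \<le> \<theta>" "0 < \<theta>"
 shows "bounded_net (1 / \<theta> ^ 3) (tr d \<theta> G)" unfolding bounded_net_def using hermitian_tr[OF assms(1)] tr_bounds[OF assms(1) _ assms(2-4)] by simp

lemma is_network_bounded_net:
 assumes "bounded_net M G"
 shows "is_network G" unfolding is_network_def
proof (intro conjI ballI)
 fix v assume v: "v \<in> verts G"
 have "(\<lambda>u. (cmod (wgt G v u))\<^sup>2) summable_on nb G v" using assms v by (intro summable_on_finite) (auto simp: bounded_net_def)
 moreover have "(\<lambda>u. (cmod (wgt G v u))\<^sup>2) summable_on nb G v \<longleftrightarrow> (\<lambda>u. (cmod (wgt G v u))\<^sup>2) summable_on verts G"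
  by (rule summable_on_cong_neutral) (auto simp: nb_def)
 ultimately show "(\<lambda>u. (cmod (wgt G v u))\<^sup>2) summable_on verts G" by simp
next
 fix u v assume "u \<in> verts G" "v \<in> verts G"
 then show "wgt G u v = cnj (wgt G v u)" using assms unfolding bounded_net_def hermitian_on_def by blast
qed

lemma is_network_tr:
 assumes "is_network G" "0 \<le> d" "2 * d \<le> \<theta>" "0 < \<theta>"
 shows "is_network (tr d \<theta> G)" by (rule is_network_bounded_net[OF bounded_net_tr[OF assms]])

text \<open>By the last clause no edge leaves the image, so the image is a union of components.
  Isomorphisms and inclusions of components are both instances, and degrees, walks and distances at
  image vertices are those of \<open>G\<close>.\<close>

definition embeds :: "(nat \<Rightarrow> nat) \<Rightarrow> network \<Rightarrow> network \<Rightarrow> bool" where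
 "embeds \<sigma> G H \<longleftrightarrow> inj_on \<sigma> (verts G) \<and> \<sigma> ` verts G \<subseteq> verts H \<and>
   (\<forall>u\<in>verts G. \<forall>v\<in>verts G. wgt H (\<sigma> u) (\<sigma> v) = wgt G u v) \<and>
   (\<forall>u\<in>verts G. \<forall>w\<in>verts H. wgt H (\<sigma> u) w \<noteq> 0 \<longrightarrow> w \<in> \<sigma> ` verts G)"

lemma embeds_infsum:
 assumes "embeds \<sigma> G H" "u \<in> verts G" "\<And>w. w \<in> verts H \<Longrightarrow> wgt H (\<sigma> u) w = 0 \<Longrightarrow> f w = 0"
 shows "infsum f (verts H) = (\<Sum>\<^sub>\<infinity>v\<in>verts G. f (\<sigma> v))"
proof -
 have "infsum f (verts H) = infsum f (\<sigma> ` verts G)"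
 proof (rule infsum_cong_neutral)
  fix w assume w: "w \<in> verts H - \<sigma> ` verts G"
  then have "wgt H (\<sigma> u) w = 0" using assms(1,2) unfolding embeds_def by blast
  then show "f w = 0" using assms(3) w by blast
 next
  fix w assume "w \<in> \<sigma> ` verts G - verts H"
  then show "f w = 0" using assms(1) unfolding embeds_def by blast
 qed simp
 also have "\<dots> = (\<Sum>\<^sub>\<infinity>v\<in>verts G. f (\<sigma> v))" by (subst infsum_reindex) (use assms in \<open>auto simp: embeds_def o_def\<close>)
 finally show ?thesis .
qed

lemma embeds_degd:
 assumes "embeds \<sigma> G H" "u \<in> verts G"
 shows "degd d H (\<sigma> u) = degd d G u" unfolding degd_def by (subst embeds_infsum[OF assms]) (use assms in \<open>auto simp: embeds_def intro!: infsum_cong\<close>)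

lemma embeds_tr:
 assumes "embeds \<sigma> G H"
 shows "embeds \<sigma> (tr d \<theta> G) (tr d \<theta> H)"
proof -
 have "trw d \<theta> H (\<sigma> u) (\<sigma> v) = trw d \<theta> G u v" if "u \<in> verts G" "v \<in> verts G" for u v
  unfolding trw_def using that assms by (simp add: embeds_degd embeds_def)
 moreover have "wgt H (\<sigma> u) w \<noteq> 0" if "wgt (tr d \<theta> H) (\<sigma> u) w \<noteq> 0" for u w using that by (auto simp: wgt_tr trw_def)
 ultimately show ?thesis using assms unfolding embeds_def verts_tr by (simp add: wgt_tr[of d \<theta> G] wgt_tr[of d \<theta> H "\<sigma> _" "\<sigma> _"])
qed

lemma embeds_nb:
 assumes "embeds \<sigma> G H" "u \<in> verts G"
 shows "nb H (\<sigma> u) = \<sigma> ` nb G u"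
proof (intro set_eqI iffI)
 fix w assume w: "w \<in> nb H (\<sigma> u)"
 then have "w \<in> verts H" "wgt H (\<sigma> u) w \<noteq> 0" by (auto simp: nb_def)
 then obtain v where "v \<in> verts G" "w = \<sigma> v" using assms unfolding embeds_def by blast
 then show "w \<in> \<sigma> ` nb G u" using assms w unfolding embeds_def nb_def by auto
next
 fix w assume "w \<in> \<sigma> ` nb G u"
 then show "w \<in> nb H (\<sigma> u)" using assms unfolding embeds_def nb_def by auto
qed

lemma embeds_walks:
 assumes "embeds \<sigma> G H" "u \<in> verts G" "v \<in> verts G"
 shows "walks H k (\<sigma> u) (\<sigma> v) = walks G k u v" using assms(2)
proof (induction k arbitrary: u)
 case 0
 then show ?case using assms by (auto simp: embeds_def dest: inj_onD)
next
 case (Suc k)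
 have inj: "inj_on \<sigma> (nb G u)" using assms(1) unfolding embeds_def nb_def by (auto intro: inj_on_subset)
 have "wgt H (\<sigma> u) (\<sigma> w) * walks H k (\<sigma> w) (\<sigma> v) = wgt G u w * walks G k w v" if "w \<in> nb G u" for w
  using that Suc assms(1) by (simp add: nb_def embeds_def)
 then show ?case by (simp add: embeds_nb[OF assms(1) Suc.prems] sum.reindex[OF inj])
qed

lemma embeds_spectral_measure:
 assumes "embeds \<sigma> G H" "v \<in> verts G" "bounded_net M G" "bounded_net M H" "0 < M"
 shows "spectral_measure H (\<sigma> v) = spectral_measure G v"
proof (rule spectral_measure_unique[OF assms(4) _ assms(5)])
 show "\<sigma> v \<in> verts H" using assms by (auto simp: embeds_def)
 note p = spectral_measure_props[OF assms(3,2,5)]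
 show "real_distribution (spectral_measure G v)" by (rule p)
 show "integrable (spectral_measure G v) (\<lambda>x. x ^ k)" for k by (rule AE_bounded_continuous_integrable[OF p(1) _ p(2)]) (intro continuous_intros)
 show "complex_of_real (\<integral>x. x ^ k \<partial>spectral_measure G v) = walks H k (\<sigma> v) (\<sigma> v)" for k using p(3) embeds_walks[OF assms(1,2,2)] by simp
qed

text \<open>Weights of \<open>H i\<close> that tend to 0 are not controlled: they may lead out of the image of \<open>G\<close>.\<close>

definition net_conv :: "'i filter \<Rightarrow> network \<Rightarrow> ('i \<Rightarrow> network) \<Rightarrow> ('i \<Rightarrow> nat \<Rightarrow> nat) \<Rightarrow> bool" where
 "net_conv F G H \<sigma> \<longleftrightarrow>
   (\<forall>u\<in>verts G. \<forall>\<^sub>F i in F. \<sigma> i u \<in> verts (H i)) \<and>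
   (\<forall>u\<in>verts G. \<forall>v\<in>verts G. u \<noteq> v \<longrightarrow> (\<forall>\<^sub>F i in F. \<sigma> i u \<noteq> \<sigma> i v)) \<and>
   (\<forall>u\<in>verts G. \<forall>v\<in>verts G. ((\<lambda>i. wgt (H i) (\<sigma> i u) (\<sigma> i v)) \<longlongrightarrow> wgt G u v) F) \<and>
   (\<forall>u\<in>verts G. \<forall>d>0. \<forall>\<^sub>F i in F. \<forall>w\<in>verts (H i). d \<le> cmod (wgt (H i) (\<sigma> i u) w) \<longrightarrow>
    (\<exists>v\<in>verts G. w = \<sigma> i v \<and> d / 2 \<le> cmod (wgt G u v)))"

lemma net_conv_verts: "net_conv F G H \<sigma> \<Longrightarrow> u \<in> verts G \<Longrightarrow> \<forall>\<^sub>F i in F. \<sigma> i u \<in> verts (H i)" by (simp add: net_conv_def)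
lemma net_conv_wgt: "net_conv F G H \<sigma> \<Longrightarrow> u \<in> verts G \<Longrightarrow> v \<in> verts G \<Longrightarrow> ((\<lambda>i. wgt (H i) (\<sigma> i u) (\<sigma> i v)) \<longlongrightarrow> wgt G u v) F" by (simp add: net_conv_def)
lemma net_conv_large: "net_conv F G H \<sigma> \<Longrightarrow> u \<in> verts G \<Longrightarrow> 0 < d \<Longrightarrow> \<forall>\<^sub>F i in F. \<forall>w\<in>verts (H i). d \<le> cmod (wgt (H i) (\<sigma> i u) w) \<longrightarrow>
    (\<exists>v\<in>verts G. w = \<sigma> i v \<and> d / 2 \<le> cmod (wgt G u v))" by (simp add: net_conv_def)

lemma net_conv_inj:
 assumes "net_conv F G H \<sigma>" "finite S" "S \<subseteq> verts G"
 shows "\<forall>\<^sub>F i in F. inj_on (\<sigma> i) S"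
proof -
 have "\<forall>\<^sub>F i in F. \<forall>u\<in>S. \<forall>v\<in>S. u \<noteq> v \<longrightarrow> \<sigma> i u \<noteq> \<sigma> i v"
  using assms unfolding net_conv_def by (intro eventually_ball_finite ballI) (auto simp: subset_iff)
 then show ?thesis by eventually_elim (auto simp: inj_on_def)
qed

text \<open>Only neighbours with weight at least d contribute. Those of \<open>\<sigma> i u\<close>
  eventually come from the finite set N of neighbours of u with weight at least d/2, the halved
  threshold being the slack in \<open>net_conv\<close>; on N the terms converge one by one.\<close>

lemma net_conv_infsum:
 fixes f :: "nat \<Rightarrow> 'b::real_normed_vector"
 assumes G: "is_network G" and conv: "net_conv F G H \<sigma>" and u: "u \<in> verts G" and d: "0 < d"
  and f: "\<And>v. v \<in> verts G \<Longrightarrow> ((\<lambda>i. f' i (\<sigma> i v)) \<longlongrightarrow> f v) F"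
  and z: "\<And>v. v \<in> verts G \<Longrightarrow> cmod (wgt G u v) < d \<Longrightarrow> f v = 0"
  and z': "\<And>i w. w \<in> verts (H i) \<Longrightarrow> cmod (wgt (H i) (\<sigma> i u) w) < d \<Longrightarrow> f' i w = 0"
 shows "((\<lambda>i. \<Sum>\<^sub>\<infinity>w\<in>verts (H i). f' i w) \<longlongrightarrow> (\<Sum>\<^sub>\<infinity>v\<in>verts G. f v)) F"
proof -
 define N where "N = {v \<in> verts G. d / 2 \<le> cmod (wgt G u v)}"
 have N: "finite N" "N \<subseteq> verts G" using finite_large_weights[OF G u, of "d/2"] d by (auto simp: N_def)
 have "(\<Sum>\<^sub>\<infinity>v\<in>verts G. f v) = (\<Sum>v\<in>N. f v)" by (rule infsum_eq_sum_neutral[OF N]) (use z d in \<open>auto simp: N_def\<close>)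
 moreover have "((\<lambda>i. \<Sum>v\<in>N. f' i (\<sigma> i v)) \<longlongrightarrow> (\<Sum>v\<in>N. f v)) F" using f N by (intro tendsto_sum) auto
 moreover have "\<forall>\<^sub>F i in F. (\<Sum>v\<in>N. f' i (\<sigma> i v)) = (\<Sum>\<^sub>\<infinity>w\<in>verts (H i). f' i w)"
 proof -
  have "\<forall>\<^sub>F i in F. \<forall>v\<in>N. \<sigma> i v \<in> verts (H i)" using N net_conv_verts[OF conv] by (intro eventually_ball_finite ballI) auto
  with net_conv_inj[OF conv N] net_conv_large[OF conv u d] show ?thesis
  proof eventually_elim
   case (elim i)
   have "(\<Sum>\<^sub>\<infinity>w\<in>verts (H i). f' i w) = (\<Sum>w\<in>\<sigma> i ` N. f' i w)"
   proof (rule infsum_eq_sum_neutral)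
    fix w assume w: "w \<in> verts (H i) - \<sigma> i ` N"
    have "cmod (wgt (H i) (\<sigma> i u) w) < d"
    proof (rule ccontr)
     assume "\<not> cmod (wgt (H i) (\<sigma> i u) w) < d"
     then obtain v where "v \<in> verts G" "w = \<sigma> i v" "d / 2 \<le> cmod (wgt G u v)" using elim(2) w by (meson DiffD1 not_less)
     then show False using w by (auto simp: N_def)
    qed
    then show "f' i w = 0" using z' w by auto
   qed (use N elim in auto)
   then show ?case using elim by (simp add: sum.reindex)
  qed
 qed
 ultimately show ?thesis by (simp only: Lim_transform_eventually)
qed

lemma net_conv_degd:
 assumes "is_network G" "net_conv F G H \<sigma>" "u \<in> verts G" "0 < d"
 shows "((\<lambda>i. degd d (H i) (\<sigma> i u)) \<longlongrightarrow> degd d G u) F" unfolding degd_def by (rule net_conv_infsum[OF assms])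
  (use net_conv_wgt[OF assms(2,3)] assms(4) in
   \<open>auto simp: chi_eq_0 intro!: tendsto_intros continuous_on_tendsto_compose[OF continuous_chi]\<close>)

lemma net_conv_wgt_tr:
 assumes "is_network G" "net_conv F G H \<sigma>" "u \<in> verts G" "v \<in> verts G" "0 < d" "0 < \<theta>"
 shows "((\<lambda>i. wgt (tr d \<theta> (H i)) (\<sigma> i u) (\<sigma> i v)) \<longlongrightarrow> wgt (tr d \<theta> G) u v) F"
proof -
 have "((\<lambda>i. chi_tilde \<theta> (max (degd d (H i) (\<sigma> i u)) (degd d (H i) (\<sigma> i v)))) \<longlongrightarrow> chi_tilde \<theta> (max (degd d G u) (degd d G v))) F"
  using assms by (intro continuous_on_tendsto_compose[OF continuous_chi_tilde] tendsto_max net_conv_degd) auto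
 then have t: "((\<lambda>i. trw d \<theta> (H i) (\<sigma> i u) (\<sigma> i v)) \<longlongrightarrow> trw d \<theta> G u v) F" unfolding trw_def by (intro tendsto_intros net_conv_wgt assms)
 have "((\<lambda>i. chi \<theta> (cmod (trw d \<theta> (H i) (\<sigma> i u) (\<sigma> i v)))) \<longlongrightarrow> chi \<theta> (cmod (trw d \<theta> G u v))) F"
  by (intro continuous_on_tendsto_compose[OF continuous_chi[OF assms(6)]] tendsto_norm t) auto
 then show ?thesis unfolding wgt_tr by (intro tendsto_intros t)
qed

text \<open>Each step of a walk is a sum over neighbours to which \<open>net_conv_infsum\<close>
  applies with threshold \<theta>, since truncation removes all weights below it.\<close>

lemma net_conv_walks_tr:
 assumes "is_network G" "\<And>i. is_network (H i)" "net_conv F G H \<sigma>" "u \<in> verts G" "v \<in> verts G" "0 < d" "2 * d \<le> \<theta>"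
 shows "((\<lambda>i. walks (tr d \<theta> (H i)) k (\<sigma> i u) (\<sigma> i v)) \<longlongrightarrow> walks (tr d \<theta> G) k u v) F" using assms(4)
proof (induction k arbitrary: u)
 case 0
 show ?case
 proof (cases "u = v")
  case False
  then have "\<forall>\<^sub>F i in F. \<sigma> i u \<noteq> \<sigma> i v" using assms(3,5) 0 by (simp add: net_conv_def)
  then have "\<forall>\<^sub>F i in F. walks (tr d \<theta> (H i)) 0 (\<sigma> i u) (\<sigma> i v) = 0" by eventually_elim simp
  then show ?thesis using False by (simp add: tendsto_eventually)
 qed simp
next
 case (Suc k)
 have \<theta>: "0 < \<theta>" using assms by simp
 have "((\<lambda>i. \<Sum>\<^sub>\<infinity>w\<in>verts (H i). wgt (tr d \<theta> (H i)) (\<sigma> i u) w * walks (tr d \<theta> (H i)) k w (\<sigma> i v))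
   \<longlongrightarrow> (\<Sum>\<^sub>\<infinity>w\<in>verts G. wgt (tr d \<theta> G) u w * walks (tr d \<theta> G) k w v)) F" by (rule net_conv_infsum[OF assms(1,3) Suc.prems \<theta>])
   (use Suc \<theta> assms in \<open>auto simp: wgt_tr_eq_0 intro!: tendsto_intros net_conv_wgt_tr\<close>)
 moreover have "(\<Sum>\<^sub>\<infinity>w\<in>verts G. wgt (tr d \<theta> G) u w * walks (tr d \<theta> G) k w v) = walks (tr d \<theta> G) (Suc k) u v"
  using walks_Suc_infsum[OF finite_nb_tr[OF assms(1) Suc.prems _ assms(7) \<theta>], of k v] assms(6) by simp
 moreover have "\<forall>\<^sub>F i in F. (\<Sum>\<^sub>\<infinity>w\<in>verts (H i). wgt (tr d \<theta> (H i)) (\<sigma> i u) w * walks (tr d \<theta> (H i)) k w (\<sigma> i v))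
   = walks (tr d \<theta> (H i)) (Suc k) (\<sigma> i u) (\<sigma> i v)" using net_conv_verts[OF assms(3) Suc.prems]
 proof eventually_elim
  case (elim i)
  then show ?case using walks_Suc_infsum[OF finite_nb_tr[OF assms(2) elim _ assms(7) \<theta>], of k "\<sigma> i v"] assms(6) by simp
 qed
 ultimately show ?case by (simp only: Lim_transform_eventually)
qed

section \<open>The limit as the cut-off d tends to 0\<close>

lemma degd_tendsto:
 assumes G: "is_network G" and v: "v \<in> verts G"
 shows "((\<lambda>d. degd d G v) \<longlongrightarrow> deg G v) (at_right 0)"
proof (rule tendstoI)
 fix e :: real assume e: "e > 0"
 have sm: "(\<lambda>u. (cmod (wgt G v u))\<^sup>2) summable_on verts G" using assms by (simp add: is_network_def)
 then have "((\<lambda>u. (cmod (wgt G v u))\<^sup>2) has_sum deg G v) (verts G)" unfolding deg_def by (rule has_sum_infsum)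
 \<comment> \<open>A finite set carries the degree up to e/2, and for small d all its nonzero
   weights are counted in full.\<close>
 then obtain S where S: "finite S" "S \<subseteq> verts G" "dist (\<Sum>u\<in>S. (cmod (wgt G v u))\<^sup>2) (deg G v) \<le> e / 2"
  using has_sum_finite_approximation[where \<epsilon>="e/2"] e by (metis half_gt_zero)
 have "\<forall>\<^sub>F d in at_right 0. \<forall>u\<in>S. wgt G v u \<noteq> 0 \<longrightarrow> 2 * d \<le> cmod (wgt G v u)"
 proof (intro eventually_ball_finite S(1) ballI)
  fix u assume "u \<in> S"
  show "\<forall>\<^sub>F d in at_right 0. wgt G v u \<noteq> 0 \<longrightarrow> 2 * d \<le> cmod (wgt G v u)"
  proof (cases "wgt G v u = 0")
   case False
   then have "\<forall>\<^sub>F d in at_right 0. 0 < d \<and> d < cmod (wgt G v u) / 2" by (intro eventually_at_right_small) simp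
   then show ?thesis by eventually_elim simp
  qed simp
 qed
 moreover have "\<forall>\<^sub>F d in at_right (0::real). 0 < d" by (rule eventually_at_right_less)
 ultimately show "\<forall>\<^sub>F d in at_right 0. dist (degd d G v) (deg G v) < e"
 proof eventually_elim
  case (elim d)
  have "(\<Sum>u\<in>S. (cmod (wgt G v u))\<^sup>2) = (\<Sum>u\<in>S. (cmod (wgt G v u))\<^sup>2 * chi d (cmod (wgt G v u)))"
  proof (rule sum.cong)
   fix u assume u: "u \<in> S"
   show "(cmod (wgt G v u))\<^sup>2 = (cmod (wgt G v u))\<^sup>2 * chi d (cmod (wgt G v u))" using elim u by (cases "wgt G v u = 0") (auto simp: chi_eq_1)
  qed simp
  also have "\<dots> \<le> degd d G v" unfolding degd_def by (rule finite_sum_le_infsum[OF summable_degd[OF G v]]) (use S elim in \<open>auto simp: chi_nonneg\<close>)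
  finally show ?case using S(3) e degd_le_deg[OF G v, of d] elim by (simp add: dist_real_def)
 qed
qed

lemma wgt_tr_tendsto:
 assumes "is_network G" "u \<in> verts G" "v \<in> verts G" "0 < \<theta>"
 shows "((\<lambda>d. wgt (tr d \<theta> G) u v) \<longlongrightarrow> wgt (tr 0 \<theta> G) u v) (at_right 0)"
proof -
 have "((\<lambda>d. chi_tilde \<theta> (max (degd d G u) (degd d G v))) \<longlongrightarrow> chi_tilde \<theta> (max (degd 0 G u) (degd 0 G v))) (at_right 0)"
  unfolding degd_0 using assms by (intro continuous_on_tendsto_compose[OF continuous_chi_tilde] tendsto_max degd_tendsto) auto
 then have t: "((\<lambda>d. trw d \<theta> G u v) \<longlongrightarrow> trw 0 \<theta> G u v) (at_right 0)" unfolding trw_def by (intro tendsto_intros)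
 have "((\<lambda>d. chi \<theta> (cmod (trw d \<theta> G u v))) \<longlongrightarrow> chi \<theta> (cmod (trw 0 \<theta> G u v))) (at_right 0)"
  by (intro continuous_on_tendsto_compose[OF continuous_chi[OF assms(4)]] tendsto_norm t) auto
 then show ?thesis unfolding wgt_tr by (intro tendsto_intros t)
qed

lemma walks_tr_tendsto:
 assumes G: "is_network G" and "u \<in> verts G" "v \<in> verts G" and \<theta>: "0 < \<theta>"
 shows "((\<lambda>d. walks (tr d \<theta> G) k u v) \<longlongrightarrow> walks (tr 0 \<theta> G) k u v) (at_right 0)" using assms(2)
proof (induction k arbitrary: u)
 case (Suc k)
 \<comment> \<open>A finite set of neighbours that serves all d at once, as weights below \<theta>
   are removed whatever d is.\<close>
 define N where "N = {w \<in> verts G. \<theta> \<le> cmod (wgt G u w)}"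
 have N: "finite N" "N \<subseteq> verts G" using finite_large_weights[OF G Suc.prems \<theta>] by (auto simp: N_def)
 have eq: "walks (tr d \<theta> G) (Suc k) u v = (\<Sum>w\<in>N. wgt (tr d \<theta> G) u w * walks (tr d \<theta> G) k w v)" for d unfolding walks.simps
  by (rule sum.mono_neutral_left[OF N(1)]) (use wgt_tr_nonzero(1)[of d \<theta> G u] in \<open>auto simp: nb_def N_def\<close>)
 show ?case unfolding eq using N Suc \<theta> G by (intro tendsto_sum tendsto_mult wgt_tr_tendsto) auto
qed simp

definition st :: "complex \<Rightarrow> real \<Rightarrow> real \<Rightarrow> network \<Rightarrow> nat \<Rightarrow> complex" where
 "st z d \<theta> G v = stieltjes (spectral_measure (tr d \<theta> G) v) z"

lemma spectral_tr:
 assumes "is_network G" "v \<in> verts G" "0 \<le> d" "2 * d \<le> \<theta>" "0 < \<theta>"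
 shows "real_distribution (spectral_measure (tr d \<theta> G) v)" "AE x in spectral_measure (tr d \<theta> G) v. \<bar>x\<bar> \<le> 1 / \<theta> ^ 3"
  "complex_of_real (\<integral>x. x ^ k \<partial>spectral_measure (tr d \<theta> G) v) = walks (tr d \<theta> G) k v v"
 using spectral_measure_props[OF bounded_net_tr[OF assms(1,3-5)], of v] assms by auto

lemma norm_st_le:
 assumes "is_network G" "v \<in> verts G" "0 \<le> d" "2 * d \<le> \<theta>" "0 < \<theta>" "0 < Im z"
 shows "cmod (st z d \<theta> G v) \<le> 1 / Im z"
proof -
 interpret real_distribution "spectral_measure (tr d \<theta> G) v" using spectral_tr(1)[OF assms(1-5)] .
 have "cmod (st z d \<theta> G v) \<le> (\<integral>x. cmod (1 / (complex_of_real x - z)) \<partial>spectral_measure (tr d \<theta> G) v)" unfolding st_def by (rule integral_norm_bound)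
 also have "\<dots> \<le> 1 / Im z" by (rule integral_le_const)
   (use integrable_norm[OF integrable_resolvent[OF assms(6)]] spectral_tr(1)[OF assms(1-5)] norm_resolvent_le[OF assms(6)] in auto)
 finally show ?thesis .
qed

lemma tendsto_walks_imp_moments:
 assumes "((\<lambda>i. walks (H i) k (s i) (s i)) \<longlongrightarrow> walks G k v v) F"
  and "\<forall>\<^sub>F i in F. complex_of_real (\<integral>x. x ^ k \<partial>\<mu> i) = walks (H i) k (s i) (s i)"
  and "complex_of_real (\<integral>x. x ^ k \<partial>\<nu>) = walks G k v v"
 shows "((\<lambda>i. \<integral>x. x ^ k \<partial>\<mu> i) \<longlongrightarrow> (\<integral>x. x ^ k \<partial>\<nu>)) F"
proof -
 have "((\<lambda>i. complex_of_real (\<integral>x. x ^ k \<partial>\<mu> i)) \<longlongrightarrow> complex_of_real (\<integral>x. x ^ k \<partial>\<nu>)) F" using assms by (simp add: tendsto_cong)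
 then show ?thesis by (simp add: tendsto_of_real_iff)
qed

text \<open>The moments are weighted counts of closed walks, which converge, and all supports lie in
  the interval of radius 1/\<theta>^3.\<close>

lemma net_conv_spectral_integral:
 fixes f :: "real \<Rightarrow> complex"
 assumes "is_network G" "\<And>i. is_network (H i)" "net_conv F G H \<sigma>" "v \<in> verts G" "0 < d" "2 * d \<le> \<theta>" "continuous_on UNIV f"
 shows "((\<lambda>i. \<integral>x. f x \<partial>spectral_measure (tr d \<theta> (H i)) (\<sigma> i v)) \<longlongrightarrow> (\<integral>x. f x \<partial>spectral_measure (tr d \<theta> G) v)) F"
proof (rule tendsto_integral_of_moments)
 have \<theta>: "0 < \<theta>" "0 \<le> d" using assms by auto
 show "\<forall>\<^sub>F i in F. real_distribution (spectral_measure (tr d \<theta> (H i)) (\<sigma> i v)) \<and>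
   (AE x in spectral_measure (tr d \<theta> (H i)) (\<sigma> i v). \<bar>x\<bar> \<le> 1 / \<theta> ^ 3)"
  using net_conv_verts[OF assms(3,4)] by eventually_elim (use spectral_tr[OF assms(2) _ \<theta>(2) assms(6) \<theta>(1)] in auto)
 show "real_distribution (spectral_measure (tr d \<theta> G) v)" "AE x in spectral_measure (tr d \<theta> G) v. \<bar>x\<bar> \<le> 1 / \<theta> ^ 3"
  using spectral_tr[OF assms(1,4) \<theta>(2) assms(6) \<theta>(1)] by auto
 show "((\<lambda>i. \<integral>x. x ^ k \<partial>spectral_measure (tr d \<theta> (H i)) (\<sigma> i v)) \<longlongrightarrow> (\<integral>x. x ^ k \<partial>spectral_measure (tr d \<theta> G) v)) F" for k
 proof (rule tendsto_walks_imp_moments[OF net_conv_walks_tr[OF assms(1-4,4-6)]])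
  show "\<forall>\<^sub>F i in F. complex_of_real (\<integral>x. x ^ k \<partial>spectral_measure (tr d \<theta> (H i)) (\<sigma> i v)) = walks (tr d \<theta> (H i)) k (\<sigma> i v) (\<sigma> i v)"
   using net_conv_verts[OF assms(3,4)] by eventually_elim (use spectral_tr[OF assms(2) _ \<theta>(2) assms(6) \<theta>(1)] in auto)
  show "complex_of_real (\<integral>x. x ^ k \<partial>spectral_measure (tr d \<theta> G) v) = walks (tr d \<theta> G) k v v"
   using spectral_tr[OF assms(1,4) \<theta>(2) assms(6) \<theta>(1)] by auto
 qed
qed (rule assms(7))

lemma spectral_integral_tr_tendsto:
 fixes f :: "real \<Rightarrow> complex"
 assumes "is_network G" "v \<in> verts G" "0 < \<theta>" "continuous_on UNIV f"
 shows "((\<lambda>d. \<integral>x. f x \<partial>spectral_measure (tr d \<theta> G) v) \<longlongrightarrow> (\<integral>x. f x \<partial>spectral_measure (tr 0 \<theta> G) v)) (at_right 0)"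
proof (rule tendsto_integral_of_moments)
 have "\<forall>\<^sub>F d in at_right 0. 0 < d \<and> d < \<theta> / 2" by (rule eventually_at_right_small) (use assms in simp)
 then have ev: "\<forall>\<^sub>F d in at_right 0. 0 \<le> d \<and> 2 * d \<le> \<theta>" by eventually_elim auto
 then show "\<forall>\<^sub>F d in at_right 0. real_distribution (spectral_measure (tr d \<theta> G) v) \<and>
   (AE x in spectral_measure (tr d \<theta> G) v. \<bar>x\<bar> \<le> 1 / \<theta> ^ 3)" by eventually_elim (use spectral_tr[OF assms(1,2) _ _ assms(3)] in auto)
 show "real_distribution (spectral_measure (tr 0 \<theta> G) v)" "AE x in spectral_measure (tr 0 \<theta> G) v. \<bar>x\<bar> \<le> 1 / \<theta> ^ 3"
  using spectral_tr[OF assms(1,2) _ _ assms(3), of 0] assms(3) by auto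
 show "((\<lambda>d. \<integral>x. x ^ k \<partial>spectral_measure (tr d \<theta> G) v) \<longlongrightarrow> (\<integral>x. x ^ k \<partial>spectral_measure (tr 0 \<theta> G) v)) (at_right 0)" for k
 proof (rule tendsto_walks_imp_moments[OF walks_tr_tendsto[OF assms(1,2,2,3)]])
  show "\<forall>\<^sub>F d in at_right 0. complex_of_real (\<integral>x. x ^ k \<partial>spectral_measure (tr d \<theta> G) v) = walks (tr d \<theta> G) k v v"
   using ev by eventually_elim (use spectral_tr[OF assms(1,2) _ _ assms(3)] in auto)
  show "complex_of_real (\<integral>x. x ^ k \<partial>spectral_measure (tr 0 \<theta> G) v) = walks (tr 0 \<theta> G) k v v"
   using spectral_tr[OF assms(1,2) _ _ assms(3), of 0] assms(3) by auto
 qed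
qed (rule assms(4))

section \<open>Paths, components and the local topology\<close>

text \<open>The squared length, which is additive when an edge is appended.\<close>

definition psum :: "network \<Rightarrow> nat list \<Rightarrow> real" where
 "psum G p = (\<Sum>i<length p - 1. 1 / (cmod (wgt G (p ! i) (p ! Suc i)))\<^sup>2)"

lemma psum_nonneg: "0 \<le> psum G p" unfolding psum_def by (rule sum_nonneg) simp

lemma path_length_eq: "path_length G p = sqrt (psum G p)" by (simp add: path_length_def psum_def)

lemma psum_single [simp]: "psum G [u] = 0" by (simp add: psum_def)

lemma psum_snoc:
 assumes "p \<noteq> []"
 shows "psum G (p @ [w]) = psum G p + 1 / (cmod (wgt G (last p) w))\<^sup>2"
proof -
 obtain n where n: "length p = Suc n" using assms by (cases p) auto
 have "last p = p ! n" using n assms by (simp add: last_conv_nth)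
 moreover have "(\<Sum>i<n. 1 / (cmod (wgt G ((p @ [w]) ! i) ((p @ [w]) ! Suc i)))\<^sup>2) = (\<Sum>i<n. 1 / (cmod (wgt G (p ! i) (p ! Suc i)))\<^sup>2)"
  by (rule sum.cong) (use n in \<open>auto simp: nth_append\<close>)
 ultimately show ?thesis using n by (simp add: psum_def nth_append)
qed

lemma is_path_single [simp]: "is_path G u v [x] \<longleftrightarrow> x = u \<and> x = v \<and> x \<in> verts G" by (auto simp: is_path_def)

lemma is_path_snoc:
 assumes "p \<noteq> []"
 shows "is_path G u v (p @ [w]) \<longleftrightarrow> w = v \<and> is_path G u (last p) p \<and> v \<in> verts G \<and> wgt G (last p) v \<noteq> 0"
proof -
 obtain n where n: "length p = Suc n" using assms by (cases p) auto
 have l: "last p = p ! n" using n assms by (simp add: last_conv_nth)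
 have "(\<forall>i. Suc i < length (p @ [w]) \<longrightarrow> wgt G ((p @ [w]) ! i) ((p @ [w]) ! Suc i) \<noteq> 0) \<longleftrightarrow>
  (\<forall>i. Suc i < length p \<longrightarrow> wgt G (p ! i) (p ! Suc i) \<noteq> 0) \<and> wgt G (last p) w \<noteq> 0"
 proof (intro iffI conjI allI impI)
  assume *: "\<forall>i. Suc i < length (p @ [w]) \<longrightarrow> wgt G ((p @ [w]) ! i) ((p @ [w]) ! Suc i) \<noteq> 0"
  show "wgt G (last p) w \<noteq> 0" using *[rule_format, of n] n l by (simp add: nth_append)
  fix i assume "Suc i < length p"
  then show "wgt G (p ! i) (p ! Suc i) \<noteq> 0" using *[rule_format, of i] by (simp add: nth_append)
 next
  fix i assume *: "(\<forall>i. Suc i < length p \<longrightarrow> wgt G (p ! i) (p ! Suc i) \<noteq> 0) \<and> wgt G (last p) w \<noteq> 0"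
   and i: "Suc i < length (p @ [w])"
  show "wgt G ((p @ [w]) ! i) ((p @ [w]) ! Suc i) \<noteq> 0" using * i n l by (cases "i = n") (auto simp: nth_append)
 qed
 then show ?thesis using assms unfolding is_path_def by (auto simp: hd_append)
qed

lemma path_induct [consumes 1, case_names single snoc]:
 assumes "is_path G u v p"
  and "u \<in> verts G \<Longrightarrow> P u [u]"
  and "\<And>w p x. is_path G u w p \<Longrightarrow> P w p \<Longrightarrow> p \<noteq> [] \<Longrightarrow> last p = w \<Longrightarrow> x \<in> verts G \<Longrightarrow> wgt G w x \<noteq> 0 \<Longrightarrow> P x (p @ [x])"
 shows "P v p" using assms(1)
proof (induction p arbitrary: v rule: rev_induct)
 case Nil
 then show ?case by (simp add: is_path_def)
next
 case (snoc x p)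
 show ?case
 proof (cases "p = []")
  case True
  then show ?thesis using snoc assms(2) by auto
 next
  case False
  then have "x = v" "is_path G u (last p) p" "v \<in> verts G" "wgt G (last p) v \<noteq> 0" using snoc.prems by (auto simp: is_path_snoc)
  then show ?thesis using snoc.IH False assms(3) by blast
 qed
qed

lemma is_path_props: "is_path G u v p \<Longrightarrow> p \<noteq> [] \<and> last p = v \<and> u \<in> verts G \<and> v \<in> verts G \<and> set p \<subseteq> verts G"
 unfolding is_path_def by (metis hd_in_set last_in_set subsetD)

lemma net_dist_le_path: "is_path G u v p \<Longrightarrow> net_dist G u v \<le> ennreal (path_length G p)" unfolding net_dist_def by (rule INF_lower) simp

lemma net_dist_lessD:
 assumes "net_dist G u v < ennreal c"
 obtains p where "is_path G u v p" "path_length G p < c"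
proof -
 obtain p where "is_path G u v p" "ennreal (path_length G p) < ennreal c" using assms unfolding net_dist_def INF_less_iff by blast
 moreover have "0 \<le> path_length G p" by (simp add: path_length_eq psum_nonneg)
 ultimately show thesis using that by (simp add: ennreal_less_iff)
qed

definition reach :: "network \<Rightarrow> nat \<Rightarrow> nat \<Rightarrow> bool" where
 "reach G u v \<longleftrightarrow> (\<exists>p. is_path G u v p)"

lemma net_dist_finite: "net_dist G u v < \<top> \<longleftrightarrow> reach G u v"
proof
 assume "net_dist G u v < \<top>"
 then show "reach G u v" unfolding net_dist_def INF_less_iff reach_def by blast
next
 assume "reach G u v"
 then obtain p where "is_path G u v p" unfolding reach_def by blast
 then show "net_dist G u v < \<top>" using net_dist_le_path by (meson ennreal_less_top le_less_trans)
qed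

lemma reach_refl: "u \<in> verts G \<Longrightarrow> reach G u u" unfolding reach_def by (intro exI[of _ "[u]"]) simp

lemma reach_step:
 assumes "reach G u v" "w \<in> verts G" "wgt G v w \<noteq> 0"
 shows "reach G u w"
proof -
 obtain p where p: "is_path G u v p" using assms(1) unfolding reach_def by blast
 then have "is_path G u w (p @ [w])" using assms is_path_props[OF p] by (simp add: is_path_snoc)
 then show ?thesis unfolding reach_def by blast
qed

lemma reach_trans:
 assumes "reach G u v" "reach G v w"
 shows "reach G u w"
proof -
 obtain p where "is_path G v w p" using assms(2) unfolding reach_def by blast
 then show ?thesis by (induction rule: path_induct) (use assms(1) reach_step in blast)+
qed

lemma reach_sym:
 assumes G: "is_network G" and "reach G u v"
 shows "reach G v u"
proof -
 obtain p where "is_path G u v p" using assms(2) unfolding reach_def by blast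
 then show ?thesis
 proof (induction rule: path_induct)
  case (snoc w p x)
  have w: "w \<in> verts G" using is_path_props[OF snoc(1)] by simp
  then have "wgt G x w \<noteq> 0" using cmod_wgt_sym[OF G w snoc(4)] snoc(5) by auto
  then have "reach G x w" using reach_step[OF reach_refl[OF snoc(4)] w] by simp
  then show ?case using snoc.IH reach_trans by blast
 qed (rule reach_refl)
qed

section \<open>Components, and transport of paths and balls along embeddings\<close>

lemma verts_component: "verts (component G v) = {u \<in> verts G. reach G v u}" by (auto simp: component_def induced_def net_dist_finite)

lemma wgt_component [simp]: "wgt (component G v) = wgt G" by (simp add: component_def induced_def)

lemma is_rooted_component:
 assumes G: "is_network G" and v: "v \<in> verts G"
 shows "is_rooted (Rooted (component G v) v)"
proof -
 have net: "is_network (component G v)" unfolding is_network_def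
 proof (intro conjI ballI)
  fix u w assume "u \<in> verts (component G v)" "w \<in> verts (component G v)"
  then show "wgt (component G v) u w = cnj (wgt (component G v) w u)" using G unfolding is_network_def wgt_component verts_component by blast
 next
  fix u assume "u \<in> verts (component G v)"
  then have "(\<lambda>w. (cmod (wgt G u w))\<^sup>2) summable_on verts G" using G unfolding is_network_def verts_component by blast
  then show "(\<lambda>w. (cmod (wgt (component G v) u w))\<^sup>2) summable_on verts (component G v)"
   by (simp add: verts_component) (rule summable_on_subset_banach, auto)
 qed
 have r: "reach (component G v) v u" if r0: "reach G v u" for u
 proof -
  obtain p where "is_path G v u p" using r0 unfolding reach_def by blast
  then show ?thesis
  proof (induction rule: path_induct)
   case single
   then show ?case by (intro reach_refl) (simp add: verts_component reach_refl)
  next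
   case (snoc w p x)
   then have "reach G v x" using reach_step unfolding reach_def by blast
   then show ?case using snoc by (intro reach_step[OF snoc.IH]) (auto simp: verts_component)
  qed
 qed
 have "net_connected (component G v)" unfolding net_connected_def net_dist_finite
 proof (intro ballI)
  fix u w assume "u \<in> verts (component G v)" "w \<in> verts (component G v)"
  then have "reach (component G v) v u" "reach (component G v) v w" using r by (auto simp: verts_component)
  then show "reach (component G v) u w" using reach_trans[OF reach_sym[OF net]] by blast
 qed
 then show ?thesis using net v by (simp add: is_rooted_def verts_component reach_refl)
qed

lemma embeds_component:
 assumes "v \<in> verts G"
 shows "embeds id (component G v) G" unfolding embeds_def by (auto simp: verts_component intro: reach_step)

lemma embeds_iso:
 assumes "rooted_iso R S"
 obtains \<sigma> where "embeds \<sigma> (net R) (net S)" "\<sigma> (base R) = base S"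
proof -
 obtain \<sigma> where \<sigma>: "bij_betw \<sigma> (verts (net R)) (verts (net S))" "\<sigma> (base R) = base S"
  "\<forall>u\<in>verts (net R). \<forall>v\<in>verts (net R). wgt (net S) (\<sigma> u) (\<sigma> v) = wgt (net R) u v" using assms unfolding rooted_iso_def by blast
 have "embeds \<sigma> (net R) (net S)" unfolding embeds_def using \<sigma> by (auto simp: bij_betw_def)
 with \<sigma>(2) show thesis by (rule that[rotated])
qed

lemma embeds_trans:
 assumes "embeds \<sigma> G H" "embeds \<tau> H K"
 shows "embeds (\<tau> \<circ> \<sigma>) G K" unfolding embeds_def
proof (intro conjI ballI impI)
 show "inj_on (\<tau> \<circ> \<sigma>) (verts G)" using assms unfolding embeds_def by (meson comp_inj_on inj_on_subset)
 show "(\<tau> \<circ> \<sigma>) ` verts G \<subseteq> verts K" using assms unfolding embeds_def by auto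
 fix u assume u: "u \<in> verts G"
 then have su: "\<sigma> u \<in> verts H" using assms unfolding embeds_def by auto
 { fix v assume v: "v \<in> verts G"
  then have "\<sigma> v \<in> verts H" using assms unfolding embeds_def by auto
  then show "wgt K ((\<tau> \<circ> \<sigma>) u) ((\<tau> \<circ> \<sigma>) v) = wgt G u v" using assms u v su unfolding embeds_def by simp }
 fix w assume w: "w \<in> verts K" "wgt K ((\<tau> \<circ> \<sigma>) u) w \<noteq> 0"
 then obtain x where x: "x \<in> verts H" "w = \<tau> x" using assms(2) su unfolding embeds_def o_def by blast
 then have "wgt H (\<sigma> u) x \<noteq> 0" using w su assms(2) unfolding embeds_def by auto
 then have "x \<in> \<sigma> ` verts G" using assms(1) u x unfolding embeds_def by auto
 then show "w \<in> (\<tau> \<circ> \<sigma>) ` verts G" using x by auto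
qed

lemma embeds_verts: "embeds \<sigma> G H \<Longrightarrow> u \<in> verts G \<Longrightarrow> \<sigma> u \<in> verts H" unfolding embeds_def by auto
lemma embeds_wgt: "embeds \<sigma> G H \<Longrightarrow> u \<in> verts G \<Longrightarrow> v \<in> verts G \<Longrightarrow> wgt H (\<sigma> u) (\<sigma> v) = wgt G u v" unfolding embeds_def by auto

lemma embeds_path:
 assumes e: "embeds \<sigma> G H" and "is_path G u v p"
 shows "is_path H (\<sigma> u) (\<sigma> v) (map \<sigma> p) \<and> psum H (map \<sigma> p) = psum G p" using assms(2)
proof (induction rule: path_induct)
 case single
 then show ?case using e by (simp add: embeds_verts)
next
 case (snoc w p x)
 have w: "w \<in> verts G" using is_path_props[OF snoc(1)] by simp
 show ?case using snoc w embeds_verts[OF e] embeds_wgt[OF e w] by (simp add: is_path_snoc psum_snoc last_map)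
qed

text \<open>No edge leaves the image, so a path that starts in it can be lifted vertex by
  vertex.\<close>

lemma embeds_path_lift:
 assumes e: "embeds \<sigma> G H" and u: "u \<in> verts G" and "is_path H (\<sigma> u) w q"
 shows "\<exists>v p. v \<in> verts G \<and> w = \<sigma> v \<and> q = map \<sigma> p \<and> is_path G u v p" using assms(3)
proof (induction rule: path_induct)
 case single
 then show ?case using u by (intro exI[of _ u] exI[of _ "[u]"]) simp
next
 case (snoc w q x)
 then obtain v p where vp: "v \<in> verts G" "w = \<sigma> v" "q = map \<sigma> p" "is_path G u v p" by blast
 then have "x \<in> \<sigma> ` verts G" using snoc e unfolding embeds_def by blast
 then obtain y where y: "y \<in> verts G" "x = \<sigma> y" by blast
 then have "wgt G v y \<noteq> 0" using snoc vp embeds_wgt[OF e vp(1) y(1)] by simp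
 then have "is_path G u y (p @ [y])" using vp y is_path_props[OF vp(4)] by (simp add: is_path_snoc)
 then show ?case using y vp by (intro exI[of _ y] exI[of _ "p @ [y]"]) simp
qed

lemma embeds_net_dist:
 assumes e: "embeds \<sigma> G H" and "u \<in> verts G" "v \<in> verts G"
 shows "net_dist H (\<sigma> u) (\<sigma> v) = net_dist G u v"
proof (rule antisym)
 show "net_dist H (\<sigma> u) (\<sigma> v) \<le> net_dist G u v" unfolding net_dist_def[of G]
 proof (rule INF_greatest)
  fix p assume "p \<in> {p. is_path G u v p}"
  then show "net_dist H (\<sigma> u) (\<sigma> v) \<le> ennreal (path_length G p)"
   using net_dist_le_path[of H "\<sigma> u" "\<sigma> v" "map \<sigma> p"] embeds_path[OF e] by (simp add: path_length_eq)
 qed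
 show "net_dist G u v \<le> net_dist H (\<sigma> u) (\<sigma> v)" unfolding net_dist_def[of H]
 proof (rule INF_greatest)
  fix q assume "q \<in> {q. is_path H (\<sigma> u) (\<sigma> v) q}"
  then obtain w p where "w \<in> verts G" "\<sigma> v = \<sigma> w" "q = map \<sigma> p" "is_path G u w p" using embeds_path_lift[OF e assms(2)] by blast
  moreover then have "w = v" using e assms(3) unfolding embeds_def by (metis inj_onD)
  ultimately show "net_dist G u v \<le> ennreal (path_length H q)"
   using net_dist_le_path[of G u v p] embeds_path[OF e, of u v p] by (simp add: path_length_eq)
 qed
qed

definition bl :: "network \<Rightarrow> nat \<Rightarrow> real \<Rightarrow> nat set" where
 "bl G v t = {u \<in> verts G. net_dist G v u \<le> ennreal t}"

lemma verts_rooted_ball: "verts (net (rooted_ball R t)) = bl (net R) (base R) t" by (auto simp: rooted_ball_def induced_def bl_def)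

lemma embeds_bl:
 assumes e: "embeds \<sigma> G H" and u: "u \<in> verts G"
 shows "bl H (\<sigma> u) t = \<sigma> ` bl G u t"
proof (intro set_eqI iffI)
 fix w assume w: "w \<in> bl H (\<sigma> u) t"
 then have "net_dist H (\<sigma> u) w < \<top>" unfolding bl_def by (auto intro: le_less_trans)
 then obtain q where "is_path H (\<sigma> u) w q" unfolding net_dist_finite reach_def by blast
 then obtain v where "v \<in> verts G" "w = \<sigma> v" using embeds_path_lift[OF e u] by blast
 then show "w \<in> \<sigma> ` bl G u t" using w embeds_net_dist[OF e u] by (auto simp: bl_def)
next
 fix w assume "w \<in> \<sigma> ` bl G u t"
 then show "w \<in> bl H (\<sigma> u) t" using embeds_net_dist[OF e u] embeds_verts[OF e] by (auto simp: bl_def)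
qed

text \<open>\<open>close_at\<close> with the matching as a parameter, and for networks that need not
  be representatives of classes.\<close>

definition close_via :: "network \<Rightarrow> nat \<Rightarrow> network \<Rightarrow> nat \<Rightarrow> real \<Rightarrow> (nat \<Rightarrow> nat) \<Rightarrow> bool" where
 "close_via G u H v t \<sigma> \<longleftrightarrow> bij_betw \<sigma> (bl G u t) (bl H v t) \<and> \<sigma> u = v \<and>
   (\<forall>x\<in>bl G u t. \<forall>y\<in>bl G u t. cmod (wgt H (\<sigma> x) (\<sigma> y) - wgt G x y) \<le> 1 / t)"

lemma close_at_iff: "close_at R S t \<longleftrightarrow> (\<exists>\<sigma>. close_via (net R) (base R) (net S) (base S) t \<sigma>)" unfolding close_at_def close_via_def verts_rooted_ball ..

text \<open>The matching is conjugated by the embeddings, which map balls onto balls. Closeness of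
  two classes may thus be checked on any networks that contain the components.\<close>

lemma close_via_embeds:
 assumes e: "embeds \<tau> G' G" "embeds \<rho> H' H" and u: "u \<in> verts G'" and v: "v \<in> verts H'"
  and c: "close_via G (\<tau> u) H (\<rho> v) t \<sigma>" and t: "0 \<le> t"
 shows "\<exists>\<sigma>'. close_via G' u H' v t \<sigma>'"
proof -
 define \<rho>' where "\<rho>' = inv_into (verts H') \<rho>"
 have inv: "\<rho>' (\<rho> x) = x" if "x \<in> verts H'" for x using that e(2) by (simp add: \<rho>'_def embeds_def inv_into_f_f)
 have bG: "bl G (\<tau> u) t = \<tau> ` bl G' u t" and bH: "bl H (\<rho> v) t = \<rho> ` bl H' v t" using embeds_bl e u v by auto
 have sub: "bl G' u t \<subseteq> verts G'" "bl H' v t \<subseteq> verts H'" by (auto simp: bl_def)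
 have "bij_betw \<tau> (bl G' u t) (bl G (\<tau> u) t)" unfolding bG using e(1) sub by (auto simp: embeds_def intro: inj_on_imp_bij_betw inj_on_subset)
 moreover have "bij_betw \<sigma> (bl G (\<tau> u) t) (bl H (\<rho> v) t)" using c by (simp add: close_via_def)
 moreover have "bij_betw \<rho>' (bl H (\<rho> v) t) (bl H' v t)" unfolding bH by (rule bij_betw_byWitness[where f'=\<rho>]) (use inv sub in \<open>auto simp: subset_iff\<close>)
 ultimately have bij: "bij_betw (\<rho>' \<circ> (\<sigma> \<circ> \<tau>)) (bl G' u t) (bl H' v t)" by (intro bij_betw_trans)
 have im: "\<exists>z\<in>bl H' v t. \<sigma> (\<tau> x) = \<rho> z" if "x \<in> bl G' u t" for x using c that bG bH unfolding close_via_def bij_betw_def by blast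
 have "\<sigma> (\<tau> u) = \<rho> v" using c by (simp add: close_via_def)
 then have base: "(\<rho>' \<circ> (\<sigma> \<circ> \<tau>)) u = v" using inv v by simp
 have w: "cmod (wgt H' ((\<rho>' \<circ> (\<sigma> \<circ> \<tau>)) x) ((\<rho>' \<circ> (\<sigma> \<circ> \<tau>)) y) - wgt G' x y) \<le> 1 / t"
  if x: "x \<in> bl G' u t" and y: "y \<in> bl G' u t" for x y
 proof -
  obtain x' where x': "x' \<in> bl H' v t" "\<sigma> (\<tau> x) = \<rho> x'" using im[OF x] by blast
  obtain y' where y': "y' \<in> bl H' v t" "\<sigma> (\<tau> y) = \<rho> y'" using im[OF y] by blast
  have "cmod (wgt H (\<sigma> (\<tau> x)) (\<sigma> (\<tau> y)) - wgt G (\<tau> x) (\<tau> y)) \<le> 1 / t" using c x y bG unfolding close_via_def by blast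
  then show ?thesis using x y x' y' sub inv embeds_wgt[OF e(1)] embeds_wgt[OF e(2)] by (simp add: subset_iff)
 qed
 show ?thesis using bij base w unfolding close_via_def by blast
qed

section \<open>Isomorphism classes, their representatives and the distance\<close>

abbreviation nt :: "gstar \<Rightarrow> network" where "nt g \<equiv> net (rep_gstar g)"
abbreviation rt :: "gstar \<Rightarrow> nat" where "rt g \<equiv> base (rep_gstar g)"

abbreviation rspec :: "real \<Rightarrow> real \<Rightarrow> gstar \<Rightarrow> real measure" where
 "rspec d \<theta> g \<equiv> spectral_measure (tr d \<theta> (nt g)) (rt g)"
abbreviation rst :: "complex \<Rightarrow> real \<Rightarrow> real \<Rightarrow> gstar \<Rightarrow> complex" where "rst z d \<theta> g \<equiv> st z d \<theta> (nt g) (rt g)"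
abbreviation rdeg :: "real \<Rightarrow> gstar \<Rightarrow> real" where "rdeg d g \<equiv> degd d (nt g) (rt g)"
abbreviation mean_tr :: "real \<Rightarrow> gstar measure \<Rightarrow> real measure" where
 "mean_tr \<theta> \<rho> \<equiv> mean_spectral_measure (truncate_law \<theta> \<rho>)"

lemma is_rooted_rep: "is_rooted (rep_gstar g)" using Quotient3_rep_reflp[OF Quotient3_gstar, of g] by (simp add: rooted_iso_def)

lemma rep_network: "is_network (nt g)" and rep_root: "rt g \<in> verts (nt g)"
 and rep_reach: "v \<in> verts (nt g) \<Longrightarrow> reach (nt g) (rt g) v" using is_rooted_rep[of g] by (auto simp: is_rooted_def net_connected_def net_dist_finite)

text \<open>The representative of a class is an unspecified network; this embedding carries the
  invariants of \<open>G\<close> at v over to it.\<close>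

lemma rep_component:
 assumes "is_network G" "v \<in> verts G"
 obtains \<sigma> where "embeds \<sigma> (nt (rooted_component G v)) G" "\<sigma> (rt (rooted_component G v)) = v"
proof -
 have r: "is_rooted (Rooted (component G v) v)" by (rule is_rooted_component[OF assms])
 then have "rooted_iso (rep_gstar (rooted_component G v)) (Rooted (component G v) v)"
  unfolding rooted_component_def using Quotient3_rep_abs[OF Quotient3_gstar] rooted_iso_refl by blast
 then obtain \<sigma> where \<sigma>: "embeds \<sigma> (nt (rooted_component G v)) (component G v)" "\<sigma> (rt (rooted_component G v)) = v" by (rule embeds_iso) simp
 have "embeds (id \<circ> \<sigma>) (nt (rooted_component G v)) G" by (rule embeds_trans[OF \<sigma>(1) embeds_component[OF assms(2)]])
 with \<sigma>(2) show thesis by (intro that[of \<sigma>]) auto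
qed

lemma d_loc_nonneg: "0 \<le> d_loc g h" by (simp add: d_loc_def)

lemma d_loc_le:
 assumes "close_at (rep_gstar g) (rep_gstar h) t" "0 < t"
 shows "d_loc g h \<le> 1 / (1 + t)"
proof -
 define T where "T = (SUP t\<in>{t. 0 < t \<and> close_at (rep_gstar g) (rep_gstar h) t}. ennreal t)"
 have "ennreal t \<le> T" unfolding T_def by (rule SUP_upper) (use assms in auto)
 have "enn2real (1 / (1 + T)) \<le> 1 / (1 + t)"
 proof (cases T)
  case (real r)
  then have "t \<le> r" using \<open>ennreal t \<le> T\<close> assms(2) by simp
  have "1 / (1 + T) = ennreal (1 / (1 + r))" using real by (simp add: divide_ennreal flip: ennreal_1 ennreal_plus)
  moreover have "1 / (1 + r) \<le> 1 / (1 + t)" using \<open>t \<le> r\<close> assms(2) by (intro divide_left_mono) auto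
  ultimately show ?thesis using real by simp
 qed (use assms(2) in simp)
 then show ?thesis unfolding d_loc_def T_def .
qed

text \<open>What is obtained is some radius s > t, and not t itself: a matching with inexact weights
  need not map smaller balls onto each other, so closeness at s is not inherited by smaller
  radii.\<close>

lemma d_loc_lessD:
 assumes "d_loc g h < 1 / (1 + t)" "0 \<le> t"
 obtains s where "t < s" "close_at (rep_gstar g) (rep_gstar h) s"
proof -
 define T where "T = (SUP t\<in>{t. 0 < t \<and> close_at (rep_gstar g) (rep_gstar h) t}. ennreal t)"
 have "ennreal t < T"
 proof (rule ccontr)
  assume "\<not> ennreal t < T"
  then have le: "T \<le> ennreal t" by simp
  then obtain r where r: "T = ennreal r" "0 \<le> r" by (cases T) (auto simp: top_unique)
  then have "r \<le> t" using le assms(2) by simp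
  have "1 / (1 + T) = ennreal (1 / (1 + r))" using r by (simp add: divide_ennreal flip: ennreal_1 ennreal_plus)
  then have "d_loc g h = 1 / (1 + r)" unfolding d_loc_def T_def[symmetric] using r by simp
  moreover have "1 / (1 + t) \<le> 1 / (1 + r)" using \<open>r \<le> t\<close> r(2) by (intro divide_left_mono) auto
  ultimately show False using assms by linarith
 qed
 then obtain s where "0 < s" "close_at (rep_gstar g) (rep_gstar h) s" "ennreal t < ennreal s" unfolding T_def less_SUP_iff by blast
 then show thesis using that assms(2) by (simp add: ennreal_less_iff)
qed

lemma net_conv_path_lift:
 assumes vert: "\<And>u. u \<in> verts G \<Longrightarrow> \<forall>\<^sub>F i in F. \<sigma> i u \<in> verts (H i)"
  and wgt: "\<And>u v. u \<in> verts G \<Longrightarrow> v \<in> verts G \<Longrightarrow> ((\<lambda>i. wgt (H i) (\<sigma> i u) (\<sigma> i v)) \<longlongrightarrow> wgt G u v) F"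
  and "is_path G u v p"
 shows "(\<forall>\<^sub>F i in F. is_path (H i) (\<sigma> i u) (\<sigma> i v) (map (\<sigma> i) p)) \<and> ((\<lambda>i. psum (H i) (map (\<sigma> i) p)) \<longlongrightarrow> psum G p) F" using assms(3)
proof (induction rule: path_induct)
 case single
 then show ?case using vert by simp
next
 case (snoc w p x)
 have w: "w \<in> verts G" using is_path_props[OF snoc(1)] by simp
 have t: "((\<lambda>i. wgt (H i) (\<sigma> i w) (\<sigma> i x)) \<longlongrightarrow> wgt G w x) F" using wgt w snoc by blast
 have "\<forall>\<^sub>F i in F. is_path (H i) (\<sigma> i u) (\<sigma> i w) (map (\<sigma> i) p)" using snoc by blast
 then have "\<forall>\<^sub>F i in F. is_path (H i) (\<sigma> i u) (\<sigma> i x) (map (\<sigma> i) (p @ [x]))" using vert[OF snoc(4)] tendsto_imp_eventually_ne[OF t snoc(5)]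
  by eventually_elim (use snoc in \<open>auto simp: is_path_snoc last_map\<close>)
 moreover have "((\<lambda>i. psum (H i) (map (\<sigma> i) p) + 1 / (cmod (wgt (H i) (\<sigma> i w) (\<sigma> i x)))\<^sup>2) \<longlongrightarrow> psum G p + 1 / (cmod (wgt G w x))\<^sup>2) F"
  using snoc by (intro tendsto_intros t) auto
 then have "((\<lambda>i. psum (H i) (map (\<sigma> i) (p @ [x]))) \<longlongrightarrow> psum G (p @ [x])) F" using snoc by (simp add: psum_snoc last_map)
 ultimately show ?case by blast
qed

text \<open>One path of length below c is a finite object whose weights converge, so the strict
  bound persists. Stated from two clauses of \<open>net_conv\<close> because
  \<open>cfil_net_conv\<close> uses it to establish another one.\<close>

lemma net_conv_dist:
 assumes vert: "\<And>u. u \<in> verts G \<Longrightarrow> \<forall>\<^sub>F i in F. \<sigma> i u \<in> verts (H i)"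
  and wgt: "\<And>u v. u \<in> verts G \<Longrightarrow> v \<in> verts G \<Longrightarrow> ((\<lambda>i. wgt (H i) (\<sigma> i u) (\<sigma> i v)) \<longlongrightarrow> wgt G u v) F"
  and d: "net_dist G u v < ennreal c"
 shows "\<forall>\<^sub>F i in F. net_dist (H i) (\<sigma> i u) (\<sigma> i v) < ennreal c"
proof -
 obtain p where p: "is_path G u v p" "path_length G p < c" using d by (rule net_dist_lessD)
 note l = net_conv_path_lift[OF vert wgt p(1)]
 have "((\<lambda>i. path_length (H i) (map (\<sigma> i) p)) \<longlongrightarrow> path_length G p) F" unfolding path_length_eq by (intro tendsto_real_sqrt) (use l in blast)
 then have "\<forall>\<^sub>F i in F. path_length (H i) (map (\<sigma> i) p) < c" using p(2) by (rule order_tendstoD)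
 moreover have "\<forall>\<^sub>F i in F. is_path (H i) (\<sigma> i u) (\<sigma> i v) (map (\<sigma> i) p)" using l by blast
 ultimately show ?thesis
 proof eventually_elim
  case (elim i)
  have "ennreal (path_length (H i) (map (\<sigma> i) p)) < ennreal c" using elim(1) by (subst ennreal_less_iff) (auto simp: path_length_eq psum_nonneg)
  then show ?case using net_dist_le_path[OF elim(2)] by (rule le_less_trans[rotated])
 qed
qed

text \<open>The filter of the pairs \<open>(h, \<sigma>)\<close> such that \<open>\<sigma>\<close> matches large balls of \<open>g\<close> and \<open>h\<close>. The matching
 has to be part of the index: at distance 0 a single matching need not work for all radii.\<close>

definition cset :: "gstar \<Rightarrow> real \<Rightarrow> (gstar \<times> (nat \<Rightarrow> nat)) set" where
 "cset g t = {(h, \<sigma>). \<exists>s\<ge>t. close_via (nt g) (rt g) (nt h) (rt h) s \<sigma>}"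

definition cfil :: "gstar \<Rightarrow> (gstar \<times> (nat \<Rightarrow> nat)) filter" where
 "cfil g = (INF t\<in>{0<..}. principal (cset g t))"

lemma eventually_cfil: "eventually P (cfil g) \<longleftrightarrow> (\<exists>t>0. \<forall>x\<in>cset g t. P x)"
proof -
 have "eventually P (cfil g) \<longleftrightarrow> (\<exists>t\<in>{0<..}. eventually P (principal (cset g t)))" unfolding cfil_def
 proof (rule eventually_INF_base)
  fix a b :: real assume "a \<in> {0<..}" "b \<in> {0<..}"
  then show "\<exists>x\<in>{0<..}. principal (cset g x) \<le> inf (principal (cset g a)) (principal (cset g b))"
   by (intro bexI[of _ "max a b"]) (auto simp: cset_def)
 qed auto
 then show ?thesis by (auto simp: eventually_principal)
qed

lemma eventually_cset: "0 < t \<Longrightarrow> \<forall>\<^sub>F x in cfil g. x \<in> cset g t" unfolding eventually_cfil by blast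

text \<open>Every class at distance less than 1/(1 + t) has a matching that puts it into
  \<open>cset g t\<close>, so what holds along the filter holds on a ball.\<close>

lemma eventually_cfil_d_loc:
 assumes "eventually (\<lambda>x. P (fst x)) (cfil g)"
 shows "\<exists>r>0. \<forall>h. d_loc g h < r \<longrightarrow> P h"
proof -
 obtain t where t: "0 < t" "\<And>x. x \<in> cset g t \<Longrightarrow> P (fst x)" using assms unfolding eventually_cfil by blast
 show ?thesis
 proof (intro exI[of _ "1 / (1 + t)"] conjI allI impI)
  fix h assume "d_loc g h < 1 / (1 + t)"
  then obtain s where s: "t < s" "close_at (rep_gstar g) (rep_gstar h) s" by (rule d_loc_lessD) (use t in auto)
  then obtain \<sigma> where "close_via (nt g) (rt g) (nt h) (rt h) s \<sigma>" unfolding close_at_iff by blast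
  then have "(h, \<sigma>) \<in> cset g t" using s by (auto simp: cset_def intro: less_imp_le)
  then show "P h" using t(2) by force
 qed (use t in simp)
qed

lemma open_gstarI:
 assumes "\<And>g. g \<in> U \<Longrightarrow> \<forall>\<^sub>F x in cfil g. fst x \<in> U"
 shows "open (U :: gstar set)" unfolding open_gstar_def
proof
 fix g assume "g \<in> U"
 from eventually_cfil_d_loc[OF assms[OF this]] show "\<exists>r>0. \<forall>h. d_loc g h < r \<longrightarrow> h \<in> U" .
qed

lemma continuous_gstarI:
 fixes f :: "gstar \<Rightarrow> 'b::topological_space"
 assumes "\<And>g. ((\<lambda>x. f (fst x)) \<longlongrightarrow> f g) (cfil g)"
 shows "continuous_on UNIV f"
proof (subst continuous_on_open_vimage, simp, intro allI impI)
 fix V :: "'b set" assume "open V"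
 have "open (f -` V)"
 proof (rule open_gstarI)
  fix g assume "g \<in> f -` V"
  then show "\<forall>\<^sub>F x in cfil g. fst x \<in> f -` V" using topological_tendstoD[OF assms \<open>open V\<close>] by simp
 qed
 then show "open (f -` V \<inter> UNIV)" by simp
qed

lemma cfil_root: "\<forall>\<^sub>F x in cfil g. snd x (rt g) = rt (fst x)"
 using eventually_cset[OF zero_less_one, of g] by eventually_elim (auto simp: cset_def close_via_def)

lemma eventually_in_bl:
 assumes "u \<in> verts (nt g)"
 shows "\<exists>t>0. \<forall>s\<ge>t. u \<in> bl (nt g) (rt g) s"
proof -
 have "net_dist (nt g) (rt g) u < \<top>" unfolding net_dist_finite by (rule rep_reach[OF assms])
 then obtain r where r: "net_dist (nt g) (rt g) u = ennreal r" "0 \<le> r" by (cases "net_dist (nt g) (rt g) u") auto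
 show ?thesis by (rule exI[of _ "r + 1"]) (use r assms in \<open>auto simp: bl_def intro!: ennreal_leI\<close>)
qed

text \<open>Fixed vertices eventually lie in the matched balls, where weights differ by at most 1/s.
  The last clause rests on the form of the distance: an edge of weight at least d adds at most 1/d^2
  to the squared length, so the large neighbours of a fixed vertex stay at bounded distance from the
  root and are matched too.\<close>

lemma cfil_net_conv: "net_conv (cfil g) (nt g) (\<lambda>x. nt (fst x)) snd"
proof -
 have vert: "\<forall>\<^sub>F x in cfil g. snd x u \<in> verts (nt (fst x))" if u: "u \<in> verts (nt g)" for u
 proof -
  obtain t where t: "t > 0" "\<And>s. t \<le> s \<Longrightarrow> u \<in> bl (nt g) (rt g) s" using eventually_in_bl[OF u] by blast
  show ?thesis using eventually_cset[OF t(1)]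
  proof eventually_elim
   case (elim x)
   then obtain s where s: "t \<le> s" "close_via (nt g) (rt g) (nt (fst x)) (rt (fst x)) s (snd x)" by (auto simp: cset_def)
   then have "snd x u \<in> bl (nt (fst x)) (rt (fst x)) s" using t(2)[OF s(1)] unfolding close_via_def by (metis bij_betwE)
   then show ?case by (simp add: bl_def)
  qed
 qed
 have wgt: "((\<lambda>x. wgt (nt (fst x)) (snd x u) (snd x v)) \<longlongrightarrow> wgt (nt g) u v) (cfil g)"
  if u: "u \<in> verts (nt g)" and v: "v \<in> verts (nt g)" for u v
 proof (rule tendstoI)
  fix e :: real assume e: "e > 0"
  obtain t where t: "t > 0" "\<And>s. t \<le> s \<Longrightarrow> u \<in> bl (nt g) (rt g) s" using eventually_in_bl[OF u] by blast
  obtain t' where t': "t' > 0" "\<And>s. t' \<le> s \<Longrightarrow> v \<in> bl (nt g) (rt g) s" using eventually_in_bl[OF v] by blast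
  have "0 < max t (max t' (2 / e))" using t by simp
  from eventually_cset[OF this] show "\<forall>\<^sub>F x in cfil g. dist (wgt (nt (fst x)) (snd x u) (snd x v)) (wgt (nt g) u v) < e"
  proof eventually_elim
   case (elim x)
   then obtain s where s: "max t (max t' (2 / e)) \<le> s" "close_via (nt g) (rt g) (nt (fst x)) (rt (fst x)) s (snd x)" by (auto simp: cset_def)
   then have "cmod (wgt (nt (fst x)) (snd x u) (snd x v) - wgt (nt g) u v) \<le> 1 / s" using t(2)[of s] t'(2)[of s] unfolding close_via_def by auto
   also have "1 / s < e"
   proof -
    have "2 / e \<le> s" "0 < s" using s(1) t(1) by auto
    then show ?thesis using e by (simp add: field_simps)
   qed
   finally show ?case by (simp add: dist_norm)
  qed
 qed
 have inj: "\<forall>\<^sub>F x in cfil g. snd x u \<noteq> snd x v" if u: "u \<in> verts (nt g)" and v: "v \<in> verts (nt g)" and uv: "u \<noteq> v" for u v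
 proof -
  obtain t where t: "t > 0" "\<And>s. t \<le> s \<Longrightarrow> u \<in> bl (nt g) (rt g) s" using eventually_in_bl[OF u] by blast
  obtain t' where t': "t' > 0" "\<And>s. t' \<le> s \<Longrightarrow> v \<in> bl (nt g) (rt g) s" using eventually_in_bl[OF v] by blast
  have "0 < max t t'" using t by simp
  from eventually_cset[OF this] show ?thesis
  proof eventually_elim
   case (elim x)
   then obtain s where s: "max t t' \<le> s" "close_via (nt g) (rt g) (nt (fst x)) (rt (fst x)) s (snd x)" by (auto simp: cset_def)
   then have "inj_on (snd x) (bl (nt g) (rt g) s)" by (simp add: close_via_def bij_betw_def)
   then show ?case using t(2)[of s] t'(2)[of s] s(1) uv by (auto dest: inj_onD)
  qed
 qed
 have large: "\<forall>\<^sub>F x in cfil g. \<forall>w\<in>verts (nt (fst x)). d \<le> cmod (wgt (nt (fst x)) (snd x u) w) \<longrightarrow>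
    (\<exists>v\<in>verts (nt g). w = snd x v \<and> d / 2 \<le> cmod (wgt (nt g) u v))"
  if u: "u \<in> verts (nt g)" and d: "0 < d" for u d
 proof -
  have "net_dist (nt g) (rt g) u < \<top>" unfolding net_dist_finite by (rule rep_reach[OF u])
  then obtain r where r: "net_dist (nt g) (rt g) u = ennreal r" "0 \<le> r" by (cases "net_dist (nt g) (rt g) u") auto
  have "net_dist (nt g) (rt g) u < ennreal (r + 1)" using r by (simp add: ennreal_less_iff)
  from net_conv_dist[where F="cfil g" and H="\<lambda>x. nt (fst x)" and \<sigma>=snd, OF vert wgt this]
  have ev: "\<forall>\<^sub>F x in cfil g. net_dist (nt (fst x)) (snd x (rt g)) (snd x u) < ennreal (r + 1)" .
  \<comment> \<open>Bounds the distance to a neighbour reached over an edge of weight at least d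
    from a vertex at distance below r + 1.\<close>
  define c where "c = sqrt ((r + 1)\<^sup>2 + 1 / d\<^sup>2)"
  obtain t where t: "t > 0" "\<And>s. t \<le> s \<Longrightarrow> u \<in> bl (nt g) (rt g) s" using eventually_in_bl[OF u] by blast
  have "0 < max t (max c (2 / d))" using t by simp
  from eventually_cset[OF this] ev cfil_root show ?thesis
  proof eventually_elim
   case (elim x)
   obtain s where s: "max t (max c (2 / d)) \<le> s" "close_via (nt g) (rt g) (nt (fst x)) (rt (fst x)) s (snd x)" using elim(1) by (auto simp: cset_def)
   show ?case
   proof (intro ballI impI)
    fix w assume w: "w \<in> verts (nt (fst x))" "d \<le> cmod (wgt (nt (fst x)) (snd x u) w)"
    obtain p where p: "is_path (nt (fst x)) (rt (fst x)) (snd x u) p" "path_length (nt (fst x)) p < r + 1"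
     using elim(2) unfolding elim(3) by (rule net_dist_lessD)
    have "wgt (nt (fst x)) (snd x u) w \<noteq> 0" using w(2) d by auto
    then have p': "is_path (nt (fst x)) (rt (fst x)) w (p @ [w])" using p(1) w(1) is_path_props[OF p(1)] by (simp add: is_path_snoc)
    have "psum (nt (fst x)) p \<le> (r + 1)\<^sup>2"
     using p(2) unfolding path_length_eq by (metis less_eq_real_def real_le_lsqrt real_sqrt_le_iff real_sqrt_unique psum_nonneg sqrt_le_D)
    moreover have "1 / (cmod (wgt (nt (fst x)) (snd x u) w))\<^sup>2 \<le> 1 / d\<^sup>2" using w(2) d by (intro frac_le power_mono) auto
    ultimately have "path_length (nt (fst x)) (p @ [w]) \<le> c"
     using is_path_props[OF p(1)] unfolding path_length_eq c_def by (intro real_sqrt_le_mono) (simp add: psum_snoc)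
    then have "net_dist (nt (fst x)) (rt (fst x)) w \<le> ennreal s" using net_dist_le_path[OF p'] s(1) by (elim order_trans) (auto intro!: ennreal_leI)
    then have "w \<in> bl (nt (fst x)) (rt (fst x)) s" using w(1) by (simp add: bl_def)
    then obtain v where v: "v \<in> bl (nt g) (rt g) s" "w = snd x v" using s(2) unfolding close_via_def bij_betw_def by blast
    have "u \<in> bl (nt g) (rt g) s" using t(2)[of s] s(1) by simp
    then have le: "cmod (wgt (nt (fst x)) (snd x u) (snd x v) - wgt (nt g) u v) \<le> 1 / s" using s(2) v(1) unfolding close_via_def by blast
    \<comment> \<open>The radius was taken at least 2/d, so an error of 1/s leaves at least half of
      the weight d.\<close>
    have "1 / s \<le> d / 2"
    proof -
     have "2 / d \<le> s" "0 < s" using s(1) t(1) by auto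
     then show ?thesis using d by (simp add: field_simps)
    qed
    moreover have "cmod (wgt (nt (fst x)) (snd x u) (snd x v)) \<le> cmod (wgt (nt g) u v) + cmod (wgt (nt (fst x)) (snd x u) (snd x v) - wgt (nt g) u v)"
     by (rule norm_triangle_sub)
    ultimately have "d / 2 \<le> cmod (wgt (nt g) u v)" using le w(2) unfolding v(2) by linarith
    then show "\<exists>v\<in>verts (nt g). w = snd x v \<and> d / 2 \<le> cmod (wgt (nt g) u v)" using v by (auto simp: bl_def)
   qed
  qed
 qed
 show ?thesis unfolding net_conv_def using vert inj wgt large by blast
qed

text \<open>A radius that is attained as a distance from the root would not be stable under the limit.\<close>

lemma net_conv_close:
 assumes G: "is_network G" and o: "v0 \<in> verts G" and conv: "net_conv F G H \<sigma>" and t: "0 < t"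
  and fin: "finite (bl G v0 t)" and gap: "\<And>u. u \<in> verts G \<Longrightarrow> net_dist G v0 u \<noteq> ennreal t"
 shows "\<forall>\<^sub>F i in F. close_via G v0 (H i) (\<sigma> i v0) t (\<sigma> i)"
proof -
 define B where "B = bl G v0 t"
 have B: "finite B" "B \<subseteq> verts G" using fin by (auto simp: B_def bl_def)
 have "net_dist G v0 v0 \<le> ennreal (path_length G [v0])" by (rule net_dist_le_path) (use o in simp)
 then have oB: "v0 \<in> B" using o by (simp add: B_def bl_def path_length_eq)
 have Blt: "net_dist G v0 u < ennreal t" if "u \<in> B" for u using that gap[of u] by (auto simp: B_def bl_def less_le)
 \<comment> \<open>With the t' < 2t chosen below, an edge on a path shorter than t' has weight at
   least 1/t' > 1/(2t); its counterpart in G keeps half of that, more than 1/(4t). So A contains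
   every vertex one relevant step away from the ball.\<close>
 define A where "A = B \<union> (\<Union>v\<in>B. {u \<in> verts G. 1 / (4 * t) \<le> cmod (wgt G v u)})"
 have A: "finite A" "A \<subseteq> verts G" "B \<subseteq> A" using B finite_large_weights[OF G, of _ "1 / (4 * t)"] t by (auto simp: A_def)
 have "\<exists>c>t. \<forall>u\<in>A - B. ennreal c < net_dist G v0 u"
 proof -
  have *: "\<exists>c>t. ennreal c < net_dist G v0 u" if "u \<in> A - B" for u
  proof -
   have "ennreal t < net_dist G v0 u" using that A by (auto simp: B_def bl_def not_le)
   then obtain x where x: "ennreal t < x" "x < net_dist G v0 u" using dense by blast
   then obtain c where "x = ennreal c" "0 \<le> c" by (cases x) auto
   then show ?thesis using x t by (intro exI[of _ c]) (auto simp: ennreal_less_iff)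
  qed
  then obtain c where c: "\<And>u. u \<in> A - B \<Longrightarrow> t < c u \<and> ennreal (c u) < net_dist G v0 u" by metis
  define c0 where "c0 = Min (insert (t + 1) (c ` (A - B)))"
  have "t < c0" unfolding c0_def using A c by (subst Min_gr_iff) auto
  moreover have "ennreal c0 < net_dist G v0 u" if u: "u \<in> A - B" for u
  proof -
   have "c0 \<le> c u" unfolding c0_def using A u by (intro Min_le) auto
   then have "ennreal c0 \<le> ennreal (c u)" by (rule ennreal_leI)
   then show ?thesis using c[OF u] by (meson le_less_trans)
  qed
  ultimately show ?thesis by blast
 qed
 then obtain c' where c': "t < c'" "\<And>u. u \<in> A - B \<Longrightarrow> ennreal c' < net_dist G v0 u" by blast
 \<comment> \<open>A - B is finite and lies outside the ball, so its distances stay above some c >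
   t; the cap 2t is what the threshold in A was made for.\<close>
 define c where "c = min c' (2 * t)"
 have c: "t < c" "c \<le> 2 * t" "\<And>u. u \<in> A - B \<Longrightarrow> ennreal c < net_dist G v0 u"
 proof -
  fix u assume "u \<in> A - B"
  then have "ennreal c' < net_dist G v0 u" by (rule c'(2))
  moreover have "ennreal c \<le> ennreal c'" unfolding c_def by (intro ennreal_leI) simp
  ultimately show "ennreal c < net_dist G v0 u" by (rule le_less_trans[rotated])
 qed (use c'(1) t in \<open>auto simp: c_def\<close>)
 define t' where "t' = (t + c) / 2"
 have t': "t < t'" "t' < c" using c(1) by (auto simp: t'_def)
 \<comment> \<open>A path in \<open>H i\<close> shorter than t' is lifted to G with squared length
   increased by a factor of at most \<rho>, hence to a path of length at most c; its end is in A,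
   and no vertex of A - B is that close.\<close>
 define \<rho> where "\<rho> = (c / t')\<^sup>2"
 have "t'\<^sup>2 < c\<^sup>2" using t' t by (intro power_strict_mono) auto
 then have \<rho>: "1 < \<rho>" "\<rho> * t'\<^sup>2 = c\<^sup>2" using t' t by (auto simp: \<rho>_def power_divide)
 have E1: "\<forall>\<^sub>F i in F. inj_on (\<sigma> i) A" by (rule net_conv_inj[OF conv A(1,2)])
 have E2: "\<forall>\<^sub>F i in F. \<forall>u\<in>B. net_dist (H i) (\<sigma> i v0) (\<sigma> i u) < ennreal t"
  by (intro eventually_ball_finite B ballI net_conv_dist[OF net_conv_verts[OF conv] net_conv_wgt[OF conv]] Blt)
 have E2': "\<forall>\<^sub>F i in F. \<forall>u\<in>A. \<sigma> i u \<in> verts (H i)" by (intro eventually_ball_finite A ballI net_conv_verts[OF conv]) (use A in auto)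
 have E3: "\<forall>\<^sub>F i in F. \<forall>a\<in>A. \<forall>b\<in>A. 1 / t' \<le> cmod (wgt (H i) (\<sigma> i a) (\<sigma> i b)) \<longrightarrow>
   wgt G a b \<noteq> 0 \<and> 1 / (cmod (wgt G a b))\<^sup>2 \<le> \<rho> / (cmod (wgt (H i) (\<sigma> i a) (\<sigma> i b)))\<^sup>2"
 proof (intro eventually_ball_finite A ballI)
  fix a b assume ab: "a \<in> A" "b \<in> A"
  have lim: "((\<lambda>i. cmod (wgt (H i) (\<sigma> i a) (\<sigma> i b))) \<longlongrightarrow> cmod (wgt G a b)) F" using ab A by (intro tendsto_norm net_conv_wgt[OF conv]) auto
  show "\<forall>\<^sub>F i in F. 1 / t' \<le> cmod (wgt (H i) (\<sigma> i a) (\<sigma> i b)) \<longrightarrow>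
   wgt G a b \<noteq> 0 \<and> 1 / (cmod (wgt G a b))\<^sup>2 \<le> \<rho> / (cmod (wgt (H i) (\<sigma> i a) (\<sigma> i b)))\<^sup>2"
  proof (cases "wgt G a b = 0")
   case True
   then have "\<forall>\<^sub>F i in F. cmod (wgt (H i) (\<sigma> i a) (\<sigma> i b)) < 1 / t'" using lim t' t by (intro order_tendstoD[OF lim]) simp
   then show ?thesis by eventually_elim simp
  next
   case False
   have "((\<lambda>i. (cmod (wgt (H i) (\<sigma> i a) (\<sigma> i b)))\<^sup>2) \<longlongrightarrow> (cmod (wgt G a b))\<^sup>2) F" by (intro tendsto_intros lim)
   then have "\<forall>\<^sub>F i in F. (cmod (wgt (H i) (\<sigma> i a) (\<sigma> i b)))\<^sup>2 < \<rho> * (cmod (wgt G a b))\<^sup>2" by (rule order_tendstoD) (use False \<rho> in simp)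
   then show ?thesis
   proof eventually_elim
    case (elim i)
    show ?case
    proof
     assume "1 / t' \<le> cmod (wgt (H i) (\<sigma> i a) (\<sigma> i b))"
     moreover have "0 < 1 / t'" using t' t by simp
     ultimately have "0 < cmod (wgt (H i) (\<sigma> i a) (\<sigma> i b))" by linarith
     then show "wgt G a b \<noteq> 0 \<and> 1 / (cmod (wgt G a b))\<^sup>2 \<le> \<rho> / (cmod (wgt (H i) (\<sigma> i a) (\<sigma> i b)))\<^sup>2" using elim False by (simp add: divide_simps)
    qed
   qed
  qed
 qed
 have E4: "\<forall>\<^sub>F i in F. \<forall>u\<in>B. \<forall>w\<in>verts (H i). 1 / t' \<le> cmod (wgt (H i) (\<sigma> i u) w) \<longrightarrow> (\<exists>v\<in>A. w = \<sigma> i v)"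
 proof (intro eventually_ball_finite B ballI)
  fix u assume u: "u \<in> B"
  have "0 < 1 / t'" using t' t by simp
  from net_conv_large[OF conv _ this, of u] u B
  have "\<forall>\<^sub>F i in F. \<forall>w\<in>verts (H i). 1 / t' \<le> cmod (wgt (H i) (\<sigma> i u) w) \<longrightarrow>
    (\<exists>v\<in>verts G. w = \<sigma> i v \<and> 1 / t' / 2 \<le> cmod (wgt G u v))" by blast
  moreover have "1 / (4 * t) \<le> 1 / t' / 2" using t' t c(2) by (simp add: field_simps)
  ultimately show "\<forall>\<^sub>F i in F. \<forall>w\<in>verts (H i). 1 / t' \<le> cmod (wgt (H i) (\<sigma> i u) w) \<longrightarrow> (\<exists>v\<in>A. w = \<sigma> i v)"
  proof (elim eventually_mono, intro ballI impI)
   fix i w assume *: "\<forall>w\<in>verts (H i). 1 / t' \<le> cmod (wgt (H i) (\<sigma> i u) w) \<longrightarrow> (\<exists>v\<in>verts G. w = \<sigma> i v \<and> 1 / t' / 2 \<le> cmod (wgt G u v))"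
    and w: "w \<in> verts (H i)" "1 / t' \<le> cmod (wgt (H i) (\<sigma> i u) w)"
   then obtain v where v: "v \<in> verts G" "w = \<sigma> i v" "1 / t' / 2 \<le> cmod (wgt G u v)" by blast
   then have "1 / (4 * t) \<le> cmod (wgt G u v)" using \<open>1 / (4 * t) \<le> 1 / t' / 2\<close> by linarith
   then have "v \<in> A" using u v(1) unfolding A_def by blast
   then show "\<exists>v\<in>A. w = \<sigma> i v" using v(2) by blast
  qed
 qed
 have E5: "\<forall>\<^sub>F i in F. \<forall>a\<in>B. \<forall>b\<in>B. cmod (wgt (H i) (\<sigma> i a) (\<sigma> i b) - wgt G a b) \<le> 1 / t"
 proof (intro eventually_ball_finite B ballI)
  fix a b assume "a \<in> B" "b \<in> B"
  then have "((\<lambda>i. wgt (H i) (\<sigma> i a) (\<sigma> i b)) \<longlongrightarrow> wgt G a b) F" using B by (intro net_conv_wgt[OF conv]) auto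
  then have "\<forall>\<^sub>F i in F. dist (wgt (H i) (\<sigma> i a) (\<sigma> i b)) (wgt G a b) < 1 / t" by (rule tendstoD) (use t in simp)
  then show "\<forall>\<^sub>F i in F. cmod (wgt (H i) (\<sigma> i a) (\<sigma> i b) - wgt G a b) \<le> 1 / t" by eventually_elim (simp add: dist_norm)
 qed
 from E1 E2 E2' E3 E4 E5 show ?thesis
 proof eventually_elim
  case (elim i)
  have claim: "\<exists>u p. u \<in> B \<and> w = \<sigma> i u \<and> is_path G v0 u p \<and> psum G p \<le> \<rho> * psum (H i) q"
   if "is_path (H i) (\<sigma> i v0) w q" "psum (H i) q < t'\<^sup>2" for w q using that
  proof (induction rule: path_induct)
   case single
   then show ?case using oB o by (intro exI[of _ v0] exI[of _ "[v0]"]) simp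
  next
   case (snoc w q x)
   have s: "psum (H i) (q @ [x]) = psum (H i) q + 1 / (cmod (wgt (H i) w x))\<^sup>2" using snoc by (simp add: psum_snoc)
   have nn: "0 \<le> 1 / (cmod (wgt (H i) w x))\<^sup>2" "0 \<le> psum (H i) q" by (simp_all add: psum_nonneg)
   have "psum (H i) q < t'\<^sup>2" "1 / (cmod (wgt (H i) w x))\<^sup>2 < t'\<^sup>2" using snoc.prems s nn by linarith+
   then obtain u p where u: "u \<in> B" "w = \<sigma> i u" "is_path G v0 u p" "psum G p \<le> \<rho> * psum (H i) q" using snoc.IH by blast
   have "(1 / cmod (wgt (H i) w x))\<^sup>2 < t'\<^sup>2" using \<open>1 / (cmod (wgt (H i) w x))\<^sup>2 < t'\<^sup>2\<close> by (simp add: power_divide)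
   then have "1 / cmod (wgt (H i) w x) < t'" by (rule power_less_imp_less_base) (use t t' in simp)
   then have big: "1 / t' \<le> cmod (wgt (H i) w x)" using snoc(5) t t' by (simp add: field_simps)
   then obtain v where v: "v \<in> A" "x = \<sigma> i v" using elim(5) u snoc(4) by blast
   have e: "wgt G u v \<noteq> 0" "1 / (cmod (wgt G u v))\<^sup>2 \<le> \<rho> / (cmod (wgt (H i) w x))\<^sup>2" using elim(4) u(1,2) v big A(3) by blast+
   have pv: "is_path G v0 v (p @ [v])" using u(3) e(1) v(1) A is_path_props[OF u(3)] by (auto simp: is_path_snoc)
   have le: "psum G (p @ [v]) \<le> \<rho> * psum (H i) (q @ [x])" using is_path_props[OF u(3)] u(4) e(2) unfolding s by (simp add: psum_snoc distrib_left)
   have "\<rho> * psum (H i) (q @ [x]) < c\<^sup>2" unfolding \<rho>(2)[symmetric] using snoc.prems \<rho>(1) by (intro mult_strict_left_mono) auto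
   then have "path_length G (p @ [v]) \<le> c" using le c(1) t unfolding path_length_eq by (intro real_le_lsqrt) auto
   then have "net_dist G v0 v \<le> ennreal c" using net_dist_le_path[OF pv] by (meson ennreal_leI order_trans)
   then have "v \<in> B" using c(3)[of v] v(1) by (meson DiffI leD)
   then show ?case using v pv le by blast
  qed
  have "bl (H i) (\<sigma> i v0) t = \<sigma> i ` B"
  proof (intro set_eqI iffI)
   fix w assume w: "w \<in> bl (H i) (\<sigma> i v0) t"
   then have "net_dist (H i) (\<sigma> i v0) w < ennreal t'" using t t' by (auto simp: bl_def ennreal_less_iff elim!: le_less_trans)
   then obtain q where q: "is_path (H i) (\<sigma> i v0) w q" "path_length (H i) q < t'" by (rule net_dist_lessD)
   then have "psum (H i) q < t'\<^sup>2"
    unfolding path_length_eq using t t' by (metis less_trans real_less_rsqrt real_sqrt_less_iff real_sqrt_unique less_imp_le)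
   then show "w \<in> \<sigma> i ` B" using claim[OF q(1)] by blast
  next
   fix w assume "w \<in> \<sigma> i ` B"
   then show "w \<in> bl (H i) (\<sigma> i v0) t" using elim(2,3) A(3) by (auto simp: bl_def less_imp_le)
  qed
  moreover have "inj_on (\<sigma> i) B" using elim(1) A(3) by (rule inj_on_subset)
  ultimately show ?case using elim(6) unfolding close_via_def B_def[symmetric] by (auto intro: inj_on_imp_bij_betw)
 qed
qed

lemma net_conv_d_loc:
 assumes G: "is_network G" and H: "\<And>i. is_network (H i)" and o: "v0 \<in> verts G" "\<And>i. \<sigma> i v0 \<in> verts (H i)"
  and conv: "net_conv F G H \<sigma>" and fin: "\<And>t. finite (bl G v0 t)"
 shows "((\<lambda>i. d_loc (rooted_component G v0) (rooted_component (H i) (\<sigma> i v0))) \<longlongrightarrow> 0) F"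
proof (rule tendstoI)
 fix e :: real assume e: "e > 0"
 define T where "T = 1 / e"
 have T0: "T > 0" using e by (simp add: T_def)
 \<comment> \<open>The distances from v0 are countably many and an interval is uncountable, so some
   radius t > 1/e is not a distance and \<open>net_conv_close\<close> applies to it.\<close>
 have "\<exists>t\<in>{T<..<T+1}. \<forall>u\<in>verts G. net_dist G v0 u \<noteq> ennreal t"
 proof (rule ccontr)
  assume "\<not> ?thesis"
  then have *: "\<forall>t\<in>{T<..<T+1}. \<exists>u\<in>verts G. net_dist G v0 u = ennreal t" by blast
  have "{T<..<T+1} \<subseteq> (\<lambda>u. enn2real (net_dist G v0 u)) ` verts G"
  proof
   fix t assume t: "t \<in> {T<..<T+1}"
   then obtain u where "u \<in> verts G" "net_dist G v0 u = ennreal t" using * by blast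
   then show "t \<in> (\<lambda>u. enn2real (net_dist G v0 u)) ` verts G" using t T0 by (intro image_eqI[of _ _ u]) auto
  qed
  then have "countable {T<..<T+1}" by (rule countable_subset) auto
  then show False using uncountable_open_interval[of T "T+1"] by simp
 qed
 then obtain t where t: "T < t" "\<And>u. u \<in> verts G \<Longrightarrow> net_dist G v0 u \<noteq> ennreal t" by auto
 have "0 < t" using T0 t by simp
 have "\<forall>\<^sub>F i in F. close_via G v0 (H i) (\<sigma> i v0) t (\<sigma> i)" by (rule net_conv_close[OF G o(1) conv \<open>0 < t\<close> fin]) (rule t(2))
 then show "\<forall>\<^sub>F i in F. dist (d_loc (rooted_component G v0) (rooted_component (H i) (\<sigma> i v0))) 0 < e"
 proof eventually_elim
  case (elim i)
  obtain \<tau> where \<tau>: "embeds \<tau> (nt (rooted_component G v0)) G" "\<tau> (rt (rooted_component G v0)) = v0" by (rule rep_component[OF G o(1)])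
  obtain \<rho> where \<rho>: "embeds \<rho> (nt (rooted_component (H i) (\<sigma> i v0))) (H i)" "\<rho> (rt (rooted_component (H i) (\<sigma> i v0))) = \<sigma> i v0"
   by (rule rep_component[OF H o(2)])
  have "close_at (rep_gstar (rooted_component G v0)) (rep_gstar (rooted_component (H i) (\<sigma> i v0))) t" unfolding close_at_iff
   by (rule close_via_embeds[OF \<tau>(1) \<rho>(1) rep_root rep_root, where \<sigma>="\<sigma> i"]) (use elim \<tau>(2) \<rho>(2) \<open>0 < t\<close> in auto)
  then have "d_loc (rooted_component G v0) (rooted_component (H i) (\<sigma> i v0)) \<le> 1 / (1 + t)" using \<open>0 < t\<close> by (rule d_loc_le)
  also have "\<dots> < e" using t(1) T0 e \<open>0 < t\<close> by (simp add: T_def field_simps) 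
  finally show ?case by (simp add: d_loc_nonneg)
 qed
qed

section \<open>Finiteness of balls when the weights are bounded\<close>

primrec steps :: "network \<Rightarrow> nat \<Rightarrow> nat \<Rightarrow> nat set" where
 "steps G v 0 = {v}"
| "steps G v (Suc k) = steps G v k \<union> (\<Union>u\<in>steps G v k. nb G u)"

lemma steps_verts: "v \<in> verts G \<Longrightarrow> steps G v k \<subseteq> verts G" by (induction k) (auto simp: nb_def)

lemma finite_steps:
 assumes "bounded_net M G" "v \<in> verts G"
 shows "finite (steps G v k)" by (induction k) (use assms steps_verts[OF assms(2)] in \<open>auto simp: bounded_net_def\<close>)

lemma steps_mono: "k \<le> l \<Longrightarrow> steps G v k \<subseteq> steps G v l" by (induction l) (auto simp: le_Suc_eq)

lemma path_steps:
 assumes "is_path G v u p"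
 shows "u \<in> steps G v (length p - 1)" using assms
proof (induction rule: path_induct)
 case (snoc w p x)
 then obtain n where "length p = Suc n" by (cases p) auto
 then show ?case using snoc by (auto simp: nb_def intro: disjI2)
qed simp

lemma bounded_net_wgt:
 assumes "bounded_net M G" "u \<in> verts G" "v \<in> verts G" "0 \<le> M"
 shows "cmod (wgt G u v) \<le> M"
proof (cases "v \<in> nb G u")
 case True
 have "cmod (wgt G u v) \<le> (\<Sum>v\<in>nb G u. cmod (wgt G u v))" using assms True by (intro member_le_sum) (auto simp: bounded_net_def)
 also have "\<dots> \<le> M" using assms by (auto simp: bounded_net_def)
 finally show ?thesis .
qed (use assms in \<open>auto simp: nb_def\<close>)

lemma psum_bounded_net:
 assumes "bounded_net M G" "0 < M" "is_path G v u p"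
 shows "real (length p - 1) / M\<^sup>2 \<le> psum G p" using assms(3)
proof (induction rule: path_induct)
 case (snoc w p x)
 have w: "w \<in> verts G" using is_path_props[OF snoc(1)] by simp
 have "cmod (wgt G w x) \<le> M" using bounded_net_wgt[OF assms(1) w snoc(4)] assms(2) by simp
 then have "1 / M\<^sup>2 \<le> 1 / (cmod (wgt G w x))\<^sup>2" using snoc(5) by (intro frac_le power_mono) auto
 moreover have "real (length (p @ [x]) - 1) = real (length p - 1) + 1" using snoc(2) by (cases p) auto
 then have "real (length (p @ [x]) - 1) / M\<^sup>2 = real (length p - 1) / M\<^sup>2 + 1 / M\<^sup>2" by (simp only: add_divide_distrib)
 ultimately show ?case using snoc.IH unfolding psum_snoc[OF snoc(2)] snoc(3) by linarith
qed simp

text \<open>Every edge adds at least 1/M^2 to the squared length, so a path of length below |t| + 1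
  has at most (|t| + 1)^2 M^2 edges, and only finitely many vertices are reached in that many
  steps.\<close>

lemma finite_bl:
 assumes G: "bounded_net M G" and M: "0 < M" and v: "v \<in> verts G"
 shows "finite (bl G v t)"
proof -
 define n where "n = nat \<lceil>(\<bar>t\<bar> + 1)\<^sup>2 * M\<^sup>2\<rceil>"
 have "bl G v t \<subseteq> steps G v n"
 proof
  fix u assume "u \<in> bl G v t"
  then have "net_dist G v u \<le> ennreal t" by (simp add: bl_def)
  also have "\<dots> < ennreal (\<bar>t\<bar> + 1)" by (rule ennreal_lessI) auto
  finally obtain p where p: "is_path G v u p" "path_length G p < \<bar>t\<bar> + 1" by (rule net_dist_lessD)
  have "psum G p \<le> (\<bar>t\<bar> + 1)\<^sup>2" using p(2) unfolding path_length_eq by (intro sqrt_le_D) simp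
  then have "real (length p - 1) / M\<^sup>2 \<le> (\<bar>t\<bar> + 1)\<^sup>2" using psum_bounded_net[OF G M p(1)] by linarith
  then have "real (length p - 1) \<le> (\<bar>t\<bar> + 1)\<^sup>2 * M\<^sup>2" using M by (simp add: divide_le_eq)
  then have "length p - 1 \<le> n" unfolding n_def by linarith
  then show "u \<in> steps G v n" using path_steps[OF p(1)] steps_mono by blast
 qed
 then show ?thesis by (rule finite_subset) (rule finite_steps[OF G v])
qed

section \<open>Measurability of the truncation\<close>

text \<open>Repetitions among the marks are allowed. Marks make it possible to quantify over
  vertices and remain measurable; the root of a class is the first mark.\<close>

definition marked :: "nat \<Rightarrow> (network \<times> nat list) set" where
 "marked k = {(G, vs). is_network G \<and> set vs \<subseteq> verts G \<and> length vs = k}"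

definition mset_near :: "network \<Rightarrow> nat set \<Rightarrow> real \<Rightarrow> (network \<times> (nat \<Rightarrow> nat)) set" where
 "mset_near G F e = {(H, \<sigma>). is_network H \<and> inj_on \<sigma> F \<and> \<sigma> ` F \<subseteq> verts H \<and>
   (\<forall>u\<in>F. \<forall>v\<in>F. cmod (wgt H (\<sigma> u) (\<sigma> v) - wgt G u v) < e)}"

text \<open>Weights are compared on finitely many vertices, and the rest of H is free. Local
  convergence implies this one (\<open>filterlim_cfil_mfil\<close>), and its open sets are the
  properties witnessed by finitely many vertices up to a small error.\<close>

definition mfil :: "network \<Rightarrow> (network \<times> (nat \<Rightarrow> nat)) filter" where
 "mfil G = (INF x\<in>{(F, e). finite F \<and> F \<subseteq> verts G \<and> (0::real) < e}. principal (mset_near G (fst x) (snd x)))"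

lemma eventually_mfil:
 "eventually P (mfil G) \<longleftrightarrow> (\<exists>F e. finite F \<and> F \<subseteq> verts G \<and> 0 < e \<and> (\<forall>x\<in>mset_near G F e. P x))"
proof -
 have "eventually P (mfil G) \<longleftrightarrow> (\<exists>x\<in>{(F, e). finite F \<and> F \<subseteq> verts G \<and> (0::real) < e}. eventually P (principal (mset_near G (fst x) (snd x))))"
  unfolding mfil_def
 proof (rule eventually_INF_base)
  fix a b :: "nat set \<times> real"
  assume "a \<in> {(F, e). finite F \<and> F \<subseteq> verts G \<and> 0 < e}" "b \<in> {(F, e). finite F \<and> F \<subseteq> verts G \<and> 0 < e}"
  moreover have "mset_near G (fst a \<union> fst b) (min (snd a) (snd b)) \<subseteq> mset_near G (fst a) (snd a) \<inter> mset_near G (fst b) (snd b)"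
   unfolding mset_near_def by (auto intro: inj_on_subset)
  ultimately show "\<exists>x\<in>{(F, e). finite F \<and> F \<subseteq> verts G \<and> 0 < e}. principal (mset_near G (fst x) (snd x))
    \<le> inf (principal (mset_near G (fst a) (snd a))) (principal (mset_near G (fst b) (snd b)))"
   by (intro bexI[of _ "(fst a \<union> fst b, min (snd a) (snd b))"]) auto
 next
  have "({}, 1) \<in> {(F, e). finite F \<and> F \<subseteq> verts G \<and> (0::real) < e}" by simp
  then show "{(F, e). finite F \<and> F \<subseteq> verts G \<and> (0::real) < e} \<noteq> {}" by blast
 qed
 then show ?thesis by (auto simp: eventually_principal)
qed

lemma eventually_mset_near: "finite F \<Longrightarrow> F \<subseteq> verts G \<Longrightarrow> 0 < e \<Longrightarrow> \<forall>\<^sub>F x in mfil G. x \<in> mset_near G F e" unfolding eventually_mfil by blast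

lemma mfil_network: "\<forall>\<^sub>F x in mfil G. is_network (fst x)"
proof -
 have "\<forall>\<^sub>F x in mfil G. x \<in> mset_near G {} 1" by (rule eventually_mset_near) auto
 then show ?thesis by eventually_elim (auto simp: mset_near_def)
qed

lemma mfil_inj:
 assumes "finite F" "F \<subseteq> verts G"
 shows "\<forall>\<^sub>F x in mfil G. inj_on (snd x) F \<and> snd x ` F \<subseteq> verts (fst x)"
proof -
 have "\<forall>\<^sub>F x in mfil G. x \<in> mset_near G F 1" by (rule eventually_mset_near) (use assms in auto)
 then show ?thesis by eventually_elim (auto simp: mset_near_def)
qed

lemma mfil_wgt:
 assumes "u \<in> verts G" "v \<in> verts G"
 shows "((\<lambda>x. wgt (fst x) (snd x u) (snd x v)) \<longlongrightarrow> wgt G u v) (mfil G)"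
proof (rule tendstoI)
 fix e :: real assume "e > 0"
 then have "\<forall>\<^sub>F x in mfil G. x \<in> mset_near G {u, v} e" using assms by (intro eventually_mset_near) auto
 then show "\<forall>\<^sub>F x in mfil G. dist (wgt (fst x) (snd x u) (snd x v)) (wgt G u v) < e" by eventually_elim (auto simp: mset_near_def dist_norm)
qed

lemma filterlim_cfil_mfil: "filterlim (\<lambda>x. (nt (fst x), snd x)) (mfil (nt g)) (cfil g)" unfolding filterlim_iff
proof (intro allI impI)
 fix P assume "eventually P (mfil (nt g))"
 then obtain F e where F: "finite F" "F \<subseteq> verts (nt g)" "0 < e" "\<And>x. x \<in> mset_near (nt g) F e \<Longrightarrow> P x" unfolding eventually_mfil by blast
 have 1: "\<forall>\<^sub>F x in cfil g. \<forall>u\<in>F. \<forall>v\<in>F. cmod (wgt (nt (fst x)) (snd x u) (snd x v) - wgt (nt g) u v) < e"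
 proof (intro eventually_ball_finite F(1) ballI)
  fix u v assume "u \<in> F" "v \<in> F"
  then have "((\<lambda>x. wgt (nt (fst x)) (snd x u) (snd x v)) \<longlongrightarrow> wgt (nt g) u v) (cfil g)" using F by (intro net_conv_wgt[OF cfil_net_conv]) auto
  from tendstoD[OF this F(3)] show "\<forall>\<^sub>F x in cfil g. cmod (wgt (nt (fst x)) (snd x u) (snd x v) - wgt (nt g) u v) < e" by (simp add: dist_norm)
 qed
 have 2: "\<forall>\<^sub>F x in cfil g. \<forall>u\<in>F. snd x u \<in> verts (nt (fst x))" using F by (intro eventually_ball_finite ballI net_conv_verts[OF cfil_net_conv]) auto
 from 1 2 net_conv_inj[OF cfil_net_conv F(1,2)] show "\<forall>\<^sub>F x in cfil g. P (nt (fst x), snd x)"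
  by eventually_elim (rule F(4), auto simp: mset_near_def rep_network)
qed

text \<open>Openness for the convergence \<open>mfil\<close>, where the matching also carries the
  marks along.\<close>

definition eopen :: "nat \<Rightarrow> (network \<times> nat list) set \<Rightarrow> bool" where
 "eopen k S \<longleftrightarrow> S \<subseteq> marked k \<and> (\<forall>(G, vs)\<in>S. \<forall>\<^sub>F x in mfil G. (fst x, map (snd x) vs) \<in> S)"

lemma eopenI:
 assumes "\<And>G vs. (G, vs) \<in> S \<Longrightarrow> (G, vs) \<in> marked k"
  and "\<And>G vs. (G, vs) \<in> S \<Longrightarrow> (G, vs) \<in> marked k \<Longrightarrow> \<forall>\<^sub>F x in mfil G. (fst x, map (snd x) vs) \<in> S"
 shows "eopen k S" unfolding eopen_def
proof (intro conjI ballI)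
 show "S \<subseteq> marked k" using assms(1) by force
 fix x assume "x \<in> S"
 then show "case x of (G, vs) \<Rightarrow> \<forall>\<^sub>F x in mfil G. (fst x, map (snd x) vs) \<in> S" using assms by (cases x) auto
qed

lemma mfil_marked:
 assumes "(G, vs) \<in> marked k"
 shows "\<forall>\<^sub>F x in mfil G. (fst x, map (snd x) vs) \<in> marked k"
proof -
 have "\<forall>\<^sub>F x in mfil G. inj_on (snd x) (set vs) \<and> snd x ` set vs \<subseteq> verts (fst x)" using assms by (intro mfil_inj) (auto simp: marked_def)
 with mfil_network[of G] show ?thesis by eventually_elim (use assms in \<open>auto simp: marked_def\<close>)
qed

lemma eopen_marked: "eopen k (marked k)" by (rule eopenI) (auto intro: mfil_marked)

definition MK :: "nat \<Rightarrow> (network \<times> nat list) measure" where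
 "MK k = sigma (marked k) {S. eopen k S}"

lemma space_MK [simp]: "space (MK k) = marked k" unfolding MK_def by (rule space_measure_of) (auto simp: eopen_def)

lemma sets_MK: "sets (MK k) = sigma_sets (marked k) {S. eopen k S}" unfolding MK_def by (rule sets_measure_of) (auto simp: eopen_def)

lemma eopen_sets: "eopen k S \<Longrightarrow> S \<in> sets (MK k)" unfolding sets_MK by (rule sigma_sets.Basic) simp

lemma eopen_Int: "eopen k S \<Longrightarrow> eopen k T \<Longrightarrow> eopen k (S \<inter> T)" unfolding eopen_def by (auto intro: eventually_conj)

lemma measurable_MK_I:
 fixes f :: "network \<times> nat list \<Rightarrow> 'b::topological_space"
 assumes "\<And>G vs. (G, vs) \<in> marked k \<Longrightarrow> ((\<lambda>x. f (fst x, map (snd x) vs)) \<longlongrightarrow> f (G, vs)) (mfil G)"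
 shows "f \<in> borel_measurable (MK k)"
proof (rule borel_measurableI)
 fix S :: "'b set" assume S: "open S"
 have "eopen k (f -` S \<inter> marked k)"
 proof (rule eopenI)
  fix G vs assume gv: "(G, vs) \<in> f -` S \<inter> marked k"
  then have "\<forall>\<^sub>F x in mfil G. f (fst x, map (snd x) vs) \<in> S" using topological_tendstoD[OF assms S] by simp
  moreover have "\<forall>\<^sub>F x in mfil G. (fst x, map (snd x) vs) \<in> marked k" using gv by (intro mfil_marked) simp
  ultimately show "\<forall>\<^sub>F x in mfil G. (fst x, map (snd x) vs) \<in> f -` S \<inter> marked k" by eventually_elim simp
 qed simp
 then show "f -` S \<inter> space (MK k) \<in> sets (MK k)" by (simp add: eopen_sets)
qed

lemma measurable_MK_wgt [measurable]:
 assumes "i < k" "j < k"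
 shows "(\<lambda>x. wgt (fst x) (snd x ! i) (snd x ! j)) \<in> borel_measurable (MK k)"
proof (rule measurable_MK_I)
 fix G vs assume gv: "(G, vs) \<in> marked k"
 then have "vs ! i \<in> verts G" "vs ! j \<in> verts G" using assms by (auto simp: marked_def)
 from mfil_wgt[OF this] show "((\<lambda>x. wgt (fst (fst x, map (snd x) vs)) (snd (fst x, map (snd x) vs) ! i) (snd (fst x, map (snd x) vs) ! j))
   \<longlongrightarrow> wgt (fst (G, vs)) (snd (G, vs) ! i) (snd (G, vs) ! j)) (mfil G)" using gv assms by (simp add: marked_def)
qed

text \<open>Lower semicontinuity: a finite part of the sum already exceeds c, and this persists for
  every network that is close on those vertices.\<close>

lemma measurable_MK_deg [measurable]:
 assumes i: "i < k"
 shows "(\<lambda>x. deg (fst x) (snd x ! i)) \<in> borel_measurable (MK k)" unfolding borel_measurable_iff_greater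
proof
 fix c :: real
 have "eopen k {x \<in> marked k. c < deg (fst x) (snd x ! i)}"
 proof (rule eopenI)
  fix G vs assume gv: "(G, vs) \<in> {x \<in> marked k. c < deg (fst x) (snd x ! i)}" and m: "(G, vs) \<in> marked k"
  have v: "vs ! i \<in> verts G" using m i by (auto simp: marked_def)
  have "(\<lambda>u. (cmod (wgt G (vs ! i) u))\<^sup>2) summable_on verts G" using m v by (auto simp: marked_def is_network_def)
  then have "((\<lambda>u. (cmod (wgt G (vs ! i) u))\<^sup>2) has_sum deg G (vs ! i)) (verts G)" unfolding deg_def by (rule has_sum_infsum)
  then have "((\<lambda>S. \<Sum>u\<in>S. (cmod (wgt G (vs ! i) u))\<^sup>2) \<longlongrightarrow> deg G (vs ! i)) (finite_subsets_at_top (verts G))" by (simp add: has_sum_def)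
  then have "\<forall>\<^sub>F S in finite_subsets_at_top (verts G). c < (\<Sum>u\<in>S. (cmod (wgt G (vs ! i) u))\<^sup>2)" using gv by (intro order_tendstoD) auto
  then obtain S where S: "finite S" "S \<subseteq> verts G" "c < (\<Sum>u\<in>S. (cmod (wgt G (vs ! i) u))\<^sup>2)" unfolding eventually_finite_subsets_at_top by blast
  have "((\<lambda>x. \<Sum>u\<in>S. (cmod (wgt (fst x) (snd x (vs ! i)) (snd x u)))\<^sup>2) \<longlongrightarrow> (\<Sum>u\<in>S. (cmod (wgt G (vs ! i) u))\<^sup>2)) (mfil G)"
   using S v by (intro tendsto_intros mfil_wgt) auto
  then have "\<forall>\<^sub>F x in mfil G. c < (\<Sum>u\<in>S. (cmod (wgt (fst x) (snd x (vs ! i)) (snd x u)))\<^sup>2)" using S(3) by (rule order_tendstoD)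
  then show "\<forall>\<^sub>F x in mfil G. (fst x, map (snd x) vs) \<in> {x \<in> marked k. c < deg (fst x) (snd x ! i)}" using mfil_marked[OF m] mfil_inj[OF S(1,2)]
  proof eventually_elim
   case (elim x)
   have "(\<Sum>u\<in>S. (cmod (wgt (fst x) (snd x (vs ! i)) (snd x u)))\<^sup>2) = (\<Sum>w\<in>snd x ` S. (cmod (wgt (fst x) (snd x (vs ! i)) w))\<^sup>2)"
    using elim by (simp add: sum.reindex)
   also have "\<dots> \<le> deg (fst x) (snd x (vs ! i))" unfolding deg_def
   proof (rule finite_sum_le_infsum)
    have "snd x (vs ! i) \<in> verts (fst x)" using elim(2) i by (auto simp: marked_def)
    then show "(\<lambda>u. (cmod (wgt (fst x) (snd x (vs ! i)) u))\<^sup>2) summable_on verts (fst x)" using elim(2) unfolding marked_def is_network_def by blast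
   qed (use elim S in auto)
   finally show ?case using elim m i by (simp add: marked_def)
  qed
 qed simp
 then show "{x \<in> space (MK k). c < deg (fst x) (snd x ! i)} \<in> sets (MK k)" by (simp add: eopen_sets)
qed

lemma measurable_MK_neq:
 assumes "i < k" "j < k"
 shows "{x \<in> marked k. snd x ! i \<noteq> snd x ! j} \<in> sets (MK k)"
proof (rule eopen_sets, rule eopenI)
 fix G vs assume gv: "(G, vs) \<in> {x \<in> marked k. snd x ! i \<noteq> snd x ! j}" and m: "(G, vs) \<in> marked k"
 have "\<forall>\<^sub>F x in mfil G. inj_on (snd x) (set vs) \<and> snd x ` set vs \<subseteq> verts (fst x)" using m by (intro mfil_inj) (auto simp: marked_def)
 with mfil_marked[OF m] show "\<forall>\<^sub>F x in mfil G. (fst x, map (snd x) vs) \<in> {x \<in> marked k. snd x ! i \<noteq> snd x ! j}"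
  by eventually_elim (use gv m assms in \<open>auto simp: marked_def dest: inj_onD\<close>)
qed simp

text \<open>The strict inequality makes membership an open condition, while d > 0 keeps the set
  finite.\<close>

definition near_set :: "real \<Rightarrow> network \<times> nat list \<Rightarrow> nat set" where
 "near_set d x = {u \<in> verts (fst x). \<exists>v\<in>set (snd x). d < cmod (wgt (fst x) v u)}"

lemma finite_near_set:
 assumes "x \<in> marked k" "0 < d"
 shows "finite (near_set d x)"
proof -
 have "near_set d x \<subseteq> (\<Union>v\<in>set (snd x). {u \<in> verts (fst x). d \<le> cmod (wgt (fst x) v u)})" by (auto simp: near_set_def)
 moreover have "finite \<dots>" using assms finite_large_weights[of "fst x" _ d] by (auto simp: marked_def)
 ultimately show ?thesis by (rule finite_subset)
qed

text \<open>The number of witnesses is measurable, by induction over the generated \<open>\<sigma>\<close>-algebra.\<close>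

lemma measurable_MK_ex:
 assumes S: "S \<in> sets (MK (Suc k))" and d: "0 < d"
 shows "{x \<in> marked k. \<exists>u\<in>near_set d x. (fst x, snd x @ [u]) \<in> S} \<in> sets (MK k)"
proof -
 \<comment> \<open>Counts in place of existence: \<open>near_set\<close> is finite, so the count for
   a complement is a difference of counts, whereas existence does not pass to complements.\<close>
 define cnt where "cnt S x = emeasure (count_space UNIV) {u \<in> near_set d x. (fst x, snd x @ [u]) \<in> S}" for S x
 have mem: "(fst x, snd x @ [u]) \<in> marked (Suc k)" if "x \<in> marked k" "u \<in> near_set d x" for x u using that by (auto simp: marked_def near_set_def)
 have basic: "cnt A \<in> borel_measurable (MK k)" if A: "eopen (Suc k) A" for A
 proof (rule borel_measurableI_greater)
  fix c
  have "eopen k {x \<in> marked k. c < cnt A x}"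
  proof (rule eopenI)
   fix G vs assume gv: "(G, vs) \<in> {x \<in> marked k. c < cnt A x}" and m: "(G, vs) \<in> marked k"
   define U where "U = {u \<in> near_set d (G, vs). (G, vs @ [u]) \<in> A}"
   have "U \<subseteq> near_set d (G, vs)" by (auto simp: U_def)
   then have Uf: "finite U" using finite_near_set[OF m d] by (rule finite_subset)
   have Us: "U \<subseteq> verts G" by (auto simp: U_def near_set_def)
   note U = Uf Us
   have "c < of_nat (card U)" using gv U(1) by (simp add: cnt_def U_def)
   have 1: "\<forall>\<^sub>F x in mfil G. \<forall>u\<in>U. (fst x, map (snd x) (vs @ [u])) \<in> A" using A U by (intro eventually_ball_finite ballI) (auto simp: eopen_def U_def)
   have 2: "\<forall>\<^sub>F x in mfil G. \<forall>u\<in>U. \<exists>v\<in>set vs. d < cmod (wgt (fst x) (snd x v) (snd x u))"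
   proof (intro eventually_ball_finite U(1) ballI)
    fix u assume "u \<in> U"
    then obtain v where v: "v \<in> set vs" "d < cmod (wgt G v u)" "u \<in> verts G" by (auto simp: U_def near_set_def)
    then have "v \<in> verts G" using m by (auto simp: marked_def)
    then have "((\<lambda>x. cmod (wgt (fst x) (snd x v) (snd x u))) \<longlongrightarrow> cmod (wgt G v u)) (mfil G)" using v by (intro tendsto_norm mfil_wgt)
    then have "\<forall>\<^sub>F x in mfil G. d < cmod (wgt (fst x) (snd x v) (snd x u))" using v(2) by (rule order_tendstoD)
    then show "\<forall>\<^sub>F x in mfil G. \<exists>v\<in>set vs. d < cmod (wgt (fst x) (snd x v) (snd x u))" by eventually_elim (use v in blast)
   qed
   from 1 2 mfil_inj[OF U] mfil_marked[OF m]
   show "\<forall>\<^sub>F x in mfil G. (fst x, map (snd x) vs) \<in> {x \<in> marked k. c < cnt A x}"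
   proof eventually_elim
    case (elim x)
    let ?y = "(fst x, map (snd x) vs)"
    have sub: "snd x ` U \<subseteq> {u \<in> near_set d ?y. (fst ?y, snd ?y @ [u]) \<in> A}" using elim by (auto simp: near_set_def)
    have "c < of_nat (card (snd x ` U))" using \<open>c < of_nat (card U)\<close> elim(3) by (simp add: card_image)
    also have "of_nat (card (snd x ` U)) = emeasure (count_space UNIV) (snd x ` U)" using U(1) by simp
    also have "\<dots> \<le> cnt A ?y" unfolding cnt_def by (rule emeasure_mono[OF sub]) simp
    finally show ?case using elim(4) by simp
   qed
  qed simp
  then show "{x \<in> space (MK k). c < cnt A x} \<in> sets (MK k)" by (simp add: eopen_sets)
 qed
 have S': "S \<in> sigma_sets (marked (Suc k)) {S. eopen (Suc k) S}" using S by (simp only: sets_MK)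
 have "cnt S \<in> borel_measurable (MK k)"
 proof (rule sigma_sets_induct_disjoint[where P="\<lambda>A. cnt A \<in> borel_measurable (MK k)", OF _ _ S'])
  show "Int_stable {S. eopen (Suc k) S}" by (auto simp: Int_stable_def eopen_Int)
  show "{S. eopen (Suc k) S} \<subseteq> Pow (marked (Suc k))" by (auto simp: eopen_def)
 next
  fix A assume "A \<in> {S. eopen (Suc k) S}"
  then show "cnt A \<in> borel_measurable (MK k)" by (simp add: basic)
 next
  show "cnt {} \<in> borel_measurable (MK k)" unfolding cnt_def by simp
 next
  fix A assume A: "A \<in> sigma_sets (marked (Suc k)) {S. eopen (Suc k) S}" "cnt A \<in> borel_measurable (MK k)"
  show "cnt (marked (Suc k) - A) \<in> borel_measurable (MK k)"
  proof -
   have tot: "cnt (marked (Suc k)) x = emeasure (count_space UNIV) (near_set d x)" if "x \<in> marked k" for x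
    unfolding cnt_def by (rule arg_cong[where f="emeasure _"]) (use mem[OF that] in auto)
   have eq: "cnt (marked (Suc k) - A) x = cnt (marked (Suc k)) x - cnt A x" if x: "x \<in> marked k" for x
   proof -
    have "{u \<in> near_set d x. (fst x, snd x @ [u]) \<in> marked (Suc k) - A} = near_set d x - {u \<in> near_set d x. (fst x, snd x @ [u]) \<in> A}"
     using mem[OF x] by auto
    moreover have "finite {u \<in> near_set d x. (fst x, snd x @ [u]) \<in> A}" using finite_near_set[OF x d] by simp
    then have "emeasure (count_space UNIV) (near_set d x - {u \<in> near_set d x. (fst x, snd x @ [u]) \<in> A})
      = emeasure (count_space UNIV) (near_set d x) - emeasure (count_space UNIV) {u \<in> near_set d x. (fst x, snd x @ [u]) \<in> A}"
     by (intro emeasure_Diff) auto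
    ultimately show ?thesis unfolding tot[OF x] unfolding cnt_def by (simp only:)
   qed
   have "cnt (marked (Suc k)) \<in> borel_measurable (MK k)" by (rule basic[OF eopen_marked])
   then have "(\<lambda>x. cnt (marked (Suc k)) x - cnt A x) \<in> borel_measurable (MK k)" using A(2) by measurable
   then show ?thesis by (rule measurable_cong[THEN iffD1, rotated]) (use eq in auto)
  qed
 next
  fix A :: "nat \<Rightarrow> (network \<times> nat list) set"
  assume A: "disjoint_family A" "\<And>i. cnt (A i) \<in> borel_measurable (MK k)"
  have "cnt (\<Union>(range A)) x = (\<Sum>i. cnt (A i) x)" for x
  proof -
   have "{u \<in> near_set d x. (fst x, snd x @ [u]) \<in> \<Union>(range A)} = (\<Union>i. {u \<in> near_set d x. (fst x, snd x @ [u]) \<in> A i})" by auto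
   moreover have "disjoint_family (\<lambda>i. {u \<in> near_set d x. (fst x, snd x @ [u]) \<in> A i})" using A(1) by (auto simp: disjoint_family_on_def)
   ultimately show ?thesis unfolding cnt_def by (simp add: suminf_emeasure)
  qed
  then show "cnt (\<Union>(range A)) \<in> borel_measurable (MK k)" using A(2) by (simp add: borel_measurable_suminf cong: measurable_cong)
 qed
 then have "{x \<in> space (MK k). 0 < cnt S x} \<in> sets (MK k)" by measurable
 moreover have "{x \<in> space (MK k). 0 < cnt S x} = {x \<in> marked k. \<exists>u\<in>near_set d x. (fst x, snd x @ [u]) \<in> S}"
  by (auto simp: cnt_def zero_less_iff_neq_zero emeasure_count_space_eq_0)
 ultimately show ?thesis by simp
qed

section \<open>From marked networks to isomorphism classes\<close>

lemma measurable_root_MK: "(\<lambda>g. (nt g, [rt g])) \<in> measurable borel (MK 1)" unfolding MK_def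
proof (rule measurable_measure_of)
 show "{S. eopen 1 S} \<subseteq> Pow (marked 1)" by (auto simp: eopen_def)
 show "(\<lambda>g. (nt g, [rt g])) \<in> space borel \<rightarrow> marked 1" by (simp add: marked_def rep_network rep_root)
 fix S assume "S \<in> {S. eopen 1 S}"
 then have S: "eopen 1 S" by simp
 have "open ((\<lambda>g. (nt g, [rt g])) -` S)"
 proof (rule open_gstarI)
  fix g assume "g \<in> (\<lambda>g. (nt g, [rt g])) -` S"
  then have "\<forall>\<^sub>F x in mfil (nt g). (fst x, map (snd x) [rt g]) \<in> S" using S unfolding eopen_def by auto
  from eventually_compose_filterlim[OF this filterlim_cfil_mfil] cfil_root
  show "\<forall>\<^sub>F x in cfil g. fst x \<in> (\<lambda>g. (nt g, [rt g])) -` S" by eventually_elim simp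
 qed
 then show "(\<lambda>g. (nt g, [rt g])) -` S \<inter> space borel \<in> sets borel" by simp
qed

text \<open>Each vertex of the list is found near an earlier one. An existential over such lists is
  a succession of existentials over \<open>near_set\<close>, which \<open>measurable_MK_ex\<close>
  eliminates one mark at a time.\<close>

definition chain :: "real \<Rightarrow> network \<Rightarrow> nat list \<Rightarrow> bool" where
 "chain d G vs \<longleftrightarrow> (\<forall>j. 0 < j \<and> j < length vs \<longrightarrow> (\<exists>i<j. d < cmod (wgt G (vs ! i) (vs ! j))))"

lemma chain_snoc:
 assumes "vs \<noteq> []"
 shows "chain d G (vs @ [u]) \<longleftrightarrow> chain d G vs \<and> (\<exists>v\<in>set vs. d < cmod (wgt G v u))"
proof
 assume c: "chain d G (vs @ [u])"
 have "\<exists>i<length vs. d < cmod (wgt G (vs ! i) u)" using c[unfolded chain_def, rule_format, of "length vs"] assms by (auto simp: nth_append)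
 moreover have "chain d G vs" unfolding chain_def
 proof (intro allI impI)
  fix j assume j: "0 < j \<and> j < length vs"
  then show "\<exists>i<j. d < cmod (wgt G (vs ! i) (vs ! j))" using c[unfolded chain_def, rule_format, of j] by (auto simp: nth_append)
 qed
 ultimately show "chain d G vs \<and> (\<exists>v\<in>set vs. d < cmod (wgt G v u))" using nth_mem by blast
next
 assume c: "chain d G vs \<and> (\<exists>v\<in>set vs. d < cmod (wgt G v u))"
 show "chain d G (vs @ [u])" unfolding chain_def
 proof (intro allI impI)
  fix j assume j: "0 < j \<and> j < length (vs @ [u])"
  show "\<exists>i<j. d < cmod (wgt G ((vs @ [u]) ! i) ((vs @ [u]) ! j))"
  proof (cases "j < length vs")
   case True
   then obtain i where "i < j" "d < cmod (wgt G (vs ! i) (vs ! j))" using c j unfolding chain_def by blast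
   then show ?thesis using True by (intro exI[of _ i]) (simp add: nth_append)
  next
   case False
   then have "j = length vs" using j by simp
   moreover obtain i where "i < length vs" "d < cmod (wgt G (vs ! i) u)" using c by (auto simp: in_set_conv_nth)
   ultimately show ?thesis by (intro exI[of _ i]) (simp add: nth_append)
  qed
 qed
qed

lemma measurable_chain_ex:
 assumes "S \<in> sets (MK (Suc k))" "0 < d"
 shows "{g. \<exists>vs. (nt g, vs) \<in> S \<and> hd vs = rt g \<and> chain d (nt g) vs} \<in> sets borel" using assms(1)
proof (induction k arbitrary: S)
 case 0
 have "{g. \<exists>vs. (nt g, vs) \<in> S \<and> hd vs = rt g \<and> chain d (nt g) vs} = (\<lambda>g. (nt g, [rt g])) -` S \<inter> space borel"
 proof (intro set_eqI iffI)
  fix g assume "g \<in> {g. \<exists>vs. (nt g, vs) \<in> S \<and> hd vs = rt g \<and> chain d (nt g) vs}"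
  then obtain vs where vs: "(nt g, vs) \<in> S" "hd vs = rt g" by blast
  then have "length vs = 1" using sets.sets_into_space[OF 0] by (auto simp: marked_def)
  then have "vs = [rt g]" using vs(2) by (cases vs) auto
  then show "g \<in> (\<lambda>g. (nt g, [rt g])) -` S \<inter> space borel" using vs by simp
 next
  fix g assume "g \<in> (\<lambda>g. (nt g, [rt g])) -` S \<inter> space borel"
  then show "g \<in> {g. \<exists>vs. (nt g, vs) \<in> S \<and> hd vs = rt g \<and> chain d (nt g) vs}" by (auto intro!: exI[of _ "[rt g]"] simp: chain_def)
 qed
 then show ?case using measurable_sets[OF measurable_root_MK, of S] 0 by simp
next
 case (Suc k)
 define T where "T = {x \<in> marked (Suc k). \<exists>u\<in>near_set d x. (fst x, snd x @ [u]) \<in> S}"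
 have "T \<in> sets (MK (Suc k))" unfolding T_def by (rule measurable_MK_ex[OF Suc.prems assms(2)])
 from Suc.IH[OF this] have "{g. \<exists>vs. (nt g, vs) \<in> T \<and> hd vs = rt g \<and> chain d (nt g) vs} \<in> sets borel" .
 moreover have "{g. \<exists>vs. (nt g, vs) \<in> T \<and> hd vs = rt g \<and> chain d (nt g) vs} = {g. \<exists>vs. (nt g, vs) \<in> S \<and> hd vs = rt g \<and> chain d (nt g) vs}"
 proof (intro set_eqI iffI)
  fix g assume "g \<in> {g. \<exists>vs. (nt g, vs) \<in> T \<and> hd vs = rt g \<and> chain d (nt g) vs}"
  then obtain vs u where vs: "(nt g, vs) \<in> marked (Suc k)" "u \<in> near_set d (nt g, vs)" "(nt g, vs @ [u]) \<in> S" "hd vs = rt g" "chain d (nt g) vs"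
   by (auto simp: T_def)
  then have "vs \<noteq> []" by (auto simp: marked_def)
  then have "chain d (nt g) (vs @ [u])" "hd (vs @ [u]) = rt g" using vs by (auto simp: chain_snoc near_set_def)
  then show "g \<in> {g. \<exists>vs. (nt g, vs) \<in> S \<and> hd vs = rt g \<and> chain d (nt g) vs}" using vs(3) by blast
 next
  fix g assume "g \<in> {g. \<exists>vs. (nt g, vs) \<in> S \<and> hd vs = rt g \<and> chain d (nt g) vs}"
  then obtain ws where ws: "(nt g, ws) \<in> S" "hd ws = rt g" "chain d (nt g) ws" by blast
  then have m: "(nt g, ws) \<in> marked (Suc (Suc k))" using sets.sets_into_space[OF Suc.prems] by auto
  then obtain vs u where wv: "ws = vs @ [u]" "length vs = Suc k" by (auto simp: marked_def length_Suc_conv_rev)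
  then have "vs \<noteq> []" by auto
  then have "(nt g, vs) \<in> T \<and> hd vs = rt g \<and> chain d (nt g) vs" using ws m unfolding T_def wv by (auto simp: chain_snoc near_set_def marked_def)
  then show "g \<in> {g. \<exists>vs. (nt g, vs) \<in> T \<and> hd vs = rt g \<and> chain d (nt g) vs}" by blast
 qed
 ultimately show ?case by simp
qed

section \<open>Finite patterns and measurability of the truncation map\<close>

lemma component_component:
 "component (component G v) v = component G v"
proof -
 have r: "reach (component G v) v u" if r0: "reach G v u" for u
 proof -
  obtain p where "is_path G v u p" using r0 unfolding reach_def by blast
  then show ?thesis
  proof (induction rule: path_induct)
   case single
   then show ?case by (intro reach_refl) (simp add: verts_component reach_refl)
  next
   case (snoc w p x)
   then have "reach G v x" using reach_step unfolding reach_def by blast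
   then show ?case using snoc by (intro reach_step[OF snoc.IH]) (auto simp: verts_component)
  qed
 qed
 have "verts (component (component G v) v) = verts (component G v)" using r by (auto simp: verts_component)
 then show ?thesis by (simp add: network.expand)
qed

lemma rooted_component_component: "rooted_component (component G v) v = rooted_component G v" by (simp add: rooted_component_def component_component)

text \<open>A breadth-first listing of the vertices within n steps. Each list is a prefix of the
  next, and every vertex but the first has a neighbour earlier in the list, as \<open>chain\<close>
  asks.\<close>

primrec enum :: "network \<Rightarrow> nat \<Rightarrow> nat \<Rightarrow> nat list" where
 "enum G v 0 = [v]"
| "enum G v (Suc n) = enum G v n @ sorted_list_of_set (steps G v (Suc n) - steps G v n)"

lemma enum_props:
 assumes G: "bounded_net M G" and v: "v \<in> verts G"
 shows "set (enum G v n) = steps G v n" "distinct (enum G v n)" "hd (enum G v n) = v" "enum G v n \<noteq> []"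
  "\<forall>j. 0 < j \<and> j < length (enum G v n) \<longrightarrow> (\<exists>i<j. wgt G (enum G v n ! i) (enum G v n ! j) \<noteq> 0)"
proof (induction n)
 case 0
 case 1 show ?case by simp
 case 2 show ?case by simp
 case 3 show ?case by simp
 case 4 show ?case by simp
 case 5 show ?case by auto
next
 case (Suc n)
 have fin: "finite (steps G v (Suc n) - steps G v n)" using finite_steps[OF G v, of "Suc n"] by blast
 case 1 show ?case using Suc(1) fin steps_mono[of n "Suc n" G v] by auto
 case 2 show ?case using Suc(1,2) fin by auto
 case 3 show ?case using Suc(3,4) by simp
 case 4 show ?case using Suc(4) by simp
 case 5 show ?case
 proof (intro allI impI)
  let ?L = "enum G v n" and ?N = "sorted_list_of_set (steps G v (Suc n) - steps G v n)"
  fix j assume j: "0 < j \<and> j < length (enum G v (Suc n))"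
  show "\<exists>i<j. wgt G (enum G v (Suc n) ! i) (enum G v (Suc n) ! j) \<noteq> 0"
  proof (cases "j < length ?L")
   case True
   then obtain i where "i < j" "wgt G (?L ! i) (?L ! j) \<noteq> 0" using Suc(5) j by blast
   then show ?thesis using True by (intro exI[of _ i]) (simp add: nth_append)
  next
   case False
   then have "(?L @ ?N) ! j = ?N ! (j - length ?L)" "j - length ?L < length ?N" using j by (auto simp: nth_append)
   then have "(?L @ ?N) ! j \<in> set ?N" by simp
   then have jn: "(?L @ ?N) ! j \<in> steps G v (Suc n) - steps G v n" unfolding set_sorted_list_of_set[OF fin] .
   then obtain u where u: "u \<in> steps G v n" "(?L @ ?N) ! j \<in> nb G u" unfolding steps.simps(2) by blast
   then obtain i where i: "i < length ?L" "?L ! i = u" using Suc(1) by (metis in_set_conv_nth)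
   then have "i < j" using False by simp
   then show ?thesis using i u(2) by (intro exI[of _ i]) (simp add: nth_append nb_def)
  qed
 qed
qed

lemma reach_in_steps:
 assumes "reach G v u"
 obtains n where "\<And>m. n \<le> m \<Longrightarrow> u \<in> steps G v m"
proof -
 obtain p where "is_path G v u p" using assms unfolding reach_def by blast
 then have "u \<in> steps G v (length p - 1)" by (rule path_steps)
 then show thesis using that[of "length p - 1"] steps_mono by blast
qed

lemma steps_reach:
 assumes "v \<in> verts G" "u \<in> steps G v n"
 shows "reach G v u" using assms(2)
proof (induction n arbitrary: u)
 case 0
 then show ?case using assms(1) by (simp add: reach_refl)
next
 case (Suc n)
 then consider "u \<in> steps G v n" | w where "w \<in> steps G v n" "u \<in> nb G w" by auto
 then show ?case
 proof cases
  case 1 then show ?thesis by (rule Suc.IH)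
 next
  case 2 then show ?thesis using Suc.IH by (auto simp: nb_def intro: reach_step)
 qed
qed

text \<open>Finite rational patterns: \<open>k\<close> vertices, approximate weights \<open>W\<close>, accuracy \<open>e\<close>; the first \<open>m\<close>
 vertices have no further neighbours with weight at least \<open>e\<close>.\<close>

definition pattern :: "real \<Rightarrow> nat \<Rightarrow> nat \<Rightarrow> (nat \<Rightarrow> nat \<Rightarrow> complex) \<Rightarrow> real \<Rightarrow> (network \<times> nat list) set" where
 "pattern \<theta> k m W e = {x \<in> marked k. distinct (snd x) \<and>
   (\<forall>i<k. \<forall>j<k. cmod (wgt (truncate \<theta> (fst x)) (snd x ! i) (snd x ! j) - W i j) < e) \<and>
   (\<forall>i<m. \<forall>u\<in>verts (fst x). u \<notin> set (snd x) \<longrightarrow> cmod (wgt (truncate \<theta> (fst x)) (snd x ! i) u) < e)}"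

lemma measurable_MK_trunc:
 assumes \<theta>: "0 < \<theta>" and ij: "i < k" "j < k"
 shows "(\<lambda>x. wgt (truncate \<theta> (fst x)) (snd x ! i) (snd x ! j)) \<in> borel_measurable (MK k)"
proof -
 have [measurable]: "chi_tilde \<theta> \<in> borel_measurable borel" "chi \<theta> \<in> borel_measurable borel"
  by (rule borel_measurable_continuous_onI, rule continuous_chi_tilde, rule borel_measurable_continuous_onI, rule continuous_chi[OF \<theta>])
 note [measurable] = measurable_MK_wgt[OF ij] measurable_MK_deg[OF ij(1)] measurable_MK_deg[OF ij(2)]
 show ?thesis unfolding truncate_def wgt_tilde_def network.sel by measurable
qed

text \<open>The universal condition on further neighbours is the complement of \<open>D\<close>. A
  counterexample has positive truncated weight, hence weight at least \<theta> > \<theta>/2, so it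
  is found in \<open>near_set\<close> and \<open>measurable_MK_ex\<close> applies.\<close>

lemma pattern_sets:
 assumes \<theta>: "0 < \<theta>" and m: "m \<le> k" and e: "0 < e"
 shows "pattern \<theta> k m W e \<in> sets (MK k)"
proof -
 note [measurable] = measurable_MK_trunc[OF \<theta>]
 have A: "{x \<in> marked k. distinct (snd x)} \<in> sets (MK k)"
 proof -
  have "{x \<in> marked k. distinct (snd x)} = {x \<in> space (MK k). \<forall>i\<in>{..<k}. \<forall>j\<in>{..<k} - {i}. snd x ! i \<noteq> snd x ! j}"
   by (auto simp: marked_def distinct_conv_nth)
  also have "\<dots> \<in> sets (MK k)" using measurable_MK_neq[of _ k] by (intro sets.sets_Collect_finite_All) auto
  finally show ?thesis .
 qed
 have B: "{x \<in> space (MK k). \<forall>i\<in>{..<k}. \<forall>j\<in>{..<k}. cmod (wgt (truncate \<theta> (fst x)) (snd x ! i) (snd x ! j) - W i j) < e} \<in> sets (MK k)"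
  by (intro sets.sets_Collect_finite_All borel_measurable_less) (auto intro!: measurable_MK_trunc[OF \<theta>] borel_measurable_diff borel_measurable_norm)
 have C: "{x \<in> marked k. \<exists>u\<in>near_set (\<theta> / 2) x. (fst x, snd x @ [u]) \<in> Q i} \<in> sets (MK k)"
  if Q: "Q i = {y \<in> marked (Suc k). (\<forall>j<k. snd y ! k \<noteq> snd y ! j) \<and> e \<le> cmod (wgt (truncate \<theta> (fst y)) (snd y ! i) (snd y ! k))}" and i: "i < m" for i Q
 proof (rule measurable_MK_ex)
  have "{y \<in> space (MK (Suc k)). \<forall>j\<in>{..<k}. snd y ! k \<noteq> snd y ! j} \<in> sets (MK (Suc k))"
   using measurable_MK_neq[of k "Suc k"] by (intro sets.sets_Collect_finite_All) auto
  moreover have "{y \<in> space (MK (Suc k)). e \<le> cmod (wgt (truncate \<theta> (fst y)) (snd y ! i) (snd y ! k))} \<in> sets (MK (Suc k))"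
   using i m by (intro borel_measurable_le borel_measurable_norm measurable_MK_trunc[OF \<theta>]) auto
  ultimately have "{y \<in> space (MK (Suc k)). \<forall>j\<in>{..<k}. snd y ! k \<noteq> snd y ! j}
    \<inter> {y \<in> space (MK (Suc k)). e \<le> cmod (wgt (truncate \<theta> (fst y)) (snd y ! i) (snd y ! k))} \<in> sets (MK (Suc k))" by (rule sets.Int)
  moreover have "{y \<in> space (MK (Suc k)). \<forall>j\<in>{..<k}. snd y ! k \<noteq> snd y ! j}
    \<inter> {y \<in> space (MK (Suc k)). e \<le> cmod (wgt (truncate \<theta> (fst y)) (snd y ! i) (snd y ! k))} = Q i" unfolding Q by auto
  ultimately show "Q i \<in> sets (MK (Suc k))" by simp
 qed (use \<theta> in simp)
 define Q where "Q i = {y \<in> marked (Suc k). (\<forall>j<k. snd y ! k \<noteq> snd y ! j) \<and> e \<le> cmod (wgt (truncate \<theta> (fst y)) (snd y ! i) (snd y ! k))}" for i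
 define D where "D = (\<Union>i\<in>{..<m}. {x \<in> marked k. \<exists>u\<in>near_set (\<theta> / 2) x. (fst x, snd x @ [u]) \<in> Q i})"
 have D: "D \<in> sets (MK k)" unfolding D_def 
 proof (rule sets.finite_UN)
  fix i assume "i \<in> {..<m}"
  then show "{x \<in> marked k. \<exists>u\<in>near_set (\<theta> / 2) x. (fst x, snd x @ [u]) \<in> Q i} \<in> sets (MK k)" using C[where Q=Q, OF Q_def] by blast
 qed simp
 have "x \<in> D \<longleftrightarrow> (\<exists>i<m. \<exists>u\<in>verts (fst x). u \<notin> set (snd x) \<and> e \<le> cmod (wgt (truncate \<theta> (fst x)) (snd x ! i) u))" if x: "x \<in> marked k" for x
 proof -
  have len: "length (snd x) = k" using x by (auto simp: marked_def)
  have near: "u \<in> near_set (\<theta> / 2) x" if "i < m" "u \<in> verts (fst x)" "e \<le> cmod (wgt (truncate \<theta> (fst x)) (snd x ! i) u)" for i u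
  proof -
   have "\<theta> \<le> cmod (wgt (fst x) (snd x ! i) u)"
   proof (rule wgt_tr_nonzero(1))
    show "wgt (tr 0 \<theta> (fst x)) (snd x ! i) u \<noteq> 0" using that(3) e by (auto simp: truncate_eq_tr)
   qed
   then show ?thesis using that len m \<theta> unfolding near_set_def by (auto intro!: bexI[of _ "snd x ! i"])
  qed
  have mem: "(fst x, snd x @ [u]) \<in> Q i \<longleftrightarrow> u \<notin> set (snd x) \<and> e \<le> cmod (wgt (truncate \<theta> (fst x)) (snd x ! i) u)" if "i < m" "u \<in> verts (fst x)" for i u
  proof -
   have "(fst x, snd x @ [u]) \<in> marked (Suc k)" using x that by (auto simp: marked_def)
   moreover have "(\<forall>j<k. u \<noteq> snd x ! j) \<longleftrightarrow> u \<notin> set (snd x)" using len by (metis in_set_conv_nth)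
   moreover have "i < k" using that m by simp
   ultimately show ?thesis using len by (simp add: Q_def nth_append)
  qed
  show ?thesis
  proof
   assume "x \<in> D"
   then obtain i u where "i < m" "u \<in> near_set (\<theta> / 2) x" "(fst x, snd x @ [u]) \<in> Q i" by (auto simp: D_def)
   then show "\<exists>i<m. \<exists>u\<in>verts (fst x). u \<notin> set (snd x) \<and> e \<le> cmod (wgt (truncate \<theta> (fst x)) (snd x ! i) u)"
    using mem[of i u] by (auto simp: near_set_def)
  next
   assume "\<exists>i<m. \<exists>u\<in>verts (fst x). u \<notin> set (snd x) \<and> e \<le> cmod (wgt (truncate \<theta> (fst x)) (snd x ! i) u)"
   then obtain i u where "i < m" "u \<in> verts (fst x)" "u \<notin> set (snd x) \<and> e \<le> cmod (wgt (truncate \<theta> (fst x)) (snd x ! i) u)" by blast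
   then show "x \<in> D" using mem[of i u] near[of i u] x unfolding D_def by blast
  qed
 qed
 then have mD: "x \<in> D \<longleftrightarrow> \<not> (\<forall>i<m. \<forall>u\<in>verts (fst x). u \<notin> set (snd x) \<longrightarrow> cmod (wgt (truncate \<theta> (fst x)) (snd x ! i) u) < e)"
  if "x \<in> marked k" for x using that by (meson not_le)
 have "pattern \<theta> k m W e = {x \<in> marked k. distinct (snd x)}
   \<inter> {x \<in> space (MK k). \<forall>i\<in>{..<k}. \<forall>j\<in>{..<k}. cmod (wgt (truncate \<theta> (fst x)) (snd x ! i) (snd x ! j) - W i j) < e} - D"
 proof (rule set_eqI)
  fix x
  show "x \<in> pattern \<theta> k m W e \<longleftrightarrow> x \<in> {x \<in> marked k. distinct (snd x)}
   \<inter> {x \<in> space (MK k). \<forall>i\<in>{..<k}. \<forall>j\<in>{..<k}. cmod (wgt (truncate \<theta> (fst x)) (snd x ! i) (snd x ! j) - W i j) < e} - D"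
   using mD[of x] unfolding pattern_def by (cases "x \<in> marked k") (simp_all add: Ball_def, blast)
 qed
 then show ?thesis using A B D by auto
qed

lemma complex_rational_approx:
 assumes "0 < e"
 obtains q :: "rat \<times> rat" where "cmod (Complex (of_rat (fst q)) (of_rat (snd q)) - z) < e"
proof -
 obtain a where a: "Re z - e/2 < of_rat a" "of_rat a < Re z + e/2" using of_rat_dense[of "Re z - e/2" "Re z + e/2"] assms by auto
 obtain b where b: "Im z - e/2 < of_rat b" "of_rat b < Im z + e/2" using of_rat_dense[of "Im z - e/2" "Im z + e/2"] assms by auto
 have "cmod (Complex (of_rat a) (of_rat b) - z) \<le> \<bar>of_rat a - Re z\<bar> + \<bar>of_rat b - Im z\<bar>" using cmod_le[of "Complex (of_rat a) (of_rat b) - z"] by simp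
 also have "\<dots> < e" using a b by (simp add: abs_less_iff)
 finally show thesis using that[of "(a, b)"] by simp
qed

text \<open>The parameters form a countable type. \<open>Suc k\<close> is the number of vertices, so
  that there is always a root, and \<open>l\<close> holds the rational approximations of the weights
  row by row.\<close>

definition pattern_class :: "real \<Rightarrow> nat \<times> nat \<times> (rat \<times> rat) list \<times> nat \<Rightarrow> gstar set" where
 "pattern_class \<theta> P = (case P of (k, m, l, n) \<Rightarrow>
   {g. \<exists>vs. (nt g, vs) \<in> pattern \<theta> (Suc k) (min m (Suc k))
        (\<lambda>i j. Complex (of_rat (fst (l ! (i * Suc k + j)))) (of_rat (snd (l ! (i * Suc k + j))))) (1 / Suc n)
     \<and> hd vs = rt g \<and> chain (\<theta> / 2) (nt g) vs})"

lemma pattern_class_sets: "0 < \<theta> \<Longrightarrow> pattern_class \<theta> P \<in> sets borel"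
 unfolding pattern_class_def by (cases P) (auto intro!: measurable_chain_ex pattern_sets)

text \<open>If every pattern around \<open>g\<close> had a counterexample, a sequence of counterexamples for finer and
 larger patterns would converge to the truncation of \<open>g\<close>.\<close>

lemma pattern_class_base:
 assumes \<theta>: "0 < \<theta>" and U: "open U" and gU: "truncate_class \<theta> g \<in> U"
 shows "\<exists>P. g \<in> pattern_class \<theta> P \<and> pattern_class \<theta> P \<subseteq> truncate_class \<theta> -` U"
proof (rule ccontr)
 assume no: "\<not> ?thesis"
 define K where "K = truncate \<theta> (nt g)"
 have Kb: "bounded_net (1 / \<theta> ^ 3) K" unfolding K_def truncate_eq_tr by (rule bounded_net_tr) (use rep_network \<theta> in auto)
 have Kn: "is_network K" by (rule is_network_bounded_net[OF Kb])
 have vK: "verts K = verts (nt g)" by (simp add: K_def truncate_eq_tr)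
 have oK: "rt g \<in> verts K" by (simp add: vK rep_root)
 \<comment> \<open>\<open>L n\<close> lists the vertices within n + 1 steps, and its first
   \<open>m n\<close> entries are those within n steps. All neighbours of the latter are listed,
   which gives the closing condition of the pattern.\<close>
 define L where "L n = enum K (rt g) (Suc n)" for n
 define m where "m n = length (enum K (rt g) n)" for n
 note en = enum_props[OF Kb oK]
 have L: "set (L n) = steps K (rt g) (Suc n)" "distinct (L n)" "hd (L n) = rt g" "L n \<noteq> []" for n unfolding L_def by (rule en)+
 have Lm: "set (take (m n) (L n)) = steps K (rt g) n" "m n \<le> length (L n)" for n using en(1)[of n] by (simp_all add: L_def m_def)
 have Lchain: "chain (\<theta> / 2) (nt g) (L n)" for n unfolding chain_def
 proof (intro allI impI)
  fix j assume "0 < j \<and> j < length (L n)"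
  then obtain i where i: "i < j" "wgt K (L n ! i) (L n ! j) \<noteq> 0" using en(5) unfolding L_def by blast
  then have "\<theta> \<le> cmod (wgt (nt g) (L n ! i) (L n ! j))" using wgt_tr_nonzero(1) unfolding K_def truncate_eq_tr by blast
  then show "\<exists>i<j. \<theta> / 2 < cmod (wgt (nt g) (L n ! i) (L n ! j))" using i(1) \<theta> by (intro exI[of _ i]) simp
 qed
 have "\<exists>g' vs W. truncate_class \<theta> g' \<notin> U \<and> (nt g', vs) \<in> pattern \<theta> (length (L n)) (m n) W (1 / Suc n)
   \<and> hd vs = rt g' \<and> (nt g, L n) \<in> pattern \<theta> (length (L n)) (m n) W (1 / Suc n)" for n
 proof -
  obtain k where k: "length (L n) = Suc k" using L(4)[of n] by (cases "L n") auto
  have "\<exists>q. cmod (Complex (of_rat (fst q)) (of_rat (snd q)) - wgt K (L n ! i) (L n ! j)) < 1 / Suc n" for i j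
   using complex_rational_approx[of "1 / Suc n"] by (metis of_nat_0_less_iff zero_less_Suc zero_less_divide_1_iff)
  then obtain q where q: "\<And>i j. cmod (Complex (of_rat (fst (q i j))) (of_rat (snd (q i j))) - wgt K (L n ! i) (L n ! j)) < 1 / Suc n" by metis
  \<comment> \<open>Row-major storage, matching the lookup in \<open>pattern_class\<close>.\<close>
  define l where "l = map (\<lambda>t. q (t div Suc k) (t mod Suc k)) [0..<Suc k * Suc k]"
  have l: "l ! (i * Suc k + j) = q i j" if "i < Suc k" "j < Suc k" for i j
  proof -
   have "i * Suc k + j < i * Suc k + Suc k" using that by simp
   also have "\<dots> = Suc i * Suc k" by simp
   also have "\<dots> \<le> Suc k * Suc k" by (rule mult_le_mono1) (use that in simp)
   finally have "i * Suc k + j < Suc k * Suc k" .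
   moreover have "(i * Suc k + j) div Suc k = i" "(i * Suc k + j) mod Suc k = j" using that(2) by (simp_all add: div_mult_self3 del: mult_Suc_right)
   ultimately show ?thesis unfolding l_def by (simp del: mult_Suc_right mult_Suc)
  qed
  define W where "W = (\<lambda>i j. Complex (of_rat (fst (l ! (i * Suc k + j)))) (of_rat (snd (l ! (i * Suc k + j)))))"
  have min: "min (m n) (Suc k) = m n" using Lm(2)[of n] k by simp
  have gp: "(nt g, L n) \<in> pattern \<theta> (Suc k) (m n) W (1 / Suc n)" unfolding pattern_def mem_Collect_eq fst_conv snd_conv K_def[symmetric]
  proof (intro conjI allI impI ballI)
   show "(nt g, L n) \<in> marked (Suc k)" using L(1)[of n] steps_verts[OF oK, of "Suc n"] k vK by (auto simp: marked_def rep_network)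
   show "distinct (L n)" by (rule L)
   fix i j assume "i < Suc k" "j < Suc k"
   then show "cmod (wgt K (L n ! i) (L n ! j) - W i j) < 1 / Suc n" unfolding W_def using q[of i j] by (simp only: l norm_minus_commute)
  next
   fix i u assume i: "i < m n" and u: "u \<in> verts (nt g)" "u \<notin> set (L n)"
   have "L n ! i \<in> set (take (m n) (L n))" using i Lm(2)[of n] by (metis in_set_conv_nth length_take min.absorb2 nth_take)
   then have "L n ! i \<in> steps K (rt g) n" using Lm(1) by simp
   then have "wgt K (L n ! i) u = 0" using u vK unfolding L(1) by (auto simp: nb_def)
   then show "cmod (wgt K (L n ! i) u) < 1 / Suc n" by simp
  qed
  then have "g \<in> pattern_class \<theta> (k, m n, l, n)" unfolding pattern_class_def prod.case min W_def using L(3) Lchain by blast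
  then have "\<not> pattern_class \<theta> (k, m n, l, n) \<subseteq> truncate_class \<theta> -` U" using no by blast
  then obtain g' where g': "g' \<in> pattern_class \<theta> (k, m n, l, n)" "truncate_class \<theta> g' \<notin> U" by auto
  then obtain vs where "(nt g', vs) \<in> pattern \<theta> (Suc k) (m n) W (1 / Suc n)" "hd vs = rt g'" unfolding pattern_class_def prod.case min W_def by blast
  then show ?thesis using g'(2) gp unfolding k by blast
 qed
 then obtain g' vs W where bad: "\<And>n. truncate_class \<theta> (g' n) \<notin> U"
  and p': "\<And>n. (nt (g' n), vs n) \<in> pattern \<theta> (length (L n)) (m n) (W n) (1 / Suc n)"
  and hd': "\<And>n. hd (vs n) = rt (g' n)"
  and p: "\<And>n. (nt g, L n) \<in> pattern \<theta> (length (L n)) (m n) (W n) (1 / Suc n)" by metis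
 define H where "H n = truncate \<theta> (nt (g' n))" for n
 have Hn: "is_network (H n)" for n unfolding H_def truncate_eq_tr by (rule is_network_tr) (use rep_network \<theta> in auto)
 have vH: "verts (H n) = verts (nt (g' n))" for n by (simp add: H_def truncate_eq_tr)
 have len: "length (vs n) = length (L n)" and vsv: "set (vs n) \<subseteq> verts (H n)" and dist: "distinct (vs n)" for n
  using p'[of n] vH[of n] by (auto simp: pattern_def marked_def)
 define idx where "idx n u = (THE i. i < length (L n) \<and> L n ! i = u)" for n u
 have idx: "idx n (L n ! i) = i" if "i < length (L n)" for n i
  unfolding idx_def by (rule the_equality) (use that L(2)[of n] in \<open>auto simp: nth_eq_iff_index_eq\<close>)
 \<comment> \<open>Pairs the i-th vertex listed around g with the i-th vertex of the counterexample.
   Both lists fit the same pattern up to 1 / Suc n, hence the error 2 / Suc n between their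
   weights.\<close>
 define \<sigma> where "\<sigma> n u = vs n ! idx n u" for n u
 have \<sigma>: "\<sigma> n (L n ! i) = vs n ! i" if "i < length (L n)" for n i by (simp add: \<sigma>_def idx[OF that])
 have inL: "\<exists>i<length (L n). L n ! i = u" if "u \<in> set (L n)" for n u using that by (simp add: in_set_conv_nth)
 have \<sigma>v: "\<sigma> n u \<in> verts (H n)" if u: "u \<in> set (L n)" for n u
 proof -
  obtain i where i: "i < length (L n)" "L n ! i = u" using inL[OF u] by blast
  then have "\<sigma> n u = vs n ! i" using \<sigma> by blast
  then show ?thesis using vsv[of n] len[of n] i(1) by (metis nth_mem subsetD)
 qed
 have \<sigma>o: "\<sigma> n (rt g) = rt (g' n)" for n
 proof -
  have "0 < length (L n)" "L n ! 0 = rt g" using L(3,4)[of n] by (auto simp: hd_conv_nth)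
  then have "\<sigma> n (rt g) = vs n ! 0" using \<sigma>[of 0 n] by simp
  also have "\<dots> = rt (g' n)" using hd'[of n] len[of n] L(4)[of n] by (metis hd_conv_nth length_0_conv)
  finally show ?thesis .
 qed
 have close: "cmod (wgt (H n) (\<sigma> n u) (\<sigma> n v) - wgt K u v) < 2 / Suc n" if uv: "u \<in> set (L n)" "v \<in> set (L n)" for n u v
 proof -
  obtain i where i: "i < length (L n)" "L n ! i = u" using inL[OF uv(1)] by blast
  obtain j where j: "j < length (L n)" "L n ! j = v" using inL[OF uv(2)] by blast
  have "cmod (wgt (H n) (vs n ! i) (vs n ! j) - W n i j) < 1 / Suc n" "cmod (wgt K (L n ! i) (L n ! j) - W n i j) < 1 / Suc n"
   using p'[of n] p[of n] i(1) j(1) unfolding pattern_def H_def K_def by auto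
  moreover have "\<sigma> n u = vs n ! i" "\<sigma> n v = vs n ! j" using \<sigma> i j by blast+
  ultimately show ?thesis
   using norm_triangle_ineq4[of "wgt (H n) (vs n ! i) (vs n ! j) - W n i j" "wgt K (L n ! i) (L n ! j) - W n i j"] i(2) j(2) by simp
 qed
 \<comment> \<open>The truncation may disconnect the network; the lists exhaust the component of the
   root, and the class depends on it alone.\<close>
 define G where "G = component K (rt g)"
 have vG: "verts G = {u \<in> verts K. reach K (rt g) u}" by (simp add: G_def verts_component)
 have Gr: "is_rooted (Rooted G (rt g))" unfolding G_def by (rule is_rooted_component[OF Kn oK])
 have ev_in: "\<forall>\<^sub>F n in sequentially. u \<in> steps K (rt g) n" if u: "u \<in> verts G" for u
 proof -
  have "reach K (rt g) u" using u vG by simp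
  then obtain N where "\<And>k. N \<le> k \<Longrightarrow> u \<in> steps K (rt g) k" by (rule reach_in_steps) blast
  then show ?thesis by (auto simp: eventually_sequentially)
 qed
 have sub: "steps K (rt g) n \<subseteq> set (L n)" for n unfolding L(1) by (rule steps_mono) simp
 have LG: "set (L n) \<subseteq> verts G" for n unfolding L(1) vG using steps_reach[OF oK] steps_verts[OF oK] by blast
 have to0: "(\<lambda>n. 2 / real (Suc n)) \<longlonglongrightarrow> 0" using LIMSEQ_Suc[OF lim_const_over_n[of 2]] by simp
 have conv: "net_conv sequentially G H \<sigma>" unfolding net_conv_def
 proof (intro conjI ballI allI impI)
  fix u assume u: "u \<in> verts G"
  show "\<forall>\<^sub>F n in sequentially. \<sigma> n u \<in> verts (H n)" using ev_in[OF u] by eventually_elim (use sub \<sigma>v in blast)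
 next
  fix u v assume uv: "u \<in> verts G" "v \<in> verts G" "u \<noteq> v"
  from ev_in[OF uv(1)] ev_in[OF uv(2)] show "\<forall>\<^sub>F n in sequentially. \<sigma> n u \<noteq> \<sigma> n v"
  proof eventually_elim
   case (elim n)
   obtain i where i: "i < length (L n)" "L n ! i = u" using inL[of u n] elim sub by blast
   obtain j where j: "j < length (L n)" "L n ! j = v" using inL[of v n] elim sub by blast
   have "\<sigma> n u = vs n ! i" "\<sigma> n v = vs n ! j" using \<sigma> i j by blast+
   moreover have "i \<noteq> j" using i j uv(3) by blast
   ultimately show ?case using dist[of n] len[of n] i(1) j(1) by (simp add: nth_eq_iff_index_eq)
  qed
 next
  fix u v assume uv: "u \<in> verts G" "v \<in> verts G"
  show "(\<lambda>n. wgt (H n) (\<sigma> n u) (\<sigma> n v)) \<longlonglongrightarrow> wgt G u v"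
  proof (rule LIM_zero_cancel, rule Lim_null_comparison[OF _ to0])
   from ev_in[OF uv(1)] ev_in[OF uv(2)] show "\<forall>\<^sub>F n in sequentially. norm (wgt (H n) (\<sigma> n u) (\<sigma> n v) - wgt G u v) \<le> 2 / real (Suc n)"
   proof eventually_elim
    case (elim n)
    then have "u \<in> set (L n)" "v \<in> set (L n)" using sub by blast+
    from close[OF this] show ?case by (simp add: G_def)
   qed
  qed
 next
  fix u d assume u: "u \<in> verts G" and d: "(0::real) < d"
  have "\<forall>\<^sub>F n in sequentially. 2 / real (Suc n) < d / 2" using to0 d by (intro order_tendstoD) auto
  with ev_in[OF u] show "\<forall>\<^sub>F n in sequentially. \<forall>w\<in>verts (H n). d \<le> cmod (wgt (H n) (\<sigma> n u) w) \<longrightarrow> (\<exists>v\<in>verts G. w = \<sigma> n v \<and> d / 2 \<le> cmod (wgt G u v))"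
  proof eventually_elim
   case (elim n)
   show ?case
   proof (intro ballI impI)
    fix w assume w: "w \<in> verts (H n)" "d \<le> cmod (wgt (H n) (\<sigma> n u) w)"
    obtain i where i: "i < length (take (m n) (L n))" "take (m n) (L n) ! i = u" using elim(1) unfolding Lm(1)[symmetric] in_set_conv_nth by blast
    then have i': "i < m n" "i < length (L n)" "L n ! i = u" by auto
    have "1 / real (Suc n) \<le> 2 / real (Suc n)" by (simp add: divide_right_mono)
    then have "\<not> cmod (wgt (H n) (vs n ! i) w) < 1 / real (Suc n)" using w(2) elim(2) d \<sigma>[OF i'(2)] i'(3) by auto
    then have "w \<in> set (vs n)" using p'[of n] i'(1) w(1) unfolding pattern_def H_def vH[of n, unfolded H_def] by auto
    then obtain j where j: "j < length (L n)" "w = vs n ! j" by (metis in_set_conv_nth len)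
    then have wv: "w = \<sigma> n (L n ! j)" using \<sigma> by simp
    have mem: "L n ! j \<in> set (L n)" "u \<in> set (L n)" using j i' by auto
    have "cmod (wgt (H n) (\<sigma> n u) w) \<le> cmod (wgt K u (L n ! j)) + cmod (wgt (H n) (\<sigma> n u) w - wgt K u (L n ! j))" by (rule norm_triangle_sub)
    then have "d / 2 \<le> cmod (wgt K u (L n ! j))" using close[OF mem(2,1)] w(2) elim(2) unfolding wv by linarith
    then show "\<exists>v\<in>verts G. w = \<sigma> n v \<and> d / 2 \<le> cmod (wgt G u v)" using wv LG mem(1) by (intro bexI[of _ "L n ! j"]) (auto simp: G_def)
   qed
  qed
 qed
 have Gnet: "is_network G" "rt g \<in> verts G" using Gr by (simp_all add: is_rooted_def)
 have fin: "finite (bl G (rt g) t)" for t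
 proof -
  have "bl K (id (rt g)) t = id ` bl G (rt g) t" by (rule embeds_bl[OF embeds_component[OF oK, folded G_def] Gnet(2)])
  then show ?thesis using finite_bl[OF Kb _ oK, of t] \<theta> by simp
 qed
 have "(\<lambda>n. d_loc (rooted_component G (rt g)) (rooted_component (H n) (\<sigma> n (rt g)))) \<longlonglongrightarrow> 0"
  by (rule net_conv_d_loc[OF Gnet(1) Hn Gnet(2) _ conv fin]) (simp add: \<sigma>o vH rep_root)
 moreover have "rooted_component G (rt g) = truncate_class \<theta> g" by (simp add: G_def rooted_component_component truncate_class_def K_def)
 moreover have "rooted_component (H n) (\<sigma> n (rt g)) = truncate_class \<theta> (g' n)" for n by (simp add: \<sigma>o truncate_class_def H_def)
 ultimately have lim: "(\<lambda>n. d_loc (truncate_class \<theta> g) (truncate_class \<theta> (g' n))) \<longlonglongrightarrow> 0" by simp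
 obtain r where r: "r > 0" "\<And>h. d_loc (truncate_class \<theta> g) h < r \<Longrightarrow> h \<in> U" using U gU unfolding open_gstar_def by blast
 have "\<forall>\<^sub>F n in sequentially. d_loc (truncate_class \<theta> g) (truncate_class \<theta> (g' n)) < r" using lim r(1) by (rule order_tendstoD)
 then obtain n where "d_loc (truncate_class \<theta> g) (truncate_class \<theta> (g' n)) < r" by (auto simp: eventually_sequentially)
 then show False using r(2) bad by blast
qed

text \<open>By \<open>pattern_class_base\<close> the preimage of an open set is the union of the
  pattern classes inside it, and there are countably many of them.\<close>

theorem measurable_truncate_class:
 assumes "0 < \<theta>"
 shows "truncate_class \<theta> \<in> measurable borel borel"
proof (rule borel_measurableI)
 fix U :: "gstar set" assume U: "open U"
 have "truncate_class \<theta> -` U \<inter> space borel = (\<Union>P\<in>{P. pattern_class \<theta> P \<subseteq> truncate_class \<theta> -` U}. pattern_class \<theta> P)"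
  using pattern_class_base[OF assms U] by (intro set_eqI) (simp, blast)
 also have "\<dots> \<in> sets borel" by (rule sets.countable_UN') (auto intro!: pattern_class_sets[OF assms])
 finally show "truncate_class \<theta> -` U \<inter> space borel \<in> sets borel" .
qed

section \<open>Truncation of a bounded network as \<theta> tends to 0\<close>

lemma bounded_net_tr_same:
 assumes "bounded_net M G" "0 \<le> \<theta>"
 shows "bounded_net M (tr d \<theta> G)" unfolding bounded_net_def verts_tr
proof (intro conjI ballI)
 show "hermitian_on (verts G) (wgt (tr d \<theta> G))" by (rule hermitian_tr[OF is_network_bounded_net[OF assms(1)]])
 fix u assume u: "u \<in> verts G"
 have fin: "finite (nb G u)" using assms u by (simp add: bounded_net_def)
 have sub: "nb (tr d \<theta> G) u \<subseteq> nb G u" by (auto simp: nb_def wgt_tr trw_def)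
 show "finite (nb (tr d \<theta> G) u)" by (rule finite_subset[OF sub fin])
 have "(\<Sum>v\<in>nb (tr d \<theta> G) u. cmod (wgt (tr d \<theta> G) u v)) \<le> (\<Sum>v\<in>nb (tr d \<theta> G) u. cmod (wgt G u v))" by (intro sum_mono wgt_tr_le assms(2))
 also have "\<dots> \<le> (\<Sum>v\<in>nb G u. cmod (wgt G u v))" by (rule sum_mono2[OF fin sub]) simp
 also have "\<dots> \<le> M" using assms u by (simp add: bounded_net_def)
 finally show "(\<Sum>v\<in>nb (tr d \<theta> G) u. cmod (wgt (tr d \<theta> G) u v)) \<le> M" .
qed

lemma wgt_tr_eventually:
 assumes G: "is_network G" and u: "u \<in> verts G" "v \<in> verts G"
 shows "\<forall>\<^sub>F \<theta> in at_right 0. \<forall>d\<ge>0. wgt (tr d \<theta> G) u v = wgt G u v"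
proof (cases "wgt G u v = 0")
 case True
 then show ?thesis by (simp add: wgt_tr trw_def)
next
 case False
 define D where "D = max (deg G u) (deg G v)"
 have D0: "0 \<le> D" unfolding D_def degd_0[symmetric] by (simp add: degd_nonneg le_max_iff_disj)
 \<comment> \<open>\<theta> <= 1 and \<theta> < 1/(D + 1) give 1/\<theta>^2 > D + 1, the range where
   \<open>chi_tilde\<close> is 1 at degrees up to D; \<theta> below half the weight makes
   \<open>chi\<close> equal to 1.\<close>
 have "0 < min (min 1 (1 / (D + 1))) (cmod (wgt G u v) / 2)" using False D0 by simp
 from eventually_at_right_small[OF this] show ?thesis
 proof eventually_elim
  case (elim \<theta>)
  show ?case
  proof (intro allI impI)
   fix d :: real assume d: "0 \<le> d"
   have "\<theta> * (D + 1) < 1" using elim D0 by (simp add: field_simps)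
   moreover have "1 / (D + 1) \<le> 1" using D0 by simp
   then have "\<theta> \<le> 1" using elim by linarith
   then have "\<theta> * (\<theta> * (D + 1)) \<le> 1 * (\<theta> * (D + 1))" using elim D0 by (intro mult_right_mono) auto
   ultimately have "\<theta> * (\<theta> * (D + 1)) < 1" by linarith
   then have "D + 1 < 1 / \<theta>\<^sup>2" using elim by (simp add: field_simps power2_eq_square)
   moreover have "max (degd d G u) (degd d G v) \<le> D" unfolding D_def using degd_le_deg[OF G _ d] u by (intro max.mono) auto
   ultimately have "chi_tilde \<theta> (max (degd d G u) (degd d G v)) = 1" by (simp add: chi_tilde_def)
   then have "trw d \<theta> G u v = wgt G u v" by (simp add: trw_def)
   moreover have "chi \<theta> (cmod (wgt G u v)) = 1" using elim by (intro chi_eq_1) auto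
   ultimately show "wgt (tr d \<theta> G) u v = wgt G u v" by (simp add: wgt_tr)
  qed
 qed
qed

lemma bounded_net_walks_tr_tendsto:
 assumes G: "bounded_net M G" and u: "u \<in> verts G" and d: "\<And>\<theta>. 0 < \<theta> \<Longrightarrow> 0 \<le> d \<theta>"
 shows "\<forall>\<^sub>F \<theta> in at_right 0. walks (tr (d \<theta>) \<theta> G) k u v = walks G k u v" using u
proof (induction k arbitrary: u)
 case (Suc k)
 have fin: "finite (nb G u)" using G Suc.prems by (simp add: bounded_net_def)
 have sub: "nb (tr d \<theta> G) u \<subseteq> nb G u" for d \<theta> by (auto simp: nb_def wgt_tr trw_def)
 have "\<forall>\<^sub>F \<theta> in at_right 0. \<forall>w\<in>nb G u. walks (tr (d \<theta>) \<theta> G) k w v = walks G k w v"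
  using fin Suc.IH by (intro eventually_ball_finite) (auto simp: nb_def)
 moreover have "\<forall>\<^sub>F \<theta> in at_right 0. \<forall>w\<in>nb G u. \<forall>d\<ge>0. wgt (tr d \<theta> G) u w = wgt G u w"
  using fin Suc.prems by (intro eventually_ball_finite ballI wgt_tr_eventually is_network_bounded_net[OF G]) (auto simp: nb_def)
 moreover have "\<forall>\<^sub>F \<theta> in at_right (0::real). 0 < \<theta>" by (rule eventually_at_right_less)
 ultimately show ?case
 proof eventually_elim
  case (elim \<theta>)
  have "walks (tr (d \<theta>) \<theta> G) (Suc k) u v = (\<Sum>w\<in>nb G u. wgt (tr (d \<theta>) \<theta> G) u w * walks (tr (d \<theta>) \<theta> G) k w v)"
   unfolding walks.simps by (rule sum.mono_neutral_left[OF fin sub]) (auto simp: nb_def)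
  also have "\<dots> = (\<Sum>w\<in>nb G u. wgt G u w * walks G k w v)" by (rule sum.cong[OF refl]) (use elim d in auto)
  finally show ?case by simp
 qed
qed simp

text \<open>The cut-off may vary with \<theta>: the choice \<theta>/2 gives continuous functions of
  the class and serves measurability, the choice 0 is the truncation of the definitions.\<close>

lemma bounded_net_spectral_tr_tendsto:
 fixes f :: "real \<Rightarrow> complex"
 assumes G: "bounded_net M G" and v: "v \<in> verts G" and M: "0 < M" and d: "\<And>\<theta>. 0 < \<theta> \<Longrightarrow> 0 \<le> d \<theta>" and f: "continuous_on UNIV f"
 shows "((\<lambda>\<theta>. \<integral>x. f x \<partial>spectral_measure (tr (d \<theta>) \<theta> G) v) \<longlongrightarrow> (\<integral>x. f x \<partial>spectral_measure G v)) (at_right 0)"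
proof (rule tendsto_integral_of_moments)
 have ev: "\<forall>\<^sub>F \<theta> in at_right (0::real). 0 < \<theta>" by (rule eventually_at_right_less)
 have b: "bounded_net M (tr (d \<theta>) \<theta> G)" if "0 < \<theta>" for \<theta> using bounded_net_tr_same[OF G] that by simp
 show "\<forall>\<^sub>F \<theta> in at_right 0. real_distribution (spectral_measure (tr (d \<theta>) \<theta> G) v) \<and> (AE x in spectral_measure (tr (d \<theta>) \<theta> G) v. \<bar>x\<bar> \<le> M)"
  using ev by eventually_elim (use spectral_measure_props(1,2)[OF b _ M] v in auto)
 show "real_distribution (spectral_measure G v)" "AE x in spectral_measure G v. \<bar>x\<bar> \<le> M" by (rule spectral_measure_props[OF G v M])+
 show "((\<lambda>\<theta>. \<integral>x. x ^ k \<partial>spectral_measure (tr (d \<theta>) \<theta> G) v) \<longlongrightarrow> (\<integral>x. x ^ k \<partial>spectral_measure G v)) (at_right 0)" for k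
 proof (rule tendsto_walks_imp_moments)
  show "((\<lambda>\<theta>. walks (tr (d \<theta>) \<theta> G) k v v) \<longlongrightarrow> walks G k v v) (at_right 0)" by (rule tendsto_eventually[OF bounded_net_walks_tr_tendsto[OF G v d]])
  show "\<forall>\<^sub>F \<theta> in at_right 0. complex_of_real (\<integral>x. x ^ k \<partial>spectral_measure (tr (d \<theta>) \<theta> G) v) = walks (tr (d \<theta>) \<theta> G) k v v"
   using ev by eventually_elim (use spectral_measure_props(3)[OF b _ M] v in auto)
  show "complex_of_real (\<integral>x. x ^ k \<partial>spectral_measure G v) = walks G k v v" by (rule spectral_measure_props[OF G v M])
 qed
qed (rule f)

lemma continuous_spectral_tr:
 fixes f :: "real \<Rightarrow> complex"
 assumes "0 < d" "2 * d \<le> \<theta>" "continuous_on UNIV f"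
 shows "continuous_on UNIV (\<lambda>g. \<integral>x. f x \<partial>rspec d \<theta> g)"
proof (rule continuous_gstarI)
 fix g
 have "((\<lambda>x. \<integral>y. f y \<partial>spectral_measure (tr d \<theta> (nt (fst x))) (snd x (rt g))) \<longlongrightarrow> (\<integral>y. f y \<partial>rspec d \<theta> g)) (cfil g)"
  by (rule net_conv_spectral_integral[OF rep_network rep_network cfil_net_conv rep_root assms])
 moreover have "\<forall>\<^sub>F x in cfil g. (\<integral>y. f y \<partial>spectral_measure (tr d \<theta> (nt (fst x))) (snd x (rt g))) = (\<integral>y. f y \<partial>spectral_measure (tr d \<theta> (nt (fst x))) (rt (fst x)))"
  using cfil_root by eventually_elim simp
 ultimately show "((\<lambda>x. \<integral>y. f y \<partial>spectral_measure (tr d \<theta> (nt (fst x))) (rt (fst x))) \<longlongrightarrow> (\<integral>y. f y \<partial>rspec d \<theta> g)) (cfil g)"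
  by (rule Lim_transform_eventually)
qed

text \<open>The bounds are tested on finite sets, so a violation is visible on finitely many
  vertices and the set is closed. Truncated classes lie in it, and its members are represented by
  bounded networks.\<close>

definition bset :: "real \<Rightarrow> nat \<Rightarrow> gstar set" where
 "bset M K = {g. \<forall>u\<in>verts (nt g). \<forall>S. finite S \<and> S \<subseteq> verts (nt g) \<longrightarrow>
   (\<Sum>v\<in>S. cmod (wgt (nt g) u v)) \<le> M \<and> card {v \<in> S. wgt (nt g) u v \<noteq> 0} \<le> K}"

lemma closed_bset: "closed (bset M K)" unfolding closed_def
proof (rule open_gstarI)
 fix g assume "g \<in> - bset M K"
 then obtain u S where u: "u \<in> verts (nt g)" and S: "finite S" "S \<subseteq> verts (nt g)"
  and bad: "M < (\<Sum>v\<in>S. cmod (wgt (nt g) u v)) \<or> K < card {v \<in> S. wgt (nt g) u v \<noteq> 0}" unfolding bset_def by (auto simp: not_le)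
 note c = cfil_net_conv[of g]
 have ev: "\<forall>\<^sub>F x in cfil g. \<forall>v\<in>S. snd x v \<in> verts (nt (fst x))" using S by (intro eventually_ball_finite ballI net_conv_verts[OF c]) auto
 have lim: "((\<lambda>x. wgt (nt (fst x)) (snd x u) (snd x v)) \<longlongrightarrow> wgt (nt g) u v) (cfil g)" if "v \<in> S" for v using net_conv_wgt[OF c u] that S by auto
 have "\<forall>\<^sub>F x in cfil g. M < (\<Sum>v\<in>S. cmod (wgt (nt (fst x)) (snd x u) (snd x v))) \<or> K < card {v \<in> S. wgt (nt (fst x)) (snd x u) (snd x v) \<noteq> 0}"
 proof (cases "M < (\<Sum>v\<in>S. cmod (wgt (nt g) u v))")
  case True
  have "((\<lambda>x. \<Sum>v\<in>S. cmod (wgt (nt (fst x)) (snd x u) (snd x v))) \<longlongrightarrow> (\<Sum>v\<in>S. cmod (wgt (nt g) u v))) (cfil g)" by (intro tendsto_intros lim)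
  then have "\<forall>\<^sub>F x in cfil g. M < (\<Sum>v\<in>S. cmod (wgt (nt (fst x)) (snd x u) (snd x v)))" using True by (rule order_tendstoD)
  then show ?thesis by eventually_elim simp
 next
  case False
  have "\<forall>\<^sub>F x in cfil g. \<forall>v\<in>{v \<in> S. wgt (nt g) u v \<noteq> 0}. wgt (nt (fst x)) (snd x u) (snd x v) \<noteq> 0"
   using S(1) by (intro eventually_ball_finite ballI) (auto intro: tendsto_imp_eventually_ne[OF lim])
  then show ?thesis
  proof eventually_elim
   case (elim x)
   have "card {v \<in> S. wgt (nt g) u v \<noteq> 0} \<le> card {v \<in> S. wgt (nt (fst x)) (snd x u) (snd x v) \<noteq> 0}" using S(1) elim by (intro card_mono) auto
   then show ?case using bad False by simp
  qed
 qed
 with ev net_conv_verts[OF c u] net_conv_inj[OF c S] show "\<forall>\<^sub>F x in cfil g. fst x \<in> - bset M K"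
 proof eventually_elim
  case (elim x)
  have 1: "(\<Sum>w\<in>snd x ` S. cmod (wgt (nt (fst x)) (snd x u) w)) = (\<Sum>v\<in>S. cmod (wgt (nt (fst x)) (snd x u) (snd x v)))"
   using elim(3) by (simp add: sum.reindex)
  have "{w \<in> snd x ` S. wgt (nt (fst x)) (snd x u) w \<noteq> 0} = snd x ` {v \<in> S. wgt (nt (fst x)) (snd x u) (snd x v) \<noteq> 0}" by auto
  then have 2: "card {w \<in> snd x ` S. wgt (nt (fst x)) (snd x u) w \<noteq> 0} = card {v \<in> S. wgt (nt (fst x)) (snd x u) (snd x v) \<noteq> 0}"
   using elim(3) by (simp add: card_image inj_on_subset[of _ S])
  have "finite (snd x ` S)" "snd x ` S \<subseteq> verts (nt (fst x))" using S(1) elim(1) by auto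
  then show ?case using elim(2,4) 1 2 unfolding bset_def by (auto simp: not_le intro!: bexI[of _ "snd x u"] exI[of _ "snd x ` S"])
 qed
qed

lemma bset_bounded_net:
 assumes "g \<in> bset M K"
 shows "bounded_net M (nt g)" unfolding bounded_net_def
proof (intro conjI ballI)
 show "hermitian_on (verts (nt g)) (wgt (nt g))" by (rule is_network_hermitian[OF rep_network])
 fix u assume u: "u \<in> verts (nt g)"
 show fin: "finite (nb (nt g) u)"
 proof (rule ccontr)
  assume "infinite (nb (nt g) u)"
  then obtain S where S: "S \<subseteq> nb (nt g) u" "finite S" "card S = Suc K" using infinite_arbitrarily_large by metis
  then have "{v \<in> S. wgt (nt g) u v \<noteq> 0} = S" "S \<subseteq> verts (nt g)" by (auto simp: nb_def)
  then show False using assms u S unfolding bset_def by force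
 qed
 have "nb (nt g) u \<subseteq> verts (nt g)" by (auto simp: nb_def)
 then show "(\<Sum>v\<in>nb (nt g) u. cmod (wgt (nt g) u v)) \<le> M" using assms u fin unfolding bset_def by blast
qed

section \<open>The spectral measure at the root as a probability kernel\<close>

lemma truncate_class_embeds:
 assumes "0 < \<theta>"
 obtains \<sigma> where "embeds \<sigma> (nt (truncate_class \<theta> g)) (tr 0 \<theta> (nt g))" "\<sigma> (rt (truncate_class \<theta> g)) = rt g"
proof -
 have "is_network (tr 0 \<theta> (nt g))" by (rule is_network_tr) (use rep_network assms in auto)
 moreover have "rt g \<in> verts (tr 0 \<theta> (nt g))" by (simp add: rep_root)
 ultimately show thesis using rep_component that unfolding truncate_class_def truncate_eq_tr by metis
qed

lemma truncate_class_bset: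
 assumes \<theta>: "0 < \<theta>"
 shows "truncate_class \<theta> g \<in> bset (1 / \<theta> ^ 3) (nat \<lfloor>1 / \<theta> ^ 4\<rfloor>)" unfolding bset_def
proof (intro CollectI ballI allI impI)
 let ?H = "nt (truncate_class \<theta> g)" and ?G = "tr 0 \<theta> (nt g)"
 fix u S assume u: "u \<in> verts ?H" and S: "finite S \<and> S \<subseteq> verts ?H"
 obtain \<sigma> where e: "embeds \<sigma> ?H ?G" by (rule truncate_class_embeds[OF \<theta>, of g])
 have su: "\<sigma> u \<in> verts (nt g)" using embeds_verts[OF e u] by simp
 note b = tr_bounds[OF rep_network su order_refl _ \<theta>]
 define N where "N = {v \<in> S. wgt ?H u v \<noteq> 0}"
 have N: "\<sigma> ` N \<subseteq> nb ?G (\<sigma> u)" "finite N" "N \<subseteq> verts ?H" using S embeds_wgt[OF e u] embeds_verts[OF e] by (auto simp: N_def nb_def subset_iff)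
 have inj: "inj_on \<sigma> N" using e N(3) unfolding embeds_def by (meson inj_on_subset)
 have fin: "finite (nb ?G (\<sigma> u))" using b(1) \<theta> by simp
 have "(\<Sum>v\<in>S. cmod (wgt ?H u v)) = (\<Sum>v\<in>N. cmod (wgt ?H u v))" unfolding N_def using S by (intro sum.mono_neutral_right) auto
 also have "\<dots> = (\<Sum>v\<in>N. cmod (wgt ?G (\<sigma> u) (\<sigma> v)))" by (rule sum.cong) (use embeds_wgt[OF e u] N(3) in auto)
 also have "\<dots> = (\<Sum>w\<in>\<sigma> ` N. cmod (wgt ?G (\<sigma> u) w))" using inj by (simp add: sum.reindex)
 also have "\<dots> \<le> (\<Sum>w\<in>nb ?G (\<sigma> u). cmod (wgt ?G (\<sigma> u) w))" by (rule sum_mono2[OF fin N(1)]) simp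
 also have "\<dots> \<le> 1 / \<theta> ^ 3" using b(3) \<theta> by simp
 finally show "(\<Sum>v\<in>S. cmod (wgt ?H u v)) \<le> 1 / \<theta> ^ 3 \<and> card {v \<in> S. wgt ?H u v \<noteq> 0} \<le> nat \<lfloor>1 / \<theta> ^ 4\<rfloor>"
 proof
  have "card N \<le> card (nb ?G (\<sigma> u))" using card_mono[OF fin N(1)] inj by (simp add: card_image)
  then have "real (card N) \<le> 1 / \<theta> ^ 4" using b(2) \<theta> by (metis mult_zero_right less_imp_le of_nat_le_iff order_trans)
  then show "card {v \<in> S. wgt ?H u v \<noteq> 0} \<le> nat \<lfloor>1 / \<theta> ^ 4\<rfloor>" unfolding N_def[symmetric] by linarith
 qed
qed

lemma root_spectral_truncate_class:
 assumes \<theta>: "0 < \<theta>"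
 shows "root_spectral_measure (truncate_class \<theta> g) = rspec 0 \<theta> g"
proof -
 obtain \<sigma> where e: "embeds \<sigma> (nt (truncate_class \<theta> g)) (tr 0 \<theta> (nt g))" "\<sigma> (rt (truncate_class \<theta> g)) = rt g" by (rule truncate_class_embeds[OF \<theta>])
 have "spectral_measure (tr 0 \<theta> (nt g)) (\<sigma> (rt (truncate_class \<theta> g))) = spectral_measure (nt (truncate_class \<theta> g)) (rt (truncate_class \<theta> g))"
  by (rule embeds_spectral_measure[OF e(1) rep_root bset_bounded_net[OF truncate_class_bset[OF \<theta>]] bounded_net_tr])
   (use rep_network \<theta> in auto)
 then show ?thesis by (simp add: root_spectral_measure_def e(2))
qed

text \<open>Off \<open>bset\<close> the moment equations may fail to determine a measure; the point
  mass at 0 is a default that makes the kernel measurable everywhere. Truncated laws do not charge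
  that region.\<close>

definition kern :: "real \<Rightarrow> nat \<Rightarrow> gstar \<Rightarrow> real measure" where
 "kern M K g = (if g \<in> bset M K then root_spectral_measure g else return borel 0)"

lemma kern_props:
 assumes "0 < M"
 shows "real_distribution (kern M K g)" "AE x in kern M K g. \<bar>x\<bar> \<le> M"
proof -
 have "real_distribution (kern M K g) \<and> (AE x in kern M K g. \<bar>x\<bar> \<le> M)"
 proof (cases "g \<in> bset M K")
  case True
  then have k: "kern M K g = spectral_measure (nt g) (rt g)" by (simp add: kern_def root_spectral_measure_def)
  show ?thesis unfolding k using spectral_measure_props(1,2)[OF bset_bounded_net[OF True] rep_root assms] by blast
 next
  case False
  have "prob_space (return borel (0::real))" by (rule prob_space_return) simp
  moreover have "AE x in return borel (0::real). \<bar>x\<bar> \<le> M" using assms by (subst AE_return) auto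
  moreover have k: "kern M K g = return borel 0" using False by (simp add: kern_def)
  ultimately show ?thesis unfolding k by (simp add: real_distribution_def real_distribution_axioms_def)
 qed
 then show "real_distribution (kern M K g)" "AE x in kern M K g. \<bar>x\<bar> \<le> M" by auto
qed

lemma measurable_kern_integral:
 fixes f :: "real \<Rightarrow> real"
 assumes M: "0 < M" and f: "continuous_on UNIV f"
 shows "(\<lambda>g. \<integral>x. f x \<partial>kern M K g) \<in> borel_measurable borel"
proof -
 have fc: "continuous_on UNIV (\<lambda>x. complex_of_real (f x))" using f by (intro continuous_intros)
 \<comment> \<open>On \<open>bset\<close> the network is bounded, so truncating it at level \<theta>
   = 1/(n + 1) with cut-off \<theta>/2 changes the integral little, and for d > 0 that integral is
   continuous in g.\<close>
 define F where "F n g = (if g \<in> bset M K then (\<integral>x. complex_of_real (f x) \<partial>rspec (1 / Suc n / 2) (1 / Suc n) g) else complex_of_real (f 0))" for n :: nat and g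
 have "(\<lambda>g. \<integral>x. complex_of_real (f x) \<partial>kern M K g) \<in> borel_measurable borel"
 proof (rule borel_measurable_LIMSEQ_metric)
  fix n
  have [measurable]: "bset M K \<in> sets borel" using closed_bset by (rule borel_closed)
  have [measurable]: "(\<lambda>g. \<integral>x. complex_of_real (f x) \<partial>rspec (1 / Suc n / 2) (1 / Suc n) g) \<in> borel_measurable borel"
   by (rule borel_measurable_continuous_onI, rule continuous_spectral_tr) (use fc in \<open>auto simp: field_simps\<close>)
  show "F n \<in> borel_measurable borel" unfolding F_def by measurable
 next
  fix g
  show "(\<lambda>n. F n g) \<longlonglongrightarrow> (\<integral>x. complex_of_real (f x) \<partial>kern M K g)"
  proof (cases "g \<in> bset M K")
   case True
   have "((\<lambda>\<theta>. \<integral>x. complex_of_real (f x) \<partial>rspec (\<theta> / 2) \<theta> g) \<longlongrightarrow> (\<integral>x. complex_of_real (f x) \<partial>spectral_measure (nt g) (rt g))) (at_right 0)"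
    by (rule bounded_net_spectral_tr_tendsto[OF bset_bounded_net[OF True] rep_root M _ fc]) simp
   moreover have "filterlim (\<lambda>n. 1 / real (Suc n)) (at_right 0) sequentially"
    unfolding filterlim_at using LIMSEQ_Suc[OF lim_1_over_n] by (auto intro!: always_eventually)
   ultimately have "(\<lambda>n. \<integral>x. complex_of_real (f x) \<partial>rspec (1 / Suc n / 2) (1 / Suc n) g) \<longlonglongrightarrow> (\<integral>x. complex_of_real (f x) \<partial>spectral_measure (nt g) (rt g))"
    by (rule filterlim_compose)
   then show ?thesis using True by (simp add: F_def kern_def root_spectral_measure_def)
  next
   case False
   have "(\<integral>x. complex_of_real (f x) \<partial>return borel 0) = complex_of_real (f 0)"
    by (subst integral_return) (auto intro!: borel_measurable_continuous_onI f)
   then show ?thesis using False by (simp add: F_def kern_def)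
  qed
 qed
 then have "(\<lambda>g. Re (\<integral>x. complex_of_real (f x) \<partial>kern M K g)) \<in> borel_measurable borel" by measurable
 then show ?thesis by simp
qed

lemma measurable_kern:
 assumes M: "0 < M"
 shows "kern M K \<in> measurable borel (prob_algebra borel)"
proof (rule measurable_prob_algebra_generated)
 show "sets (borel :: real measure) = sigma_sets UNIV (range (\<lambda>a. {..a}))" by (simp add: borel_eq_atMost sets_measure_of)
 show "Int_stable (range (\<lambda>a::real. {..a}))" by (auto simp: Int_stable_def)
 show "prob_space (kern M K g)" "sets (kern M K g) = sets borel" for g
  using kern_props(1)[OF M, of K g] by (auto simp: real_distribution_def real_distribution_axioms_def)
 fix A assume "A \<in> range (\<lambda>a::real. {..a})"
 then obtain a where A: "A = {..a}" by blast
 \<comment> \<open>Continuous functions decreasing to the indicator of the half-line, which reduce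
   probabilities to integrals of continuous functions.\<close>
 define f where "f n x = min 1 (max 0 (1 - real n * (x - a)))" for n :: nat and x
 have fc: "continuous_on UNIV (f n)" for n unfolding f_def by (intro continuous_intros)
 have "(\<lambda>g. measure (kern M K g) A) \<in> borel_measurable borel"
 proof (rule borel_measurable_LIMSEQ_metric)
  show "(\<lambda>g. \<integral>x. f n x \<partial>kern M K g) \<in> borel_measurable borel" for n by (rule measurable_kern_integral[OF M fc])
  fix g
  interpret real_distribution "kern M K g" by (rule kern_props(1)[OF M])
  have "(\<lambda>n. \<integral>x. f n x \<partial>kern M K g) \<longlonglongrightarrow> (\<integral>x. indicator A x \<partial>kern M K g)"
  proof (rule integral_dominated_convergence[where w="\<lambda>_. 1"])
   show "f n \<in> borel_measurable (kern M K g)" for n using borel_measurable_continuous_onI[OF fc] by simp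
   show "AE x in kern M K g. (\<lambda>n. f n x) \<longlonglongrightarrow> indicator A x"
   proof (rule AE_I2)
    fix x
    show "(\<lambda>n. f n x) \<longlonglongrightarrow> indicator A x"
    proof (cases "x \<le> a")
     case True
     then have "real n * (x - a) \<le> 0" for n by (intro mult_nonneg_nonpos) auto
     then have "f n x = 1" for n unfolding f_def by (smt (verit))
     then show ?thesis using True by (simp add: A)
    next
     case False
     obtain N :: nat where N: "1 / (x - a) < real N" using reals_Archimedean2 by blast
     have "f n x = 0" if "N \<le> n" for n
     proof -
      have "1 < real N * (x - a)" using N False by (simp add: field_simps)
      also have "\<dots> \<le> real n * (x - a)" using that False by (intro mult_right_mono) auto
      finally show ?thesis by (simp add: f_def)
     qed
     then have "\<forall>\<^sub>F n in sequentially. f n x = 0" by (auto simp: eventually_sequentially)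
     then show ?thesis using False by (simp add: A tendsto_eventually)
    qed
   qed
   show "AE x in kern M K g. norm (f n x) \<le> 1" for n by (simp add: f_def)
  qed (auto simp: A)
  then show "(\<lambda>n. \<integral>x. f n x \<partial>kern M K g) \<longlonglongrightarrow> measure (kern M K g) A" by (simp add: A)
 qed
 moreover have "emeasure (kern M K g) A = ennreal (measure (kern M K g) A)" for g
 proof -
  interpret real_distribution "kern M K g" by (rule kern_props(1)[OF M])
  show ?thesis by (rule emeasure_eq_measure)
 qed
 ultimately show "(\<lambda>g. emeasure (kern M K g) A) \<in> borel_measurable borel" by simp
qed simp

text \<open>\<open>truncate_law\<close> is concentrated on \<open>bset\<close>, where
  \<open>root_spectral_measure\<close> equals the measurable kernel \<open>kern\<close>. The
  explicit mixture is then a \<open>bind\<close> over \<rho> itself, and the integration rules for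
  \<open>bind\<close> become available.\<close>

lemma mean_spectral_eq_bind:
 assumes \<rho>: "prob_on \<rho>" and \<theta>: "0 < \<theta>"
 shows "mean_tr \<theta> \<rho> = \<rho> \<bind> (\<lambda>g. rspec 0 \<theta> g)"
  and "(\<lambda>g. rspec 0 \<theta> g) \<in> measurable \<rho> (prob_algebra borel)"
proof -
 interpret prob_space \<rho> using \<rho> by (simp add: prob_on_def)
 have s\<rho>: "sets \<rho> = sets borel" using \<rho> by (simp add: prob_on_def)
 let ?M = "1 / \<theta> ^ 3" and ?K = "nat \<lfloor>1 / \<theta> ^ 4\<rfloor>"
 have M: "0 < ?M" using \<theta> by simp
 have T: "truncate_class \<theta> \<in> measurable \<rho> borel" using measurable_truncate_class[OF \<theta>] s\<rho> by (simp cong: measurable_cong_sets)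
 have k: "kern ?M ?K (truncate_class \<theta> g) = rspec 0 \<theta> g" for g by (simp add: kern_def truncate_class_bset[OF \<theta>] root_spectral_truncate_class[OF \<theta>])
 show meas: "(\<lambda>g. rspec 0 \<theta> g) \<in> measurable \<rho> (prob_algebra borel)" using measurable_compose[OF T measurable_kern[OF M, of ?K]] by (simp add: k)
 have meas': "(\<lambda>g. rspec 0 \<theta> g) \<in> measurable \<rho> (subprob_algebra borel)" by (rule measurable_prob_algebraD[OF meas])
 have [measurable]: "bset ?M ?K \<in> sets borel" using closed_bset by (rule borel_closed)
 have val: "(\<integral>\<^sup>+ g. emeasure (root_spectral_measure g) A \<partial>truncate_law \<theta> \<rho>) = emeasure (\<rho> \<bind> (\<lambda>g. rspec 0 \<theta> g)) A"
  if A: "A \<in> sets borel" for A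
 proof -
  have "AE g in truncate_law \<theta> \<rho>. g \<in> bset ?M ?K" unfolding truncate_law_def by (subst AE_distr_iff[OF T]) (use truncate_class_bset[OF \<theta>] in auto)
  then have "(\<integral>\<^sup>+ g. emeasure (root_spectral_measure g) A \<partial>truncate_law \<theta> \<rho>) = (\<integral>\<^sup>+ g. emeasure (kern ?M ?K g) A \<partial>truncate_law \<theta> \<rho>)"
   by (intro nn_integral_cong_AE) (auto simp: kern_def elim: eventually_mono)
  also have "\<dots> = (\<integral>\<^sup>+ g. emeasure (kern ?M ?K (truncate_class \<theta> g)) A \<partial>\<rho>)" unfolding truncate_law_def by (rule nn_integral_distr[OF T])
    (simp, rule measurable_compose[OF measurable_prob_algebraD[OF measurable_kern[OF M]] measurable_emeasure_subprob_algebra[OF A]])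
  also have "\<dots> = emeasure (\<rho> \<bind> (\<lambda>g. rspec 0 \<theta> g)) A" unfolding k by (rule emeasure_bind[OF not_empty meas' A, symmetric])
  finally show ?thesis .
 qed
 let ?B = "\<rho> \<bind> (\<lambda>g. rspec 0 \<theta> g)"
 have sB: "sets ?B = sets borel" using sets_bind[OF sets_kernel[OF meas'] not_empty] by simp
 then have spB: "space ?B = UNIV" using sets_eq_imp_space_eq[of ?B borel] by simp
 have "mean_tr \<theta> \<rho> = measure_of UNIV (sets borel) (emeasure ?B)" unfolding mean_spectral_measure_def
  by (rule measure_of_eq) (use val sets.sigma_sets_eq[of "borel :: real measure"] in auto)
 also have "\<dots> = ?B" using measure_of_of_measure[of ?B] by (simp add: sB spB)
 finally show "mean_tr \<theta> \<rho> = ?B" .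
qed

section \<open>Comparison of truncations on finite networks\<close>

lemma walks_add_finite:
 assumes "finite (verts G)" "u \<in> verts G"
 shows "walks G (i + j) u v = (\<Sum>w\<in>verts G. walks G i u w * walks G j w v)" using assms(2)
proof (induction i arbitrary: u)
 case 0
 have "(\<Sum>w\<in>verts G. walks G 0 u w * walks G j w v) = (\<Sum>w\<in>verts G. if u = w then walks G j w v else 0)" by (rule sum.cong) auto
 then show ?case using assms(1) 0 by simp
next
 case (Suc i)
 have "walks G (Suc i + j) u v = (\<Sum>x\<in>nb G u. wgt G u x * (\<Sum>w\<in>verts G. walks G i x w * walks G j w v))"
  unfolding add_Suc walks.simps by (rule sum.cong) (use Suc.IH in \<open>auto simp: nb_def\<close>)
 also have "\<dots> = (\<Sum>w\<in>verts G. \<Sum>x\<in>nb G u. wgt G u x * walks G i x w * walks G j w v)" by (simp add: sum_distrib_left mult.assoc) (rule sum.swap)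
 finally show ?case by (simp add: sum_distrib_right)
qed

lemma walks_Suc_verts:
 assumes "finite (verts G)"
 shows "walks G (Suc k) u v = (\<Sum>w\<in>verts G. wgt G u w * walks G k w v)"
 unfolding walks.simps by (rule sum.mono_neutral_left) (use assms in \<open>auto simp: nb_def\<close>)

lemma walks_hermitian:
 assumes fin: "finite (verts G)" and h: "hermitian_on (verts G) (wgt G)" and uv: "u \<in> verts G" "v \<in> verts G"
 shows "cnj (walks G k u v) = walks G k v u" using uv
proof (induction k arbitrary: u v)
 case 0
 show ?case by (simp add: eq_commute)
next
 case (Suc k)
 have "cnj (walks G (Suc k) u v) = (\<Sum>w\<in>verts G. walks G k v w * wgt G w u)" unfolding walks_Suc_verts[OF fin] cnj_sum
  by (rule sum.cong) (use Suc hermitian_onD[OF h] in \<open>auto simp: mult.commute\<close>)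
 also have "\<dots> = (\<Sum>w\<in>verts G. walks G k v w * walks G 1 w u)"
 proof (rule sum.cong[OF refl])
  fix w assume "w \<in> verts G"
  have "walks G 1 w u = (\<Sum>x\<in>verts G. if x = u then wgt G w x else 0)" unfolding One_nat_def walks_Suc_verts[OF fin] by (rule sum.cong) auto
  then show "walks G k v w * wgt G w u = walks G k v w * walks G 1 w u" using fin Suc.prems by simp
 qed
 also have "\<dots> = walks G (k + 1) v u" using walks_add_finite[OF fin Suc.prems(2), of k 1 u] by simp
 finally show ?case by (simp del: walks.simps)
qed

text \<open>Both sides are the squared norm of p(T) e_v for the polynomial p with coefficients
  \<open>b\<close>: expand the squares and compare moments.\<close>

lemma spectral_L2:
 fixes b :: "nat \<Rightarrow> complex"
 assumes fin: "finite (verts G)" and G: "bounded_net M G" and v: "v \<in> verts G" and M: "0 < M"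
 shows "(\<Sum>u\<in>verts G. (cmod (\<Sum>j\<le>m. b j * walks G j u v))\<^sup>2)
   = (\<integral>x. (cmod (\<Sum>j\<le>m. b j * of_real x ^ j))\<^sup>2 \<partial>spectral_measure G v)"
proof -
 have h: "hermitian_on (verts G) (wgt G)" using G by (simp add: bounded_net_def)
 note p = spectral_measure_props[OF G v M]
 have i: "integrable (spectral_measure G v) (\<lambda>x. cnj (b j) * b k * of_real (x ^ (j + k)))" for j k
  by (rule AE_bounded_continuous_integrable[OF p(1) _ p(2)]) (intro continuous_intros)
 have sq: "complex_of_real ((cmod (\<Sum>j\<le>m. b j * t j))\<^sup>2) = (\<Sum>j\<le>m. \<Sum>k\<le>m. cnj (b j) * b k * (cnj (t j) * t k))" for t
 proof -
  have "complex_of_real ((cmod (\<Sum>j\<le>m. b j * t j))\<^sup>2) = cnj (\<Sum>j\<le>m. b j * t j) * (\<Sum>j\<le>m. b j * t j)" by (subst complex_norm_square) (rule mult.commute)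
  then show ?thesis unfolding cnj_sum sum_product by (simp add: mult_ac)
 qed
 have "complex_of_real (\<Sum>u\<in>verts G. (cmod (\<Sum>j\<le>m. b j * walks G j u v))\<^sup>2)
   = (\<Sum>u\<in>verts G. \<Sum>j\<le>m. \<Sum>k\<le>m. cnj (b j) * b k * (cnj (walks G j u v) * walks G k u v))" unfolding of_real_sum sq ..
 also have "\<dots> = (\<Sum>j\<le>m. \<Sum>k\<le>m. \<Sum>u\<in>verts G. cnj (b j) * b k * (cnj (walks G j u v) * walks G k u v))"
  by (subst sum.swap, rule sum.cong[OF refl], rule sum.swap)
 also have "\<dots> = (\<Sum>j\<le>m. \<Sum>k\<le>m. cnj (b j) * b k * walks G (j + k) v v)"
 proof (intro sum.cong refl)
  fix j k
  have "(\<Sum>u\<in>verts G. cnj (walks G j u v) * walks G k u v) = (\<Sum>u\<in>verts G. walks G j v u * walks G k u v)"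
   by (rule sum.cong) (use walks_hermitian[OF fin h] v in auto)
  then show "(\<Sum>u\<in>verts G. cnj (b j) * b k * (cnj (walks G j u v) * walks G k u v)) = cnj (b j) * b k * walks G (j + k) v v"
   using walks_add_finite[OF fin v, of j k v] by (simp only: sum_distrib_left[symmetric])
 qed
 also have "\<dots> = (\<Sum>j\<le>m. \<Sum>k\<le>m. (\<integral>x. cnj (b j) * b k * of_real (x ^ (j + k)) \<partial>spectral_measure G v))" by (simp add: p(3)[symmetric] del: of_real_power)
 also have "\<dots> = (\<integral>x. (\<Sum>j\<le>m. \<Sum>k\<le>m. cnj (b j) * b k * of_real (x ^ (j + k))) \<partial>spectral_measure G v)"
  using i by (simp add: Bochner_Integration.integral_sum Bochner_Integration.integrable_sum del: of_real_power)
 also have "\<dots> = (\<integral>x. complex_of_real ((cmod (\<Sum>j\<le>m. b j * of_real x ^ j))\<^sup>2) \<partial>spectral_measure G v)"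
  unfolding sq by (rule Bochner_Integration.integral_cong) (simp_all add: power_add)
 finally have "complex_of_real (\<Sum>u\<in>verts G. (cmod (\<Sum>j\<le>m. b j * walks G j u v))\<^sup>2)
   = complex_of_real (\<integral>x. (cmod (\<Sum>j\<le>m. b j * of_real x ^ j))\<^sup>2 \<partial>spectral_measure G v)" by (simp del: of_real_power)
 then show ?thesis by (simp only: of_real_eq_iff)
qed

text \<open>The diagonal of the resolvent is the Stieltjes transform of the spectral measure: apply the
 resolvent bound to \<open>(A - z) p(A) e\<^sub>v - e\<^sub>v\<close> for polynomials \<open>p\<close> close to \<open>1 / (x - z)\<close>.\<close>

lemma resolvent_diagonal:
 assumes fin: "finite (verts G)" and G: "bounded_net M G" and v: "v \<in> verts G" and M: "0 < M"
  and R: "hermitian_resolvent (verts G) (wgt G) z R"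
 shows "R v v = stieltjes (spectral_measure G v) z"
proof -
 interpret R: hermitian_resolvent "verts G" "wgt G" z R by fact
 note p = spectral_measure_props[OF G v M]
 interpret P: real_distribution "spectral_measure G v" by (rule p)
 \<comment> \<open>For an approximation of quality e, the approximate resolvent column is off by at
   most e (M + |z|) / Im z, and its entry at v differs from the integral by at most e.\<close>
 define C where "C = 1 + (M + cmod z) / Im z"
 have C: "0 < C" using M R.Im_z by (simp add: C_def add_pos_nonneg)
 have ri: "integrable (spectral_measure G v) (\<lambda>x. 1 / (complex_of_real x - z))" by (rule integrable_resolvent[OF R.Im_z p(1)])
 have main: "cmod (R v v - stieltjes (spectral_measure G v) z) \<le> e * C" if e: "0 < e" for e
 proof -
  obtain a n where an: "\<And>x. x \<in> {-M..M} \<Longrightarrow> cmod (1 / (complex_of_real x - z) - (\<Sum>i\<le>n::nat. a i * of_real x ^ i)) < e"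
   by (rule complex_polynomial_approx[of M "\<lambda>x. 1 / (complex_of_real x - z)" e])
    (use e continuous_on_subset[OF continuous_resolvent[OF R.Im_z]] in auto)
  \<comment> \<open>The coefficients of (x - z) p(x) - 1 for the approximating polynomial p.\<close>
  define b where "b j = (if j = 0 then 0 else a (j - 1)) - (if j \<le> n then z * a j else 0) - (if j = 0 then 1 else 0)" for j
  have lin: "(\<Sum>j\<le>Suc n. b j * t j) = (\<Sum>i\<le>n. a i * t (Suc i)) - z * (\<Sum>i\<le>n. a i * t i) - t 0" for t
  proof -
   have "(\<Sum>j\<le>Suc n. b j * t j) = (\<Sum>j\<le>Suc n. (if j = 0 then 0 else a (j - 1)) * t j) - (\<Sum>j\<le>Suc n. (if j \<le> n then z * a j else 0) * t j) - (\<Sum>j\<le>Suc n. (if j = 0 then 1 else 0) * t j)"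
    unfolding b_def by (simp only: left_diff_distrib sum_subtractf)
   also have "(\<Sum>j\<le>Suc n. (if j = 0 then 0 else a (j - 1)) * t j) = (\<Sum>i\<le>n. a i * t (Suc i))" by (subst sum.atMost_Suc_shift) simp
   also have "(\<Sum>j\<le>Suc n. (if j \<le> n then z * a j else 0) * t j) = z * (\<Sum>i\<le>n. a i * t i)" by (simp add: sum_distrib_left mult.assoc)
   also have "(\<Sum>j\<le>Suc n. (if j = 0 then 1 else 0) * t j) = t 0" by (subst sum.atMost_Suc_shift) simp
   finally show ?thesis .
  qed
  define y where "y u = (\<Sum>i\<le>n. a i * walks G i u v)" for u
  define q where "q u = (\<Sum>j\<le>Suc n. b j * walks G j u v)" for u
  have q: "(\<Sum>w\<in>verts G. wgt G u w * y w) - z * y u = (if u = v then 1 else 0) + q u" for u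
  proof -
   have "(\<Sum>w\<in>verts G. wgt G u w * y w) = (\<Sum>i\<le>n. a i * walks G (Suc i) u v)"
    unfolding y_def walks_Suc_verts[OF fin] sum_distrib_left by (subst sum.swap) (simp add: mult_ac)
   then show ?thesis unfolding q_def lin by (simp add: y_def del: walks.simps(2))
  qed
  have "(L2_set (\<lambda>u. cmod (q u)) (verts G))\<^sup>2 = (\<Sum>u\<in>verts G. (cmod (q u))\<^sup>2)" by (simp add: L2_set_def sum_nonneg)
  also have "\<dots> = (\<integral>x. (cmod (\<Sum>j\<le>Suc n. b j * of_real x ^ j))\<^sup>2 \<partial>spectral_measure G v)" unfolding q_def by (rule spectral_L2[OF fin G v M])
  also have "\<dots> \<le> (e * (M + cmod z))\<^sup>2"
  proof (rule P.integral_le_const)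
   show "integrable (spectral_measure G v) (\<lambda>x. (cmod (\<Sum>j\<le>Suc n. b j * of_real x ^ j))\<^sup>2)"
    by (rule AE_bounded_continuous_integrable[OF p(1) _ p(2)]) (intro continuous_intros)
   show "AE x in spectral_measure G v. (cmod (\<Sum>j\<le>Suc n. b j * of_real x ^ j))\<^sup>2 \<le> (e * (M + cmod z))\<^sup>2" using p(2)
   proof eventually_elim
    case (elim x)
    have nz: "complex_of_real x - z \<noteq> 0" using R.Im_z by (auto simp: complex_eq_iff)
    have "(\<Sum>j\<le>Suc n. b j * of_real x ^ j) = (complex_of_real x - z) * ((\<Sum>i\<le>n. a i * of_real x ^ i) - 1 / (complex_of_real x - z))"
    proof -
     have "(\<Sum>i\<le>n. a i * complex_of_real x ^ Suc i) = complex_of_real x * (\<Sum>i\<le>n. a i * complex_of_real x ^ i)" by (simp add: sum_distrib_left mult_ac)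
     then show ?thesis unfolding lin using nz by (simp add: right_diff_distrib left_diff_distrib)
    qed
    then have "cmod (\<Sum>j\<le>Suc n. b j * of_real x ^ j) = cmod (complex_of_real x - z) * cmod (1 / (complex_of_real x - z) - (\<Sum>i\<le>n. a i * of_real x ^ i))"
     by (simp only: norm_mult norm_minus_commute)
    also have "\<dots> \<le> (M + cmod z) * e"
    proof (rule mult_mono)
     have "cmod (complex_of_real x - z) \<le> cmod (complex_of_real x) + cmod z" by (rule norm_triangle_ineq4)
     then show "cmod (complex_of_real x - z) \<le> M + cmod z" using elim by simp
     show "cmod (1 / (complex_of_real x - z) - (\<Sum>i\<le>n. a i * of_real x ^ i)) \<le> e" using an[of x] elim by (auto simp: abs_le_iff intro!: less_imp_le)
    qed (use M in auto)
    finally show ?case by (intro power_mono) (auto simp: mult.commute)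
   qed
  qed
  finally have q_le: "L2_set (\<lambda>u. cmod (q u)) (verts G) \<le> e * (M + cmod z)" by (rule power2_le_imp_le) (use e M in simp)
  have "R v v + (\<Sum>u\<in>verts G. R v u * q u) = y v"
  proof -
   have "(\<Sum>u\<in>verts G. R v u * ((if u = v then 1 else 0) + q u)) = (\<Sum>u\<in>verts G. R v u * ((\<Sum>w\<in>verts G. wgt G u w * y w) - z * y u))" unfolding q ..
   also have "\<dots> = (\<Sum>w\<in>verts G. (\<Sum>u\<in>verts G. R v u * wgt G u w) * y w) - z * (\<Sum>u\<in>verts G. R v u * y u)"
    unfolding right_diff_distrib sum_subtractf sum_distrib_left sum_distrib_right by (subst sum.swap) (simp add: mult_ac)
   also have "(\<Sum>w\<in>verts G. (\<Sum>u\<in>verts G. R v u * wgt G u w) * y w) = (\<Sum>w\<in>verts G. (if v = w then y w else 0) + z * (R v w * y w))"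
    by (rule sum.cong) (use v in \<open>auto simp: R.left_inverse distrib_right\<close>)
   also have "\<dots> = y v + z * (\<Sum>u\<in>verts G. R v u * y u)" using fin v by (simp add: sum.distrib sum_distrib_left)
   also have "(\<Sum>u\<in>verts G. R v u * ((if u = v then 1 else 0) + q u)) = (\<Sum>u\<in>verts G. (if u = v then R v u else 0) + R v u * q u)"
    by (rule sum.cong) (auto simp: distrib_left)
   finally show ?thesis using fin v by (simp add: sum.distrib)
  qed
  then have "cmod (R v v - y v) = cmod (\<Sum>u\<in>verts G. R v u * q u)" by (metis add_diff_cancel_left' diff_add_cancel norm_minus_cancel minus_diff_eq)
  also have "\<dots> \<le> L2_set (\<lambda>u. cmod (\<Sum>w\<in>verts G. R u w * q w)) (verts G)"
   using member_le_L2_set[OF fin v, of "\<lambda>u. cmod (\<Sum>w\<in>verts G. R u w * q w)"] by simp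
  also have "\<dots> \<le> L2_set (\<lambda>u. cmod (q u)) (verts G) / Im z" by (rule R.bound)
  also have "\<dots> \<le> e * (M + cmod z) / Im z" using q_le R.Im_z by (intro divide_right_mono) auto
  finally have 1: "cmod (R v v - y v) \<le> e * (M + cmod z) / Im z" .
  have pi: "integrable (spectral_measure G v) (\<lambda>x. \<Sum>i\<le>n. a i * of_real x ^ i)"
   by (rule AE_bounded_continuous_integrable[OF p(1) _ p(2)]) (intro continuous_intros)
  have "y v = (\<integral>x. (\<Sum>i\<le>n. a i * of_real x ^ i) \<partial>spectral_measure G v)"
  proof -
   have "integrable (spectral_measure G v) (\<lambda>x. a i * of_real (x ^ i))" for i
    by (rule AE_bounded_continuous_integrable[OF p(1) _ p(2)]) (intro continuous_intros)
   then have "(\<integral>x. (\<Sum>i\<le>n. a i * of_real (x ^ i)) \<partial>spectral_measure G v) = (\<Sum>i\<le>n. a i * of_real (\<integral>x. x ^ i \<partial>spectral_measure G v))"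
    by (simp add: Bochner_Integration.integral_sum del: of_real_power)
   then show ?thesis by (simp add: y_def p(3))
  qed
  then have "cmod (y v - stieltjes (spectral_measure G v) z)
    = cmod (\<integral>x. (\<Sum>i\<le>n. a i * of_real x ^ i) - 1 / (complex_of_real x - z) \<partial>spectral_measure G v)" using pi ri by simp
  also have "\<dots> \<le> (\<integral>x. cmod ((\<Sum>i\<le>n. a i * of_real x ^ i) - 1 / (complex_of_real x - z)) \<partial>spectral_measure G v)" by (rule integral_norm_bound)
  also have "\<dots> \<le> e"
  proof (rule P.integral_le_const)
   show "integrable (spectral_measure G v) (\<lambda>x. cmod ((\<Sum>i\<le>n. a i * of_real x ^ i) - 1 / (complex_of_real x - z)))"
    using pi ri by (intro integrable_norm Bochner_Integration.integrable_diff)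
   show "AE x in spectral_measure G v. cmod ((\<Sum>i\<le>n. a i * of_real x ^ i) - 1 / (complex_of_real x - z)) \<le> e" using p(2)
   proof eventually_elim
    case (elim x)
    then show ?case using an[of x] by (subst norm_minus_commute) (auto simp: abs_le_iff intro!: less_imp_le)
   qed
  qed
  finally have 2: "cmod (y v - stieltjes (spectral_measure G v) z) \<le> e" .
  have "cmod (R v v - stieltjes (spectral_measure G v) z)
    \<le> cmod (R v v - y v) + cmod (y v - stieltjes (spectral_measure G v) z)" by (rule norm_diff_triangle_le[OF order_refl order_refl])
  also have "\<dots> \<le> e * C" using 1 2 by (simp add: C_def distrib_left)
  finally show ?thesis .
 qed
 have "cmod (R v v - stieltjes (spectral_measure G v) z) \<le> 0"
 proof (rule field_le_epsilon)
  fix e :: real assume "0 < e"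
  then show "cmod (R v v - stieltjes (spectral_measure G v) z) \<le> 0 + e" using main[of "e / C"] C by simp
 qed
 then show ?thesis by simp
qed

text \<open>A bounded continuous majorant, as in Markov's inequality, of the indicator of the
  vertices to be removed: those with degree x above 1/\<theta>^2 - 1, and those where weights
  between the two levels carry a degree y - z above e.\<close>

abbreviation bad :: "real \<Rightarrow> real \<Rightarrow> real \<Rightarrow> real \<Rightarrow> real \<Rightarrow> real" where
 "bad \<theta> e x y z \<equiv> min 1 (x / (1 / \<theta>\<^sup>2 - 1)) + min 1 ((y - z) / e)"

text \<open>Off the set of vertices of large degree, the truncations at \<open>\<theta>\<close> and \<open>\<theta>'\<close> differ only by
 small weights.\<close>

lemma st_compare_finite:
 assumes G: "is_network G" and fin: "finite (verts G)" and th: "0 < \<theta>'" "\<theta>' \<le> \<theta>" "\<theta> < 1"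
  and d: "0 < d" "2 * d \<le> \<theta>'" and e: "0 < e" and z: "0 < Im z"
 shows "cmod ((\<Sum>v\<in>verts G. st z d \<theta>' G v) - (\<Sum>v\<in>verts G. st z d \<theta> G v))
   \<le> (8 / Im z) * (\<Sum>v\<in>verts G. bad \<theta> e (degd d G v) (degd \<theta>' G v) (degd \<theta> G v))
    + real (card (verts G)) * (sqrt e / (Im z)\<^sup>2)"
proof -
 let ?V = "verts G" and ?A = "wgt (tr d \<theta> G)" and ?B = "wgt (tr d \<theta>' G)"
 \<comment> \<open>Up to degree L both factors \<open>chi_tilde\<close> are 1, so the two
   truncations differ only through \<open>chi\<close>.\<close>
 define L where "L = 1 / \<theta>\<^sup>2 - 1"
 have "\<theta>\<^sup>2 < 1" using th by (simp add: abs_square_less_1)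
 then have L: "0 < L" using th unfolding L_def by simp
 have L': "L \<le> 1 / \<theta>'\<^sup>2 - 1" unfolding L_def using th by (intro diff_right_mono divide_left_mono power_mono) auto
 obtain R where R: "hermitian_resolvent ?V ?A z R" using resolvent_exists[OF fin hermitian_tr[OF G] z] by blast
 obtain S where S: "hermitian_resolvent ?V ?B z S" using resolvent_exists[OF fin hermitian_tr[OF G] z] by blast
 have bA: "bounded_net (1 / \<theta> ^ 3) (tr d \<theta> G)" by (rule bounded_net_tr[OF G]) (use th d in auto)
 have bB: "bounded_net (1 / \<theta>' ^ 3) (tr d \<theta>' G)" by (rule bounded_net_tr[OF G]) (use th d in auto)
 have Rv: "R v v = st z d \<theta> G v" if "v \<in> ?V" for v unfolding st_def by (rule resolvent_diagonal[OF _ bA]) (use fin that R th in auto)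
 have Sv: "S v v = st z d \<theta>' G v" if "v \<in> ?V" for v unfolding st_def by (rule resolvent_diagonal[OF _ bB]) (use fin that S th in auto)
 define E where "E = {v \<in> ?V. L < degd d G v \<or> e < degd \<theta>' G v - degd \<theta> G v}"
 have EV: "E \<subseteq> ?V" by (auto simp: E_def)
 have small: "L2_set (\<lambda>u. cmod (?A u v - ?B u v)) (?V - E) \<le> sqrt e" if v: "v \<in> ?V" "v \<notin> E" for v
 proof -
  have w: "(cmod (?A u v - ?B u v))\<^sup>2 \<le> (cmod (wgt G v u))\<^sup>2 * chi \<theta>' (cmod (wgt G v u)) - (cmod (wgt G v u))\<^sup>2 * chi \<theta> (cmod (wgt G v u))"
   if u: "u \<in> ?V - E" for u
  proof -
   have "max (degd d G u) (degd d G v) \<le> L" using u v by (auto simp: E_def)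
   then have "1 \<le> 1 / \<theta>\<^sup>2 - max (degd d G u) (degd d G v)" "1 \<le> 1 / \<theta>'\<^sup>2 - max (degd d G u) (degd d G v)" using L' unfolding L_def by linarith+
   then have "chi_tilde \<theta> (max (degd d G u) (degd d G v)) = 1" "chi_tilde \<theta>' (max (degd d G u) (degd d G v)) = 1" by (simp_all add: chi_tilde_eq_clip)
   then have "?A u v = wgt G u v * of_real (chi \<theta> (cmod (wgt G u v)))" "?B u v = wgt G u v * of_real (chi \<theta>' (cmod (wgt G u v)))"
    by (simp_all add: wgt_tr trw_def)
   then have "?A u v - ?B u v = wgt G u v * of_real (chi \<theta> (cmod (wgt G u v)) - chi \<theta>' (cmod (wgt G u v)))" by (simp add: right_diff_distrib)
   then have "(cmod (?A u v - ?B u v))\<^sup>2 = (cmod (wgt G u v))\<^sup>2 * (chi \<theta>' (cmod (wgt G u v)) - chi \<theta> (cmod (wgt G u v)))\<^sup>2"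
    by (simp only: norm_mult power_mult_distrib norm_of_real power2_abs power2_commute)
   \<comment> \<open>The difference of the two values of \<open>chi\<close> lies in [0,1], so it
     dominates its square; weighted and summed over u it is the difference of the two degrees at
     v.\<close>
   also have "\<dots> \<le> (cmod (wgt G u v))\<^sup>2 * (chi \<theta>' (cmod (wgt G u v)) - chi \<theta> (cmod (wgt G u v)))"
   proof (rule mult_left_mono)
    let ?c = "chi \<theta>' (cmod (wgt G u v)) - chi \<theta> (cmod (wgt G u v))"
    have "0 \<le> ?c" "?c \<le> 1"
     using chi_antimono[of \<theta>' \<theta> "cmod (wgt G u v)"] chi_le_1[of \<theta>' "cmod (wgt G u v)"] chi_nonneg[of "cmod (wgt G u v)" \<theta>] th by auto
    then show "?c\<^sup>2 \<le> ?c" by (simp add: power2_eq_square mult_left_le)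
   qed simp
   also have "cmod (wgt G u v) = cmod (wgt G v u)" using cmod_wgt_sym[OF G] u v by auto
   finally show ?thesis by (simp add: right_diff_distrib)
  qed
  have "(\<Sum>u\<in>?V - E. (cmod (?A u v - ?B u v))\<^sup>2) \<le> (\<Sum>u\<in>?V - E. (cmod (wgt G v u))\<^sup>2 * chi \<theta>' (cmod (wgt G v u)) - (cmod (wgt G v u))\<^sup>2 * chi \<theta> (cmod (wgt G v u)))"
   by (rule sum_mono[OF w])
  also have "\<dots> \<le> (\<Sum>u\<in>?V. (cmod (wgt G v u))\<^sup>2 * chi \<theta>' (cmod (wgt G v u)) - (cmod (wgt G v u))\<^sup>2 * chi \<theta> (cmod (wgt G v u)))"
   using fin chi_antimono[of \<theta>' \<theta>] th by (intro sum_mono2) (auto intro!: mult_left_mono)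
  also have "\<dots> = degd \<theta>' G v - degd \<theta> G v" using fin by (simp add: degd_def sum_subtractf)
  also have "\<dots> \<le> e" using v by (auto simp: E_def)
  finally show ?thesis by (simp add: L2_set_def)
 qed
 have "cmod ((\<Sum>v\<in>?V. S v v) - (\<Sum>v\<in>?V. R v v)) \<le> real (card E) * (8 / Im z) + real (card ?V) * sqrt e / (Im z)\<^sup>2"
  by (rule resolvent_trace_compare[OF R S EV _ small]) (use e in auto)
 also have "(\<Sum>v\<in>?V. S v v) = (\<Sum>v\<in>?V. st z d \<theta>' G v)" by (rule sum.cong) (auto simp: Sv)
 also have "(\<Sum>v\<in>?V. R v v) = (\<Sum>v\<in>?V. st z d \<theta> G v)" by (rule sum.cong) (auto simp: Rv)
 finally have *: "cmod ((\<Sum>v\<in>?V. st z d \<theta>' G v) - (\<Sum>v\<in>?V. st z d \<theta> G v)) \<le> real (card E) * (8 / Im z) + real (card ?V) * sqrt e / (Im z)\<^sup>2" .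
 define k where "k v = min 1 (degd d G v / L) + min 1 ((degd \<theta>' G v - degd \<theta> G v) / e)" for v
 have k0: "0 \<le> min 1 (degd d G v / L)" "0 \<le> min 1 ((degd \<theta>' G v - degd \<theta> G v) / e)" if "v \<in> ?V" for v
  using degd_nonneg[of d G v] degd_antimono[OF G that th(1,2)] d L e by auto
 have "real (card E) = (\<Sum>v\<in>E. 1)" by simp
 also have "\<dots> \<le> (\<Sum>v\<in>E. k v)"
 proof (rule sum_mono)
  fix v assume v: "v \<in> E"
  then have "L < degd d G v \<or> e < degd \<theta>' G v - degd \<theta> G v" by (simp add: E_def)
  then have "1 \<le> degd d G v / L \<or> 1 \<le> (degd \<theta>' G v - degd \<theta> G v) / e" using L e by auto
  then show "1 \<le> k v" using k0[of v] v EV unfolding k_def by auto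
 qed
 also have "\<dots> \<le> (\<Sum>v\<in>?V. k v)" by (rule sum_mono2[OF fin EV]) (use k0 in \<open>auto simp: k_def\<close>)
 finally have "real (card E) * (8 / Im z) \<le> (\<Sum>v\<in>?V. k v) * (8 / Im z)" using z by (intro mult_right_mono) auto
 then show ?thesis using * unfolding k_def L_def by (simp add: mult.commute)
qed

section \<open>Existence of the limit for sofic measures\<close>

lemma prob_on_U_law:
 assumes "finite (verts G)" "verts G \<noteq> {}"
 shows "prob_on (U_law G)" unfolding prob_on_def U_law_def by (intro conjI prob_space.prob_space_distr[OF prob_space_uniform_count_measure[OF assms]])
  (simp_all add: uniform_count_measure_def measurable_point_measure_eq1)

lemma integral_U_law:
 fixes f :: "gstar \<Rightarrow> real"
 assumes "finite (verts G)" "f \<in> borel_measurable borel"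
 shows "(\<integral>g. f g \<partial>U_law G) = (\<Sum>v\<in>verts G. f (rooted_component G v)) / card (verts G)"
proof -
 have "rooted_component G \<in> measurable (uniform_count_measure (verts G)) borel" by (simp add: uniform_count_measure_def measurable_point_measure_eq1)
 then show ?thesis unfolding U_law_def by (subst integral_distr) (use assms in \<open>simp_all add: integral_uniform_count_measure\<close>)
qed

lemma integrable_bounded_prob_on:
 fixes f :: "'a::topological_space \<Rightarrow> 'b::{banach, second_countable_topology}"
 assumes "prob_on \<rho>" "f \<in> borel_measurable borel" "\<And>x. norm (f x) \<le> B"
 shows "integrable \<rho> f"
proof -
 interpret prob_space \<rho> using assms(1) by (simp add: prob_on_def)
 have "f \<in> borel_measurable \<rho>" using assms(1,2) by (simp add: prob_on_def cong: measurable_cong_sets)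
 then show ?thesis by (rule integrable_const_bound[where B=B, rotated]) (use assms(3) in auto)
qed

lemma integral_U_law_complex:
 fixes f :: "gstar \<Rightarrow> complex"
 assumes G: "finite (verts G)" "verts G \<noteq> {}" and f: "f \<in> borel_measurable borel" "\<And>g. cmod (f g) \<le> B"
 shows "(\<integral>g. f g \<partial>U_law G) = (\<Sum>v\<in>verts G. f (rooted_component G v)) / card (verts G)"
proof (rule complex_eqI)
 have i: "integrable (U_law G) f" by (rule integrable_bounded_prob_on[OF prob_on_U_law[OF G] f])
 show "Re (\<integral>g. f g \<partial>U_law G) = Re ((\<Sum>v\<in>verts G. f (rooted_component G v)) / card (verts G))"
  using f i by (simp add: integral_U_law[OF G(1)] Re_divide_of_nat flip: integral_Re)
 show "Im (\<integral>g. f g \<partial>U_law G) = Im ((\<Sum>v\<in>verts G. f (rooted_component G v)) / card (verts G))"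
  using f i by (simp add: integral_U_law[OF G(1)] Im_divide_of_nat flip: integral_Im)
qed

lemma weakly_converges_complex:
 fixes f :: "'a::topological_space \<Rightarrow> complex"
 assumes w: "weakly_converges \<mu> \<mu>' F" and p: "\<forall>\<^sub>F i in F. prob_on (\<mu> i)" "prob_on \<mu>'"
  and f: "continuous_on UNIV f" "\<And>x. cmod (f x) \<le> B"
 shows "((\<lambda>i. \<integral>x. f x \<partial>\<mu> i) \<longlongrightarrow> (\<integral>x. f x \<partial>\<mu>')) F"
proof -
 have m: "f \<in> borel_measurable borel" using f(1) by (rule borel_measurable_continuous_onI)
 have i: "integrable \<rho> f" if "prob_on \<rho>" for \<rho> by (rule integrable_bounded_prob_on[OF that m f(2)])
 have "((\<lambda>i. \<integral>x. Re (f x) \<partial>\<mu> i) \<longlongrightarrow> (\<integral>x. Re (f x) \<partial>\<mu>')) F" "((\<lambda>i. \<integral>x. Im (f x) \<partial>\<mu> i) \<longlongrightarrow> (\<integral>x. Im (f x) \<partial>\<mu>')) F" using w unfolding weakly_converges_def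
  by (auto intro!: continuous_intros f boundedI[where B=B] order_trans[OF abs_Re_le_cmod f(2)] order_trans[OF abs_Im_le_cmod f(2)])
 then have "((\<lambda>i. Complex (\<integral>x. Re (f x) \<partial>\<mu> i) (\<integral>x. Im (f x) \<partial>\<mu> i)) \<longlongrightarrow> Complex (\<integral>x. Re (f x) \<partial>\<mu>') (\<integral>x. Im (f x) \<partial>\<mu>')) F" by (rule tendsto_Complex)
 moreover have C: "Complex (\<integral>x. Re (f x) \<partial>\<rho>) (\<integral>x. Im (f x) \<partial>\<rho>) = (\<integral>x. f x \<partial>\<rho>)" if "prob_on \<rho>" for \<rho> using i[OF that] by (simp add: complex_eq_iff)
 moreover have "\<forall>\<^sub>F i in F. Complex (\<integral>x. Re (f x) \<partial>\<mu> i) (\<integral>x. Im (f x) \<partial>\<mu> i) = (\<integral>x. f x \<partial>\<mu> i)" using p(1) by eventually_elim (rule C)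
 ultimately show ?thesis unfolding C[OF p(2)] by (blast intro: Lim_transform_eventually)
qed

lemma admissible_network:
 assumes "admissible Sa Sb n H"
 shows "is_network (Network {1..n} H)" unfolding is_network_def
proof (intro conjI ballI)
 show "wgt (Network {1..n} H) u v = cnj (wgt (Network {1..n} H) v u)" if "u \<in> verts (Network {1..n} H)" "v \<in> verts (Network {1..n} H)" for u v
  using assms that unfolding admissible_def network.sel by blast
qed (simp add: summable_on_finite)

lemma spectral_tr_rooted_component:
 assumes G: "is_network G" and v: "v \<in> verts G" and d: "0 \<le> d" "2 * d \<le> \<theta>" "0 < \<theta>"
 shows "spectral_measure (tr d \<theta> (nt (rooted_component G v))) (rt (rooted_component G v)) = spectral_measure (tr d \<theta> G) v"
proof -
 obtain \<sigma> where \<sigma>: "embeds \<sigma> (nt (rooted_component G v)) G" "\<sigma> (rt (rooted_component G v)) = v" by (rule rep_component[OF G v])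
 have "spectral_measure (tr d \<theta> G) (\<sigma> (rt (rooted_component G v))) = spectral_measure (tr d \<theta> (nt (rooted_component G v))) (rt (rooted_component G v))"
  by (rule embeds_spectral_measure[OF embeds_tr[OF \<sigma>(1)] _ bounded_net_tr bounded_net_tr])
   (use rep_root rep_network G d in auto)
 then show ?thesis by (simp add: \<sigma>(2))
qed

lemma degd_rooted_component:
 assumes "is_network G" "v \<in> verts G"
 shows "degd e (nt (rooted_component G v)) (rt (rooted_component G v)) = degd e G v"
proof -
 obtain \<sigma> where \<sigma>: "embeds \<sigma> (nt (rooted_component G v)) G" "\<sigma> (rt (rooted_component G v)) = v" by (rule rep_component[OF assms])
 show ?thesis using embeds_degd[OF \<sigma>(1) rep_root, of e] \<sigma>(2) by simp
qed

lemma continuous_degd: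
 assumes "0 < d"
 shows "continuous_on UNIV (\<lambda>g. rdeg d g)"
proof (rule continuous_gstarI)
 fix g
 have "((\<lambda>x. degd d (nt (fst x)) (snd x (rt g))) \<longlongrightarrow> rdeg d g) (cfil g)" by (rule net_conv_degd[OF rep_network cfil_net_conv rep_root assms])
 moreover have "\<forall>\<^sub>F x in cfil g. degd d (nt (fst x)) (snd x (rt g)) = degd d (nt (fst x)) (rt (fst x))" using cfil_root by eventually_elim simp
 ultimately show "((\<lambda>x. degd d (nt (fst x)) (rt (fst x))) \<longlongrightarrow> rdeg d g) (cfil g)" by (rule Lim_transform_eventually)
qed

lemma measurable_deg_root: "(\<lambda>g. deg (nt g) (rt g)) \<in> borel_measurable borel"
 using measurable_compose[OF measurable_root_MK measurable_MK_deg[of 0 1]] by simp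

lemma continuous_st:
 assumes "0 < d" "2 * d \<le> \<theta>" "0 < Im z"
 shows "continuous_on UNIV (\<lambda>g. rst z d \<theta> g)" unfolding st_def by (rule continuous_spectral_tr[OF assms(1,2) continuous_resolvent[OF assms(3)]])

lemma norm_st_root_le:
 assumes "0 \<le> d" "2 * d \<le> \<theta>" "0 < \<theta>" "0 < Im z"
 shows "cmod (rst z d \<theta> g) \<le> 1 / Im z" by (rule norm_st_le[OF rep_network rep_root assms])

text \<open>Divided by n, the finite estimate is an inequality between integrals against
  \<open>U_law\<close>; for d > 0 the integrands are bounded and continuous, so it survives the
  local limit.\<close>

lemma integral_st_compare:
 assumes \<rho>: "prob_on \<rho>" and H: "\<And>n. 1 \<le> n \<Longrightarrow> is_network (Network {1..n} (H n))"
  and w: "weakly_converges (\<lambda>n. U_law (Network {1..n} (H n))) \<rho> sequentially"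
  and th: "0 < \<theta>'" "\<theta>' \<le> \<theta>" "\<theta> < 1" and d: "0 < d" "2 * d \<le> \<theta>'" and e: "0 < e" and z: "0 < Im z"
 shows "cmod ((\<integral>g. rst z d \<theta>' g \<partial>\<rho>) - (\<integral>g. rst z d \<theta> g \<partial>\<rho>))
   \<le> (8 / Im z) * (\<integral>g. bad \<theta> e (rdeg d g) (rdeg \<theta>' g) (rdeg \<theta> g) \<partial>\<rho>) + sqrt e / (Im z)\<^sup>2"
proof -
 define k where "k g = bad \<theta> e (rdeg d g) (rdeg \<theta>' g) (rdeg \<theta> g)" for g
 let ?U = "\<lambda>n. U_law (Network {1..n} (H n))"
 have "\<theta>\<^sup>2 < 1" using th by (simp add: abs_square_less_1)
 then have L: "0 < 1 / \<theta>\<^sup>2 - 1" using th by simp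
 have kc: "continuous_on UNIV k" unfolding k_def using L e d th by (intro continuous_intros continuous_degd) auto
 have kb: "\<bar>k g\<bar> \<le> 2" for g
 proof -
  have "0 \<le> rdeg d g / (1 / \<theta>\<^sup>2 - 1)" using degd_nonneg[of d] d L by simp
  moreover have "0 \<le> (rdeg \<theta>' g - rdeg \<theta> g) / e" using degd_antimono[OF rep_network rep_root th(1,2), of g] e by simp
  ultimately show ?thesis unfolding k_def by auto
 qed
 have pU: "\<forall>\<^sub>F n in sequentially. prob_on (?U n)" using eventually_ge_at_top[of "1::nat"] by eventually_elim (rule prob_on_U_law, auto)
 have c: "((\<lambda>n. \<integral>g. rst z d \<theta>' g \<partial>?U n) \<longlongrightarrow> (\<integral>g. rst z d \<theta>' g \<partial>\<rho>)) sequentially"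
   "((\<lambda>n. \<integral>g. rst z d \<theta> g \<partial>?U n) \<longlongrightarrow> (\<integral>g. rst z d \<theta> g \<partial>\<rho>)) sequentially"
  by (rule weakly_converges_complex[OF w pU \<rho> continuous_st norm_st_root_le]; use th d z in simp)+
 have ck: "((\<lambda>n. \<integral>g. k g \<partial>?U n) \<longlongrightarrow> (\<integral>g. k g \<partial>\<rho>)) sequentially" using w kc kb unfolding weakly_converges_def by (auto intro!: boundedI[where B=2])
 have le: "\<forall>\<^sub>F n in sequentially. cmod ((\<integral>g. rst z d \<theta>' g \<partial>?U n) - (\<integral>g. rst z d \<theta> g \<partial>?U n))
   \<le> (8 / Im z) * (\<integral>g. k g \<partial>?U n) + sqrt e / (Im z)\<^sup>2" using eventually_ge_at_top[of "1::nat"]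
 proof eventually_elim
  case (elim n)
  let ?N = "Network {1..n} (H n)"
  note N = H[OF elim]
  have st: "(\<integral>g. rst z d t g \<partial>?U n) = (\<Sum>v\<in>verts ?N. st z d t ?N v) / n" if "2 * d \<le> t" for t
  proof -
   have t: "0 < t" using that d by simp
   have "(\<integral>g. rst z d t g \<partial>?U n) = (\<Sum>v\<in>verts ?N. st z d t (nt (rooted_component ?N v)) (rt (rooted_component ?N v))) / card (verts ?N)"
    by (rule integral_U_law_complex[OF _ _ borel_measurable_continuous_onI[OF continuous_st] norm_st_root_le]) (use elim d t z that in auto)
   then show ?thesis using spectral_tr_rooted_component[OF N _ less_imp_le[OF d(1)] that t] by (simp add: st_def)
  qed
  have "(\<integral>g. k g \<partial>?U n) = (\<Sum>v\<in>verts ?N. k (rooted_component ?N v)) / n" by (subst integral_U_law[OF _ borel_measurable_continuous_onI[OF kc]]) auto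
  also have "(\<Sum>v\<in>verts ?N. k (rooted_component ?N v)) = (\<Sum>v\<in>verts ?N. bad \<theta> e (degd d ?N v) (degd \<theta>' ?N v) (degd \<theta> ?N v))"
   unfolding k_def by (rule sum.cong) (use degd_rooted_component[OF N] in auto)
  finally have k: "(\<integral>g. k g \<partial>?U n) = (\<Sum>v\<in>verts ?N. bad \<theta> e (degd d ?N v) (degd \<theta>' ?N v) (degd \<theta> ?N v)) / n" .
  have "cmod ((\<Sum>v\<in>verts ?N. st z d \<theta>' ?N v) - (\<Sum>v\<in>verts ?N. st z d \<theta> ?N v)) / n
   \<le> ((8 / Im z) * (\<Sum>v\<in>verts ?N. bad \<theta> e (degd d ?N v) (degd \<theta>' ?N v) (degd \<theta> ?N v)) + real (card (verts ?N)) * (sqrt e / (Im z)\<^sup>2)) / n"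
   by (rule divide_right_mono[OF st_compare_finite[OF N _ th d e z]]) auto
  also have "\<dots> = (8 / Im z) * (\<integral>g. k g \<partial>?U n) + sqrt e / (Im z)\<^sup>2" unfolding k using elim by (simp add: add_divide_distrib)
  finally show ?case using st[OF d(2)] st[of \<theta>] d th by (simp add: norm_divide flip: diff_divide_distrib)
 qed
 show ?thesis unfolding k_def[symmetric] by (rule tendsto_le[OF sequentially_bot _ _ le]) (intro tendsto_intros ck c)+
qed

lemma integral_st_tendsto:
 assumes \<rho>: "prob_on \<rho>" and \<theta>: "0 < \<theta>" and z: "0 < Im z"
  and d: "\<And>n::nat. 0 < d n" "\<And>n. 2 * d n \<le> \<theta>" "d \<longlonglongrightarrow> 0"
 shows "(\<lambda>g. rst z 0 \<theta> g) \<in> borel_measurable borel"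
  and "(\<lambda>n. \<integral>g. rst z (d n) \<theta> g \<partial>\<rho>) \<longlonglongrightarrow> (\<integral>g. rst z 0 \<theta> g \<partial>\<rho>)"
proof -
 interpret prob_space \<rho> using \<rho> by (simp add: prob_on_def)
 have s: "sets \<rho> = sets borel" using \<rho> by (simp add: prob_on_def)
 have m: "(\<lambda>g. rst z (d n) \<theta> g) \<in> borel_measurable borel" for n by (rule borel_measurable_continuous_onI[OF continuous_st]) (use d z in auto)
 have "filterlim d (at_right 0) sequentially"
  unfolding filterlim_at using d(1,3) not_sym[OF less_imp_neq[OF d(1)]] by (auto intro!: always_eventually)
 then have lim: "(\<lambda>n. rst z (d n) \<theta> g) \<longlonglongrightarrow> rst z 0 \<theta> g" for g
  unfolding st_def by (rule filterlim_compose[OF spectral_integral_tr_tendsto[OF rep_network rep_root \<theta> continuous_resolvent[OF z]]])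
 show m0: "(\<lambda>g. rst z 0 \<theta> g) \<in> borel_measurable borel" by (rule borel_measurable_LIMSEQ_metric[OF m lim])
 show "(\<lambda>n. \<integral>g. rst z (d n) \<theta> g \<partial>\<rho>) \<longlonglongrightarrow> (\<integral>g. rst z 0 \<theta> g \<partial>\<rho>)"
 proof (rule integral_dominated_convergence[where w="\<lambda>_. 1 / Im z"])
  show "(\<lambda>g. rst z 0 \<theta> g) \<in> borel_measurable \<rho>" "\<And>n. (\<lambda>g. rst z (d n) \<theta> g) \<in> borel_measurable \<rho>" using m m0 s by (simp_all cong: measurable_cong_sets)
  show "AE g in \<rho>. (\<lambda>n. rst z (d n) \<theta> g) \<longlonglongrightarrow> rst z 0 \<theta> g" using lim by simp
  show "AE g in \<rho>. cmod (rst z (d n) \<theta> g) \<le> 1 / Im z" for n using norm_st_root_le[of "d n" \<theta> z] d(1,2)[of n] \<theta> z by (simp add: less_imp_le)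
 qed simp
qed

text \<open>The cut-off d tends to 0 on the left; on the right the first two degrees are replaced by
  the larger \<open>deg\<close>. The bound is then free of \<theta>', which is what makes the family
  Cauchy.\<close>

lemma integral_st_compare_0:
 assumes \<rho>: "prob_on \<rho>" and H: "\<And>n. 1 \<le> n \<Longrightarrow> is_network (Network {1..n} (H n))"
  and w: "weakly_converges (\<lambda>n. U_law (Network {1..n} (H n))) \<rho> sequentially"
  and th: "0 < \<theta>'" "\<theta>' \<le> \<theta>" "\<theta> < 1" and e: "0 < e" and z: "0 < Im z"
 shows "cmod ((\<integral>g. rst z 0 \<theta>' g \<partial>\<rho>) - (\<integral>g. rst z 0 \<theta> g \<partial>\<rho>))
   \<le> (8 / Im z) * (\<integral>g. bad \<theta> e (deg (nt g) (rt g)) (deg (nt g) (rt g)) (rdeg \<theta> g) \<partial>\<rho>) + sqrt e / (Im z)\<^sup>2" (is "_ \<le> ?B")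
proof -
 have "\<theta>\<^sup>2 < 1" using th by (simp add: abs_square_less_1)
 then have L: "0 < 1 / \<theta>\<^sup>2 - 1" using th by simp
 have s: "sets \<rho> = sets borel" using \<rho> by (simp add: prob_on_def)
 have [measurable]: "(\<lambda>g. rdeg t g) \<in> borel_measurable borel" if "0 < t" for t by (rule borel_measurable_continuous_onI[OF continuous_degd[OF that]])
 note [measurable] = measurable_deg_root
 note p = degd_le_deg[OF rep_network rep_root] degd_nonneg degd_antimono[OF rep_network rep_root th(1,2)]
 define d where "d n = \<theta>' / 2 * inverse (real (Suc n))" for n
 have d: "0 < d n" "2 * d n \<le> \<theta>'" "2 * d n \<le> \<theta>" for n
 proof -
  show "0 < d n" using th by (simp add: d_def)
  have "\<theta>' * inverse (real (Suc n)) \<le> \<theta>' * 1" by (rule mult_left_mono) (use th in \<open>auto simp: field_simps\<close>)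
  then have "2 * d n \<le> \<theta>'" by (simp add: d_def)
  then show "2 * d n \<le> \<theta>'" "2 * d n \<le> \<theta>" using th by linarith+
 qed
 have d0: "d \<longlonglongrightarrow> 0" unfolding d_def[abs_def] by (rule tendsto_mult_right_zero[OF LIMSEQ_inverse_real_of_nat])
 have lim: "(\<lambda>n. cmod ((\<integral>g. rst z (d n) \<theta>' g \<partial>\<rho>) - (\<integral>g. rst z (d n) \<theta> g \<partial>\<rho>)))
   \<longlonglongrightarrow> cmod ((\<integral>g. rst z 0 \<theta>' g \<partial>\<rho>) - (\<integral>g. rst z 0 \<theta> g \<partial>\<rho>))" by (intro tendsto_intros integral_st_tendsto(2)[OF \<rho> _ z] d d0) (use th in auto)
 show ?thesis
 proof (rule LIMSEQ_le_const2[OF lim], intro exI allI impI)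
  fix n
  have "cmod ((\<integral>g. rst z (d n) \<theta>' g \<partial>\<rho>) - (\<integral>g. rst z (d n) \<theta> g \<partial>\<rho>))
   \<le> (8 / Im z) * (\<integral>g. bad \<theta> e (rdeg (d n) g) (rdeg \<theta>' g) (rdeg \<theta> g) \<partial>\<rho>) + sqrt e / (Im z)\<^sup>2" by (rule integral_st_compare[OF \<rho> H w th d(1,2) e z])
  also have "\<dots> \<le> ?B"
  proof (intro add_right_mono mult_left_mono integral_mono)
   have "0 \<le> rdeg (d n) g / (1 / \<theta>\<^sup>2 - 1)" "0 \<le> (rdeg \<theta>' g - rdeg \<theta> g) / e"
     "0 \<le> deg (nt g) (rt g) / (1 / \<theta>\<^sup>2 - 1)" "0 \<le> (deg (nt g) (rt g) - rdeg \<theta> g) / e" for g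
    using p(1)[of "d n" g] p(1)[of \<theta> g] p(2)[of "d n" "nt g" "rt g"] p(3)[of g] d(1)[of n] L e th by auto
   then have b: "\<bar>bad \<theta> e (rdeg (d n) g) (rdeg \<theta>' g) (rdeg \<theta> g)\<bar> \<le> 2"
    "\<bar>bad \<theta> e (deg (nt g) (rt g)) (deg (nt g) (rt g)) (rdeg \<theta> g)\<bar> \<le> 2" for g by (auto simp: min_def)
   show "integrable \<rho> (\<lambda>g. bad \<theta> e (rdeg (d n) g) (rdeg \<theta>' g) (rdeg \<theta> g))"
    by (rule integrable_bounded_prob_on[OF \<rho>, where B=2]) (use b(1) d th in \<open>measurable, auto\<close>)
   show "integrable \<rho> (\<lambda>g. bad \<theta> e (deg (nt g) (rt g)) (deg (nt g) (rt g)) (rdeg \<theta> g))"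
    by (rule integrable_bounded_prob_on[OF \<rho>, where B=2]) (use b(2) th in \<open>measurable, auto\<close>)
   fix g
   have "rdeg (d n) g / (1 / \<theta>\<^sup>2 - 1) \<le> deg (nt g) (rt g) / (1 / \<theta>\<^sup>2 - 1)" using p(1)[of "d n" g] d(1)[of n] L by (simp add: divide_right_mono)
   moreover have "(rdeg \<theta>' g - rdeg \<theta> g) / e \<le> (deg (nt g) (rt g) - rdeg \<theta> g) / e" using p(1)[of "\<theta>'" g] th e by (simp add: divide_right_mono)
   ultimately show "bad \<theta> e (rdeg (d n) g) (rdeg \<theta>' g) (rdeg \<theta> g)
     \<le> bad \<theta> e (deg (nt g) (rt g)) (deg (nt g) (rt g)) (rdeg \<theta> g)" by (intro add_mono min.mono order_refl)
  qed (use z in simp)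
  finally show "cmod ((\<integral>g. rst z (d n) \<theta>' g \<partial>\<rho>) - (\<integral>g. rst z (d n) \<theta> g \<partial>\<rho>)) \<le> ?B" .
 qed
qed

text \<open>Dominated convergence: degrees are finite, and \<open>degd t\<close> tends to
  \<open>deg\<close> as t tends to 0. The shift by 2 keeps the level below 1, where the denominator
  is positive.\<close>

lemma bad_mass_tendsto:
 assumes \<rho>: "prob_on \<rho>" and e: "0 < e"
 shows "((\<lambda>n. \<integral>g. min 1 (deg (nt g) (rt g) / (1 / (1 / real (n + 2))\<^sup>2 - 1))
      + min 1 ((deg (nt g) (rt g) - rdeg (1 / real (n + 2)) g) / e) \<partial>\<rho>) \<longlonglongrightarrow> 0)"
proof -
 interpret prob_space \<rho> using \<rho> by (simp add: prob_on_def)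
 have s: "sets \<rho> = sets borel" using \<rho> by (simp add: prob_on_def)
 have [measurable]: "(\<lambda>g. rdeg t g) \<in> borel_measurable borel" if "0 < t" for t by (rule borel_measurable_continuous_onI[OF continuous_degd[OF that]])
 note [measurable] = measurable_deg_root
 define t where "t n = 1 / real (n + 2)" for n :: nat
 have t: "0 < t n" for n by (simp add: t_def)
 define k where "k n g = min 1 (deg (nt g) (rt g) / (1 / (t n)\<^sup>2 - 1)) + min 1 ((deg (nt g) (rt g) - rdeg (t n) g) / e)" for n g
 have km: "k n \<in> borel_measurable \<rho>" for n
 proof -
  have "k n \<in> borel_measurable borel" unfolding k_def using t[of n] by measurable
  then show ?thesis using s by (simp cong: measurable_cong_sets)
 qed
 have "t \<longlonglongrightarrow> 0" unfolding t_def using LIMSEQ_ignore_initial_segment[OF lim_1_over_n, of 2] by simp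
 then have tf: "filterlim t (at_right 0) sequentially" unfolding filterlim_at using t not_sym[OF less_imp_neq[OF t]] by (auto intro!: always_eventually)
 have lim: "(\<lambda>n. k n g) \<longlonglongrightarrow> 0" for g
 proof -
  have "filterlim (\<lambda>n. (real (n + 2))\<^sup>2 - 1) at_top sequentially" by real_asymp
  then have "(\<lambda>n. deg (nt g) (rt g) / ((real (n + 2))\<^sup>2 - 1)) \<longlonglongrightarrow> 0" by (intro tendsto_divide_0[OF tendsto_const] filterlim_at_top_imp_at_infinity)
  then have 1: "(\<lambda>n. deg (nt g) (rt g) / (1 / (t n)\<^sup>2 - 1)) \<longlonglongrightarrow> 0" by (simp add: t_def power_divide)
  have "(\<lambda>n. rdeg (t n) g) \<longlonglongrightarrow> deg (nt g) (rt g)" by (rule filterlim_compose[OF degd_tendsto[OF rep_network rep_root] tf])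
  then have 2: "(\<lambda>n. (deg (nt g) (rt g) - rdeg (t n) g) / e) \<longlonglongrightarrow> (deg (nt g) (rt g) - deg (nt g) (rt g)) / e" using e by (intro tendsto_intros) auto
  have "(\<lambda>n. k n g) \<longlonglongrightarrow> min 1 0 + min 1 ((deg (nt g) (rt g) - deg (nt g) (rt g)) / e)" unfolding k_def by (intro tendsto_intros 1 2)
  then show ?thesis by simp
 qed
 have kb: "norm (k n g) \<le> 2" for n g
 proof -
  have "(t n)\<^sup>2 < 1" by (simp add: abs_square_less_1 t_def)
  then have "0 < 1 / (t n)\<^sup>2 - 1" using t[of n] by simp
  then have "0 \<le> deg (nt g) (rt g) / (1 / (t n)\<^sup>2 - 1)" using degd_nonneg[of 0 "nt g" "rt g"] by (simp add: degd_0)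
  moreover have "0 \<le> (deg (nt g) (rt g) - rdeg (t n) g) / e" using degd_le_deg[OF rep_network rep_root, of "t n" g] t[of n] e by simp
  ultimately show ?thesis unfolding k_def by auto
 qed
 have "(\<lambda>n. \<integral>g. k n g \<partial>\<rho>) \<longlonglongrightarrow> (\<integral>g. 0 \<partial>\<rho>)" by (rule integral_dominated_convergence[where w="\<lambda>_. 2"]) (use km lim kb in auto)
 then show ?thesis unfolding k_def t_def by simp
qed

text \<open>Comparing with one level t is enough: two smaller levels are compared through t by the
  triangle inequality.\<close>

lemma cauchy_at_right_0:
 fixes S :: "real \<Rightarrow> 'a::banach"
 assumes "\<And>e. 0 < e \<Longrightarrow> \<exists>t>0. \<forall>s. 0 < s \<and> s \<le> t \<longrightarrow> norm (S s - S t) \<le> e"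
 shows "\<exists>l. (S \<longlongrightarrow> l) (at_right 0)"
proof -
 have c: "\<exists>t>0. \<forall>s r. 0 < s \<and> s \<le> t \<and> 0 < r \<and> r \<le> t \<longrightarrow> norm (S s - S r) < e" if e: "0 < e" for e
 proof -
  obtain t where t: "0 < t" "\<And>s. 0 < s \<Longrightarrow> s \<le> t \<Longrightarrow> norm (S s - S t) \<le> e / 3" using assms[of "e / 3"] e by auto
  have "norm (S s - S r) < e" if "0 < s" "s \<le> t" "0 < r" "r \<le> t" for s r
   using norm_triangle_ineq4[of "S s - S t" "S r - S t"] t(2)[OF that(1,2)] t(2)[OF that(3,4)] e by simp
  then show ?thesis using t(1) by blast
 qed
 define x where "x n = 1 / real (Suc n)" for n
 have x0: "0 < x n" for n by (simp add: x_def)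
 have "x \<longlonglongrightarrow> 0" unfolding x_def using LIMSEQ_Suc[OF lim_1_over_n] by simp
 then have xs: "\<forall>\<^sub>F n in sequentially. x n \<le> t" if "0 < t" for t using that by (auto dest: order_tendstoD(2) elim!: eventually_mono)
 have "Cauchy (\<lambda>n. S (x n))"
 proof (rule CauchyI)
  fix e :: real assume "0 < e"
  then obtain t where t: "0 < t" "\<And>s r. 0 < s \<and> s \<le> t \<and> 0 < r \<and> r \<le> t \<Longrightarrow> norm (S s - S r) < e" using c by blast
  then obtain N where "\<And>n. N \<le> n \<Longrightarrow> x n \<le> t" using xs[OF t(1)] by (auto simp: eventually_sequentially)
  then show "\<exists>M. \<forall>m\<ge>M. \<forall>n\<ge>M. norm (S (x m) - S (x n)) < e" using t(2) x0 by blast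
 qed
 then obtain l where l: "(\<lambda>n. S (x n)) \<longlonglongrightarrow> l" using Cauchy_convergent convergent_def by blast
 have "(S \<longlongrightarrow> l) (at_right 0)"
 proof (rule tendstoI)
  fix e :: real assume e: "0 < e"
  then obtain t where t: "0 < t" "\<And>s r. 0 < s \<and> s \<le> t \<and> 0 < r \<and> r \<le> t \<Longrightarrow> norm (S s - S r) < e / 2" using c[of "e / 2"] by auto
  show "\<forall>\<^sub>F s in at_right 0. dist (S s) l < e" using eventually_at_right_small[OF t(1)]
  proof eventually_elim
   case (elim s)
   have "norm (S s - l) \<le> e / 2"
   proof (rule tendsto_upperbound)
    show "(\<lambda>n. norm (S s - S (x n))) \<longlonglongrightarrow> norm (S s - l)" by (intro tendsto_intros l)
    show "\<forall>\<^sub>F n in sequentially. norm (S s - S (x n)) \<le> e / 2" using xs[OF t(1)] by eventually_elim (use t(2) elim x0 in \<open>auto intro!: less_imp_le\<close>)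
   qed simp
   then show ?case using e by (simp add: dist_norm)
  qed
 qed
 then show ?thesis ..
qed

lemma integral_st_converges:
 assumes \<rho>: "prob_on \<rho>" and H: "\<And>n. 1 \<le> n \<Longrightarrow> is_network (Network {1..n} (H n))"
  and w: "weakly_converges (\<lambda>n. U_law (Network {1..n} (H n))) \<rho> sequentially" and z: "0 < Im z"
 shows "\<exists>l. ((\<lambda>\<theta>. \<integral>g. rst z 0 \<theta> g \<partial>\<rho>) \<longlongrightarrow> l) (at_right 0)"
proof (rule cauchy_at_right_0)
 fix \<epsilon> :: real assume \<epsilon>: "0 < \<epsilon>"
 \<comment> \<open>Makes the second term of the comparison equal to \<epsilon>/2; the level t is
   then chosen for the first term.\<close>
 define e where "e = (\<epsilon> / 2 * (Im z)\<^sup>2)\<^sup>2"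
 have e: "0 < e" using \<epsilon> z by (simp add: e_def)
 have se: "sqrt e / (Im z)\<^sup>2 = \<epsilon> / 2" using \<epsilon> z by (simp add: e_def)
 let ?k = "\<lambda>\<theta>. \<integral>g. bad \<theta> e (deg (nt g) (rt g)) (deg (nt g) (rt g)) (rdeg \<theta> g) \<partial>\<rho>"
 have "(\<lambda>n. (8 / Im z) * ?k (1 / real (n + 2))) \<longlonglongrightarrow> (8 / Im z) * 0" by (intro tendsto_intros bad_mass_tendsto[OF \<rho> e])
 then have "\<forall>\<^sub>F n in sequentially. (8 / Im z) * ?k (1 / real (n + 2)) < \<epsilon> / 2" using \<epsilon> by (auto dest!: order_tendstoD(2)[of _ _ _ "\<epsilon> / 2"])
 then obtain n where n: "(8 / Im z) * ?k (1 / real (n + 2)) < \<epsilon> / 2" by (auto simp: eventually_sequentially)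
 define t where "t = 1 / real (n + 2)"
 have t: "0 < t" "t < 1" by (simp_all add: t_def)
 have "cmod ((\<integral>g. rst z 0 s g \<partial>\<rho>) - (\<integral>g. rst z 0 t g \<partial>\<rho>)) \<le> \<epsilon>" if "0 < s" "s \<le> t" for s
  using integral_st_compare_0[OF \<rho> H w that t(2) e z] n[folded t_def] se by linarith
 then show "\<exists>t>0. \<forall>s. 0 < s \<and> s \<le> t \<longrightarrow> cmod ((\<integral>g. rst z 0 s g \<partial>\<rho>) - (\<integral>g. rst z 0 t g \<partial>\<rho>)) \<le> \<epsilon>" using t(1) by blast
qed

section \<open>The lower bound\<close>

text \<open>Each share \<open>a i / S\<close> is at most 1, hence at most its p-th power, and the
  shares sum to 1.\<close>

lemma powr_sum_le_sum_powr:
 fixes a :: "'i \<Rightarrow> real"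
 assumes fin: "finite A" and a: "\<And>i. i \<in> A \<Longrightarrow> 0 \<le> a i" and p: "0 < p" "p \<le> 1"
 shows "(\<Sum>i\<in>A. a i) powr p \<le> (\<Sum>i\<in>A. a i powr p)"
proof (cases "(\<Sum>i\<in>A. a i) = 0")
 case True
 then show ?thesis by (simp add: sum_nonneg)
next
 case False
 define S where "S = (\<Sum>i\<in>A. a i)"
 have S: "0 < S" using False a sum_nonneg[of A a] by (auto simp: S_def order_less_le)
 have "S powr p = (\<Sum>i\<in>A. S powr p * (a i / S))" using S by (simp add: S_def flip: sum_distrib_left sum_divide_distrib)
 also have "\<dots> \<le> (\<Sum>i\<in>A. a i powr p)"
 proof (rule sum_mono)
  fix i assume i: "i \<in> A"
  have "a i \<le> S" unfolding S_def by (rule member_le_sum[OF i _ fin]) (use a in auto)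
  then have "a i / S \<le> (a i / S) powr p" using powr_mono'[OF p(2), of "a i / S"] S a[OF i] by simp
  then have "S powr p * (a i / S) \<le> S powr p * (a i / S) powr p" by (intro mult_left_mono) auto
  also have "\<dots> = a i powr p" using S a[OF i] by (simp flip: powr_mult)
  finally show "S powr p * (a i / S) \<le> a i powr p" .
 qed
 finally show ?thesis by (simp add: S_def)
qed

lemma power2_powr_half: "0 \<le> c \<Longrightarrow> (c\<^sup>2) powr (\<alpha> / 2) = c powr (\<alpha>::real)" by (cases "c = 0") (simp_all add: powr_powr flip: powr_numeral)

text \<open>Jensen's inequality through a tangent line: with p = \<alpha>/2, Young's inequality
  bounds the p-th power of x^2/s by p x^2/s + 1 - p, where s is the second moment. If that moment is
  0, every small s > 0 serves.\<close>

lemma abs_moment_le_second_moment: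
 assumes \<mu>: "real_distribution \<mu>" and i: "integrable \<mu> (\<lambda>x. x\<^sup>2)" and \<alpha>: "0 < \<alpha>" "\<alpha> < 2"
 shows "abs_moment \<alpha> \<mu> \<le> ennreal ((\<integral>x. x\<^sup>2 \<partial>\<mu>) powr (\<alpha> / 2))"
proof -
 interpret real_distribution \<mu> by fact
 let ?s = "\<integral>x. x\<^sup>2 \<partial>\<mu>" and ?p = "\<alpha> / 2"
 have *: "abs_moment \<alpha> \<mu> \<le> ennreal (s powr ?p)" if s: "0 < s" "?s \<le> s" for s
 proof -
  have y: "\<bar>x\<bar> powr \<alpha> \<le> s powr ?p * (?p * (x\<^sup>2 / s) + (1 - ?p))" for x
  proof (cases "x = 0")
   case True
   then show ?thesis using \<alpha> by simp
  next
   case False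
   have "(x\<^sup>2 / s) powr ?p * 1 powr (1 - ?p) \<le> ?p * (x\<^sup>2 / s) + (1 - ?p) * 1" by (rule Youngs_inequality_0) (use \<alpha> s False in auto)
   then have "s powr ?p * (x\<^sup>2 / s) powr ?p \<le> s powr ?p * (?p * (x\<^sup>2 / s) + (1 - ?p))" by (intro mult_left_mono) auto
   moreover have "s powr ?p * (x\<^sup>2 / s) powr ?p = (\<bar>x\<bar>\<^sup>2) powr ?p" using s by (simp flip: powr_mult)
   ultimately show ?thesis by (simp only: power2_powr_half[OF abs_ge_zero])
  qed
  have "abs_moment \<alpha> \<mu> \<le> (\<integral>\<^sup>+ x. ennreal (s powr ?p * (?p * (x\<^sup>2 / s) + (1 - ?p))) \<partial>\<mu>)"
   unfolding abs_moment_def by (intro nn_integral_mono ennreal_leI y)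
  also have "\<dots> = ennreal (\<integral>x. s powr ?p * (?p * (x\<^sup>2 / s) + (1 - ?p)) \<partial>\<mu>)" by (rule nn_integral_eq_integral) (use i \<alpha> s in auto)
  also have "(\<integral>x. s powr ?p * (?p * (x\<^sup>2 / s) + (1 - ?p)) \<partial>\<mu>) = s powr ?p * (?p * (?s / s) + (1 - ?p))"
   using i by (simp add: prob_space[unfolded space_eq_univ])
  also have "\<dots> \<le> s powr ?p * (?p * 1 + (1 - ?p))"
  proof -
   have "?s / s \<le> 1" using s by (simp add: divide_le_eq_1)
   then show ?thesis using \<alpha> by (intro mult_left_mono add_right_mono) auto
  qed
  finally show ?thesis by (simp add: ennreal_leI)
 qed
 show ?thesis
 proof (cases "?s = 0")
  case True
  have "abs_moment \<alpha> \<mu> \<le> 0 + ennreal e" if "0 < e" for e using *[of "e powr (1 / ?p)"] that True \<alpha> by (simp add: powr_powr)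
  then have "abs_moment \<alpha> \<mu> \<le> 0" by (rule ennreal_le_epsilon)
  then show ?thesis by simp
 next
  case False
  moreover have "0 \<le> ?s" by simp
  ultimately show ?thesis by (intro *) linarith+
 qed
qed

lemma abs_moment_spectral_tr_le:
 assumes G: "is_network G" and v: "v \<in> verts G" and \<theta>: "0 < \<theta>" and \<alpha>: "0 < \<alpha>" "\<alpha> < 2"
 shows "abs_moment \<alpha> (spectral_measure (tr 0 \<theta> G) v) \<le> (\<Sum>\<^sub>\<infinity>u\<in>verts G. ennreal (cmod (wgt G v u) powr \<alpha>))"
proof -
 let ?T = "tr 0 \<theta> G"
 let ?N = "nb ?T v"
 have th: "(0::real) \<le> 0" "2 * 0 \<le> \<theta>" using \<theta> by auto
 note p = spectral_tr[OF G v th \<theta>]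
 have fin: "finite ?N" by (rule finite_nb_tr[OF G v th \<theta>])
 have N: "?N \<subseteq> verts G" by (auto simp: nb_def)
 \<comment> \<open>The second moment counts closed walks of two steps, so it is the sum of the
   squared moduli of the weights at v.\<close>
 have "walks ?T 2 v v = (\<Sum>w\<in>?N. wgt ?T v w * (\<Sum>x\<in>nb ?T w. wgt ?T w x * (if x = v then 1 else 0)))" by (simp add: numeral_2_eq_2)
 also have "\<dots> = (\<Sum>w\<in>?N. complex_of_real ((cmod (wgt ?T v w))\<^sup>2))"
 proof (rule sum.cong[OF refl])
  fix w assume w: "w \<in> ?N"
  have wv: "wgt ?T w v = cnj (wgt ?T v w)" using hermitian_onD[OF hermitian_tr[OF G] v, of w] w N by auto
  have "finite (nb ?T w)" by (rule finite_nb_tr[OF G _ th \<theta>]) (use w N in auto)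
  moreover have "v \<in> nb ?T w" using w v wv by (auto simp: nb_def)
  ultimately have "(\<Sum>x\<in>nb ?T w. wgt ?T w x * (if x = v then 1 else 0)) = wgt ?T w v" by (simp add: if_distrib cong: if_cong)
  then show "wgt ?T v w * (\<Sum>x\<in>nb ?T w. wgt ?T w x * (if x = v then 1 else 0)) = complex_of_real ((cmod (wgt ?T v w))\<^sup>2)"
   unfolding wv by (simp only: complex_norm_square)
 qed
 finally have w2: "walks ?T 2 v v = complex_of_real (\<Sum>w\<in>?N. (cmod (wgt ?T v w))\<^sup>2)" by (simp only: of_real_sum)
 have s: "(\<integral>x. x\<^sup>2 \<partial>spectral_measure ?T v) = (\<Sum>w\<in>?N. (cmod (wgt ?T v w))\<^sup>2)" using p(3)[of 2] unfolding w2 by (simp only: of_real_eq_iff)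
 have "integrable (spectral_measure ?T v) (\<lambda>x. x\<^sup>2)" by (rule AE_bounded_continuous_integrable[OF p(1) _ p(2)]) (intro continuous_intros)
 from abs_moment_le_second_moment[OF p(1) this \<alpha>]
 have "abs_moment \<alpha> (spectral_measure ?T v) \<le> ennreal ((\<Sum>w\<in>?N. (cmod (wgt ?T v w))\<^sup>2) powr (\<alpha> / 2))" unfolding s .
 also have "\<dots> \<le> ennreal (\<Sum>w\<in>?N. ((cmod (wgt ?T v w))\<^sup>2) powr (\<alpha> / 2))" by (intro ennreal_leI powr_sum_le_sum_powr fin) (use \<alpha> in auto)
 also have "\<dots> \<le> ennreal (\<Sum>w\<in>?N. cmod (wgt G v w) powr \<alpha>)"
  by (intro ennreal_leI sum_mono) (use \<alpha> \<theta> in \<open>auto simp: power2_powr_half intro!: powr_mono2 wgt_tr_le\<close>)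
 also have "\<dots> = (\<Sum>w\<in>?N. ennreal (cmod (wgt G v w) powr \<alpha>))" by simp
 also have "\<dots> \<le> (\<Sum>\<^sub>\<infinity>u\<in>verts G. ennreal (cmod (wgt G v u) powr \<alpha>))" by (subst nonneg_infsum_complete, simp) (rule SUP_upper, use fin N in simp)
 finally show ?thesis .
qed

lemma mean_spectral_truncate:
 assumes \<rho>: "prob_on \<rho>" and \<theta>: "0 < \<theta>"
 shows real_distribution_mean: "real_distribution (mean_tr \<theta> \<rho>)"
  and integral_mean: "\<And>(f :: real \<Rightarrow> real) B. f \<in> borel_measurable borel \<Longrightarrow> (\<And>x. \<bar>f x\<bar> \<le> B) \<Longrightarrow>
    (\<integral>x. f x \<partial>mean_tr \<theta> \<rho>) = (\<integral>g. (\<integral>x. f x \<partial>rspec 0 \<theta> g) \<partial>\<rho>)"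
  and nn_integral_mean: "\<And>f. f \<in> borel_measurable borel \<Longrightarrow>
    (\<integral>\<^sup>+ x. f x \<partial>mean_tr \<theta> \<rho>) = (\<integral>\<^sup>+ g. (\<integral>\<^sup>+ x. f x \<partial>rspec 0 \<theta> g) \<partial>\<rho>)"
proof -
 interpret prob_space \<rho> using \<rho> by (simp add: prob_on_def)
 note b = mean_spectral_eq_bind[OF \<rho> \<theta>]
 note s = measurable_prob_algebraD[OF b(2)]
 have p: "real_distribution (rspec 0 \<theta> g)" for g using spectral_tr(1)[OF rep_network rep_root] \<theta> by simp
 have "\<rho> \<in> space (prob_algebra \<rho>)" using prob_space_axioms by (simp add: space_prob_algebra)
 from prob_space_bind'[OF this b(2)] sets_bind'[OF this b(2)]
 show "real_distribution (mean_tr \<theta> \<rho>)" unfolding b(1) by (simp add: real_distribution_def real_distribution_axioms_def)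
 show "(\<integral>x. f x \<partial>mean_tr \<theta> \<rho>) = (\<integral>g. (\<integral>x. f x \<partial>rspec 0 \<theta> g) \<partial>\<rho>)"
  if "f \<in> borel_measurable borel" "\<And>x. \<bar>f x\<bar> \<le> B" for f :: "real \<Rightarrow> real" and B unfolding b(1)
 proof (rule integral_bind[OF that(1) _ s finite_measure_axioms, where B=B and B'=1])
  show "\<bar>f x\<bar> \<le> B" for x by (rule that(2))
  show "AE g in \<rho>. emeasure (rspec 0 \<theta> g) (space (rspec 0 \<theta> g)) \<le> ennreal 1"
   using prob_space.emeasure_space_1[OF real_distribution.axioms(1)[OF p]] by simp
 qed
 show "(\<integral>\<^sup>+ x. f x \<partial>mean_tr \<theta> \<rho>) = (\<integral>\<^sup>+ g. (\<integral>\<^sup>+ x. f x \<partial>rspec 0 \<theta> g) \<partial>\<rho>)"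
  if "f \<in> borel_measurable borel" for f unfolding b(1) by (rule nn_integral_bind[OF that s])
qed

lemma abs_moment_mean_le:
 assumes \<rho>: "prob_on \<rho>" and \<theta>: "0 < \<theta>" and \<alpha>: "0 < \<alpha>" "\<alpha> < 2"
 shows "abs_moment \<alpha> (mean_tr \<theta> \<rho>) \<le> (\<integral>\<^sup>+ g. xi \<alpha> g \<partial>\<rho>)"
proof -
 have "abs_moment \<alpha> (mean_tr \<theta> \<rho>) = (\<integral>\<^sup>+ g. abs_moment \<alpha> (rspec 0 \<theta> g) \<partial>\<rho>)" unfolding abs_moment_def by (rule nn_integral_mean[OF \<rho> \<theta>]) measurable
 also have "\<dots> \<le> (\<integral>\<^sup>+ g. xi \<alpha> g \<partial>\<rho>)" unfolding xi_def by (intro nn_integral_mono abs_moment_spectral_tr_le rep_network rep_root \<theta> \<alpha>)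
 finally show ?thesis .
qed

lemma stieltjes_mean:
 assumes \<rho>: "prob_on \<rho>" and \<theta>: "0 < \<theta>" and z: "0 < Im z"
 shows "stieltjes (mean_tr \<theta> \<rho>) z = (\<integral>g. rst z 0 \<theta> g \<partial>\<rho>)"
proof -
 let ?f = "\<lambda>x. 1 / (complex_of_real x - z)"
 have m: "?f \<in> borel_measurable borel" by (rule borel_measurable_continuous_onI[OF continuous_resolvent[OF z]])
 have i: "integrable \<mu> ?f" if "real_distribution \<mu>" for \<mu> by (rule integrable_resolvent[OF z that])
 have p: "real_distribution (rspec 0 \<theta> g)" for g using spectral_tr(1)[OF rep_network rep_root] \<theta> by simp
 have "(\<lambda>n. \<theta> / 2 * inverse (real (Suc n))) \<longlonglongrightarrow> 0" by (rule tendsto_mult_right_zero[OF LIMSEQ_inverse_real_of_nat])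
 moreover have "2 * (\<theta> / 2 * inverse (real (Suc n))) \<le> \<theta>" for n
 proof -
  have "\<theta> * inverse (real (Suc n)) \<le> \<theta> * 1" by (rule mult_left_mono) (use \<theta> in \<open>auto simp: field_simps\<close>)
  then show ?thesis by simp
 qed
 moreover have "0 < \<theta> / 2 * inverse (real (Suc n))" for n using \<theta> by simp
 ultimately have "(\<lambda>g. rst z 0 \<theta> g) \<in> borel_measurable borel" using integral_st_tendsto(1)[OF \<rho> \<theta> z, of "\<lambda>n. \<theta> / 2 * inverse (real (Suc n))"] by blast
 then have ist: "integrable \<rho> (\<lambda>g. rst z 0 \<theta> g)" by (rule integrable_bounded_prob_on[OF \<rho>]) (rule norm_st_root_le; use \<theta> z in simp)
 note mean = real_distribution_mean[OF \<rho> \<theta>]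
 show ?thesis
 proof (rule complex_eqI)
  have "Re (\<integral>x. ?f x \<partial>mean_tr \<theta> \<rho>) = (\<integral>x. Re (?f x) \<partial>mean_tr \<theta> \<rho>)" by (rule integral_Re[OF i[OF mean], symmetric])
  also have "\<dots> = (\<integral>g. (\<integral>x. Re (?f x) \<partial>rspec 0 \<theta> g) \<partial>\<rho>)"
   using m by (intro integral_mean[OF \<rho> \<theta> _ order_trans[OF abs_Re_le_cmod norm_resolvent_le[OF z]]]) simp
  also have "\<dots> = (\<integral>g. Re (rst z 0 \<theta> g) \<partial>\<rho>)" unfolding st_def by (rule Bochner_Integration.integral_cong[OF refl integral_Re[OF i[OF p]]])
  finally show "Re (\<integral>x. ?f x \<partial>mean_tr \<theta> \<rho>) = Re (\<integral>g. rst z 0 \<theta> g \<partial>\<rho>)" using integral_Re[OF ist] by simp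
  have "Im (\<integral>x. ?f x \<partial>mean_tr \<theta> \<rho>) = (\<integral>x. Im (?f x) \<partial>mean_tr \<theta> \<rho>)" by (rule integral_Im[OF i[OF mean], symmetric])
  also have "\<dots> = (\<integral>g. (\<integral>x. Im (?f x) \<partial>rspec 0 \<theta> g) \<partial>\<rho>)"
   using m by (intro integral_mean[OF \<rho> \<theta> _ order_trans[OF abs_Im_le_cmod norm_resolvent_le[OF z]]]) simp
  also have "\<dots> = (\<integral>g. Im (rst z 0 \<theta> g) \<partial>\<rho>)" unfolding st_def by (rule Bochner_Integration.integral_cong[OF refl integral_Im[OF i[OF p]]])
  finally show "Im (\<integral>x. ?f x \<partial>mean_tr \<theta> \<rho>) = Im (\<integral>g. rst z 0 \<theta> g \<partial>\<rho>)" using integral_Im[OF ist] by simp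
 qed
qed

text \<open>\<open>abs_moment_mean_le\<close> gives tightness and
  \<open>integral_st_converges\<close> the limits of the Stieltjes transforms; the approximating
  matrices are used in the second.\<close>

lemma sofic_mean_converges:
 assumes \<rho>: "\<rho> \<in> sofic Sa Sb" and \<alpha>: "0 < \<alpha>" "\<alpha> < 2" and fin: "(\<integral>\<^sup>+ g. xi \<alpha> g \<partial>\<rho>) < \<top>"
 shows "\<exists>\<nu>. real_distribution \<nu> \<and> weakly_converges (\<lambda>\<theta>. mean_tr \<theta> \<rho>) \<nu> (at_right 0)"
proof -
 obtain H where \<rho>: "prob_on \<rho>" and H: "\<And>n. 1 \<le> n \<Longrightarrow> admissible Sa Sb n (H n)"
  and w: "weakly_converges (\<lambda>n. U_law (Network {1..n} (H n))) \<rho> sequentially" using \<rho> unfolding sofic_def by blast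
 obtain C where C: "(\<integral>\<^sup>+ g. xi \<alpha> g \<partial>\<rho>) = ennreal C" using fin by (cases "\<integral>\<^sup>+ g. xi \<alpha> g \<partial>\<rho>") auto
 show ?thesis
 proof (rule weak_limit_of_stieltjes[OF _ _ \<alpha>(1)])
  show "real_distribution (mean_tr \<theta> \<rho>)" if "0 < \<theta>" "\<theta> < 1" for \<theta> by (rule real_distribution_mean[OF \<rho> that(1)])
  show "abs_moment \<alpha> (mean_tr \<theta> \<rho>) \<le> ennreal C" if "0 < \<theta>" "\<theta> < 1" for \<theta> using abs_moment_mean_le[OF \<rho> that(1) \<alpha>] C by simp
  fix z :: complex assume z: "0 < Im z"
  obtain l where l: "((\<lambda>\<theta>. \<integral>g. rst z 0 \<theta> g \<partial>\<rho>) \<longlongrightarrow> l) (at_right 0)" using integral_st_converges[OF \<rho> admissible_network[OF H] w z] by blast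
  have "\<forall>\<^sub>F \<theta> in at_right 0. (\<integral>g. rst z 0 \<theta> g \<partial>\<rho>) = stieltjes (mean_tr \<theta> \<rho>) z"
   using eventually_at_right_less[of "0::real"] by eventually_elim (rule stieltjes_mean[OF \<rho> _ z, symmetric])
  from Lim_transform_eventually[OF l this]
  show "\<exists>l. ((\<lambda>\<theta>. \<integral>x. 1 / (complex_of_real x - z) \<partial>mean_tr \<theta> \<rho>) \<longlongrightarrow> l) (at_right 0)" by blast
 qed
qed

lemma mu_eqI:
 assumes "0 < \<beta>" "\<beta> < 2" "(\<integral>\<^sup>+ g. xi \<beta> g \<partial>\<rho>) < \<top>" and \<nu>: "real_distribution \<nu>"
  and w: "weakly_converges (\<lambda>\<theta>. mean_tr \<theta> \<rho>) \<nu> (at_right 0)"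
 shows "mu \<rho> = \<nu>"
proof -
 have "(THE \<mu>. real_distribution \<mu> \<and> weakly_converges (\<lambda>\<theta>. mean_tr \<theta> \<rho>) \<mu> (at_right 0)) = \<nu>"
  by (rule the_equality) (use \<nu> w weakly_converges_unique[OF _ \<nu> _ w trivial_limit_at_right_real] in blast)+
 then show ?thesis using assms(1-3) unfolding mu_def by auto
qed

text \<open>The test function is the minimum of |x|^\<alpha> and n, which is bounded and continuous;
  then n grows, by monotone convergence.\<close>

lemma abs_moment_weak_limit_le:
 assumes \<nu>: "real_distribution \<nu>" and w: "weakly_converges \<mu> \<nu> F" and F: "F \<noteq> bot"
  and \<mu>: "\<forall>\<^sub>F i in F. real_distribution (\<mu> i) \<and> abs_moment \<alpha> (\<mu> i) \<le> ennreal C" and \<alpha>: "0 < \<alpha>"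
 shows "abs_moment \<alpha> \<nu> \<le> ennreal C"
proof -
 interpret N: real_distribution \<nu> by fact
 define f where "f n x = min (\<bar>x\<bar> powr \<alpha>) (real n)" for n x
 have fc: "continuous_on UNIV (f n)" for n unfolding f_def
  by (intro continuous_on_min continuous_on_powr' continuous_on_rabs continuous_on_id continuous_on_const) (use \<alpha> in auto)
 have f: "0 \<le> f n x" "\<bar>f n x\<bar> \<le> real n" "f n x \<le> \<bar>x\<bar> powr \<alpha>" for n x by (auto simp: f_def)
 have nn: "(\<integral>\<^sup>+ x. ennreal (f n x) \<partial>\<rho>) = ennreal (\<integral>x. f n x \<partial>\<rho>)" if "real_distribution \<rho>" for n \<rho>
  by (rule nn_integral_eq_integral[OF bounded_continuous_integrable[OF that fc]]) (use f in auto)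
 have "(\<integral>\<^sup>+ x. ennreal (f n x) \<partial>\<nu>) \<le> ennreal C" for n
 proof -
  have "((\<lambda>i. \<integral>x. f n x \<partial>\<mu> i) \<longlongrightarrow> (\<integral>x. f n x \<partial>\<nu>)) F"
  proof -
   have "bounded (range (f n))" by (rule boundedI[where B="real n"]) (use f in auto)
   then show ?thesis using w fc unfolding weakly_converges_def by blast
  qed
  then have "((\<lambda>i. ennreal (\<integral>x. f n x \<partial>\<mu> i)) \<longlongrightarrow> ennreal (\<integral>x. f n x \<partial>\<nu>)) F" by (rule tendsto_ennrealI)
  moreover have "\<forall>\<^sub>F i in F. ennreal (\<integral>x. f n x \<partial>\<mu> i) \<le> ennreal C" using \<mu>
  proof eventually_elim
   case (elim i)
   have "ennreal (\<integral>x. f n x \<partial>\<mu> i) = (\<integral>\<^sup>+ x. ennreal (f n x) \<partial>\<mu> i)" using nn elim by simp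
   also have "\<dots> \<le> abs_moment \<alpha> (\<mu> i)" unfolding abs_moment_def by (intro nn_integral_mono ennreal_leI f)
   also have "\<dots> \<le> ennreal C" using elim by blast
   finally show ?case .
  qed
  ultimately show ?thesis unfolding nn[OF \<nu>] using F by (rule tendsto_upperbound)
 qed
 then have "(SUP n. \<integral>\<^sup>+ x. ennreal (f n x) \<partial>\<nu>) \<le> ennreal C" by (rule SUP_least)
 also have "(SUP n. \<integral>\<^sup>+ x. ennreal (f n x) \<partial>\<nu>) = (\<integral>\<^sup>+ x. (SUP n. ennreal (f n x)) \<partial>\<nu>)"
 proof (rule nn_integral_monotone_convergence_SUP[symmetric])
  show "incseq (\<lambda>n x. ennreal (f n x))" by (auto simp: incseq_def le_fun_def f_def intro!: ennreal_leI)
  show "(\<lambda>x. ennreal (f n x)) \<in> borel_measurable \<nu>" for n unfolding f_def by measurable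
 qed
 also have "(\<lambda>x. SUP n. ennreal (f n x)) = (\<lambda>x. ennreal (\<bar>x\<bar> powr \<alpha>))"
 proof (rule ext, rule antisym)
  fix x
  show "(SUP n. ennreal (f n x)) \<le> ennreal (\<bar>x\<bar> powr \<alpha>)" by (intro SUP_least ennreal_leI f)
  obtain n :: nat where "\<bar>x\<bar> powr \<alpha> \<le> real n" using real_arch_simple by blast
  then have "f n x = \<bar>x\<bar> powr \<alpha>" by (simp add: f_def)
  then show "ennreal (\<bar>x\<bar> powr \<alpha>) \<le> (SUP n. ennreal (f n x))" by (metis SUP_upper UNIV_I)
 qed
 finally show ?thesis by (simp add: abs_moment_def)
qed

text \<open>Lower semicontinuous, as a supremum of finite sums whose terms converge along
  \<open>cfil\<close>.\<close>

lemma measurable_off_diagonal: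
 assumes "0 < \<alpha>"
 shows "(\<lambda>g. \<Sum>\<^sub>\<infinity>v\<in>verts (nt g) - {rt g}. ennreal (cmod (wgt (nt g) (rt g) v) powr \<alpha>)) \<in> borel_measurable borel" (is "?O \<in> _")
proof (rule borel_measurableI_greater)
 fix y
 have S: "?O g = (SUP F\<in>{F. finite F \<and> F \<subseteq> verts (nt g) - {rt g}}. \<Sum>v\<in>F. ennreal (cmod (wgt (nt g) (rt g) v) powr \<alpha>))" for g
  by (rule nonneg_infsum_complete) simp
 have "open {g. y < ?O g}"
 proof (rule open_gstarI)
  fix g assume "g \<in> {g. y < ?O g}"
  then obtain F where F: "finite F" "F \<subseteq> verts (nt g) - {rt g}" "y < (\<Sum>v\<in>F. ennreal (cmod (wgt (nt g) (rt g) v) powr \<alpha>))"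
   unfolding S by (auto simp: less_SUP_iff)
  let ?r = "rt g"
  note c = cfil_net_conv[of g]
  have "((\<lambda>x. \<Sum>v\<in>F. cmod (wgt (nt (fst x)) (snd x ?r) (snd x v)) powr \<alpha>) \<longlongrightarrow> (\<Sum>v\<in>F. cmod (wgt (nt g) ?r v) powr \<alpha>)) (cfil g)"
  proof (rule tendsto_sum)
   fix v assume v: "v \<in> F"
   have "((\<lambda>x. cmod (wgt (nt (fst x)) (snd x ?r) (snd x v))) \<longlongrightarrow> cmod (wgt (nt g) ?r v)) (cfil g)"
    using net_conv_wgt[OF c rep_root, of v] v F(2) by (intro tendsto_norm) auto
   then show "((\<lambda>x. cmod (wgt (nt (fst x)) (snd x ?r) (snd x v)) powr \<alpha>) \<longlongrightarrow> cmod (wgt (nt g) ?r v) powr \<alpha>) (cfil g)"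
    by (rule tendsto_powr2) (use assms in \<open>auto intro: tendsto_const\<close>)
  qed
  then have "((\<lambda>x. ennreal (\<Sum>v\<in>F. cmod (wgt (nt (fst x)) (snd x ?r) (snd x v)) powr \<alpha>)) \<longlongrightarrow> ennreal (\<Sum>v\<in>F. cmod (wgt (nt g) ?r v) powr \<alpha>)) (cfil g)"
   by (rule tendsto_ennrealI)
  moreover have "y < ennreal (\<Sum>v\<in>F. cmod (wgt (nt g) ?r v) powr \<alpha>)" using F(3) by simp
  ultimately have 1: "\<forall>\<^sub>F x in cfil g. y < ennreal (\<Sum>v\<in>F. cmod (wgt (nt (fst x)) (snd x ?r) (snd x v)) powr \<alpha>)" by (rule order_tendstoD)
  have 2: "\<forall>\<^sub>F x in cfil g. \<forall>v\<in>F. snd x v \<in> verts (nt (fst x))" using F by (intro eventually_ball_finite ballI net_conv_verts[OF c]) auto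
  \<comment> \<open>Injectivity is required on F together with the root, so that no term of F is
    moved onto the excluded diagonal.\<close>
  have 3: "\<forall>\<^sub>F x in cfil g. inj_on (snd x) (insert ?r F)" by (rule net_conv_inj[OF c]) (use F rep_root in auto)
  show "\<forall>\<^sub>F x in cfil g. fst x \<in> {g. y < ?O g}" using 1 2 3 cfil_root
  proof eventually_elim
   case (elim x)
   have inj: "inj_on (snd x) F" using elim(3) by (auto simp: inj_on_def)
   have "rt (fst x) \<notin> snd x ` F" using elim(3) F(2) unfolding elim(4)[symmetric] by (auto simp: inj_on_def)
   then have sub: "snd x ` F \<subseteq> verts (nt (fst x)) - {rt (fst x)}" using elim(2) by blast
   note elim(1)
   also have "ennreal (\<Sum>v\<in>F. cmod (wgt (nt (fst x)) (snd x ?r) (snd x v)) powr \<alpha>) = (\<Sum>v\<in>snd x ` F. ennreal (cmod (wgt (nt (fst x)) (rt (fst x)) v) powr \<alpha>))"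
    using inj elim(4) by (simp add: sum.reindex)
   also have "\<dots> \<le> ?O (fst x)" unfolding S using sub F(1) by (intro SUP_upper) auto
   finally show ?case by simp
  qed
 qed
 then show "{g \<in> space borel. y < ?O g} \<in> sets borel" by simp
qed

lemma measurable_diagonal: "(\<lambda>g. ennreal (cmod (wgt (nt g) (rt g) (rt g)) powr \<alpha>)) \<in> borel_measurable borel"
proof -
 have "(\<lambda>g. wgt (nt g) (rt g) (rt g)) \<in> borel_measurable borel" using measurable_compose[OF measurable_root_MK measurable_MK_wgt[of 0 1 0]] by simp
 then show ?thesis by measurable
qed

lemma rate_I_ge:
 assumes \<rho>: "prob_on \<rho>" and \<alpha>: "0 < \<alpha>"
 shows "min (a / 2) b * (\<integral>\<^sup>+ g. xi \<alpha> g \<partial>\<rho>) \<le> rate_I \<alpha> a b \<rho>"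
proof -
 let ?L = "\<lambda>g. ennreal (cmod (wgt (nt g) (rt g) (rt g)) powr \<alpha>)"
 let ?O = "\<lambda>g. \<Sum>\<^sub>\<infinity>v\<in>verts (nt g) - {rt g}. ennreal (cmod (wgt (nt g) (rt g) v) powr \<alpha>)"
 have s: "sets \<rho> = sets borel" using \<rho> by (simp add: prob_on_def)
 have m: "?L \<in> borel_measurable \<rho>" "?O \<in> borel_measurable \<rho>"
  using measurable_diagonal measurable_off_diagonal[OF \<alpha>] s by (simp_all cong: measurable_cong_sets)
 have "xi \<alpha> g = ?L g + ?O g" for g
 proof -
  have "infsum (\<lambda>v. ennreal (cmod (wgt (nt g) (rt g) v) powr \<alpha>)) ({rt g} \<union> (verts (nt g) - {rt g})) = ?L g + ?O g"
   by (subst infsum_Un_disjoint) (auto intro: nonneg_summable_on_complete)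
  moreover have "{rt g} \<union> (verts (nt g) - {rt g}) = verts (nt g)" using rep_root[of g] by auto
  ultimately show ?thesis by (simp add: xi_def)
 qed
 then have "min (a / 2) b * (\<integral>\<^sup>+ g. xi \<alpha> g \<partial>\<rho>) = min (a / 2) b * (\<integral>\<^sup>+ g. ?L g \<partial>\<rho>) + min (a / 2) b * (\<integral>\<^sup>+ g. ?O g \<partial>\<rho>)"
  using m by (simp add: nn_integral_add distrib_left)
 also have "\<dots> \<le> b * (\<integral>\<^sup>+ g. ?L g \<partial>\<rho>) + a / 2 * (\<integral>\<^sup>+ g. ?O g \<partial>\<rho>)" by (intro add_mono mult_right_mono) auto
 finally show ?thesis by (simp add: rate_I_def)
qed

text \<open>If the mean of \<open>xi \<alpha>\<close> is infinite, so is the rate, whatever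
  \<open>mu \<rho>\<close> is; this covers the default value in \<open>mu\<close>. Otherwise the
  moment bound passes from the truncations to their weak limit.\<close>

lemma sofic_rate_I_ge:
 assumes \<rho>: "\<rho> \<in> sofic Sa Sb" and \<alpha>: "0 < \<alpha>" "\<alpha> < 2" and ab: "0 < a" "0 < b"
 shows "min (a / 2) b * abs_moment \<alpha> (mu \<rho>) \<le> rate_I \<alpha> a b \<rho>"
proof -
 have p: "prob_on \<rho>" using \<rho> by (simp add: sofic_def)
 have c: "0 < min (a / 2) b" using ab by (simp add: ennreal_zero_less_divide)
 show ?thesis
 proof (cases "(\<integral>\<^sup>+ g. xi \<alpha> g \<partial>\<rho>) < \<top>")
  case False
  then have "min (a / 2) b * (\<integral>\<^sup>+ g. xi \<alpha> g \<partial>\<rho>) = \<top>"  using not_sym[OF less_imp_neq[OF c]] by (simp add: less_top[symmetric] ennreal_mult_top)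
  then show ?thesis using rate_I_ge[OF p \<alpha>(1), of a b] by (simp add: top_unique)
 next
  case True
  obtain \<nu> where \<nu>: "real_distribution \<nu>" "weakly_converges (\<lambda>\<theta>. mean_tr \<theta> \<rho>) \<nu> (at_right 0)" using sofic_mean_converges[OF \<rho> \<alpha> True] by blast
  have mu: "mu \<rho> = \<nu>" by (rule mu_eqI[OF \<alpha> True \<nu>])
  obtain C where C: "(\<integral>\<^sup>+ g. xi \<alpha> g \<partial>\<rho>) = ennreal C" using True by (cases "\<integral>\<^sup>+ g. xi \<alpha> g \<partial>\<rho>") auto
  have "\<forall>\<^sub>F \<theta> in at_right 0. real_distribution (mean_tr \<theta> \<rho>) \<and> abs_moment \<alpha> (mean_tr \<theta> \<rho>) \<le> ennreal C" using eventually_at_right_less[of "0::real"]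
   by eventually_elim (use real_distribution_mean[OF p] abs_moment_mean_le[OF p _ \<alpha>] C in auto)
  then have "abs_moment \<alpha> \<nu> \<le> (\<integral>\<^sup>+ g. xi \<alpha> g \<partial>\<rho>)" unfolding C by (rule abs_moment_weak_limit_le[OF \<nu> trivial_limit_at_right_real _ \<alpha>(1)])
  then show ?thesis unfolding mu using rate_I_ge[OF p \<alpha>(1), of a b] by (meson mult_left_mono order_trans zero_le)
 qed
qed

section \<open>The upper bounds\<close>

lemma embeds_rooted_component:
 assumes e: "embeds \<sigma> G H" and G: "is_network G" "is_network H" and u: "u \<in> verts G"
 shows "rooted_component H (\<sigma> u) = rooted_component G u"
proof -
 have su: "\<sigma> u \<in> verts H" by (rule embeds_verts[OF e u])
 have "\<sigma> ` verts (component G u) = verts (component H (\<sigma> u))"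
 proof (intro set_eqI iffI)
  fix w assume "w \<in> \<sigma> ` verts (component G u)"
  then obtain v p where v: "w = \<sigma> v" "v \<in> verts G" "is_path G u v p" by (auto simp: verts_component reach_def)
  then show "w \<in> verts (component H (\<sigma> u))" using embeds_path[OF e v(3)] embeds_verts[OF e v(2)] by (auto simp: verts_component reach_def)
 next
  fix w assume "w \<in> verts (component H (\<sigma> u))"
  then obtain q where "is_path H (\<sigma> u) w q" by (auto simp: verts_component reach_def)
  then show "w \<in> \<sigma> ` verts (component G u)" using embeds_path_lift[OF e u] by (fastforce simp: verts_component reach_def)
 qed
 moreover have "inj_on \<sigma> (verts (component G u))" by (rule inj_on_subset[of _ "verts G"]) (use e in \<open>auto simp: embeds_def verts_component\<close>)
 ultimately have "bij_betw \<sigma> (verts (component G u)) (verts (component H (\<sigma> u)))" by (simp add: bij_betw_def)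
 then have "rooted_iso (Rooted (component G u) u) (Rooted (component H (\<sigma> u)) (\<sigma> u))"
  unfolding rooted_iso_def using is_rooted_component[OF G(1) u] is_rooted_component[OF G(2) su] embeds_wgt[OF e]
  by (auto simp: verts_component intro!: exI[of _ \<sigma>])
 then show ?thesis unfolding rooted_component_def using Quotient3_rel[OF Quotient3_gstar] by metis
qed

text \<open>The points are the quantiles \<open>I\<close> at (j + 1)/(m + 1) for j < m; dividing by
  m + 1 keeps the arguments strictly inside (0,1), where \<open>pseudoinverse\<close> holds. The
  empirical distribution function is then within 1/m of \<open>C\<close>, uniformly.\<close>

lemma quantile_points:
 assumes \<nu>: "real_distribution \<nu>"
 obtains x :: "nat \<Rightarrow> nat \<Rightarrow> real" where
  "\<And>g :: real \<Rightarrow> real. continuous_on UNIV g \<Longrightarrow> bounded (range g) \<Longrightarrow> (\<lambda>m. (\<Sum>j<m. g (x m j)) / m) \<longlonglongrightarrow> (\<integral>x. g x \<partial>\<nu>)"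
proof -
 interpret cdf_distribution \<nu> unfolding cdf_distribution_def by fact
 define x where "x m j = I (real (j + 1) / real (m + 1))" for m j :: nat
 define \<mu> where "\<mu> m = distr (uniform_count_measure {..<m}) borel (x m)" for m
 have xm: "x m \<in> measurable (uniform_count_measure {..<m}) borel" for m by (simp add: uniform_count_measure_def measurable_point_measure_eq1)
 have \<mu>: "real_distribution (\<mu> (Suc n))" for n
 proof -
  have "prob_space (uniform_count_measure {..<Suc n})" by (rule prob_space_uniform_count_measure) auto
  from prob_space.prob_space_distr[OF this xm] show ?thesis by (simp add: \<mu>_def real_distribution_def real_distribution_axioms_def)
 qed
 have cdf: "\<bar>cdf (\<mu> (Suc n)) y - C y\<bar> \<le> 1 / real (Suc n)" for n y
 proof -
  define m where "m = Suc n"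
  define c where "c = real (m + 1) * C y"
  have C: "0 \<le> C y" "C y \<le> 1" by (auto intro: cdf_nonneg cdf_bounded_prob)
  then have c: "0 \<le> c" "c = real m * C y + C y" by (auto simp: c_def distrib_right)
  have "x m j \<le> y \<longleftrightarrow> j < nat \<lfloor>c\<rfloor>" if "j < m" for j
  proof -
   have "x m j \<le> y \<longleftrightarrow> real (j + 1) / real (m + 1) \<le> C y" unfolding x_def by (rule pseudoinverse[symmetric]) (use that in auto)
   also have "\<dots> \<longleftrightarrow> real (j + 1) \<le> c" by (simp add: c_def divide_le_eq mult.commute)
   also have "\<dots> \<longleftrightarrow> j < nat \<lfloor>c\<rfloor>" using c(1) by linarith
   finally show ?thesis .
  qed
  then have "{j \<in> {..<m}. x m j \<le> y} = {..<min m (nat \<lfloor>c\<rfloor>)}" by auto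
  moreover have "cdf (\<mu> m) y = real (card {j \<in> {..<m}. x m j \<le> y}) / m"
  proof -
   have "cdf (\<mu> m) y = measure (uniform_count_measure {..<m}) (x m -` {..y} \<inter> space (uniform_count_measure {..<m}))"
    unfolding cdf_def \<mu>_def by (rule measure_distr[OF xm]) simp
   also have "x m -` {..y} \<inter> space (uniform_count_measure {..<m}) = {j \<in> {..<m}. x m j \<le> y}" by (auto simp: space_uniform_count_measure)
   also have "measure (uniform_count_measure {..<m}) {j \<in> {..<m}. x m j \<le> y} = real (card {j \<in> {..<m}. x m j \<le> y}) / m"
    by (subst measure_uniform_count_measure) auto
   finally show ?thesis .
  qed
  ultimately have 1: "cdf (\<mu> m) y = real (min m (nat \<lfloor>c\<rfloor>)) / m" by simp
  have m: "0 < m" by (simp add: m_def)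
  have fl: "real m * C y \<le> real m" "real (nat \<lfloor>c\<rfloor>) \<le> c" "c - 1 < real (nat \<lfloor>c\<rfloor>)" using C c(1) by (simp add: mult_left_le, linarith+)
  have cm: "real m * C y \<le> c" "c \<le> real m * C y + 1" using C c by linarith+
  have "\<bar>real (min m (nat \<lfloor>c\<rfloor>)) - real m * C y\<bar> \<le> 1"
  proof (cases "m \<le> nat \<lfloor>c\<rfloor>")
   case True
   then have "real m \<le> real (nat \<lfloor>c\<rfloor>)" by simp
   then show ?thesis unfolding min_absorb1[OF True] using fl cm by linarith
  next
   case False
   then have "min m (nat \<lfloor>c\<rfloor>) = nat \<lfloor>c\<rfloor>" by simp
   then show ?thesis using fl cm by linarith
  qed
  then have "\<bar>real (min m (nat \<lfloor>c\<rfloor>)) - real m * C y\<bar> / m \<le> 1 / m" by (rule divide_right_mono) simp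
  also have "\<bar>real (min m (nat \<lfloor>c\<rfloor>)) - real m * C y\<bar> / m = \<bar>cdf (\<mu> m) y - C y\<bar>"
  proof -
   have "cdf (\<mu> m) y - C y = (real (min m (nat \<lfloor>c\<rfloor>)) - real m * C y) / m" unfolding 1 using m by (simp add: diff_divide_distrib)
   then show ?thesis by (simp add: abs_divide)
  qed
  finally show ?thesis by (simp add: m_def)
 qed
 have "weak_conv_m (\<lambda>n. \<mu> (Suc n)) \<nu>" unfolding weak_conv_m_def weak_conv_def
 proof (intro allI impI)
  fix y
  have "(\<lambda>n. 1 / real (Suc n)) \<longlonglongrightarrow> 0" using LIMSEQ_Suc[OF lim_1_over_n] by simp
  then have "(\<lambda>n. cdf (\<mu> (Suc n)) y - C y) \<longlonglongrightarrow> 0" by (rule Lim_null_comparison[rotated]) (use cdf in \<open>auto intro!: always_eventually\<close>)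
  then show "(\<lambda>n. cdf (\<mu> (Suc n)) y) \<longlonglongrightarrow> C y" by (rule LIM_zero_cancel)
 qed
 note w = this
 have "(\<lambda>m. (\<Sum>j<m. g (x m j)) / m) \<longlonglongrightarrow> (\<integral>x. g x \<partial>\<nu>)" if g: "continuous_on UNIV g" "bounded (range g)" for g :: "real \<Rightarrow> real"
 proof -
  obtain B where B: "\<And>x. norm (g x) \<le> B" using g(2) by (auto simp: bounded_iff)
  have "(\<lambda>n. \<integral>x. g x \<partial>\<mu> (Suc n)) \<longlonglongrightarrow> (\<integral>x. g x \<partial>\<nu>)"
   by (rule weak_conv_imp_integral_bdd_continuous_conv[OF \<mu> \<nu> w _ B]) (use g(1) in \<open>auto simp: continuous_on_eq_continuous_at\<close>)
  moreover have "(\<integral>x. g x \<partial>\<mu> m) = (\<Sum>j<m. g (x m j)) / m" for m unfolding \<mu>_def by (subst integral_distr[OF xm])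
    (use g(1) in \<open>auto simp: integral_uniform_count_measure intro: borel_measurable_continuous_onI\<close>)
  ultimately have "(\<lambda>n. (\<Sum>j<Suc n. g (x (Suc n) j)) / Suc n) \<longlonglongrightarrow> (\<integral>x. g x \<partial>\<nu>)" by simp
  then show ?thesis by (rule LIMSEQ_imp_Suc)
 qed
 then show thesis by (rule that)
qed

lemma filterlim_div_at_top:
 assumes "0 < k"
 shows "filterlim (\<lambda>n::nat. n div k) at_top sequentially" unfolding filterlim_at_top
proof
 fix N
 show "\<forall>\<^sub>F n in sequentially. N \<le> n div k" using eventually_ge_at_top[of "N * k"]
  by eventually_elim (use assms in \<open>simp add: less_eq_div_iff_mult_less_eq\<close>)
qed

text \<open>The optimal laws are of this form: a single vertex with a loop of weight \<open>x\<close>, and an edge of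
 weight \<open>\<bar>x\<bar> s\<close> between two vertices, the root being uniform.\<close>

locale random_block =
 fixes k :: nat and B :: "nat \<Rightarrow> nat \<Rightarrow> complex" and h :: "real \<Rightarrow> real" and \<nu> :: "real measure"
 assumes k: "0 < k" and B: "\<And>i j. i < k \<Longrightarrow> j < k \<Longrightarrow> cnj (B j i) = B i j"
  and h: "continuous_on UNIV h" and \<nu>: "real_distribution \<nu>"
begin

definition blk :: "real \<Rightarrow> network" where
 "blk x = Network {..<k} (\<lambda>u v. complex_of_real (h x) * B u v)"

definition \<iota> :: "nat \<Rightarrow> real \<Rightarrow> gstar" where
 "\<iota> i x = rooted_component (blk x) i"

definition law :: "gstar measure" where
 "law = bind \<nu> (\<lambda>x. U_law (blk x))"

lemma verts_blk [simp]: "verts (blk x) = {..<k}" and wgt_blk [simp]: "wgt (blk x) u v = complex_of_real (h x) * B u v" by (simp_all add: blk_def)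

lemma blk_network: "is_network (blk x)" unfolding is_network_def by (intro conjI ballI summable_on_finite) (use B in \<open>simp_all add: complex_cnj_mult\<close>)

text \<open>The summand 1 keeps the bound positive when all weights vanish.\<close>

lemma blk_bounded_net: "bounded_net (1 + (\<Sum>i<k. \<Sum>j<k. cmod (complex_of_real (h x) * B i j))) (blk x)" unfolding bounded_net_def
proof (intro conjI ballI)
 show "hermitian_on (verts (blk x)) (wgt (blk x))" by (rule is_network_hermitian[OF blk_network])
 fix u assume u: "u \<in> verts (blk x)"
 have N: "nb (blk x) u \<subseteq> {..<k}" by (auto simp: nb_def)
 then show "finite (nb (blk x) u)" by (rule finite_subset) simp
 have "(\<Sum>v\<in>nb (blk x) u. cmod (wgt (blk x) u v)) \<le> (\<Sum>j<k. cmod (complex_of_real (h x) * B u j))"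
  using N by (simp only: wgt_blk) (intro sum_mono2, auto)
 also have "\<dots> \<le> (\<Sum>i<k. \<Sum>j<k. cmod (complex_of_real (h x) * B i j))"
  by (rule member_le_sum[of u "{..<k}" "\<lambda>i. \<Sum>j<k. cmod (complex_of_real (h x) * B i j)"]) (use u in \<open>auto intro: sum_nonneg\<close>)
 finally show "(\<Sum>v\<in>nb (blk x) u. cmod (wgt (blk x) u v)) \<le> 1 + (\<Sum>i<k. \<Sum>j<k. cmod (complex_of_real (h x) * B i j))" by simp
qed

text \<open>The vertex set is fixed, so the identity serves as matching and only finitely many
  weights move, continuously in x.\<close>

lemma continuous_\<iota>:
 assumes i: "i < k"
 shows "continuous_on UNIV (\<iota> i)" unfolding continuous_on_def
proof (intro ballI topological_tendstoI)
 fix x0 U assume U: "open U" "\<iota> i x0 \<in> U"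
 then obtain r where r: "r > 0" "\<And>g. d_loc (\<iota> i x0) g < r \<Longrightarrow> g \<in> U" unfolding open_gstar_def by blast
 have hl: "(h \<longlongrightarrow> h x0) (at x0)" using h by (simp add: continuous_on_def)
 have wl: "((\<lambda>x. complex_of_real (h x) * B u v) \<longlongrightarrow> complex_of_real (h x0) * B u v) (at x0)" for u v by (intro tendsto_intros hl)
 have "net_conv (at x0) (blk x0) blk (\<lambda>_. id)" unfolding net_conv_def
 proof (intro conjI ballI allI impI)
  fix u d assume u: "u \<in> verts (blk x0)" and d: "(0::real) < d"
  have "\<forall>\<^sub>F x in at x0. \<forall>w\<in>{..<k}. dist (complex_of_real (h x) * B u w) (complex_of_real (h x0) * B u w) < d / 2"
   by (intro eventually_ball_finite ballI tendstoD[OF wl]) (use d in auto)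
  then show "\<forall>\<^sub>F x in at x0. \<forall>w\<in>verts (blk x). d \<le> cmod (wgt (blk x) (id u) w) \<longrightarrow> (\<exists>v\<in>verts (blk x0). w = id v \<and> d / 2 \<le> cmod (wgt (blk x0) u v))"
  proof (eventually_elim, intro ballI impI)
   fix x w assume *: "\<forall>w\<in>{..<k}. dist (complex_of_real (h x) * B u w) (complex_of_real (h x0) * B u w) < d / 2"
    and w: "w \<in> verts (blk x)" and dw: "d \<le> cmod (wgt (blk x) (id u) w)"
   have "cmod (wgt (blk x) u w - wgt (blk x0) u w) < d / 2" using * w by (simp add: dist_norm)
   then have "d / 2 \<le> cmod (wgt (blk x0) u w)" using norm_triangle_ineq2[of "wgt (blk x) u w" "wgt (blk x0) u w"] dw by simp
   then show "\<exists>v\<in>verts (blk x0). w = id v \<and> d / 2 \<le> cmod (wgt (blk x0) u v)" using w by auto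
  qed
 qed (use wl in auto)
 moreover have "finite (bl (blk x0) i t)" for t by (rule finite_subset[of _ "{..<k}"]) (auto simp: bl_def)
 ultimately have "((\<lambda>x. d_loc (rooted_component (blk x0) i) (rooted_component (blk x) (id i))) \<longlongrightarrow> 0) (at x0)"
  using i by (intro net_conv_d_loc[where \<sigma>="\<lambda>_. id"] blk_network) auto
 then have "\<forall>\<^sub>F x in at x0. d_loc (\<iota> i x0) (\<iota> i x) < r" unfolding \<iota>_def using r(1) by (auto dest: order_tendstoD)
 then show "\<forall>\<^sub>F x in at x0. \<iota> i x \<in> U" by eventually_elim (rule r(2))
qed

lemma measurable_\<iota> [measurable]: "i < k \<Longrightarrow> \<iota> i \<in> borel_measurable borel" by (rule borel_measurable_continuous_onI[OF continuous_\<iota>])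

lemma measurable_U_law_blk: "(\<lambda>x. U_law (blk x)) \<in> measurable \<nu> (prob_algebra borel)"
proof -
 interpret real_distribution \<nu> by (rule \<nu>)
 let ?u = "uniform_count_measure {..<k}"
 have u: "prob_space ?u" using k by (intro prob_space_uniform_count_measure) auto
 have "(\<lambda>x. distr ?u borel (\<lambda>i. \<iota> i x)) \<in> measurable \<nu> (prob_algebra borel)"
 proof (rule measurable_distr_prob_space2[where M="?u"])
  show "(\<lambda>x. ?u) \<in> measurable \<nu> (prob_algebra ?u)" using u by (intro measurable_const) (simp add: space_prob_algebra)
  have "(\<lambda>(i, x). \<iota> i x) \<in> measurable (count_space {..<k} \<Otimes>\<^sub>M \<nu>) borel"
  proof (rule measurable_pair_measure_countable1)
   show "(\<lambda>x. case (i, x) of (i, x) \<Rightarrow> \<iota> i x) \<in> measurable \<nu> borel" if "i \<in> {..<k}" for i using measurable_\<iota>[of i] that by simp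
  qed simp
  then have "(\<lambda>(x, i). \<iota> i x) \<in> measurable (\<nu> \<Otimes>\<^sub>M count_space {..<k}) borel" by (subst measurable_pair_swap_iff) simp
  moreover have "sets (\<nu> \<Otimes>\<^sub>M count_space {..<k}) = sets (\<nu> \<Otimes>\<^sub>M ?u)" by (rule sets_pair_measure_cong) (simp_all add: sets_uniform_count_measure)
  ultimately show "(\<lambda>(x, i). \<iota> i x) \<in> measurable (\<nu> \<Otimes>\<^sub>M ?u) borel" by (simp cong: measurable_cong_sets)
 qed
 moreover have "U_law (blk x) = distr ?u borel (\<lambda>i. \<iota> i x)" for x by (simp add: U_law_def \<iota>_def)
 ultimately show ?thesis by simp
qed

lemma law_prob: "prob_on law"
proof -
 interpret real_distribution \<nu> by (rule \<nu>)
 have "\<nu> \<in> space (prob_algebra \<nu>)" using prob_space_axioms by (simp add: space_prob_algebra)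
 from prob_space_bind'[OF this measurable_U_law_blk] sets_bind'[OF this measurable_U_law_blk]
 show ?thesis by (simp add: prob_on_def law_def)
qed

lemma nn_integral_law:
 assumes F: "F \<in> borel_measurable borel" and c: "\<And>i x. i < k \<Longrightarrow> F (\<iota> i x) = \<phi> x"
 shows "(\<integral>\<^sup>+ g. F g \<partial>law) = (\<integral>\<^sup>+ x. \<phi> x \<partial>\<nu>)"
proof -
 have "(\<integral>\<^sup>+ g. F g \<partial>law) = (\<integral>\<^sup>+ x. (\<integral>\<^sup>+ g. F g \<partial>U_law (blk x)) \<partial>\<nu>)"
  unfolding law_def by (rule nn_integral_bind[OF F measurable_prob_algebraD[OF measurable_U_law_blk]])
 also have "(\<lambda>x. \<integral>\<^sup>+ g. F g \<partial>U_law (blk x)) = \<phi>"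
 proof
  fix x
  let ?u = "uniform_count_measure {..<k}"
  interpret u: prob_space ?u using k by (intro prob_space_uniform_count_measure) auto
  have "(\<integral>\<^sup>+ g. F g \<partial>U_law (blk x)) = (\<integral>\<^sup>+ i. F (\<iota> i x) \<partial>?u)" unfolding U_law_def verts_blk \<iota>_def
   by (rule nn_integral_distr) (use F in \<open>simp_all add: uniform_count_measure_def measurable_point_measure_eq1\<close>)
  also have "\<dots> = (\<integral>\<^sup>+ i. \<phi> x \<partial>?u)" by (rule nn_integral_cong) (simp add: c space_uniform_count_measure)
  finally show "(\<integral>\<^sup>+ g. F g \<partial>U_law (blk x)) = \<phi> x" by (simp add: u.emeasure_space_1)
 qed
 finally show ?thesis .
qed

lemma integral_law:
 fixes F :: "gstar \<Rightarrow> real"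
 assumes F: "F \<in> borel_measurable borel" and b: "\<And>g. \<bar>F g\<bar> \<le> C"
 shows "(\<integral>g. F g \<partial>law) = (\<integral>x. (\<Sum>i<k. F (\<iota> i x)) / k \<partial>\<nu>)"
proof -
 interpret real_distribution \<nu> by (rule \<nu>)
 have "(\<integral>g. F g \<partial>law) = (\<integral>x. (\<integral>g. F g \<partial>U_law (blk x)) \<partial>\<nu>)" unfolding law_def
 proof (rule integral_bind[OF F _ measurable_prob_algebraD[OF measurable_U_law_blk] finite_measure_axioms, where B'=1])
  show "\<bar>F g\<bar> \<le> C" for g by (rule b)
  have "prob_on (U_law (blk x))" for x by (rule prob_on_U_law) (use k in auto)
  then show "AE x in \<nu>. emeasure (U_law (blk x)) (space (U_law (blk x))) \<le> ennreal 1" by (simp add: prob_on_def prob_space.emeasure_space_1)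
 qed
 also have "(\<lambda>x. \<integral>g. F g \<partial>U_law (blk x)) = (\<lambda>x. (\<Sum>i<k. F (\<iota> i x)) / k)" by (rule ext, subst integral_U_law) (use F in \<open>simp_all add: \<iota>_def\<close>)
 finally show ?thesis .
qed

text \<open>The matrices are block diagonal, the j-th block carrying the j-th of
  \<open>n div k\<close> quantile points of \<nu>. The remaining \<open>n mod k\<close> vertices are
  isolated with weight 0, and the probability that a uniform vertex is one of them tends to
  0.\<close>

lemma law_sofic:
 assumes a: "\<And>x i j. i < j \<Longrightarrow> j < k \<Longrightarrow> complex_of_real (h x) * B i j = 0 \<or> complex_of_real (h x) * B i j / complex_of_real (cmod (complex_of_real (h x) * B i j)) \<in> Sa"
  and b: "\<And>x i. i < k \<Longrightarrow> complex_of_real (h x) * B i i = 0 \<or> complex_of_real (h x) * B i i / complex_of_real (cmod (complex_of_real (h x) * B i i)) \<in> Sb"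
 shows "law \<in> sofic Sa Sb"
proof -
 obtain x where x: "\<And>g :: real \<Rightarrow> real. continuous_on UNIV g \<Longrightarrow> bounded (range g) \<Longrightarrow> (\<lambda>m. (\<Sum>j<m. g (x m j)) / m) \<longlonglongrightarrow> (\<integral>x. g x \<partial>\<nu>)"
  using quantile_points[OF \<nu>] by blast
 \<comment> \<open>Rows are numbered from 1, hence the shift; block and position are the quotient
   and the remainder of v - 1 by k.\<close>
 define H where "H n v w = (if (v - 1) div k = (w - 1) div k \<and> (v - 1) div k < n div k
   then complex_of_real (h (x (n div k) ((v - 1) div k))) * B ((v - 1) mod k) ((w - 1) mod k) else 0)" for n v w :: nat
 have adm: "admissible Sa Sb n (H n)" for n unfolding admissible_def
 proof (intro conjI ballI impI)
  fix i j assume "i \<in> {1..n}" "j \<in> {1..n}"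
  show "H n i j = cnj (H n j i)" unfolding H_def using B k by simp
  assume ij: "i < j"
  have "(i - 1) mod k < (j - 1) mod k" if "(i - 1) div k = (j - 1) div k"
   using div_mult_mod_eq[of "i - 1" k] div_mult_mod_eq[of "j - 1" k] ij \<open>i \<in> {1..n}\<close> unfolding that atLeastAtMost_iff by linarith
  then show "H n i j = 0 \<or> H n i j / complex_of_real (cmod (H n i j)) \<in> Sa" unfolding H_def using a[of "(i - 1) mod k" "(j - 1) mod k"] k by auto
 next
  fix i
  show "H n i i = 0 \<or> H n i i / complex_of_real (cmod (H n i i)) \<in> Sb" unfolding H_def using b[of "(i - 1) mod k"] k by auto
 qed
 have "weakly_converges (\<lambda>n. U_law (Network {1..n} (H n))) law sequentially" unfolding weakly_converges_def
 proof (intro allI impI, elim conjE)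
  fix f :: "gstar \<Rightarrow> real" assume f: "continuous_on UNIV f" and "bounded (range f)"
  then obtain C where C: "\<And>g. \<bar>f g\<bar> \<le> C" by (auto simp: bounded_iff)
  have fm: "f \<in> borel_measurable borel" by (rule borel_measurable_continuous_onI[OF f])
  define g where "g x = (\<Sum>i<k. f (\<iota> i x)) / k" for x
  have gc: "continuous_on UNIV g" unfolding g_def using continuous_\<iota> k by (intro continuous_intros continuous_on_compose2[OF f]) auto
  have gb: "\<bar>g x\<bar> \<le> C" for x
  proof -
   have "\<bar>\<Sum>i<k. f (\<iota> i x)\<bar> \<le> (\<Sum>i<k. C)" by (rule order_trans[OF sum_abs sum_mono[OF C]])
   then show ?thesis unfolding g_def using k by (simp add: abs_divide divide_le_eq mult.commute)
  qed
  define A where "A m = (\<Sum>j<m. g (x m j)) / m" for m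
  define E where "E n = (\<Sum>v\<in>{n div k * k..<n}. f (rooted_component (Network {1..n} (H n)) (v + 1)))" for n
  \<comment> \<open>The mean over n vertices splits into full blocks, each contributing k times
    \<open>g\<close> at its quantile point, and fewer than k leftover vertices.\<close>
  have U: "(\<integral>g. f g \<partial>U_law (Network {1..n} (H n))) = (1 - real (n mod k) / real n) * A (n div k) + E n / real n" if n: "k \<le> n" for n
  proof -
   let ?N = "Network {1..n} (H n)" and ?m = "n div k"
   have m: "0 < ?m" using n k by (simp add: div_greater_zero_iff)
   have N: "is_network ?N" by (rule admissible_network[OF adm])
   have rc: "rooted_component ?N (j * k + i + 1) = \<iota> i (x ?m j)" if j: "j < ?m" and i: "i < k" for i j
   proof -
    have "embeds (\<lambda>i. j * k + i + 1) (blk (x ?m j)) ?N" unfolding embeds_def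
    proof (intro conjI ballI impI)
     show "inj_on (\<lambda>i. j * k + i + 1) (verts (blk (x ?m j)))" by (auto simp: inj_on_def)
     have "j * k + u < n" if "u < k" for u
     proof -
      have "j * k + u < (j + 1) * k" using that by simp
      also have "\<dots> \<le> ?m * k" using j by (intro mult_right_mono) auto
      also have "\<dots> \<le> n" by simp
      finally show ?thesis .
     qed
     then show "(\<lambda>i. j * k + i + 1) ` verts (blk (x ?m j)) \<subseteq> verts ?N" by (auto simp: Suc_le_eq)
    next
     fix u v assume "u \<in> verts (blk (x ?m j))" "v \<in> verts (blk (x ?m j))"
     then show "wgt ?N (j * k + u + 1) (j * k + v + 1) = wgt (blk (x ?m j)) u v" using j by (simp add: H_def)
    next
     fix u w assume u: "u \<in> verts (blk (x ?m j))" and w: "w \<in> verts ?N" "wgt ?N (j * k + u + 1) w \<noteq> 0"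
     then have "(w - 1) div k = j" by (auto simp: H_def split: if_splits)
     then have "w = j * k + (w - 1) mod k + 1" using w(1) div_mult_mod_eq[of "w - 1" k] by auto
     then show "w \<in> (\<lambda>i. j * k + i + 1) ` verts (blk (x ?m j))" using k by (intro image_eqI[of _ _ "(w - 1) mod k"]) auto
    qed
    from embeds_rooted_component[OF this blk_network N] i show ?thesis by (simp add: \<iota>_def)
   qed
   let ?F = "\<lambda>v. f (rooted_component ?N (v + 1))"
   have "(\<Sum>v\<in>{1..n}. f (rooted_component ?N v)) = (\<Sum>v<n. ?F v)" by (rule sum.reindex_bij_witness[of _ "\<lambda>v. v + 1" "\<lambda>v. v - 1"]) auto
   also have "\<dots> = (\<Sum>v<?m * k. ?F v) + E n"
    unfolding E_def by (subst sum.union_disjoint[symmetric]) (auto intro!: sum.cong dest: order_less_le_trans[OF _ div_times_less_eq_dividend])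
   also have "(\<Sum>v<?m * k. ?F v) = (\<Sum>j<?m. \<Sum>v\<in>{j * k..<j * k + k}. ?F v)" by (rule sum.nat_group[symmetric])
   also have "\<dots> = (\<Sum>j<?m. k * g (x ?m j))"
   proof (rule sum.cong[OF refl])
    fix j assume j: "j \<in> {..<?m}"
    have "(\<Sum>v\<in>{j * k..<j * k + k}. ?F v) = (\<Sum>i<k. ?F (j * k + i))" by (rule sum.reindex_bij_witness[of _ "\<lambda>i. j * k + i" "\<lambda>v. v - j * k"]) auto
    also have "\<dots> = (\<Sum>i<k. f (\<iota> i (x ?m j)))" by (rule sum.cong) (use rc j in auto)
    finally show "(\<Sum>v\<in>{j * k..<j * k + k}. ?F v) = k * g (x ?m j)" using k by (simp add: g_def)
   qed
   also have "\<dots> = real (?m * k) * A ?m" using m by (simp add: A_def flip: sum_distrib_left)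
   finally have "(\<integral>g. f g \<partial>U_law ?N) = (real (?m * k) * A ?m + E n) / n" by (subst integral_U_law) (use fm in auto)
   also have "\<dots> = real (?m * k) / n * A ?m + E n / n" by (simp add: add_divide_distrib)
   also have "real (?m * k) / n = 1 - real (n mod k) / real n"
   proof -
    have "real n = real (?m * k) + real (n mod k)" by (metis div_mult_mod_eq of_nat_add)
    then show ?thesis using n k by (simp add: field_simps)
   qed
   finally show ?thesis .
  qed
  have small: "(\<lambda>n. r n / real n) \<longlonglongrightarrow> 0" if "\<And>n. \<bar>r n\<bar> \<le> c" for r :: "nat \<Rightarrow> real" and c
  proof (rule Lim_null_comparison)
   show "\<forall>\<^sub>F n in sequentially. norm (r n / real n) \<le> c * (1 / real n)"
    using that by (intro always_eventually allI) (simp add: abs_divide divide_right_mono)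
   show "(\<lambda>n. c * (1 / real n)) \<longlonglongrightarrow> 0" by (rule tendsto_mult_right_zero[OF lim_1_over_n])
  qed
  have E: "\<bar>E n\<bar> \<le> real k * C" for n
  proof -
   have "\<bar>E n\<bar> \<le> (\<Sum>v\<in>{n div k * k..<n}. C)" unfolding E_def by (rule order_trans[OF sum_abs sum_mono[OF C]])
   also have "\<dots> = real (n mod k) * C" by (simp add: minus_div_mult_eq_mod)
   also have "\<dots> \<le> real k * C" using k C[of undefined] by (intro mult_right_mono) (auto intro: less_imp_le)
   finally show ?thesis .
  qed
  have A: "A \<longlonglongrightarrow> (\<integral>x. g x \<partial>\<nu>)" unfolding A_def by (rule x[OF gc]) (rule boundedI[where B=C], use gb in auto)
  have "(\<lambda>n. (1 - real (n mod k) / real n) * A (n div k) + E n / real n) \<longlonglongrightarrow> (1 - 0) * (\<integral>x. g x \<partial>\<nu>) + 0"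
  proof (intro tendsto_intros)
   show "(\<lambda>n. real (n mod k) / real n) \<longlonglongrightarrow> 0" using k by (intro small[where c="real k"]) (auto intro: less_imp_le)
   show "(\<lambda>n. A (n div k)) \<longlonglongrightarrow> (\<integral>x. g x \<partial>\<nu>)" by (rule filterlim_compose[OF A filterlim_div_at_top[OF k]])
   show "(\<lambda>n. E n / real n) \<longlonglongrightarrow> 0" by (rule small[OF E])
  qed
  moreover have "\<forall>\<^sub>F n in sequentially. (1 - real (n mod k) / real n) * A (n div k) + E n / real n = (\<integral>g. f g \<partial>U_law (Network {1..n} (H n)))"
   using eventually_ge_at_top[of k] by eventually_elim (rule U[symmetric])
  ultimately have "(\<lambda>n. \<integral>g. f g \<partial>U_law (Network {1..n} (H n))) \<longlonglongrightarrow> (1 - 0) * (\<integral>x. g x \<partial>\<nu>) + 0" by (rule Lim_transform_eventually)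
  then show "(\<lambda>n. \<integral>g. f g \<partial>U_law (Network {1..n} (H n))) \<longlonglongrightarrow> (\<integral>g. f g \<partial>law)" unfolding integral_law[OF fm C] g_def by simp
 qed
 then show ?thesis unfolding sofic_def using law_prob adm by blast
qed

text \<open>For each x the block is a finite network, so its truncated spectral measures converge to
  its own; the mean over x follows by dominated convergence along sequences.\<close>

lemma mu_law:
 assumes \<beta>: "0 < \<beta>" "\<beta> < 2" and fin: "(\<integral>\<^sup>+ g. xi \<beta> g \<partial>law) < \<top>"
  and s: "\<And>f :: real \<Rightarrow> real. continuous_on UNIV f \<Longrightarrow> bounded (range f) \<Longrightarrow> (\<integral>x. (\<Sum>i<k. (\<integral>y. f y \<partial>spectral_measure (blk x) i)) / k \<partial>\<nu>) = (\<integral>x. f x \<partial>\<nu>)"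
 shows "mu law = \<nu>"
proof (rule mu_eqI[OF \<beta> fin \<nu>])
 interpret real_distribution \<nu> by (rule \<nu>)
 show "weakly_converges (\<lambda>\<theta>. mean_tr \<theta> law) \<nu> (at_right 0)" unfolding weakly_converges_def
 proof (intro allI impI, elim conjE)
  fix f :: "real \<Rightarrow> real" assume f: "continuous_on UNIV f" and fb: "bounded (range f)"
  then obtain C where C: "\<And>x. \<bar>f x\<bar> \<le> C" by (auto simp: bounded_iff)
  have fm: "f \<in> borel_measurable borel" by (rule borel_measurable_continuous_onI[OF f])
  have sp: "real_distribution (rspec 0 \<theta> g)" if "0 < \<theta>" for \<theta> g using spectral_tr(1)[OF rep_network rep_root] that by simp
  define J where "J \<theta> g = (\<integral>y. f y \<partial>rspec 0 \<theta> g)" for \<theta> g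
  have Jm: "J \<theta> \<in> borel_measurable borel" if "0 < \<theta>" for \<theta>
  proof -
   have "J \<theta> \<in> borel_measurable law" unfolding J_def
    by (rule measurable_compose[OF measurable_prob_algebraD[OF mean_spectral_eq_bind(2)[OF law_prob that]] integral_measurable_subprob_algebra[OF fm]])
   then show ?thesis using law_prob by (simp add: prob_on_def cong: measurable_cong_sets)
  qed
  have Jb: "\<bar>J \<theta> g\<bar> \<le> C" if "0 < \<theta>" for \<theta> g
  proof -
   interpret S: real_distribution "rspec 0 \<theta> g" by (rule sp[OF that])
   have i: "integrable (rspec 0 \<theta> g) f" by (rule bounded_continuous_integrable[OF sp[OF that] f]) (use C in auto)
   have "\<bar>J \<theta> g\<bar> \<le> (\<integral>y. \<bar>f y\<bar> \<partial>rspec 0 \<theta> g)" unfolding J_def by (rule integral_abs_bound)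
   also have "\<dots> \<le> C" by (rule S.integral_le_const) (use i C in auto)
   finally show ?thesis .
  qed
  have Jl: "((\<lambda>\<theta>. J \<theta> (\<iota> i x)) \<longlongrightarrow> (\<integral>y. f y \<partial>spectral_measure (blk x) i)) (at_right 0)" if i: "i < k" for i x
  proof -
   have "0 < 1 + (\<Sum>i<k. \<Sum>j<k. cmod (complex_of_real (h x) * B i j))" by (rule add_pos_nonneg) (auto intro!: sum_nonneg)
   then have "((\<lambda>\<theta>. \<integral>y. complex_of_real (f y) \<partial>spectral_measure (tr 0 \<theta> (blk x)) i) \<longlongrightarrow> (\<integral>y. complex_of_real (f y) \<partial>spectral_measure (blk x) i)) (at_right 0)"
    using i f by (intro bounded_net_spectral_tr_tendsto[OF blk_bounded_net, where d="\<lambda>_. 0"]) (auto intro!: continuous_intros)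
   from tendsto_Re[OF this] have *: "((\<lambda>\<theta>. \<integral>y. f y \<partial>spectral_measure (tr 0 \<theta> (blk x)) i) \<longlongrightarrow> (\<integral>y. f y \<partial>spectral_measure (blk x) i)) (at_right 0)"
    by simp
   show ?thesis
   proof (rule Lim_transform_eventually[OF *])
    show "\<forall>\<^sub>F \<theta> in at_right 0. (\<integral>y. f y \<partial>spectral_measure (tr 0 \<theta> (blk x)) i) = J \<theta> (\<iota> i x)" using eventually_at_right_less[of "0::real"]
     by eventually_elim (use i in \<open>simp add: J_def \<iota>_def spectral_tr_rooted_component[OF blk_network]\<close>)
   qed
  qed
  have eq: "(\<integral>x. f x \<partial>mean_tr \<theta> law) = (\<integral>x. (\<Sum>i<k. J \<theta> (\<iota> i x)) / k \<partial>\<nu>)" if "0 < \<theta>" for \<theta>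
   unfolding integral_mean[OF law_prob that fm C] J_def[symmetric] by (rule integral_law[OF Jm Jb]) (rule that)+
  have "((\<lambda>\<theta>. \<integral>x. (\<Sum>i<k. J \<theta> (\<iota> i x)) / k \<partial>\<nu>) \<longlongrightarrow> (\<integral>x. (\<Sum>i<k. (\<integral>y. f y \<partial>spectral_measure (blk x) i)) / k \<partial>\<nu>)) (at_right 0)"
   unfolding tendsto_at_iff_sequentially
  proof (intro allI impI)
   fix X :: "nat \<Rightarrow> real" assume X: "\<forall>n. X n \<in> {0<..} - {0}" "X \<longlonglongrightarrow> 0"
   then have X0: "0 < X n" for n by auto
   have Xf: "filterlim X (at_right 0) sequentially" unfolding filterlim_at using X by (auto intro!: always_eventually dest: not_sym[OF less_imp_neq[OF X0], THEN notE])
   have m: "(\<lambda>x. (\<Sum>i<k. J (X n) (\<iota> i x)) / k) \<in> borel_measurable borel" for n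
    using measurable_compose[OF measurable_\<iota> Jm[OF X0]] by (intro borel_measurable_divide borel_measurable_sum) auto
   have l: "(\<lambda>n. (\<Sum>i<k. J (X n) (\<iota> i x)) / k) \<longlonglongrightarrow> (\<Sum>i<k. (\<integral>y. f y \<partial>spectral_measure (blk x) i)) / k" for x
    using k by (intro tendsto_intros filterlim_compose[OF Jl Xf]) auto
   have "(\<lambda>n. \<integral>x. (\<Sum>i<k. J (X n) (\<iota> i x)) / k \<partial>\<nu>) \<longlonglongrightarrow> (\<integral>x. (\<Sum>i<k. (\<integral>y. f y \<partial>spectral_measure (blk x) i)) / k \<partial>\<nu>)"
   proof (rule integral_dominated_convergence[where w="\<lambda>_. C"])
    show "(\<lambda>x. (\<Sum>i<k. (\<integral>y. f y \<partial>spectral_measure (blk x) i)) / k) \<in> borel_measurable \<nu>" using borel_measurable_LIMSEQ_metric[OF m l] by simp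
    show "AE x in \<nu>. norm ((\<Sum>i<k. J (X n) (\<iota> i x)) / k) \<le> C" for n
    proof (rule AE_I2)
     fix x
     have "\<bar>\<Sum>i<k. J (X n) (\<iota> i x)\<bar> \<le> (\<Sum>i<k. C)" by (rule order_trans[OF sum_abs sum_mono[OF Jb[OF X0]]])
     then show "norm ((\<Sum>i<k. J (X n) (\<iota> i x)) / k) \<le> C" using k by (simp add: abs_divide divide_le_eq mult.commute)
    qed
   qed (use m l in auto)
   then show "((\<lambda>\<theta>. \<integral>x. (\<Sum>i<k. J \<theta> (\<iota> i x)) / k \<partial>\<nu>) \<circ> X) \<longlonglongrightarrow> (\<integral>x. (\<Sum>i<k. (\<integral>y. f y \<partial>spectral_measure (blk x) i)) / k \<partial>\<nu>)" by (simp add: o_def)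
  qed
  then have "((\<lambda>\<theta>. \<integral>x. (\<Sum>i<k. J \<theta> (\<iota> i x)) / k \<partial>\<nu>) \<longlongrightarrow> (\<integral>x. f x \<partial>\<nu>)) (at_right 0)" unfolding s[OF f fb] .
  then show "((\<lambda>\<theta>. \<integral>x. f x \<partial>mean_tr \<theta> law) \<longlongrightarrow> (\<integral>x. f x \<partial>\<nu>)) (at_right 0)"
  proof (rule Lim_transform_eventually)
   show "\<forall>\<^sub>F \<theta> in at_right 0. (\<integral>x. (\<Sum>i<k. J \<theta> (\<iota> i x)) / k \<partial>\<nu>) = (\<integral>x. f x \<partial>mean_tr \<theta> law)"
    using eventually_at_right_less[of "0::real"] by eventually_elim (rule eq[symmetric])
  qed
 qed
qed

end

section \<open>Cost and spectral measures of loops and edges\<close>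

lemma rooted_component_wgts:
 assumes G: "is_network G" and v: "v \<in> verts G"
 shows "wgt (nt (rooted_component G v)) (rt (rooted_component G v)) (rt (rooted_component G v)) = wgt G v v"
  and "(\<Sum>\<^sub>\<infinity>u\<in>verts (nt (rooted_component G v)) - {rt (rooted_component G v)}. ennreal (cmod (wgt (nt (rooted_component G v)) (rt (rooted_component G v)) u) powr \<alpha>))
    = (\<Sum>\<^sub>\<infinity>u\<in>verts G - {v}. ennreal (cmod (wgt G v u) powr \<alpha>))"
proof -
 let ?c = "rooted_component G v"
 obtain \<sigma> where \<sigma>: "embeds \<sigma> (nt ?c) G" "\<sigma> (rt ?c) = v" by (rule rep_component[OF G v])
 have w: "wgt G v (\<sigma> u) = wgt (nt ?c) (rt ?c) u" if "u \<in> verts (nt ?c)" for u using embeds_wgt[OF \<sigma>(1) rep_root that] by (simp add: \<sigma>(2))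
 have inj: "\<sigma> u = v \<longleftrightarrow> u = rt ?c" if "u \<in> verts (nt ?c)" for u using \<sigma> that rep_root[of ?c] unfolding embeds_def by (metis inj_on_eq_iff)
 show "wgt (nt ?c) (rt ?c) (rt ?c) = wgt G v v" using w[OF rep_root] by (simp add: \<sigma>(2))
 have "(\<Sum>\<^sub>\<infinity>u\<in>verts G - {v}. ennreal (cmod (wgt G v u) powr \<alpha>)) = (\<Sum>\<^sub>\<infinity>u\<in>verts G. if u = v then 0 else ennreal (cmod (wgt G v u) powr \<alpha>))"
  by (rule infsum_cong_neutral) auto
 also have "\<dots> = (\<Sum>\<^sub>\<infinity>u\<in>verts (nt ?c). if \<sigma> u = v then 0 else ennreal (cmod (wgt G v (\<sigma> u)) powr \<alpha>))"
  by (rule embeds_infsum[OF \<sigma>(1) rep_root]) (simp add: \<sigma>(2))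
 also have "\<dots> = (\<Sum>\<^sub>\<infinity>u\<in>verts (nt ?c) - {rt ?c}. ennreal (cmod (wgt (nt ?c) (rt ?c) u) powr \<alpha>))" by (rule infsum_cong_neutral) (auto simp: inj w)
 finally show "(\<Sum>\<^sub>\<infinity>u\<in>verts (nt ?c) - {rt ?c}. ennreal (cmod (wgt (nt ?c) (rt ?c) u) powr \<alpha>)) = (\<Sum>\<^sub>\<infinity>u\<in>verts G - {v}. ennreal (cmod (wgt G v u) powr \<alpha>))" ..
qed

context random_block
begin

lemma rate_I_law:
 assumes "0 < \<alpha>"
  and "\<And>i x. i < k \<Longrightarrow> ennreal (cmod (complex_of_real (h x) * B i i) powr \<alpha>) = \<phi> x"
  and "\<And>i x. i < k \<Longrightarrow> (\<Sum>j\<in>{..<k} - {i}. ennreal (cmod (complex_of_real (h x) * B i j) powr \<alpha>)) = \<psi> x"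
 shows "rate_I \<alpha> a b law = b * (\<integral>\<^sup>+ x. \<phi> x \<partial>\<nu>) + a / 2 * (\<integral>\<^sup>+ x. \<psi> x \<partial>\<nu>)"
proof -
 have "(\<integral>\<^sup>+ g. ennreal (cmod (wgt (nt g) (rt g) (rt g)) powr \<alpha>) \<partial>law) = (\<integral>\<^sup>+ x. \<phi> x \<partial>\<nu>)" by (rule nn_integral_law[OF measurable_diagonal])
   (simp add: \<iota>_def rooted_component_wgts(1)[OF blk_network] assms(2))
 moreover have "(\<integral>\<^sup>+ g. (\<Sum>\<^sub>\<infinity>v\<in>verts (nt g) - {rt g}. ennreal (cmod (wgt (nt g) (rt g) v) powr \<alpha>)) \<partial>law) = (\<integral>\<^sup>+ x. \<psi> x \<partial>\<nu>)"
  by (rule nn_integral_law[OF measurable_off_diagonal[OF assms(1)]])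
   (simp add: \<iota>_def rooted_component_wgts(2)[OF blk_network] assms(3) del: sum_ennreal)
 ultimately show ?thesis by (simp add: rate_I_def)
qed

lemma Phi_le_rate_law:
 assumes sofic: "law \<in> sofic (support_a M a X12) (support_b M b X11)"
  and \<alpha>: "0 < \<alpha>" "\<alpha> < 2" and ab: "0 < a" "0 < b" and rate: "rate_I \<alpha> a b law < \<top>"
  and s: "\<And>f :: real \<Rightarrow> real. continuous_on UNIV f \<Longrightarrow> bounded (range f) \<Longrightarrow> (\<integral>x. (\<Sum>i<k. (\<integral>y. f y \<partial>spectral_measure (blk x) i)) / k \<partial>\<nu>) = (\<integral>x. f x \<partial>\<nu>)"
 shows "Phi M X12 X11 \<alpha> a b \<nu> \<le> rate_I \<alpha> a b law"
proof -
 \<comment> \<open>A finite rate forces a finite mean of \<open>xi \<alpha>\<close>, by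
   \<open>rate_I_ge\<close> and the positivity of the constant, so \<open>mu\<close> is given by the
   weak limit and not by its default.\<close>
 have "0 < min (a / 2) b" using ab by (simp add: ennreal_zero_less_divide)
 then have "min (a / 2) b \<noteq> 0" by (metis less_irrefl)
 moreover have "min (a / 2) b * (\<integral>\<^sup>+ g. xi \<alpha> g \<partial>law) < \<top>" using rate_I_ge[OF law_prob \<alpha>(1)] rate by (rule order_le_less_trans)
 ultimately have "(\<integral>\<^sup>+ g. xi \<alpha> g \<partial>law) < \<top>" by (auto simp: ennreal_mult_less_top)
 then have "mu law = \<nu>" by (rule mu_law[OF \<alpha> _ s])
 then show ?thesis unfolding Phi_def using sofic by (intro INF_lower) auto
qed

end

lemma spectral_measure_loop:
 assumes G: "bounded_net M G" "verts G = {0}" "wgt G 0 0 = complex_of_real x" and M: "0 < M"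
 shows "spectral_measure G 0 = return borel x"
proof (rule spectral_measure_unique[OF G(1) _ M])
 show r: "real_distribution (return borel x)" by (simp add: real_distribution_def real_distribution_axioms_def prob_space_return)
 have "AE y in return borel x. \<bar>y\<bar> \<le> \<bar>x\<bar>" by (subst AE_return) auto
 then show "integrable (return borel x) (\<lambda>x. x ^ n)" for n by (rule AE_bounded_continuous_integrable[OF r, rotated]) (intro continuous_intros)
 have "walks G n 0 0 = complex_of_real x ^ n" for n
 proof (induction n)
  case (Suc n)
  have "walks G (Suc n) 0 0 = complex_of_real x * walks G n 0 0"
   unfolding walks_Suc_verts[of G, unfolded G(2), OF finite.insertI[OF finite.emptyI]] using G(3) by simp
  then show ?case using Suc by (simp del: walks.simps)
 qed simp
 then show "complex_of_real (\<integral>y. y ^ n \<partial>return borel x) = walks G n 0 0" for n by (subst integral_return) auto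
qed (simp add: G(2))

text \<open>The matrix has eigenvalues r and -r, each with mass 1/2 at either end. The phase s
  survives in walks from one end to the other and cancels in closed ones, because
  \<open>s * cnj s = 1\<close>.\<close>

lemma integral_spectral_measure_edge:
 fixes f :: "real \<Rightarrow> real"
 assumes G: "bounded_net M G" "verts G = {..<2}" and M: "0 < M"
  and w: "wgt G 0 0 = 0" "wgt G 1 1 = 0" "wgt G 0 1 = complex_of_real r * s" "wgt G 1 0 = complex_of_real r * cnj s" and s: "cmod s = 1"
  and f: "f \<in> borel_measurable borel" and i: "i < 2"
 shows "(\<integral>x. f x \<partial>spectral_measure G i) = (f r + f (- r)) / 2"
proof -
 let ?u = "uniform_count_measure {..<2::nat}"
 define t where "t j = (if j = 0 then r else - r)" for j :: nat
 have tm: "t \<in> measurable ?u borel" by (simp add: uniform_count_measure_def measurable_point_measure_eq1)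
 have I: "(\<integral>x. f x \<partial>distr ?u borel t) = (f r + f (- r)) / 2" if "f \<in> borel_measurable borel" for f :: "real \<Rightarrow> real"
  by (subst integral_distr[OF tm that]) (simp add: integral_uniform_count_measure numeral_2_eq_2 t_def)
 have two: "{..<2::nat} = {0, 1}" by auto
 have u: "prob_space ?u" by (rule prob_space_uniform_count_measure) (auto simp: two)
 have ss: "s * cnj s = 1" using s by (simp flip: complex_norm_square)
 let ?r = "complex_of_real r"
 have W: "walks G n 0 0 = (?r ^ n + (- ?r) ^ n) / 2 \<and> walks G n 1 1 = (?r ^ n + (- ?r) ^ n) / 2
   \<and> walks G n 0 1 = s * (?r ^ n - (- ?r) ^ n) / 2 \<and> walks G n 1 0 = cnj s * (?r ^ n - (- ?r) ^ n) / 2" for n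
 proof (induction n)
  case (Suc n)
  have S: "walks G (Suc n) u v = wgt G u 0 * walks G n 0 v + wgt G u 1 * walks G n 1 v" for u v
   unfolding walks_Suc_verts[of G, unfolded G(2), OF finite_lessThan] by (simp add: two)
  have e: "walks G n 0 0 = (?r ^ n + (- ?r) ^ n) / 2" "walks G n 1 1 = (?r ^ n + (- ?r) ^ n) / 2"
   "walks G n 0 1 = s * (?r ^ n - (- ?r) ^ n) / 2" "walks G n 1 0 = cnj s * (?r ^ n - (- ?r) ^ n) / 2" using Suc.IH by blast+
  have p: "?r * s * (cnj s * (?r ^ n - (- ?r) ^ n) / 2) = (s * cnj s) * (?r ^ Suc n + (- ?r) ^ Suc n) / 2"
   "?r * cnj s * (s * (?r ^ n - (- ?r) ^ n) / 2) = (s * cnj s) * (?r ^ Suc n + (- ?r) ^ Suc n) / 2" by (simp_all add: algebra_simps)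
  show ?case unfolding S w e p ss by (simp add: algebra_simps)
 qed simp
 have "spectral_measure G i = distr ?u borel t"
 proof (rule spectral_measure_unique[OF G(1) _ M])
  show "real_distribution (distr ?u borel t)"
   using prob_space.prob_space_distr[OF u tm] by (simp add: real_distribution_def real_distribution_axioms_def)
  show "integrable (distr ?u borel t) (\<lambda>x. x ^ n)" for n
   by (subst integrable_distr_eq[OF tm], simp, unfold uniform_count_measure_def, rule integrable_point_measure_finite, simp)
  have "walks G n i i = (?r ^ n + (- ?r) ^ n) / 2" for n using W[of n] i by (auto simp: less_2_cases_iff)
  then show "complex_of_real (\<integral>x. x ^ n \<partial>distr ?u borel t) = walks G n i i" for n by (subst I) auto
 qed (use G(2) i in auto)
 then show ?thesis using I[OF f] by simp
qed

lemma sofic_loops: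
 assumes \<nu>: "real_distribution \<nu>" and \<alpha>: "0 < \<alpha>" "\<alpha> < 2" and ab: "0 < a" "0 < b" "b < \<top>"
  and Sb: "support_b M b X11 = {- 1, 1}"
 shows "Phi M X12 X11 \<alpha> a b \<nu> \<le> b * abs_moment \<alpha> \<nu>"
proof (cases "abs_moment \<alpha> \<nu> = \<top>")
 case True
 then show ?thesis using ab by (simp add: ennreal_mult_top)
next
 case False
 interpret random_block "Suc 0" "\<lambda>_ _. 1" "\<lambda>x. x" \<nu> by (rule random_block.intro) (simp, simp, rule continuous_on_id, rule \<nu>)
 have rate: "rate_I \<alpha> a b law = b * abs_moment \<alpha> \<nu>"
 proof -
  have "rate_I \<alpha> a b law = b * (\<integral>\<^sup>+ x. ennreal (\<bar>x\<bar> powr \<alpha>) \<partial>\<nu>) + a / 2 * (\<integral>\<^sup>+ x. 0 \<partial>\<nu>)"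
  proof (rule rate_I_law[OF \<alpha>(1)])
   fix i :: nat and x :: real assume "i < Suc 0"
   then have "{..<Suc 0} - {i} = {}" by auto
   then show "(\<Sum>j\<in>{..<Suc 0} - {i}. ennreal (cmod (complex_of_real x * 1) powr \<alpha>)) = 0" by (simp only: sum.empty)
  qed simp
  then show ?thesis by (simp add: abs_moment_def)
 qed
 have "Phi M X12 X11 \<alpha> a b \<nu> \<le> rate_I \<alpha> a b law"
 proof (rule Phi_le_rate_law[OF _ \<alpha> ab(1,2)])
  show "law \<in> sofic (support_a M a X12) (support_b M b X11)"
  proof (rule law_sofic)
   fix x :: real and i :: nat
   \<comment> \<open>Here the full support {-1, 1} is used: loops of both signs have to be
     admissible.\<close>
   have "x / \<bar>x\<bar> = - 1 \<or> x / \<bar>x\<bar> = 1" if "x \<noteq> 0" using that by (auto simp: abs_if)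
   then have "complex_of_real (x / \<bar>x\<bar>) \<in> {- 1, 1}" if "x \<noteq> 0" using that by fastforce
   then show "complex_of_real x * 1 = 0 \<or> complex_of_real x * 1 / complex_of_real (cmod (complex_of_real x * 1)) \<in> support_b M b X11"
    unfolding Sb by (cases "x = 0") (simp_all add: of_real_divide[symmetric] del: of_real_divide)
  qed auto
  show "rate_I \<alpha> a b law < \<top>" unfolding rate using ab False by (simp add: ennreal_mult_less_top less_top)
  fix f :: "real \<Rightarrow> real" assume f: "continuous_on UNIV f"
  have fm: "f \<in> borel_measurable borel" by (rule borel_measurable_continuous_onI[OF f])
  have "spectral_measure (blk x) 0 = return borel x" for x
   by (rule spectral_measure_loop[OF blk_bounded_net]) (auto simp: lessThan_Suc intro!: add_pos_nonneg)
  moreover have "(\<integral>y. f y \<partial>return borel x) = f x" for x by (rule integral_return) (use fm in auto)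
  ultimately show "(\<integral>x. (\<Sum>i<Suc 0. (\<integral>y. f y \<partial>spectral_measure (blk x) i)) / real (Suc 0) \<partial>\<nu>) = (\<integral>x. f x \<partial>\<nu>)" by simp
 qed
 then show ?thesis unfolding rate .
qed

text \<open>The edge carries |x| and not x, because s is in the support and -s perhaps is not. Its
  spectral measure does not see the sign, and the symmetry of \<nu> recovers \<nu> from the average
  of f(x) and f(-x).\<close>

lemma sofic_edges:
 assumes \<nu>: "real_distribution \<nu>" and sym: "symmetric_law \<nu>" and \<alpha>: "0 < \<alpha>" "\<alpha> < 2" and ab: "0 < a" "0 < b" "a < \<top>"
  and s: "s \<in> support_a M a X12" "cmod s = 1"
 shows "Phi M X12 X11 \<alpha> a b \<nu> \<le> a / 2 * abs_moment \<alpha> \<nu>"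
proof (cases "abs_moment \<alpha> \<nu> = \<top>")
 case True
 then show ?thesis using ab by (simp add: ennreal_mult_top ennreal_divide_eq_0_iff)
next
 case False
 define B where "B i j = (if i = 0 \<and> j = 1 then s else if i = 1 \<and> j = 0 then cnj s else 0)" for i j :: nat
 interpret random_block 2 B "\<lambda>x. \<bar>x\<bar>" \<nu> by (rule random_block.intro) (simp, simp add: B_def, rule continuous_on_rabs[OF continuous_on_id], rule \<nu>)
 have two: "{..<2::nat} = {0, 1}" by auto
 have rate: "rate_I \<alpha> a b law = a / 2 * abs_moment \<alpha> \<nu>"
 proof -
  have "rate_I \<alpha> a b law = b * (\<integral>\<^sup>+ x. 0 \<partial>\<nu>) + a / 2 * (\<integral>\<^sup>+ x. ennreal (\<bar>x\<bar> powr \<alpha>) \<partial>\<nu>)"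
  proof (rule rate_I_law[OF \<alpha>(1)])
   fix i :: nat and x :: real assume i: "i < 2"
   then have i: "i = 0 \<or> i = 1" by auto
   then have "cmod (B i (1 - i)) = 1" using s(2) by (auto simp: B_def)
   then have "cmod (complex_of_real \<bar>x\<bar> * B i (1 - i)) = \<bar>x\<bar>" by (simp add: norm_mult)
   moreover have "{..<2} - {i} = {1 - i}" unfolding two using i by auto
   ultimately show "(\<Sum>j\<in>{..<2} - {i}. ennreal (cmod (complex_of_real \<bar>x\<bar> * B i j) powr \<alpha>)) = ennreal (\<bar>x\<bar> powr \<alpha>)" by simp
  qed (simp add: B_def)
  then show ?thesis by (simp add: abs_moment_def)
 qed
 have "Phi M X12 X11 \<alpha> a b \<nu> \<le> rate_I \<alpha> a b law"
 proof (rule Phi_le_rate_law[OF _ \<alpha> ab(1,2)])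
  show "law \<in> sofic (support_a M a X12) (support_b M b X11)"
  proof (rule law_sofic)
   fix x :: real and i j :: nat assume "i < j" "j < 2"
   then have "i = 0" "j = 1" by auto
   then show "complex_of_real \<bar>x\<bar> * B i j = 0 \<or> complex_of_real \<bar>x\<bar> * B i j / complex_of_real (cmod (complex_of_real \<bar>x\<bar> * B i j)) \<in> support_a M a X12"
    using s by (simp add: B_def norm_mult)
  qed (simp add: B_def)
  have "a / 2 < \<top>" using ab(3) by (cases a) (auto simp: ennreal_divide_numeral)
  then show "rate_I \<alpha> a b law < \<top>" unfolding rate using False by (simp add: ennreal_mult_less_top less_top)
  fix f :: "real \<Rightarrow> real" assume f: "continuous_on UNIV f" and fb: "bounded (range f)"
  then obtain C where C: "\<And>x. norm (f x) \<le> C" by (auto simp: bounded_iff)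
  have fm: "f \<in> borel_measurable borel" by (rule borel_measurable_continuous_onI[OF f])
  interpret real_distribution \<nu> by (rule \<nu>)
  have sp: "(\<integral>y. f y \<partial>spectral_measure (blk x) i) = (f \<bar>x\<bar> + f (- \<bar>x\<bar>)) / 2" if "i < 2" for x i
  proof (rule integral_spectral_measure_edge[OF blk_bounded_net _ _ _ _ _ _ s(2) fm that])
   show "0 < 1 + (\<Sum>i<2. \<Sum>j<2. cmod (complex_of_real \<bar>x\<bar> * B i j))" by (rule add_pos_nonneg) (auto intro!: sum_nonneg)
  qed (simp_all add: B_def)
  have "(\<Sum>i<2. (\<integral>y. f y \<partial>spectral_measure (blk x) i)) / real 2 = (f x + f (- x)) / 2" for x using sp[of 0 x] sp[of 1 x] by (simp add: two abs_if)
  then have "(\<integral>x. (\<Sum>i<2. (\<integral>y. f y \<partial>spectral_measure (blk x) i)) / real 2 \<partial>\<nu>) = (\<integral>x. (f x + f (- x)) / 2 \<partial>\<nu>)" by simp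
  also have "\<dots> = ((\<integral>x. f x \<partial>\<nu>) + (\<integral>x. f (- x) \<partial>\<nu>)) / 2"
   using bounded_continuous_integrable[OF \<nu> f C] bounded_continuous_integrable[OF \<nu> continuous_on_compose2[OF f, of UNIV uminus] C]
   by (simp add: continuous_on_minus)
  also have "(\<integral>x. f (- x) \<partial>\<nu>) = (\<integral>x. f x \<partial>distr \<nu> borel uminus)" by (subst integral_distr) (use fm in auto)
  also have "\<dots> = (\<integral>x. f x \<partial>\<nu>)" using sym by (simp add: symmetric_law_def)
  finally show "(\<integral>x. (\<Sum>i<2. (\<integral>y. f y \<partial>spectral_measure (blk x) i)) / real 2 \<partial>\<nu>) = (\<integral>x. f x \<partial>\<nu>)" by simp
 qed
 then show ?thesis unfolding rate .
qed

section \<open>The angular measure and its support\<close>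

lemma tail_exponent_finite_pos:
 assumes M: "prob_space M" and Y: "Y \<in> borel_measurable M" and t: "tail_exponent M \<alpha> a Y" and a: "a < \<top>"
 shows "0 < measure M {w \<in> space M. t0 \<le> cmod (Y w)}"
proof (rule ccontr)
 interpret prob_space M by fact
 \<comment> \<open>If one tail probability vanished, so would all later ones; \<open>neg_log\<close>
   would be infinite there, and with it the exponent.\<close>
 assume "\<not> 0 < measure M {w \<in> space M. t0 \<le> cmod (Y w)}"
 then have 0: "measure M {w \<in> space M. t0 \<le> cmod (Y w)} = 0" by (simp add: zero_less_measure_iff)
 let ?f = "\<lambda>t. ennreal (t powr (- \<alpha>)) * neg_log (measure M {w \<in> space M. t \<le> cmod (Y w)})"
 have "\<forall>\<^sub>F t in at_top. ?f t = \<top>" using eventually_ge_at_top[of t0] eventually_gt_at_top[of 0]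
 proof eventually_elim
  case (elim t)
  have "{w \<in> space M. t0 \<le> cmod (Y w)} \<in> sets M" using Y by measurable
  then have "measure M {w \<in> space M. t \<le> cmod (Y w)} \<le> measure M {w \<in> space M. t0 \<le> cmod (Y w)}" using elim by (intro finite_measure_mono) auto
  then have "measure M {w \<in> space M. t \<le> cmod (Y w)} = 0" using 0 by (simp add: measure_le_0_iff)
  then show ?case using elim by (simp add: neg_log_def ennreal_mult_top)
 qed
 then have "(?f \<longlongrightarrow> \<top>) at_top" by (rule tendsto_eventually)
 then have "a = \<top>" using t unfolding tail_exponent_def by (intro tendsto_unique[OF trivial_limit_at_top_linorder])
 then show False using a by simp
qed

text \<open>Two angular measures agree because, far out, both are the quotient of the same
  probability by the tail probability, which is positive when the exponent is finite.\<close>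

lemma angular_measure_associated:
 assumes M: "prob_space M" and Y: "class_S M \<alpha> a Y" and a: "a < \<top>"
 shows "angular_measure M Y (associated_measure M Y)"
proof -
 obtain \<theta> where \<theta>: "angular_measure M Y \<theta>" using Y a by (auto simp: class_S_def)
 show ?thesis unfolding associated_measure_def
 proof (rule theI[where P="angular_measure M Y", OF \<theta>])
  fix \<eta> assume \<eta>: "angular_measure M Y \<eta>"
  have s: "sets \<eta> = sets \<theta>" using \<theta> \<eta> by (simp add: angular_measure_def)
  obtain t1 where t1: "\<And>t U. t1 \<le> t \<Longrightarrow> U \<in> sets \<theta> \<Longrightarrow> measure M {w \<in> space M. Y w / complex_of_real (cmod (Y w)) \<in> U \<and> t \<le> cmod (Y w)}
     = measure \<theta> U * measure M {w \<in> space M. t \<le> cmod (Y w)}" using \<theta> unfolding angular_measure_def by blast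
  obtain t2 where t2: "\<And>t U. t2 \<le> t \<Longrightarrow> U \<in> sets \<eta> \<Longrightarrow> measure M {w \<in> space M. Y w / complex_of_real (cmod (Y w)) \<in> U \<and> t \<le> cmod (Y w)}
     = measure \<eta> U * measure M {w \<in> space M. t \<le> cmod (Y w)}" using \<eta> unfolding angular_measure_def by blast
  have p: "0 < measure M {w \<in> space M. max t1 t2 \<le> cmod (Y w)}" by (rule tail_exponent_finite_pos[OF M _ _ a]) (use Y in \<open>auto simp: class_S_def\<close>)
  interpret \<theta>: prob_space \<theta> using \<theta> by (simp add: angular_measure_def)
  interpret \<eta>: prob_space \<eta> using \<eta> by (simp add: angular_measure_def)
  show "\<eta> = \<theta>"
  proof (rule measure_eqI[OF s])
   fix U assume U: "U \<in> sets \<eta>"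
   have "measure \<eta> U = measure \<theta> U" using t1[of "max t1 t2" U] t2[of "max t1 t2" U] U s p by simp
   then show "emeasure \<eta> U = emeasure \<theta> U" by (simp add: \<theta>.emeasure_eq_measure \<eta>.emeasure_eq_measure)
  qed
 qed
qed

text \<open>If the support were empty, null open sets would cover the circle; by compactness
  finitely many would, against total mass 1. The point s is the phase given to the edges.\<close>

lemma support_a_nonempty:
 assumes M: "prob_space M" and Y: "class_S M \<alpha> a Y" and a: "a < \<top>"
 obtains s where "s \<in> support_a M a Y" "cmod s = 1"
proof -
 define \<theta> where "\<theta> = associated_measure M Y"
 have ang: "angular_measure M Y \<theta>" unfolding \<theta>_def by (rule angular_measure_associated[OF M Y a])
 interpret prob_space \<theta> using ang by (simp add: angular_measure_def)
 have sets: "sets \<theta> = sets (restrict_space borel unit_circle)" using ang by (simp add: angular_measure_def)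
 then have sp: "space \<theta> = unit_circle" using sets_eq_imp_space_eq[OF sets] by (simp add: space_restrict_space)
 have "msupport \<theta> \<noteq> {}"
 proof
  assume e: "msupport \<theta> = {}"
  define \<U> where "\<U> = {U. open U \<and> emeasure \<theta> (U \<inter> space \<theta>) = 0}"
  have "unit_circle \<subseteq> \<Union>\<U>"
  proof
   fix x assume "x \<in> unit_circle"
   then have "x \<notin> msupport \<theta>" "x \<in> space \<theta>" using e sp by auto
   then show "x \<in> \<Union>\<U>" unfolding msupport_def \<U>_def by (auto simp: zero_less_iff_neq_zero)
  qed
  moreover have "compact unit_circle" by (simp add: unit_circle_def)
  ultimately obtain F where F: "F \<subseteq> \<U>" "finite F" "unit_circle \<subseteq> \<Union>F" by (metis (no_types, lifting) compactE \<U>_def mem_Collect_eq)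
  have m: "U \<inter> space \<theta> \<in> sets \<theta>" if "U \<in> F" for U using F(1) that unfolding sets sp \<U>_def sets_restrict_space by (auto intro!: image_eqI[of _ _ U])
  have "space \<theta> = (\<Union>U\<in>F. U \<inter> space \<theta>)" using F(3) sp by auto
  then have "emeasure \<theta> (space \<theta>) \<le> (\<Sum>U\<in>F. emeasure \<theta> (U \<inter> space \<theta>))" using emeasure_subadditive_finite[OF F(2), of "\<lambda>U. U \<inter> space \<theta>" \<theta>] m by auto
  also have "\<dots> = 0" using F(1) by (intro sum.neutral) (auto simp: \<U>_def)
  finally show False by (simp add: emeasure_space_1)
 qed
 then obtain s where s: "s \<in> msupport \<theta>" by blast
 then have "cmod s = 1" using sp by (auto simp: msupport_def unit_circle_def)
 moreover have "s \<in> support_a M a Y" using s a by (auto simp: support_a_def \<theta>_def)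
 ultimately show thesis using that by blast
qed

theorem theorem1p2:
 fixes M :: "'w measure" and X12 :: "'w \<Rightarrow> complex" and X11 :: "'w \<Rightarrow> real"
  and \<alpha> :: real and a b :: ennreal
 assumes "prob_space M"
  and "0 < \<alpha>" and "\<alpha> < 2" and "0 < a" and "0 < b"
  and "class_S M \<alpha> a X12"
  and "class_S M \<alpha> b (\<lambda>w. complex_of_real (X11 w))"
 shows
  "(\<forall>\<nu>. real_distribution \<nu> \<longrightarrow>
    min (a / 2) b * abs_moment \<alpha> \<nu> \<le> Phi M X12 (\<lambda>w. complex_of_real (X11 w)) \<alpha> a b \<nu>)
   \<and> (b < \<top> \<and> msupport (associated_measure M (\<lambda>w. complex_of_real (X11 w))) = {- 1, 1} \<longrightarrow>
    (\<forall>\<nu>. real_distribution \<nu> \<longrightarrow>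
      Phi M X12 (\<lambda>w. complex_of_real (X11 w)) \<alpha> a b \<nu> \<le> b * abs_moment \<alpha> \<nu>))
   \<and> (b < \<top> \<and> msupport (associated_measure M (\<lambda>w. complex_of_real (X11 w))) = {- 1, 1} \<longrightarrow>
    (\<forall>\<nu>. real_distribution \<nu> \<and> symmetric_law \<nu> \<longrightarrow>
      Phi M X12 (\<lambda>w. complex_of_real (X11 w)) \<alpha> a b \<nu> = min (a / 2) b * abs_moment \<alpha> \<nu>))"
proof -
 let ?X = "\<lambda>w. complex_of_real (X11 w)"
 note \<alpha> = assms(2,3) and ab = assms(4,5)
 have lower: "min (a / 2) b * abs_moment \<alpha> \<nu> \<le> Phi M X12 ?X \<alpha> a b \<nu>" for \<nu>
  unfolding Phi_def by (rule INF_greatest) (use sofic_rate_I_ge[OF _ \<alpha> ab] in auto)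
 have upper: "Phi M X12 ?X \<alpha> a b \<nu> \<le> b * abs_moment \<alpha> \<nu>"
  if "b < \<top>" "msupport (associated_measure M ?X) = {- 1, 1}" "real_distribution \<nu>" for \<nu>
  by (rule sofic_loops[OF that(3) \<alpha> ab that(1)]) (use that in \<open>simp add: support_b_def\<close>)
 have upper_sym: "Phi M X12 ?X \<alpha> a b \<nu> \<le> min (a / 2) b * abs_moment \<alpha> \<nu>"
  if b: "b < \<top>" and Sb: "msupport (associated_measure M ?X) = {- 1, 1}" and \<nu>: "real_distribution \<nu>" "symmetric_law \<nu>" for \<nu>
 \<comment> \<open>Loops attain the minimum when b <= a/2; otherwise a/2 < b forces a to be finite,
   and edges attain it.\<close>
 proof (cases "b \<le> a / 2")
  case True
  then show ?thesis using upper[OF b Sb \<nu>(1)] by (simp add: min_absorb2)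
 next
  case False
  then have "a < \<top>" using b by (cases "a = \<top>") (auto simp: less_top ennreal_top_divide)
  then obtain s where s: "s \<in> support_a M a X12" "cmod s = 1" by (rule support_a_nonempty[OF assms(1,6)])
  have "min (a / 2) b = a / 2" using False by simp
  then show ?thesis using sofic_edges[OF \<nu> \<alpha> ab \<open>a < \<top>\<close> s] by simp
 qed
 show ?thesis by (intro conjI allI impI; (elim conjE)?; (rule lower | rule upper | rule antisym[OF upper_sym lower]); assumption)
qed

end
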